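(* Consider the resource allocation problem $$\min_{x_i\in\mathbb{R}^m,\ i\in\mathcal N}\ \sum_{i\in\mathcal N} f_i(x_i)\quad\text{subject to}\quad \sum_{i\in\mathcal N}x_i=\sum_{i\in\mathcal N}d_i,\quad x_i\in\Omega_i,\ i\in\mathcal N, \qquad (\mathrm{RA})$$ with $\mathcal N=\{1,\dots,n\}$, and suppose that Assumptions 1-5 stated in the context hold. Let the sequences $\{x_i(k)\},\{\lambda_i(k)\},\{z_i(k)\}$, $i\in\mathcal N$, be generated by the stochastic approximation based distributed algorithm described in the context, from any finite initial values $x_i(0),\lambda_i(0),z_i(0)\in\mathbb{R}^m$. Then, for every $i\in\mathcal N$, $$\lim_{k\to\infty}x_i(k)=x_i^*\quad\text{almost surely},$$ where $X^*=\mathrm{col}\{x_1^*,\dots,x_n^*\}$ is the optimal solution of (RA).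
   Context: Notation: $\|\cdot\|$ is the Euclidean norm; $\mathrm{col}\{x_1,\dots,x_n\}=(x_1^T,\dots,x_n^T)^T$; $P_\Omega(x)$ is the projection of $x$ onto the nonempty closed convex set $\Omega$, i.e. the point of $\Omega$ closest to $x$. Problem data: for $i\in\mathcal N=\{1,\dots,n\}$, $f_i:\mathbb{R}^m\to\mathbb{R}$ is the local objective, $d_i\in\mathbb{R}^m$ is a fixed local resource vector, and $\Omega_i=\{x\in\mathbb{R}^m: q_{ij}(x)\le 0,\ j=1,\dots,p_i\}$, where the $q_{ij}:\mathbb{R}^m\to\mathbb{R}$ are continuously differentiable convex functions. Random graphs: at each time $k=0,1,2,\dots$ there is a random directed graph $\mathcal G(k)$ on $\mathcal N$ with adjacency matrix $A(k)=[a_{ij}(k)]$, where $a_{ij}(k)=1$ if $i$ receives information from $j$ at time $k$ and $a_{ij}(k)=0$ otherwise. Its Laplacian is $L(k)=\mathrm{diag}\{\sum_j a_{1j}(k),\dots,\sum_j a_{nj}(k)\}-A(k)$. Algorithm: for $k\ge 0$ and $i\in\mathcal N$, $$x_i(k+1)=P_{\Omega_i}\big(x_i(k)+\alpha_k(-(\nabla f_i(x_i(k))+\nu_i(k))+\lambda_i(k))\big),$$ $$\lambda_i(k+1)=\lambda_i(k)+\alpha_k\Big((d_i+\delta_i(k))-x_i(k)-\sum_{j=1}^n a_{ij}(k)\big(\lambda_i(k)-(\lambda_j(k)+\zeta_{ij}(k))\big)-\sum_{j=1}^n a_{ij}(k)\big(z_i(k)-(z_j(k)+\epsilon_{ij}(k))\big)\Big),$$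 $$z_i(k+1)=z_i(k)+\alpha_k\sum_{j=1}^n a_{ij}(k)\big(\lambda_i(k)-(\lambda_j(k)+\zeta_{ij}(k))\big),$$ where $\nu_i(k),\delta_i(k),\zeta_{ij}(k),\epsilon_{ij}(k)$ are $\mathbb{R}^m$-valued random noises and the deterministic step sizes satisfy $\alpha_k>0$, $\sum_{k=1}^\infty\alpha_k=\infty$, $\sum_{k=1}^\infty\alpha_k^2<\infty$. Let $X(k)=\mathrm{col}\{x_i(k)\}_{i=1}^n$, $\Lambda(k)=\mathrm{col}\{\lambda_i(k)\}_{i=1}^n$, $Z(k)=\mathrm{col}\{z_i(k)\}_{i=1}^n$. Define $\mathcal F_k=\sigma\{\epsilon_{ij}(t),\zeta_{ij}(t),\delta_i(t),\nu_i(t),L(t),\ 0\le t\le k,\ i,j=1,\dots,n,\ X(0),\Lambda(0),Z(0)\}$ (with $\mathcal F_{-1}=\sigma\{X(0),\Lambda(0),Z(0)\}$) and $\mathcal F_k'=\sigma\{\mathcal F_k,L(k+1)\}$. Assumption 1: (RA) has a finite optimal solution. Each $f_i$ is differentiable and strictly convex, and there is $l_c>0$ such that $\|\nabla f_i(x)-\nabla f_i(y)\|\le l_c\|x-y\|$ for all $x,y\in\mathbb{R}^m$. Assumption 2: each $\Omega_i$ is a closed convex set with nonempty interior, and for $x\in\Omega_i$ the set $\{\nabla q_{ij}(x): j\in\mathcal I_i(x)\}$ is linearly independent, where $\mathcal I_i(x)=\{j:q_{ij}(x)=0\}$. Assumption 3: $\{L(k)\}$ is an i.i.d. sequence with mean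 $\bar L=E[L(k)]$; $\bar L$ is symmetric and its second smallest eigenvalue satisfies $s_2(\bar L)>0$. Assumption 4: for each $i\in\mathcal N$, $\{\delta_i(k)\}$ is an i.i.d. sequence with zero mean and finite second moment $\sigma_{i,\delta}^2=E[\|\delta_i(k)\|^2]$. Assumption 5: (i) $E[\zeta_{ij}(k)\mid\mathcal F_{k-1}']=\mathbf 0$ and $E[\epsilon_{ij}(k)\mid\mathcal F_{k-1}']=\mathbf 0$. (ii) There is $\mu>0$ such that for all $i,j\in\mathcal N$, $k\ge0$: $E[\|\zeta_{ij}(k)\|^2\mid\mathcal F_{k-1}']\le\mu^2$ and $E[\|\epsilon_{ij}(k)\|^2\mid\mathcal F_{k-1}']\le\mu^2$. (iii) There is $c>0$ such that for all $i\in\mathcal N$, $k\ge0$: $E[\nu_i(k)\mid\mathcal F_{k-1}]=0$ and $E[\|\nu_i(k)\|^2\mid\mathcal F_{k-1}]\le c(1+\|x_i(k)\|^2)$. (iv) For all $i\in\mathcal N$ the sequences $\{L(k)\}$ and $\{\delta_i(k)\}$ are mutually independent, and for each $k$ the family consisting of $L(k)$ and $\{\delta_i(k)\}_{i\in\mathcal N}$ is independent of $\mathcal F_{k-1}$. *)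

theory Defs
  imports "HOL-Probability.Probability" "HOL-Computational_Algebra.Computational_Algebra"
begin

section \<open>Convex optimization\<close>

definition gradient :: "('a::real_inner \<Rightarrow> real) \<Rightarrow> 'a \<Rightarrow> 'a" where
  "gradient f x = (THE D. GDERIV f x :> D)"

lemma gradient_eqI:
  assumes "GDERIV f x :> D"
  shows "gradient f x = D"
proof -
  have "D' = D" if "GDERIV f x :> D'" for D'
  proof -
    have "(\<lambda>h. h \<bullet> D') = (\<lambda>h. h \<bullet> D)"
      using that assms unfolding gderiv_def by (rule has_derivative_unique)
    then have "h \<bullet> (D' - D) = 0" for h
      by (simp add: inner_diff_right fun_eq_iff)
    then show ?thesis by (metis inner_eq_zero_iff right_minus_eq)
  qed
  with assms show ?thesis unfolding gradient_def by (rule the_equality)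
qed

lemma GDERIV_gradient:
  fixes f :: "'a::euclidean_space \<Rightarrow> real"
  assumes "f differentiable (at x)"
  shows "GDERIV f x :> gradient f x"
proof -
  obtain f' where f': "(f has_derivative f') (at x)"
    using assms by (auto simp: differentiable_def)
  then interpret bounded_linear f' by (rule has_derivative_bounded_linear)
  define D where "D = (\<Sum>b\<in>Basis. f' b *\<^sub>R b)"
  have "f' h = h \<bullet> D" for h
  proof -
    have "f' h = f' (\<Sum>b\<in>Basis. (h \<bullet> b) *\<^sub>R b)" by (simp add: euclidean_representation)
    also have "\<dots> = (\<Sum>b\<in>Basis. (h \<bullet> b) * f' b)" by (simp add: sum scaleR)
    also have "\<dots> = h \<bullet> D" by (simp add: D_def inner_sum_right mult.commute)
    finally show ?thesis .
  qed
  then have "f' = (\<lambda>h. h \<bullet> D)" by blast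
  with f' have "GDERIV f x :> D" by (simp add: gderiv_def)
  then show ?thesis using gradient_eqI by metis
qed

definition strictly_convex_on :: "'a::real_vector set \<Rightarrow> ('a \<Rightarrow> real) \<Rightarrow> bool" where
  "strictly_convex_on S f \<longleftrightarrow> convex S \<and>
    (\<forall>x\<in>S. \<forall>y\<in>S. \<forall>u>0. \<forall>v>0. x \<noteq> y \<longrightarrow> u + v = 1 \<longrightarrow>
       f (u *\<^sub>R x + v *\<^sub>R y) < u * f x + v * f y)"

text \<open>The constraint set cut out by the inequalities \<open>q j x \<le> 0\<close>, \<open>j = 1, \<dots>, p\<close>, and the set of
  constraints active at a point.\<close>

definition constraint_set :: "nat \<Rightarrow> (nat \<Rightarrow> 'a \<Rightarrow> real) \<Rightarrow> 'a set" where
  "constraint_set p q = {x. \<forall>j\<in>{1..p}. q j x \<le> 0}"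

definition active_set :: "nat \<Rightarrow> (nat \<Rightarrow> 'a \<Rightarrow> real) \<Rightarrow> 'a \<Rightarrow> nat set" where
  "active_set p q x = {j\<in>{1..p}. q j x = 0}"

definition ra_feasible ::
  "('n::finite \<Rightarrow> 'a::real_vector) \<Rightarrow> ('n \<Rightarrow> 'a set) \<Rightarrow> ('n \<Rightarrow> 'a) \<Rightarrow> bool" where
  "ra_feasible d \<Omega> X \<longleftrightarrow> (\<Sum>i\<in>UNIV. X i) = (\<Sum>i\<in>UNIV. d i) \<and> (\<forall>i. X i \<in> \<Omega> i)"

definition ra_optimal ::
  "('n::finite \<Rightarrow> 'a::real_vector \<Rightarrow> real) \<Rightarrow> ('n \<Rightarrow> 'a) \<Rightarrow> ('n \<Rightarrow> 'a set) \<Rightarrow> ('n \<Rightarrow> 'a) \<Rightarrow> bool" where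
  "ra_optimal f d \<Omega> X \<longleftrightarrow> ra_feasible d \<Omega> X \<and>
    (\<forall>Y. ra_feasible d \<Omega> Y \<longrightarrow> (\<Sum>i\<in>UNIV. f i (X i)) \<le> (\<Sum>i\<in>UNIV. f i (Y i)))"

section \<open>Laplacians and eigenvalues\<close>

definition laplacian :: "real^'n^'n \<Rightarrow> real^'n^'n" where
  "laplacian A = (\<chi> i j. if i = j then (\<Sum>l\<in>UNIV. A $ i $ l) else 0) - A"

definition charpoly :: "real^'n^'n \<Rightarrow> real poly" where
  "charpoly A = det (mat [:0, 1:] - (\<chi> i j. [:A $ i $ j:]))"

lemma poly_charpoly: "poly (charpoly A) a = det (mat a - A)"
  unfolding charpoly_def det_def
  by (auto simp: poly_sum poly_prod mat_def of_int_poly intro!: sum.cong prod.cong arg_cong2[where f = "(*)"])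

text \<open>The real eigenvalues in increasing order, repeated according to multiplicity. For a symmetric
  matrix this list has length \<open>CARD('n)\<close>.\<close>

definition eigenvalues :: "real^'n^'n \<Rightarrow> real list" where
  "eigenvalues A = sorted_list_of_multiset (proots (charpoly A))"

text \<open>Only meaningful when there are at least two eigenvalues.\<close>

definition second_smallest_eigenvalue :: "real^'n^'n \<Rightarrow> real" where
  "second_smallest_eigenvalue A = eigenvalues A ! 1"

section \<open>Probability\<close>

definition iid :: "'w measure \<Rightarrow> (nat \<Rightarrow> 'w \<Rightarrow> 'b::topological_space) \<Rightarrow> bool" where
  "iid M Y \<longleftrightarrow> prob_space.indep_vars M (\<lambda>_. borel) Y UNIV \<and>
    (\<forall>k. distr M borel (Y k) = distr M borel (Y 0))"

definition vec_cond_exp :: "'w measure \<Rightarrow> 'w measure \<Rightarrow> ('w \<Rightarrow> real^'m) \<Rightarrow> 'w \<Rightarrow> real^'m" where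
  "vec_cond_exp M F Y \<omega> = (\<chi> l. real_cond_exp M F (\<lambda>\<omega>. Y \<omega> $ l) \<omega>)"

text \<open>The events determined by a single random variable; unions of such sets generate the
  \<open>\<sigma>\<close>-algebra of a family of random variables with values in different spaces.\<close>

definition events_of :: "'w measure \<Rightarrow> ('w \<Rightarrow> 'b::topological_space) \<Rightarrow> 'w set set" where
  "events_of M Y = {Y -` B \<inter> space M | B. B \<in> sets borel}"

text \<open>\<open>past \<dots> k\<close> is \<open>\<F>\<^sub>k\<^sub>-\<^sub>1\<close>, generated by the initial values and by
  everything that happens at the times \<open>t < k\<close>; so \<open>past \<dots> 0\<close> is \<open>\<F>\<^sub>-\<^sub>1\<close>.
  Likewise \<open>past_graph \<dots> k\<close> is \<open>\<F>'\<^sub>k\<^sub>-\<^sub>1\<close>, which knows the graph at time \<open>k\<close> as well.\<close>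

definition past ::
  "'w measure \<Rightarrow> ('n \<Rightarrow> 'w \<Rightarrow> real^'m) \<Rightarrow> ('n \<Rightarrow> 'w \<Rightarrow> real^'m) \<Rightarrow> ('n \<Rightarrow> 'w \<Rightarrow> real^'m)
    \<Rightarrow> (nat \<Rightarrow> 'w \<Rightarrow> real^'n^'n) \<Rightarrow> ('n \<Rightarrow> nat \<Rightarrow> 'w \<Rightarrow> real^'m) \<Rightarrow> ('n \<Rightarrow> nat \<Rightarrow> 'w \<Rightarrow> real^'m)
    \<Rightarrow> ('n \<Rightarrow> 'n \<Rightarrow> nat \<Rightarrow> 'w \<Rightarrow> real^'m) \<Rightarrow> ('n \<Rightarrow> 'n \<Rightarrow> nat \<Rightarrow> 'w \<Rightarrow> real^'m) \<Rightarrow> nat \<Rightarrow> 'w measure"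
  where
  "past M x0 lam0 z0 L \<nu> \<delta> \<zeta> \<epsilon> k = sigma (space M)
     ((\<Union>i. events_of M (x0 i) \<union> events_of M (lam0 i) \<union> events_of M (z0 i)) \<union>
      (\<Union>t<k. events_of M (L t) \<union>
         (\<Union>i. events_of M (\<nu> i t) \<union> events_of M (\<delta> i t)) \<union>
         (\<Union>i j. events_of M (\<zeta> i j t) \<union> events_of M (\<epsilon> i j t))))"

definition past_graph ::
  "'w measure \<Rightarrow> ('n \<Rightarrow> 'w \<Rightarrow> real^'m) \<Rightarrow> ('n \<Rightarrow> 'w \<Rightarrow> real^'m) \<Rightarrow> ('n \<Rightarrow> 'w \<Rightarrow> real^'m)
    \<Rightarrow> (nat \<Rightarrow> 'w \<Rightarrow> real^'n^'n) \<Rightarrow> ('n \<Rightarrow> nat \<Rightarrow> 'w \<Rightarrow> real^'m) \<Rightarrow> ('n \<Rightarrow> nat \<Rightarrow> 'w \<Rightarrow> real^'m)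
    \<Rightarrow> ('n \<Rightarrow> 'n \<Rightarrow> nat \<Rightarrow> 'w \<Rightarrow> real^'m) \<Rightarrow> ('n \<Rightarrow> 'n \<Rightarrow> nat \<Rightarrow> 'w \<Rightarrow> real^'m) \<Rightarrow> nat \<Rightarrow> 'w measure"
  where
  "past_graph M x0 lam0 z0 L \<nu> \<delta> \<zeta> \<epsilon> k = sigma (space M)
     (sets (past M x0 lam0 z0 L \<nu> \<delta> \<zeta> \<epsilon> k) \<union> events_of M (L k))"

end

theory Submission imports Defs begin

text \<open>Write \<open>X\<close>, \<open>\<Lambda>\<close>, \<open>Z\<close> for the stacked iterates, \<open>F\<close> for the sum of the objectives and \<open>K\<close> for the action
of the mean Laplacian. Up to noise of conditional mean zero, the algorithm takes projected forward steps along
the monotone operator of the function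
\<open>F X + \<Lambda> \<bullet> (D - X) - \<Lambda> \<bullet> K \<Lambda> / 2 - \<Lambda> \<bullet> K Z\<close>, which is convex in \<open>(X, Z)\<close> and concave in \<open>\<Lambda>\<close>;
maximizing over \<open>\<Lambda>\<close> and minimizing over \<open>Z\<close> recovers the resource equation. The classical argument would
follow the squared distance of the iterates to a saddle point. A saddle point need not exist, however:
nothing ties the resource equation to the interiors of the sets \<open>\<Omega> i\<close>. If, for two agents in the plane, \<open>\<Omega> 1\<close>
and the reflected set \<open>d 1 + d 2 - \<Omega> 2\<close> are discs that touch in one point, the optimum is this point whatever the objectives are,
while a multiplier exists only if the difference of the two gradients is normal to the common tangent.

The iterates are therefore compared with a deterministic reference path, which starts at the optimum, follows
the same operator with the same step sizes, but takes implicit steps and sees no noise. It is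
enough to show that the iterates approach the reference path and that the reference path approaches the
optimum.

For the first part, monotonicity turns the squared distance \<open>W\<close> to the reference path into an almost
supermartingale (\<open>perturbed_step\<close>): in conditional mean \<open>W\<close> increases in a step of size \<open>\<alpha>\<close> by at most
\<open>\<alpha>\<^sup>2 C (1 + W)\<close>, and it decreases by a multiple of \<open>\<alpha> |\<nabla>F(X) - \<nabla>F(X')|\<^sup>2\<close>, \<open>X'\<close> being the next reference point. The random
Laplacian multiplies the dual variables, which may be unbounded, but along the reference path they are
unbounded only in the direction of consensus, which every Laplacian kills
(\<open>fluctuation_bound_reference\<close>). Hence \<open>W\<close> is bounded and the weighted sum of the squared differences of gradients is
finite almost surely (\<open>almost_supermartingale\<close>). Between two steps \<open>X\<close> moves by \<open>O(\<alpha>)\<close> and by the increment of a convergent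
martingale, so it cannot leave a neighbourhood of the reference path infinitely often
(\<open>crossing\<close>).

For the second part, the duality gap vanishes (\<open>strong_duality\<close>), although the dual problem need not have a
solution and the dual variable \<open>q\<close> of the path may be unbounded. The substitute for a multiplier
is a dual point that is nearly optimal and at bounded distance from \<open>q\<close>, as follows.
Measure time by \<open>t n = sum \<beta> {..<n}\<close>. An energy estimate for an exponential average of \<open>q\<close> yields, for every
lag up to \<open>h\<close>, two times before about \<open>h\<^sup>2\<close> at this lag between which \<open>q\<close> moves a bounded amount
(\<open>return_at_lag\<close>). Two proximal paths of the same operator stay as close as they begin, up to a bounded
error (\<open>proximal_path_distance\<close>), so from time \<open>h\<^sup>2\<close> on \<open>q\<close> moves a bounded amount over every window of length
\<open>h\<close> (\<open>window_displacement\<close>). The average of \<open>q\<close> over a window of length about \<open>sqrt (t n)\<close> is the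
desired point (\<open>near_optimal_dual\<close>). It bounds the integral of \<open>|\<nabla>F(X) - \<nabla>F(X*)|\<^sup>2\<close> over late windows of length \<open>T\<close>
by \<open>C + \<epsilon> T\<close>. On windows of bounded length the gradients hardly change, since the speed of a proximal path
decreases; so they converge (\<open>gradients_converge\<close>), and strict convexity makes the gradient determine the point.\<close>

section \<open>Convex functions and projections\<close>

(* "$" would otherwise be ambiguous between vectors and power series. *)
no_notation fps_nth (infixl "$" 75)

lemma convex_gradient_ineq:
  fixes f :: "'a::real_inner \<Rightarrow> real"
  assumes "convex_on UNIV f" "GDERIV f x :> D"
  shows "f x + D \<bullet> (y - x) \<le> f y"
proof -
  define \<phi> where "\<phi> t = f (x + t *\<^sub>R (y - x))" for t
  have "convex_on UNIV \<phi>"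
  proof (rule convex_onI)
    fix t a b :: real assume t: "0 < t" "t < 1"
    have "x + ((1 - t) *\<^sub>R a + t *\<^sub>R b) *\<^sub>R (y - x) = (1 - t) *\<^sub>R (x + a *\<^sub>R (y - x)) + t *\<^sub>R (x + b *\<^sub>R (y - x))"
      by (simp add: algebra_simps)
    then show "\<phi> ((1 - t) *\<^sub>R a + t *\<^sub>R b) \<le> (1 - t) * \<phi> a + t * \<phi> b"
      unfolding \<phi>_def using convex_onD[OF assms(1), of t] t by simp
  qed simp
  moreover have "(\<phi> has_field_derivative ((y - x) \<bullet> D)) (at 0)"
  proof -
    have "(f has_derivative (\<lambda>h. h \<bullet> D)) (at (x + 0 *\<^sub>R (y - x)))" using assms(2) by (simp add: gderiv_def)
    moreover have "((\<lambda>t. x + t *\<^sub>R (y - x)) has_derivative (\<lambda>t. t *\<^sub>R (y - x))) (at 0)"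
      by (auto intro!: derivative_eq_intros)
    ultimately have "(f \<circ> (\<lambda>t. x + t *\<^sub>R (y - x)) has_derivative (\<lambda>h. h \<bullet> D) \<circ> (\<lambda>t. t *\<^sub>R (y - x))) (at 0)"
      by (intro diff_chain_at) auto
    then show ?thesis unfolding has_field_derivative_def \<phi>_def o_def by (simp add: mult.commute[of _ "(y - x) \<bullet> D"])
  qed
  ultimately have "\<phi> 1 - \<phi> 0 \<ge> ((y - x) \<bullet> D) * (1 - 0)"
    by (intro convex_on_imp_above_tangent[where A = UNIV]) auto
  then show ?thesis by (simp add: \<phi>_def inner_commute)
qed

text \<open>Quantitative convexity: along the gradient inequality one gains the square of the difference of gradients,
  because \<open>f\<close> decreases when \<open>y\<close> is moved a little against \<open>g y - g x\<close>. Added to the same inequality with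
  \<open>x\<close> and \<open>y\<close> exchanged, it makes the gradient cocoercive.\<close>

lemma gradient_cocoercive:
  fixes f :: "'a::real_inner \<Rightarrow> real" and g :: "'a \<Rightarrow> 'a"
  assumes convex: "convex_on UNIV f" and grad: "\<And>x. GDERIV f x :> g x"
    and lip: "\<And>x y. norm (g x - g y) \<le> l * norm (x - y)" and l: "0 < l"
  shows "f x + g x \<bullet> (y - x) + 1 / (4 * l) * (norm (g y - g x))\<^sup>2 \<le> f y"
proof -
  \<comment> \<open>Only the tangent inequality at \<open>w\<close> is used to compare \<open>f w\<close> with \<open>f y\<close>; this step length is the best for it and gives \<open>1 / (4 l)\<close>.\<close>
  define s h w where "s = 1 / (2 * l)" and "h = g y - g x" and "w = y - s *\<^sub>R h"
  have s: "0 < s" "l * s = 1/2" using l by (auto simp: s_def)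
  have 1: "f x + g x \<bullet> (w - x) \<le> f w" and 2: "f w + g w \<bullet> (y - w) \<le> f y"
    using convex_gradient_ineq[OF convex grad] by auto
  have "(g y - g w) \<bullet> h \<le> norm (g y - g w) * norm h" by (rule norm_cauchy_schwarz)
  also have "\<dots> \<le> (l * norm (y - w)) * norm h" by (intro mult_right_mono lip) auto
  also have "\<dots> = l * s * (norm h)\<^sup>2" using s by (simp add: w_def power2_eq_square)
  finally have 3: "(g y - g w) \<bullet> h \<le> (norm h)\<^sup>2 / 2" using s by simp
  have "(g w - g x) \<bullet> h = (norm h)\<^sup>2 - (g y - g w) \<bullet> h"
    by (simp add: h_def power2_norm_eq_inner inner_diff_left)
  with 3 have "(norm h)\<^sup>2 / 2 \<le> (g w - g x) \<bullet> h" by linarith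
  then have "s * ((norm h)\<^sup>2 / 2) \<le> s * ((g w - g x) \<bullet> h)" using s by (intro mult_left_mono) auto
  moreover have "g x \<bullet> (w - x) = g x \<bullet> (y - x) - s * (g x \<bullet> h)" "g w \<bullet> (y - w) = s * (g w \<bullet> h)"
    by (simp_all add: w_def inner_diff_right)
  ultimately have "f x + g x \<bullet> (y - x) + s * ((norm h)\<^sup>2 / 2) \<le> f y"
    using 1 2 by (simp add: inner_diff_left right_diff_distrib)
  moreover have "s * ((norm h)\<^sup>2 / 2) = 1 / (4 * l) * (norm (g y - g x))\<^sup>2" by (simp add: s_def h_def)
  ultimately show ?thesis by simp
qed

lemma strictly_convex_on_imp_convex_on:
  assumes "strictly_convex_on S f" shows "convex_on S f"
proof (rule convex_onI)
  show "convex S" using assms by (simp add: strictly_convex_on_def)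
  fix t x y assume t: "0 < t" "t < (1::real)" and xy: "x \<in> S" "y \<in> S"
  show "f ((1 - t) *\<^sub>R x + t *\<^sub>R y) \<le> (1 - t) * f x + t * f y"
  proof (cases "x = y")
    case True
    then show ?thesis by (simp add: scaleR_left_distrib[symmetric] distrib_right[symmetric])
  next
    case False
    then show ?thesis using assms t xy unfolding strictly_convex_on_def
      by (intro less_imp_le) (metis diff_add_cancel diff_gt_0_iff_gt)
  qed
qed

text \<open>Two points with the same gradient lie on a common supporting hyperplane of the graph, and then so does their midpoint.\<close>

lemma strictly_convex_gradient_inj:
  fixes f :: "'a::real_inner \<Rightarrow> real"
  assumes convex: "strictly_convex_on UNIV f" and grad: "GDERIV f x :> D" "GDERIV f y :> D"
  shows "x = y"
proof (rule ccontr)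
  assume ne: "x \<noteq> y"
  define m where "m = (1/2) *\<^sub>R x + (1/2) *\<^sub>R y"
  have "f m < 1/2 * f x + 1/2 * f y"
    using convex[unfolded strictly_convex_on_def, THEN conjunct2, rule_format, of x y "1/2" "1/2"] ne
    by (simp add: m_def)
  moreover have "f x + D \<bullet> (m - x) \<le> f m" "f y + D \<bullet> (m - y) \<le> f m"
    using convex_gradient_ineq[OF strictly_convex_on_imp_convex_on[OF convex]] grad by auto
  moreover have "D \<bullet> (m - x) + D \<bullet> (m - y) = 0"
  proof -
    have "(m - x) + (m - y) = 0" by (simp add: m_def algebra_simps scaleR_left_distrib[symmetric])
    then show ?thesis by (metis inner_add_right inner_zero_right)
  qed
  ultimately show False by linarith
qed

definition vec_product :: "('n::finite \<Rightarrow> 'a set) \<Rightarrow> ('a^'n) set" where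
  "vec_product S = {X. \<forall>i. X $ i \<in> S i}"

lemma closed_vec_product:
  fixes S :: "'n::finite \<Rightarrow> ('a::euclidean_space) set"
  assumes "\<And>i. closed (S i)" shows "closed (vec_product S)"
proof -
  have "vec_product S = (\<Inter>i. (\<lambda>X. X $ i) -` S i)" by (auto simp: vec_product_def)
  then show ?thesis using assms by (auto intro!: closed_INT closed_vimage continuous_intros)
qed

lemma convex_vec_product:
  assumes "\<And>i. convex (S i)" shows "convex (vec_product S)"
  using assms by (auto simp: vec_product_def convex_def)

lemma norm_vec_sq:
  fixes X :: "('a::real_inner)^'n::finite"
  shows "(norm X)\<^sup>2 = (\<Sum>i\<in>UNIV. (norm (X $ i))\<^sup>2)"
  by (simp add: power2_norm_eq_inner inner_vec_def)

lemma compact_vec_product: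
  fixes S :: "'n::finite \<Rightarrow> ('a::euclidean_space) set"
  assumes "\<And>i. compact (S i)" shows "compact (vec_product S)"
proof -
  have "\<forall>i. \<exists>B. \<forall>x\<in>S i. norm x \<le> B" using assms compact_imp_bounded bounded_iff by metis
  then obtain B where B: "\<And>i x. x \<in> S i \<Longrightarrow> norm x \<le> B i" by metis
  have "norm X \<le> (\<Sum>i\<in>UNIV. B i)" if "X \<in> vec_product S" for X
  proof -
    have "norm X \<le> (\<Sum>i\<in>UNIV. norm (X $ i))" by (simp add: norm_vec_def L2_set_le_sum)
    also have "\<dots> \<le> (\<Sum>i\<in>UNIV. B i)" using that B by (intro sum_mono) (auto simp: vec_product_def)
    finally show ?thesis .
  qed
  then have "bounded (vec_product S)" unfolding bounded_iff by blast
  then show ?thesis using closed_vec_product[of S] assms compact_imp_closed compact_eq_bounded_closed by blast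
qed

lemma closest_point_vec_product:
  fixes S :: "'n::finite \<Rightarrow> ('a::euclidean_space) set"
  assumes S: "\<And>i. closed (S i)" "\<And>i. convex (S i)" "\<And>i. S i \<noteq> {}"
  shows "closest_point (vec_product S) X = (\<chi> i. closest_point (S i) (X $ i))"
proof (rule closest_point_unique[symmetric])
  show "convex (vec_product S)" "closed (vec_product S)" using S by (auto intro: convex_vec_product closed_vec_product)
  show "(\<chi> i. closest_point (S i) (X $ i)) \<in> vec_product S" using S by (auto simp: vec_product_def closest_point_in_set)
  show "\<forall>Y\<in>vec_product S. dist X (\<chi> i. closest_point (S i) (X $ i)) \<le> dist X Y"
  proof
    fix Y assume Y: "Y \<in> vec_product S"
    have "(norm (X - (\<chi> i. closest_point (S i) (X $ i))))\<^sup>2 \<le> (norm (X - Y))\<^sup>2"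
      unfolding norm_vec_sq using Y S(1)
      by (intro sum_mono power_mono) (auto simp: vec_product_def dist_norm[symmetric] closest_point_le)
    then show "dist X (\<chi> i. closest_point (S i) (X $ i)) \<le> dist X Y"
      unfolding dist_norm by (rule power2_le_imp_le) simp
  qed
qed

text \<open>Projections are determined by local conditions: cutting the set by a ball does not
  change a projection that lies inside the ball. The reference path is built in compact sets, and this lemma
  removes the cut once the path is near the optimum.\<close>

lemma closest_point_Int_ball:
  fixes S :: "'a::euclidean_space set"
  assumes "convex S" "closed S" "x = closest_point (S \<inter> cball c r) z" "x \<in> S" "dist c x < r"
  shows "x = closest_point S z"
proof -
  have cc: "convex (S \<inter> cball c r)" "closed (S \<inter> cball c r)" using assms by (auto intro: convex_Int)
  have "(z - x) \<bullet> (y - x) \<le> 0" if y: "y \<in> S" for y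
  proof -
    \<comment> \<open>so small a step from \<open>x\<close> towards \<open>y\<close> that it stays in the ball\<close>
    define s where "s = (r - dist c x) / (norm (y - x) + (r - dist c x))"
    have d: "0 < r - dist c x" using assms by simp
    have s: "0 < s" "s \<le> 1" using d by (auto simp: s_def divide_simps add_nonneg_pos)
    have "s * norm (y - x) \<le> r - dist c x"
    proof -
      have "(r - dist c x) * norm (y - x) \<le> (r - dist c x) * (norm (y - x) + (r - dist c x))"
        using d by (intro mult_left_mono) auto
      then show ?thesis using d by (simp add: s_def divide_le_eq add_nonneg_pos)
    qed
    define y' where "y' = x + s *\<^sub>R (y - x)"
    have "y' = (1 - s) *\<^sub>R x + s *\<^sub>R y" by (simp add: y'_def algebra_simps)
    then have "y' \<in> S" using s assms y by (simp add: convexD)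
    moreover have "dist c y' \<le> dist c x + dist x y'" by (rule dist_triangle)
    then have "dist c y' \<le> r" using \<open>s * norm (y - x) \<le> r - dist c x\<close> s by (simp add: y'_def dist_norm)
    ultimately have "(z - x) \<bullet> (y' - x) \<le> 0" using closest_point_dot[OF cc, of y' z] assms(3) by simp
    then show ?thesis using s by (simp add: y'_def mult_le_0_iff)
  qed
  then have "dist z x \<le> dist z y" if "y \<in> S" for y
  proof -
    have "(norm (z - y))\<^sup>2 = (norm (z - x))\<^sup>2 - 2 * ((z - x) \<bullet> (y - x)) + (norm (y - x))\<^sup>2"
      by (simp add: power2_norm_eq_inner algebra_simps inner_commute)
    then have "(norm (z - x))\<^sup>2 \<le> (norm (z - y))\<^sup>2"
      using \<open>\<And>y. y \<in> S \<Longrightarrow> (z - x) \<bullet> (y - x) \<le> 0\<close>[OF that] zero_le_power2[of "norm (y - x)"] by linarith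
    then show ?thesis unfolding dist_norm by (rule power2_le_imp_le) simp
  qed
  then show ?thesis using assms by (intro closest_point_unique) auto
qed

section \<open>Laplacian matrices\<close>

lemma matrix_mult_row:
  fixes B :: "real^'n^'n" and X :: "real^'m^'n"
  shows "(B ** X) $ i = (\<Sum>j\<in>UNIV. B $ i $ j *\<^sub>R X $ j)"
  by (simp add: vec_eq_iff matrix_matrix_mult_def)

lemma linear_matrix_mult: "linear (\<lambda>X :: real^'m^'n. (B :: real^'n^'n) ** X)"
  by (rule linearI) (simp_all add: vec_eq_iff matrix_mult_row scaleR_right_distrib sum.distrib scaleR_sum_right mult.left_commute matrix_matrix_mult_def sum_distrib_left algebra_simps)

lemma second_entry_nonpos:
  fixes xs :: "real list"
  assumes "sorted xs" "2 \<le> count (mset xs) 0" shows "xs ! 1 \<le> 0"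
proof (rule ccontr)
  assume pos: "\<not> xs ! 1 \<le> 0"
  have "count (mset xs) 0 \<le> size (mset xs)" by (rule count_le_size)
  then have len: "2 \<le> length xs" using assms(2) by simp
  then obtain a ys where xs: "xs = a # ys" by (cases xs) auto
  have ys: "0 \<notin> set ys"
  proof
    assume "0 \<in> set ys"
    then obtain i where "i < length ys" "ys ! i = 0" by (auto simp: in_set_conv_nth)
    then have "xs ! 1 \<le> 0" using assms(1) len sorted_nth_mono[of xs 1 "Suc i"] by (simp add: xs)
    then show False using pos by simp
  qed
  have "count (mset ys) 0 = 0" using ys unfolding count_eq_zero_iff by simp
  then have "count (mset xs) 0 \<le> 1" by (simp add: xs del: count_mset_0_iff)
  then show False using assms(2) by simp
qed

text \<open>The Laplacians of symmetrically weighted graphs, in terms of their entries.\<close>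

locale laplacian_matrix =
  fixes B :: "real^'n::finite^'n"
  assumes sym: "B $ i $ j = B $ j $ i" and rows: "(\<Sum>j\<in>UNIV. B $ i $ j) = 0"
    and off: "i \<noteq> j \<Longrightarrow> B $ i $ j \<le> 0"
begin

lemma cols: "(\<Sum>i\<in>UNIV. B $ i $ j) = 0"
  using rows[of j] by (simp add: sym[of j])

text \<open>For a vector-valued state the form is the weighted sum of squared disagreements; it is therefore nonnegative.\<close>

lemma quadratic_form:
  fixes x :: "'n \<Rightarrow> 'a::real_inner"
  shows "(\<Sum>i\<in>UNIV. \<Sum>j\<in>UNIV. B $ i $ j * (x i \<bullet> x j)) = (\<Sum>i\<in>UNIV. \<Sum>j\<in>UNIV. - B $ i $ j * (norm (x i - x j))\<^sup>2) / 2"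
proof -
  have *: "- B $ i $ j * (norm (x i - x j))\<^sup>2 = 2 * (B $ i $ j * (x i \<bullet> x j)) - B $ i $ j * (x i \<bullet> x i) - B $ i $ j * (x j \<bullet> x j)" for i j
    by (simp add: power2_norm_eq_inner inner_diff_left inner_diff_right inner_commute algebra_simps)
  have "(\<Sum>i\<in>UNIV. \<Sum>j\<in>UNIV. B $ i $ j * (x i \<bullet> x i)) = 0"
    by (simp add: sum_distrib_right[symmetric] rows)
  moreover have "(\<Sum>i\<in>UNIV. \<Sum>j\<in>UNIV. B $ i $ j * (x j \<bullet> x j)) = 0"
    by (subst sum.swap) (simp add: sum_distrib_right[symmetric] cols)
  ultimately show ?thesis unfolding * sum_subtractf by (simp add: sum_distrib_left[symmetric])
qed

lemma quadratic_form_nonneg: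
  fixes x :: "'n \<Rightarrow> 'a::real_inner"
  shows "0 \<le> (\<Sum>i\<in>UNIV. \<Sum>j\<in>UNIV. B $ i $ j * (x i \<bullet> x j))"
proof -
  have "0 \<le> - B $ i $ j * (norm (x i - x j))\<^sup>2" for i j
    using off[of i j] by (cases "i = j") (auto simp: mult_nonpos_nonneg)
  then show ?thesis unfolding quadratic_form by (simp add: sum_nonneg)
qed

lemma charpoly_nonzero: "charpoly B \<noteq> 0"
proof
  assume "charpoly B = 0"
  then have "det (mat (-1) - B) = 0" using poly_charpoly[of B "-1"] by simp
  then have "\<not> (\<forall>x. (mat (-1) - B) *v x = 0 \<longrightarrow> x = 0)"
    unfolding matrix_left_invertible_ker[symmetric] invertible_left_inverse[symmetric] invertible_det_nz by simp
  then obtain x where x: "(mat (-1) - B) *v x = 0" "x \<noteq> 0" by blast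
  have comp: "((mat (-1) - B) *v x) $ i = - x $ i - (\<Sum>j\<in>UNIV. B $ i $ j * x $ j)" for i
  proof -
    have "(\<Sum>j\<in>UNIV. (if i = j then - x $ j else 0)) = - x $ i" by simp
    moreover have "(mat (-1) - B) $ i $ j * x $ j = (if i = j then - x $ j else 0) - B $ i $ j * x $ j" for j
      by (simp add: mat_def left_diff_distrib)
    ultimately show ?thesis by (simp add: matrix_vector_mult_def sum_subtractf)
  qed
  have "0 = (\<Sum>i\<in>UNIV. x $ i * (- x $ i - (\<Sum>j\<in>UNIV. B $ i $ j * x $ j)))" using x(1) by (simp add: comp[symmetric])
  also have "\<dots> = - (norm x)\<^sup>2 - (\<Sum>i\<in>UNIV. \<Sum>j\<in>UNIV. B $ i $ j * (x $ i \<bullet> x $ j))"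
  proof -
    have "(norm x)\<^sup>2 = (\<Sum>i\<in>UNIV. x $ i * x $ i)" unfolding norm_vec_sq by (simp add: power2_eq_square)
    then show ?thesis by (simp add: right_diff_distrib sum_subtractf sum_negf sum_distrib_left mult_ac)
  qed
  also have "\<dots> \<le> - (norm x)\<^sup>2" using quadratic_form_nonneg[of "\<lambda>i. x $ i"] by simp
  also have "\<dots> < 0" using x(2) by simp
  finally show False by simp
qed

text \<open>The second eigenvalue is read off the characteristic polynomial, so a kernel of dimension two has to produce
  a double root. Replace two columns of the identity by the independent kernel vectors \<open>(1,\<dots>,1)\<close> and \<open>v\<close>, and
  call the result \<open>P\<close>. Then the columns \<open>r\<close> and \<open>s\<close> of \<open>(x I - B) P\<close> are divisible by \<open>x\<close>, so its
  determinant is divisible by \<open>x\<^sup>2\<close>, while \<open>det P\<close> is a nonzero constant.\<close>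

lemma zero_eigenvalue_multiplicity:
  fixes v :: "real^'n"
  assumes v: "B *v v = 0" and ne: "v $ r \<noteq> v $ s"
  shows "2 \<le> order 0 (charpoly B)"
proof -
  define P :: "real^'n^'n" where "P = (\<chi> i j. if j = r then 1 else if j = s then v $ i else if i = j then 1 else 0)"
  have rs: "r \<noteq> s" using ne by blast
  have "det P \<noteq> 0"
  proof -
    have "w = 0" if w: "P *v w = 0" for w
    proof -
      have row: "(P *v w) $ i = w $ r + v $ i * w $ s + (if i = r \<or> i = s then 0 else w $ i)" for i
      proof -
        have "(P *v w) $ i = (\<Sum>j\<in>UNIV. (if j = r then w $ j else 0) + (if j = s then v $ i * w $ j else 0)
            + (if j = i then (if i = r \<or> i = s then 0 else w $ j) else 0))"
          unfolding matrix_vector_mult_def P_def using rs by (simp, intro sum.cong) auto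
        then show ?thesis by (simp add: sum.distrib)
      qed
      have e: "w $ r + v $ r * w $ s = 0" "w $ r + v $ s * w $ s = 0"
        using row[of r] row[of s] w by simp_all
      then have "(v $ r - v $ s) * w $ s = 0" unfolding left_diff_distrib by linarith
      then have ws: "w $ s = 0" using ne by simp
      then have wr: "w $ r = 0" using e by simp
      show ?thesis unfolding vec_eq_iff
      proof
        fix i show "w $ i = 0 $ i" using row[of i] w ws wr by (auto split: if_splits)
      qed
    qed
    then show ?thesis
      unfolding invertible_det_nz[symmetric] invertible_left_inverse matrix_left_invertible_ker by blast
  qed
  define Q :: "real poly^'n^'n" where "Q = (\<chi> i j. [:P $ i $ j:])"
  define N :: "real poly^'n^'n" where "N = mat [:0, 1:] - (\<chi> i j. [:B $ i $ j:])"
  have polyQ: "poly (det Q) 0 = det P"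
    unfolding Q_def det_def
    by (auto simp: poly_sum poly_prod of_int_poly intro!: sum.cong prod.cong arg_cong2[where f = "(*)"])
  \<comment> \<open>\<open>R\<close> is \<open>N ** Q\<close> with the factor \<open>x\<close> taken out of the columns \<open>r\<close> and \<open>s\<close>.\<close>
  define R where "R = (\<chi> i j. if j = r then 1 else if j = s then [:v $ i:] else (N ** Q) $ i $ j)"
  have ker: "(\<Sum>j\<in>UNIV. B $ i $ j * P $ j $ k) = 0" if "k = r \<or> k = s" for i k
    using that rows[of i] arg_cong[OF v, of "\<lambda>x. x $ i"] rs by (auto simp: P_def matrix_vector_mult_def)
  have NQ: "(N ** Q) $ i $ k = [:0, 1:] * [:P $ i $ k:]" if "k = r \<or> k = s" for i k
  proof -
    have "(N ** Q) $ i $ k = (\<Sum>j\<in>UNIV. (if j = i then [:0, 1:] * [:P $ j $ k:] else 0) - [:B $ i $ j * P $ j $ k:])"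
      unfolding matrix_matrix_mult_def N_def Q_def by (simp add: mat_def left_diff_distrib) (intro sum.cong, auto)
    also have "\<dots> = [:0, 1:] * [:P $ i $ k:] - (\<Sum>j\<in>UNIV. [:B $ i $ j * P $ j $ k:])"
      by (simp add: sum_subtractf del: mult_pCons_left)
    also have "(\<Sum>j\<in>UNIV. [:B $ i $ j * P $ j $ k:]) = [:(\<Sum>j\<in>UNIV. B $ i $ j * P $ j $ k):]"
      by (rule poly_eqI) (simp add: coeff_sum coeff_pCons split: nat.split)
    finally show ?thesis using ker[OF that] by simp
  qed
  have "transpose (N ** Q) = (\<chi> j. (if j = r \<or> j = s then [:0, 1:] else 1) *s (transpose R $ j))"
    unfolding vec_eq_iff using NQ rs by (auto simp: transpose_def R_def P_def)
  then have "det (transpose (N ** Q)) = (\<Prod>j\<in>UNIV. if j = r \<or> j = s then [:0, 1:] else 1) * det (\<chi> j. transpose R $ j)"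
    by (simp only: det_rows_mul)
  also have "(\<Prod>j\<in>UNIV. if j = r \<or> j = s then [:0, 1:] else 1) = (\<Prod>j\<in>{r, s}. [:0, 1:] :: real poly)"
    by (intro prod.mono_neutral_cong_right) auto
  also have "\<dots> = [:0, 1:]\<^sup>2" using rs by (simp add: power2_eq_square)
  finally have "det N * det Q = [:0, 1:]\<^sup>2 * det R" by (simp add: det_mul)
  then have eq: "charpoly B * det Q = [:0, 1:]\<^sup>2 * det R" by (simp add: charpoly_def N_def)
  have nz: "charpoly B * det Q \<noteq> 0" using charpoly_nonzero polyQ \<open>det P \<noteq> 0\<close> by auto
  have "[:- 0, 1:]\<^sup>2 dvd charpoly B * det Q" unfolding eq by simp
  then have "2 \<le> order 0 (charpoly B * det Q)" using nz order_divides by blast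
  also have "\<dots> = order 0 (charpoly B) + order 0 (det Q)" by (rule order_mult[OF nz])
  also have "order 0 (det Q) = 0" using polyQ \<open>det P \<noteq> 0\<close> by (intro order_0I) simp
  finally show ?thesis by simp
qed

lemma kernel_constant:
  assumes s2: "0 < second_smallest_eigenvalue B" and v: "B *v v = 0"
  shows "v $ i = v $ j"
proof (rule ccontr)
  assume "v $ i \<noteq> v $ j"
  then have "2 \<le> order 0 (charpoly B)" using zero_eigenvalue_multiplicity[OF v] by blast
  then have "2 \<le> count (mset (eigenvalues B)) 0" by (simp add: eigenvalues_def charpoly_nonzero)
  then have "eigenvalues B ! 1 \<le> 0" by (intro second_entry_nonpos) (simp add: eigenvalues_def)
  then show False using s2 by (simp add: second_smallest_eigenvalue_def)
qed

lemma action_sym: "(B ** x) \<bullet> y = x \<bullet> (B ** y)" for x y :: "real^'m^'n"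
proof -
  have "(B ** x) \<bullet> y = (\<Sum>i\<in>UNIV. \<Sum>j\<in>UNIV. B $ i $ j * (x $ j \<bullet> y $ i))"
    by (simp add: inner_vec_def[of "B ** x"] matrix_mult_row inner_sum_left)
  also have "\<dots> = (\<Sum>j\<in>UNIV. \<Sum>i\<in>UNIV. B $ j $ i * (x $ j \<bullet> y $ i))"
    by (subst sum.swap) (simp add: sym)
  also have "\<dots> = x \<bullet> (B ** y)"
    by (simp add: inner_vec_def[of x] matrix_mult_row inner_sum_right)
  finally show ?thesis .
qed

lemma action_nonneg: "0 \<le> x \<bullet> (B ** x)" for x :: "real^'m^'n"
proof -
  have "x \<bullet> (B ** x) = (\<Sum>i\<in>UNIV. \<Sum>j\<in>UNIV. B $ i $ j * (x $ i \<bullet> x $ j))"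
    by (simp add: inner_vec_def[of x] matrix_mult_row inner_sum_right)
  then show ?thesis using quadratic_form_nonneg[of "\<lambda>i. x $ i"] by simp
qed

lemma action_sum: "(\<Sum>i\<in>UNIV. (B ** x) $ i) = 0" for x :: "real^'m^'n"
proof -
  have "(\<Sum>i\<in>UNIV. (B ** x) $ i) = (\<Sum>j\<in>UNIV. \<Sum>i\<in>UNIV. B $ i $ j *\<^sub>R x $ j)"
    unfolding matrix_mult_row by (rule sum.swap)
  then show ?thesis by (simp add: scaleR_left.sum[symmetric] cols)
qed

text \<open>A symmetric map is onto the orthogonal complement of its kernel, which consists of the consensus states.\<close>

lemma range_action:
  assumes s2: "0 < second_smallest_eigenvalue B"
  shows "range (\<lambda>x :: real^'m^'n. B ** x) = {y. (\<Sum>i\<in>UNIV. y $ i) = 0}"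
proof -
  define S :: "(real^'m^'n) set" where "S = {y. (\<Sum>i\<in>UNIV. y $ i) = 0}"
  have S: "subspace S"
    unfolding S_def subspace_def by (simp add: sum.distrib scaleR_sum_right[symmetric])
  have "inj_on (\<lambda>x. B ** x) S"
  proof (rule inj_onI)
    fix x y assume xy: "x \<in> S" "y \<in> S" "B ** x = B ** y"
    define u where "u = x - y"
    have u: "B ** u = 0" using xy(3) by (simp add: u_def linear_diff[OF linear_matrix_mult])
    have const: "u $ i = u $ j" for i j
      unfolding vec_eq_iff
    proof
      fix l
      have "B *v (\<chi> k. u $ k $ l) = 0"
        using u by (simp add: vec_eq_iff matrix_matrix_mult_def matrix_vector_mult_def)
      from kernel_constant[OF s2 this, of i j] show "u $ i $ l = u $ j $ l" by simp
    qed
    have "(\<Sum>i\<in>UNIV. u $ i) = 0" using xy(1,2) by (simp add: u_def S_def sum_subtractf)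
    moreover have "(\<Sum>i\<in>UNIV. u $ i) = real CARD('n) *\<^sub>R u $ k" for k
    proof -
      have "(\<Sum>i\<in>UNIV. u $ i) = (\<Sum>i\<in>(UNIV :: 'n set). u $ k)" by (intro sum.cong const) auto
      then show ?thesis by (simp only: sum_constant_scaleR)
    qed
    ultimately have "u $ k = 0" for k by (simp add: card_gt_0_iff)
    then have "u = 0" by (simp add: vec_eq_iff)
    then show "x = y" by (simp add: u_def)
  qed
  then have "dim ((\<lambda>x. B ** x) ` S) = dim S"
    by (intro dim_image_eq[OF linear_matrix_mult]) (simp add: S span_eq_iff[THEN iffD2])
  moreover have "(\<lambda>x. B ** x) ` S \<subseteq> S" using action_sum by (auto simp: S_def)
  ultimately have "(\<lambda>x. B ** x) ` S = S"
    by (intro subspace_dim_equal linear_subspace_image[OF linear_matrix_mult] S) auto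
  moreover have "range (\<lambda>x :: real^'m^'n. B ** x) \<subseteq> S" using action_sum by (auto simp: S_def)
  ultimately show ?thesis unfolding S_def by blast
qed

end

section \<open>Two proximal paths of one monotone operator\<close>

lemma sqrt_convex_combination:
  fixes a b c d :: real
  assumes "0 < a" "0 < b" "0 \<le> c" "0 \<le> d"
  shows "b * sqrt c + a * sqrt d \<le> (a + b) * sqrt ((b * c + a * d) / (a + b))"
proof -
  have "(b * sqrt c + a * sqrt d)\<^sup>2 \<le> (a + b) * (b * c + a * d)"
  proof -
    have "(a + b) * (b * (sqrt c)\<^sup>2 + a * (sqrt d)\<^sup>2) - (b * sqrt c + a * sqrt d)\<^sup>2
        = a * b * (sqrt c - sqrt d)\<^sup>2"
      by (simp add: power2_eq_square algebra_simps)
    moreover have "0 \<le> a * b * (sqrt c - sqrt d)\<^sup>2" using assms by simp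
    ultimately have "(b * sqrt c + a * sqrt d)\<^sup>2 \<le> (a + b) * (b * (sqrt c)\<^sup>2 + a * (sqrt d)\<^sup>2)"
      by linarith
    then show ?thesis using assms by simp
  qed
  also have "(a + b) * (b * c + a * d) = ((a + b) * sqrt ((b * c + a * d) / (a + b)))\<^sup>2"
  proof -
    have "(b * c + a * d) / (a + b) \<ge> 0" using assms by simp
    then have "((a + b) * sqrt ((b * c + a * d) / (a + b)))\<^sup>2 = (a + b) * ((a + b) * ((b * c + a * d) / (a + b)))"
      by (simp only: power_mult_distrib real_sqrt_pow2) (simp only: power2_eq_square mult.assoc)
    then show ?thesis using assms by simp
  qed
  finally show ?thesis
    by (rule power2_le_imp_le) (use assms in auto)
qed

text \<open>If \<open>x\<close> is the difference of two points after implicit steps of lengths \<open>a\<close> and \<open>b\<close> along \<open>v\<close> and \<open>w\<close>, then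
  \<open>x + a v\<close> and \<open>x - b w\<close> are the differences with only one of the two steps undone. Monotonicity bounds the
  distance after both steps by the mean of these two.\<close>

lemma resolvent_doubling:
  fixes x v w :: "'a::real_inner"
  assumes "0 < a" "0 < b" and mono: "0 \<le> (v - w) \<bullet> x"
  shows "(a + b) * norm x \<le> b * norm (x + a *\<^sub>R v) + a * norm (x - b *\<^sub>R w)"
proof (cases "x = 0")
  case False
  have "((a + b) * norm x) * norm x = (a + b) * (x \<bullet> x)"
    by (simp add: power2_norm_eq_inner[symmetric] power2_eq_square)
  also have "\<dots> \<le> (a + b) * (x \<bullet> x) + a * b * ((v - w) \<bullet> x)"
    using assms by simp
  also have "\<dots> = (b *\<^sub>R (x + a *\<^sub>R v) + a *\<^sub>R (x - b *\<^sub>R w)) \<bullet> x"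
    by (simp add: algebra_simps)
  also have "\<dots> \<le> norm (b *\<^sub>R (x + a *\<^sub>R v) + a *\<^sub>R (x - b *\<^sub>R w)) * norm x"
    by (rule norm_cauchy_schwarz)
  also have "\<dots> \<le> (b * norm (x + a *\<^sub>R v) + a * norm (x - b *\<^sub>R w)) * norm x"
    by (intro mult_right_mono order.trans[OF norm_triangle_ineq]) (use assms in auto)
  finally show ?thesis using False by simp
qed (use assms in simp)

lemma sum_lessThan_split:
  fixes f :: "nat \<Rightarrow> real"
  shows "m \<le> n \<Longrightarrow> sum f {m..<n} = sum f {..<n} - sum f {..<m}"
  by (metis add_diff_cancel_left' lessThan_atLeast0 sum.atLeastLessThan_concat zero_le)

text \<open>Kobayashi's estimate. The grid of pairs \<open>(i', j')\<close> is swept by induction: \<open>resolvent_doubling\<close> bounds an entry by a mean of its two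
  predecessors, and the square of the error term is dominated by the mean of the squares of their error terms, so that concavity of
  the root closes the induction. Most important is the mismatch of the elapsed times: paths which have
  run for the same time drift apart by at most a constant when the squares of the steps are summable.\<close>

lemma proximal_path_distance:
  fixes u v :: "nat \<Rightarrow> 'a::real_inner" and \<beta> :: "nat \<Rightarrow> real"
  assumes pos: "\<And>k. 0 < \<beta> k"
    and step: "\<And>k. u (Suc k) = u k - \<beta> k *\<^sub>R v (Suc k)"
    and mono: "\<And>i j. 0 \<le> (v (Suc i) - v (Suc j)) \<bullet> (u (Suc i) - u (Suc j))"
    and bound: "\<And>k. norm (v (Suc k)) \<le> \<rho>"
    and le: "i \<le> i'" "j \<le> j'"
  shows "norm (u i' - u j') \<le> norm (u i - u j) + \<rho> *
    sqrt ((sum \<beta> {i..<i'} - sum \<beta> {j..<j'})\<^sup>2 + (\<Sum>k\<in>{i..<i'}. (\<beta> k)\<^sup>2) + (\<Sum>k\<in>{j..<j'}. (\<beta> k)\<^sup>2))"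
proof -
  have \<rho>: "0 \<le> \<rho>" using bound[of 0] norm_ge_zero order.trans by blast
  have path: "norm (u n - u m) \<le> \<rho> * sum \<beta> {m..<n}" if "m \<le> n" for m n
    using that
  proof (induction n rule: dec_induct)
    case (step n)
    have "norm (u (Suc n) - u m) \<le> norm (u n - u m) + norm (u (Suc n) - u n)"
      using norm_triangle_ineq[of "u n - u m" "u (Suc n) - u n"] by simp
    also have "norm (u (Suc n) - u n) \<le> \<rho> * \<beta> n"
      using bound[of n] pos[of n] by (simp add: assms(2) mult.commute)
    finally show ?case using step by (simp add: algebra_simps)
  qed simp
  have near: "\<rho> * sum \<beta> A \<le> \<rho> * sqrt ((sum \<beta> A)\<^sup>2 + (\<Sum>k\<in>A. (\<beta> k)\<^sup>2))" for A
  proof -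
    have "sum \<beta> A \<le> sqrt ((sum \<beta> A)\<^sup>2 + (\<Sum>k\<in>A. (\<beta> k)\<^sup>2))"
      by (intro real_le_rsqrt) (simp add: sum_nonneg)
    then show ?thesis using \<rho> by (intro mult_left_mono) auto
  qed
  have "\<forall>i' j'. i \<le> i' \<longrightarrow> j \<le> j' \<longrightarrow> (i' - i) + (j' - j) = N \<longrightarrow> norm (u i' - u j') \<le> norm (u i - u j) + \<rho> *
    sqrt ((sum \<beta> {i..<i'} - sum \<beta> {j..<j'})\<^sup>2 + (\<Sum>k\<in>{i..<i'}. (\<beta> k)\<^sup>2) + (\<Sum>k\<in>{j..<j'}. (\<beta> k)\<^sup>2))"
    for N
  proof (induction N rule: less_induct)
    case (less N)
    show ?case
    proof (intro allI impI)
      fix i' j' assume le: "i \<le> i'" "j \<le> j'" and N: "(i' - i) + (j' - j) = N"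
      consider "i' = i" | "j' = j" | m n where "i' = Suc m" "j' = Suc n" "i \<le> m" "j \<le> n"
        using le by (cases i'; cases j') (auto simp: le_Suc_eq)
      then show "norm (u i' - u j') \<le> norm (u i - u j) + \<rho> *
        sqrt ((sum \<beta> {i..<i'} - sum \<beta> {j..<j'})\<^sup>2 + (\<Sum>k\<in>{i..<i'}. (\<beta> k)\<^sup>2) + (\<Sum>k\<in>{j..<j'}. (\<beta> k)\<^sup>2))"
      proof cases
        case 1
        have "norm (u i - u j') \<le> norm (u i - u j) + norm (u j' - u j)"
          using norm_triangle_ineq4[of "u i - u j" "u j' - u j"] by simp
        then show ?thesis using 1 path[OF le(2)] near[of "{j..<j'}"] by (simp add: add_ac)
      next
        case 2
        have "norm (u i' - u j) \<le> norm (u i - u j) + norm (u i' - u i)"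
          using norm_triangle_ineq[of "u i - u j" "u i' - u i"] by simp
        then show ?thesis using 2 path[OF le(1)] near[of "{i..<i'}"] by (simp add: add_ac)
      next
        case 3
        define a b where "a = \<beta> m" and "b = \<beta> n"
        have ab: "0 < a" "0 < b" using pos by (auto simp: a_def b_def)
        define d where "d = norm (u i - u j)"
        define D S T where "D = sum \<beta> {i..<i'} - sum \<beta> {j..<j'}"
          and "S = (\<Sum>k\<in>{i..<i'}. (\<beta> k)\<^sup>2)" and "T = (\<Sum>k\<in>{j..<j'}. (\<beta> k)\<^sup>2)"
        have sm: "sum \<beta> {i..<m} = sum \<beta> {i..<i'} - a" "(\<Sum>k\<in>{i..<m}. (\<beta> k)\<^sup>2) = S - a\<^sup>2"
          "sum \<beta> {j..<n} = sum \<beta> {j..<j'} - b" "(\<Sum>k\<in>{j..<n}. (\<beta> k)\<^sup>2) = T - b\<^sup>2"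
          using 3 by (auto simp: a_def b_def S_def T_def)
        have ST: "0 \<le> S - a\<^sup>2" "0 \<le> T - b\<^sup>2" "0 \<le> S" "0 \<le> T"
          unfolding sm(2,4)[symmetric] by (auto simp: S_def T_def sum_nonneg)
        define c1 c2 where "c1 = (D - a)\<^sup>2 + (S - a\<^sup>2) + T" and "c2 = (D + b)\<^sup>2 + S + (T - b\<^sup>2)"
        have c: "0 \<le> c1" "0 \<le> c2" using ST by (auto simp: c1_def c2_def)
        have l1: "norm (u m - u j') \<le> d + \<rho> * sqrt c1"
        proof -
          have "(m - i) + (j' - j) < N" using 3 N le by auto
          moreover have "sum \<beta> {i..<m} - sum \<beta> {j..<j'} = D - a"
            unfolding sm D_def by linarith
          ultimately show ?thesis
            using less.IH 3 le unfolding d_def c1_def T_def sm(2)[symmetric] by metis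
        qed
        have l2: "norm (u i' - u n) \<le> d + \<rho> * sqrt c2"
        proof -
          have "(i' - i) + (n - j) < N" using 3 N le by auto
          moreover have "sum \<beta> {i..<i'} - sum \<beta> {j..<n} = D + b"
            unfolding sm D_def by linarith
          ultimately show ?thesis
            using less.IH 3 le unfolding d_def c2_def S_def sm(4)[symmetric] by metis
        qed
        have "(a + b) * norm (u i' - u j') \<le> b * norm (u m - u j') + a * norm (u i' - u n)"
        proof -
          have eq: "u i' - u j' + a *\<^sub>R v i' = u m - u j'" "u i' - u j' - b *\<^sub>R v j' = u i' - u n"
            unfolding 3 a_def b_def using step[of m] step[of n] by (auto simp: algebra_simps)
          show ?thesis
            using resolvent_doubling[OF ab mono[of m n, folded 3(1,2)]] unfolding eq .
        qed
        also have "\<dots> \<le> b * (d + \<rho> * sqrt c1) + a * (d + \<rho> * sqrt c2)"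
          using ab l1 l2 by (intro add_mono mult_left_mono) auto
        also have "\<dots> = (a + b) * d + \<rho> * (b * sqrt c1 + a * sqrt c2)"
          by (simp add: algebra_simps)
        also have "\<dots> \<le> (a + b) * d + \<rho> * ((a + b) * sqrt ((b * c1 + a * c2) / (a + b)))"
          using sqrt_convex_combination[OF ab c] \<rho> by (intro add_left_mono mult_left_mono) auto
        also have "(b * c1 + a * c2) / (a + b) = D\<^sup>2 + S + T"
          using ab by (simp add: c1_def c2_def field_simps power2_eq_square)
        finally have "(a + b) * norm (u i' - u j') \<le> (a + b) * (d + \<rho> * sqrt (D\<^sup>2 + S + T))"
          by (simp add: algebra_simps)
        then show ?thesis using ab by (simp add: d_def D_def S_def T_def)
      qed
    qed
  qed
  then show ?thesis using le by blast
qed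

text \<open>The exponential moving average of \<open>f\<close> with time constant \<open>H\<close>, discretized implicitly with the step sizes \<open>\<beta>\<close>.\<close>

primrec ema :: "real \<Rightarrow> (nat \<Rightarrow> real) \<Rightarrow> (nat \<Rightarrow> 'a::real_vector) \<Rightarrow> nat \<Rightarrow> 'a" where
  "ema H \<beta> f 0 = f 0"
| "ema H \<beta> f (Suc k) = (H / (H + \<beta> k)) *\<^sub>R ema H \<beta> f k + (\<beta> k / (H + \<beta> k)) *\<^sub>R f (Suc k)"

context
  fixes H :: real and \<beta> :: "nat \<Rightarrow> real"
  assumes H: "0 < H" and \<beta>: "\<And>k. 0 < \<beta> k"
begin

lemma weight_pos: "0 < H + \<beta> k"
  using H \<beta>[of k] by linarith

lemma weights_sum: "H / (H + \<beta> k) + \<beta> k / (H + \<beta> k) = 1"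
  using weight_pos[of k] by (simp add: add_divide_distrib[symmetric])

lemma ema_Suc: "(H + \<beta> k) *\<^sub>R ema H \<beta> f (Suc k) = H *\<^sub>R ema H \<beta> f k + \<beta> k *\<^sub>R f (Suc k)"
  using weight_pos[of k] by (simp add: scaleR_right_distrib)

lemma ema_step:
  "H *\<^sub>R (ema H \<beta> f (Suc k) - ema H \<beta> f k) = \<beta> k *\<^sub>R (f (Suc k) - ema H \<beta> f (Suc k))"
  using ema_Suc[of k f] by (simp add: algebra_simps del: ema.simps)

lemma ema_const: "ema H \<beta> (\<lambda>_. c) k = c"
  by (induction k) (simp_all add: scaleR_left_distrib[symmetric] weights_sum del: scaleR_left_distrib)

lemma ema_linear:
  assumes "linear g"
  shows "ema H \<beta> (\<lambda>j. g (f j)) k = g (ema H \<beta> f k)"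
  by (induction k) (simp_all add: linear_add[OF assms] linear_scale[OF assms])

lemma ema_diff: "ema H \<beta> (\<lambda>j. f j - g j) k = ema H \<beta> f k - ema H \<beta> g k"
proof (induction k)
  case (Suc k)
  show ?case unfolding ema.simps Suc by (simp add: algebra_simps)
qed simp

lemma ema_add: "ema H \<beta> (\<lambda>j. f j + g j) k = ema H \<beta> f k + ema H \<beta> g k"
proof (induction k)
  case (Suc k)
  show ?case unfolding ema.simps Suc by (simp add: algebra_simps)
qed simp

lemma ema_mono:
  fixes f g :: "nat \<Rightarrow> real"
  assumes "\<And>j. f j \<le> g j"
  shows "ema H \<beta> f k \<le> ema H \<beta> g k"
proof (induction k)
  case (Suc k)
  then show ?case using assms[of "Suc k"] weight_pos[of k] H \<beta>[of k]
    by (simp add: add_mono mult_left_mono divide_right_mono)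
qed (use assms in simp)

lemma ema_norm_le:
  assumes "\<And>j. norm (f j) \<le> c"
  shows "norm (ema H \<beta> f k) \<le> c"
proof (induction k)
  case (Suc k)
  have "norm (ema H \<beta> f (Suc k)) \<le> (H / (H + \<beta> k)) * norm (ema H \<beta> f k) + (\<beta> k / (H + \<beta> k)) * norm (f (Suc k))"
    using H \<beta>[of k] weight_pos[of k] by (auto intro!: order.trans[OF norm_triangle_ineq])
  also have "\<dots> \<le> (H / (H + \<beta> k)) * c + (\<beta> k / (H + \<beta> k)) * c"
    using H \<beta>[of k] weight_pos[of k] Suc assms[of "Suc k"] by (intro add_mono mult_left_mono) auto
  also have "\<dots> = c" using weights_sum[of k] by (metis distrib_right mult_1)
  finally show ?case .
qed (use assms in simp)

text \<open>Averaging a derivative is the same as subtracting the average and dividing by the time constant; averages of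
  derivatives of bounded quantities are therefore small for large \<open>H\<close>.\<close>

lemma ema_increments:
  assumes "\<And>k. f (Suc k) = f k + \<beta> k *\<^sub>R g (Suc k)" and "g 0 = 0"
  shows "H *\<^sub>R ema H \<beta> g k = f k - ema H \<beta> f k"
proof (induction k)
  case (Suc k)
  have "(H + \<beta> k) *\<^sub>R (H *\<^sub>R ema H \<beta> g (Suc k)) = H *\<^sub>R ((H + \<beta> k) *\<^sub>R ema H \<beta> g (Suc k))"
    by (simp add: mult.commute del: ema.simps)
  also have "\<dots> = H *\<^sub>R (H *\<^sub>R ema H \<beta> g k) + H *\<^sub>R (\<beta> k *\<^sub>R g (Suc k))"
    unfolding ema_Suc by (rule scaleR_right_distrib)
  also have "\<dots> = H *\<^sub>R (f k - ema H \<beta> f k) + H *\<^sub>R (f (Suc k) - f k)"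
    unfolding Suc assms(1)[of k] by simp
  also have "\<dots> = (H + \<beta> k) *\<^sub>R f (Suc k) - (H + \<beta> k) *\<^sub>R ema H \<beta> f (Suc k)"
    unfolding ema_Suc by (simp add: algebra_simps)
  also have "\<dots> = (H + \<beta> k) *\<^sub>R (f (Suc k) - ema H \<beta> f (Suc k))"
    by (simp only: scaleR_right_diff_distrib)
  finally have "?case \<or> H + \<beta> k = 0"
    by (simp only: scaleR_cancel_left)
  then show ?case using weight_pos[of k] by linarith
qed (use assms in simp)

end

section \<open>Proximal paths of saddle functions\<close>

text \<open>A proximal path for a function \<open>\<L>\<close> that is convex in \<open>p\<close> and concave in \<open>q\<close>: \<open>a k\<close> is a subgradient and \<open>b k\<close> a supergradient at
  \<open>(p k, q k)\<close>, and \<open>l k\<close> is the value there. Only the inequalities between points of the path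
  are recorded. The initial point carries no step, so \<open>a 0 = 0\<close>, and \<open>l 0\<close> only has to be a lower bound for \<open>\<L>\<close> along
  the path. The quantity \<open>g\<close>, later the gradient of the objective, records the gain in the subgradient inequality.\<close>

locale saddle_path =
  fixes \<beta> :: "nat \<Rightarrow> real"
    and p a :: "nat \<Rightarrow> 'p::real_inner" and q b :: "nat \<Rightarrow> 'q::real_inner"
    and \<L> :: "'p \<Rightarrow> 'q \<Rightarrow> real" and l :: "nat \<Rightarrow> real"
    and g :: "nat \<Rightarrow> 'g::real_inner" and \<gamma> :: real
  assumes \<beta>_pos: "0 < \<beta> k"
    and p_step: "p (Suc k) = p k - \<beta> k *\<^sub>R a (Suc k)"
    and q_step: "q (Suc k) = q k + \<beta> k *\<^sub>R b (Suc k)"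
    and a_0: "a 0 = 0"
    and l_0: "l 0 \<le> \<L> (p i) (q 0)"
    and \<gamma>_pos: "0 < \<gamma>"
    and sub_strong: "l (Suc k) + a (Suc k) \<bullet> (p i - p (Suc k)) + \<gamma> * (norm (g i - g (Suc k)))\<^sup>2
        \<le> \<L> (p i) (q (Suc k))"
    and super: "\<L> (p (Suc k)) y \<le> l (Suc k) + b (Suc k) \<bullet> (y - q (Suc k))"
begin

lemma sub: "l k + a k \<bullet> (p i - p k) \<le> \<L> (p i) (q k)"
proof (cases k)
  case (Suc m)
  have "0 \<le> \<gamma> * (norm (g i - g k))\<^sup>2" using \<gamma>_pos by simp
  then show ?thesis using sub_strong[of m i] unfolding Suc by linarith
qed (use l_0 a_0 in simp)

text \<open>The sum of the two inequalities at \<open>(p j, q k)\<close> and \<open>(p k, q j)\<close> leaves only values on the path.\<close>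

lemma saddle_gap: "l k - l j \<ge> b k \<bullet> (q k - q j) + a j \<bullet> (p k - p j)" if "k > 0"
proof -
  have "\<L> (p k) (q j) \<le> l k + b k \<bullet> (q j - q k)" using super[of "k - 1" "q j"] that by simp
  with sub[of j k] show ?thesis by (simp add: inner_diff_right)
qed

lemma monotone_strong:
  "2 * \<gamma> * (norm (g (Suc i) - g (Suc j)))\<^sup>2 \<le> (a (Suc i) - a (Suc j)) \<bullet> (p (Suc i) - p (Suc j))
    - (b (Suc i) - b (Suc j)) \<bullet> (q (Suc i) - q (Suc j))"
proof -
  have *: "b (Suc i) \<bullet> (q (Suc i) - q (Suc j)) + a (Suc j) \<bullet> (p (Suc i) - p (Suc j))
      + \<gamma> * (norm (g (Suc i) - g (Suc j)))\<^sup>2 \<le> l (Suc i) - l (Suc j)" for i j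
    using super[of i "q (Suc j)"] sub_strong[of j "Suc i"] by (simp add: inner_diff_right)
  show ?thesis using *[of i j] *[of j i]
    by (simp add: inner_diff_left inner_diff_right norm_minus_commute[of "g (Suc j)"])
qed

lemma shift_mono: "0 \<le> (a (Suc i) - a (Suc j)) \<bullet> (p (Suc i) - p (Suc j))
    - (b (Suc i) - b (Suc j)) \<bullet> (q (Suc i) - q (Suc j))"
proof -
  have "0 \<le> 2 * \<gamma> * (norm (g (Suc i) - g (Suc j)))\<^sup>2" using \<gamma>_pos by simp
  with monotone_strong[of i j] show ?thesis by linarith
qed

definition \<rho> :: real where "\<rho> = norm (a 1, b 1)"

text \<open>The velocity of a proximal path of a monotone operator decreases, and the decrease pays for the
  changes of \<open>g\<close>.\<close>

lemma speed_decrease: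
  "(norm (a (Suc n), b (Suc n)))\<^sup>2 + 4 * \<gamma> * (\<Sum>k<n. (norm (g (Suc (Suc k)) - g (Suc k)))\<^sup>2 / \<beta> (Suc k)) \<le> \<rho>\<^sup>2"
proof (induction n)
  case (Suc n)
  define V W where "V = (a (Suc (Suc n)), b (Suc (Suc n)))" and "W = (a (Suc n), b (Suc n))"
  let ?d = "(norm (g (Suc (Suc n)) - g (Suc n)))\<^sup>2"
  have "2 * \<gamma> * ?d \<le> \<beta> (Suc n) * - ((V - W) \<bullet> V)"
    using monotone_strong[of "Suc n" n] p_step[of "Suc n"] q_step[of "Suc n"]
    by (simp add: V_def W_def algebra_simps)
  then have "2 * \<gamma> * (?d / \<beta> (Suc n)) \<le> - ((V - W) \<bullet> V)"
    using \<beta>_pos[of "Suc n"] by (simp add: field_simps)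
  moreover have "(norm V)\<^sup>2 - (norm W)\<^sup>2 \<le> 2 * ((V - W) \<bullet> V)"
  proof -
    have "2 * ((V - W) \<bullet> V) - ((norm V)\<^sup>2 - (norm W)\<^sup>2) = (norm (V - W))\<^sup>2"
      by (simp add: power2_norm_eq_inner algebra_simps inner_commute)
    then show ?thesis using zero_le_power2[of "norm (V - W)"] by linarith
  qed
  ultimately have "(norm V)\<^sup>2 + 4 * \<gamma> * (?d / \<beta> (Suc n)) \<le> (norm W)\<^sup>2" by linarith
  then show ?case using Suc unfolding sum.lessThan_Suc distrib_left V_def W_def by linarith
qed (simp add: \<rho>_def)

lemma \<rho>_nonneg: "0 \<le> \<rho>" by (simp add: \<rho>_def)

lemma g_increments: "(\<Sum>k<n. (norm (g (Suc (Suc k)) - g (Suc k)))\<^sup>2 / \<beta> (Suc k)) \<le> \<rho>\<^sup>2 / (4 * \<gamma>)"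
proof -
  have "4 * \<gamma> * (\<Sum>k<n. (norm (g (Suc (Suc k)) - g (Suc k)))\<^sup>2 / \<beta> (Suc k)) \<le> \<rho>\<^sup>2"
    using speed_decrease[of n] zero_le_power2[of "norm (a (Suc n), b (Suc n))"] by linarith
  then show ?thesis using \<gamma>_pos by (simp add: pos_le_divide_eq mult.commute)
qed

lemma v_le: "norm (a (Suc k), b (Suc k)) \<le> \<rho>"
proof -
  have "0 \<le> 4 * \<gamma> * (\<Sum>i<k. (norm (g (Suc (Suc i)) - g (Suc i)))\<^sup>2 / \<beta> (Suc i))"
    using \<gamma>_pos \<beta>_pos by (intro mult_nonneg_nonneg sum_nonneg divide_nonneg_pos) auto
  then have "(norm (a (Suc k), b (Suc k)))\<^sup>2 \<le> \<rho>\<^sup>2" using speed_decrease[of k] by linarith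
  then show ?thesis by (rule power2_le_imp_le) (rule \<rho>_nonneg)
qed

lemma a_le: "norm (a k) \<le> \<rho>"
proof (cases k)
  case (Suc m)
  then show ?thesis using norm_fst_le[of "a k" "b k"] v_le[of m] by simp
qed (simp add: a_0 \<rho>_nonneg)

lemma b_le: "norm (b (Suc k)) \<le> \<rho>"
  using norm_snd_le[of "b (Suc k)" "a (Suc k)"] v_le[of k] by simp

end

text \<open>Here \<open>Fs\<close> is the common value of the primal and the dual problem. The primal problem has the solution
  \<open>ps\<close> and the primal path is bounded; the dual problem has only approximate solutions.\<close>

locale saddle_descent = saddle_path \<beta> p a q b \<L> l g \<gamma>
  for \<beta> :: "nat \<Rightarrow> real"
    and p a :: "nat \<Rightarrow> 'p::real_inner" and q b :: "nat \<Rightarrow> 'q::real_inner"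
    and \<L> :: "'p \<Rightarrow> 'q \<Rightarrow> real" and l :: "nat \<Rightarrow> real"
    and g :: "nat \<Rightarrow> 'g::real_inner" and \<gamma> :: real +
  fixes ps :: 'p and Fs P S :: real and gs :: 'g
  assumes \<beta>_le: "\<beta> k \<le> 1/2"
    and \<beta>_div: "filterlim (\<lambda>n. sum \<beta> {..<n}) at_top sequentially"
    and \<beta>_sq: "(\<Sum>k<n. (\<beta> k)\<^sup>2) \<le> S"
    and concave: "convex_on UNIV (\<lambda>y. - \<L> (p i) y)"
    and p_le: "norm (p k) \<le> P" and ps_le: "norm ps \<le> P"
    and opt_primal_strong: "l (Suc k) + a (Suc k) \<bullet> (ps - p (Suc k)) + \<gamma> * (norm (gs - g (Suc k)))\<^sup>2 \<le> Fs"
    and approx_dual: "0 < \<eta> \<Longrightarrow> \<exists>y. \<forall>i. Fs - \<eta> \<le> \<L> (p i) y"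
begin

definition B :: "nat \<Rightarrow> real" where "B k = \<gamma> * (norm (gs - g k))\<^sup>2"

lemma B_nonneg: "0 \<le> B k" using \<gamma>_pos by (simp add: B_def)

lemma opt_primal: "l (Suc k) + a (Suc k) \<bullet> (ps - p (Suc k)) + B (Suc k) \<le> Fs"
  unfolding B_def by (rule opt_primal_strong)

definition t :: "nat \<Rightarrow> real" where "t n = sum \<beta> {..<n}"

lemma t_0 [simp]: "t 0 = 0" and t_Suc: "t (Suc n) = t n + \<beta> n"
  by (auto simp: t_def)

lemma t_mono: "m \<le> n \<Longrightarrow> t m \<le> t n"
  unfolding t_def using \<beta>_pos by (intro sum_mono2) (auto simp: less_imp_le)

lemma t_less: "t m < t n \<Longrightarrow> m < n"
  using t_mono by (meson not_less)

lemma sum_\<beta>: "m \<le> n \<Longrightarrow> sum \<beta> {m..<n} = t n - t m"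
  unfolding t_def by (rule sum_lessThan_split)

lemma t_unbounded: "\<exists>k. x \<le> t k"
  using \<beta>_div unfolding filterlim_at_top eventually_sequentially t_def by blast

lemma P_nonneg: "0 \<le> P"
  using ps_le norm_ge_zero order.trans by blast

lemma l_le: "l k \<le> max (l 0) (Fs + 2 * \<rho> * P)"
proof (cases k)
  case (Suc m)
  have "norm (ps - p k) \<le> 2 * P" using norm_triangle_ineq4[of ps "p k"] ps_le p_le[of k] by linarith
  then have "\<bar>a k \<bullet> (ps - p k)\<bar> \<le> \<rho> * (2 * P)"
    by (intro order.trans[OF Cauchy_Schwarz_ineq2] mult_mono a_le \<rho>_nonneg) auto
  then show ?thesis using opt_primal[of m] B_nonneg[of "Suc m"] unfolding Suc by linarith
qed simp

lemma polar_diff: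
  fixes x y c :: "'a::real_inner"
  shows "(norm (y - c))\<^sup>2 / 2 - (norm (x - c))\<^sup>2 / 2 \<le> (y - x) \<bullet> (y - c)"
proof -
  have "(norm (x - c))\<^sup>2 = (norm (y - c))\<^sup>2 - 2 * ((y - x) \<bullet> (y - c)) + (norm (y - x))\<^sup>2"
    by (simp add: power2_norm_eq_inner algebra_simps inner_commute)
  then show ?thesis using zero_le_power2[of "norm (y - x)"] by linarith
qed

context
  fixes H :: real assumes H: "0 < H"
begin

abbreviation "w \<equiv> \<lambda>k. q k - ema H \<beta> q k"

lemma w_step: "q (Suc k) - q k = w (Suc k) - w k + (\<beta> k / H) *\<^sub>R w (Suc k)"
proof -
  have "ema H \<beta> q (Suc k) - ema H \<beta> q k = (1 / H) *\<^sub>R (H *\<^sub>R (ema H \<beta> q (Suc k) - ema H \<beta> q k))"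
    using H by (simp del: ema.simps)
  also have "\<dots> = (\<beta> k / H) *\<^sub>R w (Suc k)"
    unfolding ema_step[OF H \<beta>_pos] by (simp del: ema.simps)
  finally show ?thesis by (simp del: ema.simps add: algebra_simps)
qed

text \<open>Both \<open>a j\<close> and, up to an inequality, \<open>a j \<bullet> p j\<close> are derivatives of bounded quantities, namely of \<open>- p\<close> and \<open>- |p|\<^sup>2 / 2\<close>,
  so their averages are of order \<open>1 / H\<close>.\<close>

lemma smoothed_correction:
  "ema H \<beta> (\<lambda>j. a j \<bullet> (x - p j)) k \<ge> - 3 * P\<^sup>2 / H" if x: "norm x \<le> P"
proof -
  have 1: "H *\<^sub>R ema H \<beta> (\<lambda>j. - a j) k = p k - ema H \<beta> p k"
    by (rule ema_increments[OF H \<beta>_pos]) (simp_all add: p_step a_0)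
  \<comment> \<open>the difference quotient of \<open>|p|\<^sup>2 / 2\<close>, with the value zero at the start as \<open>ema_increments\<close> demands\<close>
  define c where "c j = (case j of 0 \<Rightarrow> 0 | Suc i \<Rightarrow> ((norm (p (Suc i)))\<^sup>2 / 2 - (norm (p i))\<^sup>2 / 2) / \<beta> i)" for j
  have 2: "H *\<^sub>R ema H \<beta> c k = (norm (p k))\<^sup>2 / 2 - ema H \<beta> (\<lambda>j. (norm (p j))\<^sup>2 / 2) k"
    by (rule ema_increments[OF H \<beta>_pos, where f = "\<lambda>j. (norm (p j))\<^sup>2 / 2"])
      (use \<beta>_pos in \<open>simp_all add: c_def less_imp_neq[THEN not_sym]\<close>)
  have 3: "c j \<le> - (a j \<bullet> p j)" for j
  proof (cases j)
    case (Suc i)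
    have "\<beta> i * c j \<le> (p j - p i) \<bullet> p j"
      using polar_diff[where y = "p j" and c = 0 and x = "p i"] \<beta>_pos[of i] by (simp add: c_def Suc)
    also have "\<dots> = \<beta> i * - (a j \<bullet> p j)" by (simp add: Suc p_step)
    finally show ?thesis using \<beta>_pos[of i] by (rule mult_left_le_imp_le)
  qed (simp add: a_0 c_def)
  have sq: "norm ((norm (p j))\<^sup>2 / 2) \<le> P\<^sup>2 / 2" for j
    using power_mono[OF p_le norm_ge_zero, of j 2] by simp
  have "ema H \<beta> (\<lambda>j. a j \<bullet> (x - p j)) k \<ge> ema H \<beta> (\<lambda>j. - ((- a j) \<bullet> x) + c j) k"
    using 3 by (intro ema_mono[OF H \<beta>_pos]) (simp add: inner_diff_right add.commute)
  also have "ema H \<beta> (\<lambda>j. - ((- a j) \<bullet> x) + c j) k = - (ema H \<beta> (\<lambda>j. - a j) k \<bullet> x) + ema H \<beta> c k"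
    unfolding ema_add[OF H \<beta>_pos]
    by (subst ema_linear[OF H \<beta>_pos, where g = "\<lambda>y. - (y \<bullet> x)"])
       (auto intro!: linearI simp: algebra_simps)
  finally have main: "ema H \<beta> (\<lambda>j. a j \<bullet> (x - p j)) k \<ge> - (ema H \<beta> (\<lambda>j. - a j) k \<bullet> x) + ema H \<beta> c k" .
  have "H * (ema H \<beta> (\<lambda>j. - a j) k \<bullet> x) = (p k - ema H \<beta> p k) \<bullet> x"
    unfolding 1[symmetric] by simp
  also have "\<dots> \<le> norm (p k - ema H \<beta> p k) * norm x" by (rule norm_cauchy_schwarz)
  also have "\<dots> \<le> (P + P) * P"
    using p_le[of k] ema_norm_le[where H = H and \<beta> = \<beta> and f = p and k = k, OF H \<beta>_pos p_le] P_nonneg x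
    by (intro mult_mono order.trans[OF norm_triangle_ineq4] add_mono) auto
  finally have "H * (ema H \<beta> (\<lambda>j. - a j) k \<bullet> x) \<le> 2 * P\<^sup>2" by (simp add: power2_eq_square)
  moreover have "H * ema H \<beta> c k \<ge> - P\<^sup>2"
    using 2 sq[of k] ema_norm_le[where H = H and \<beta> = \<beta> and f = "\<lambda>j. (norm (p j))\<^sup>2 / 2" and k = k, OF H \<beta>_pos sq] zero_le_power2[of "norm (p k)"]
    by (simp only: real_scaleR_def real_norm_def abs_le_iff) linarith
  ultimately have "H * (- (ema H \<beta> (\<lambda>j. - a j) k \<bullet> x) + ema H \<beta> c k) \<ge> - 3 * P\<^sup>2"
    by (simp add: algebra_simps)
  then have "- (ema H \<beta> (\<lambda>j. - a j) k \<bullet> x) + ema H \<beta> c k \<ge> - 3 * P\<^sup>2 / H"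
    using H by (simp add: field_simps)
  with main show ?thesis by linarith
qed

text \<open>Comparing time \<open>k + 1\<close> with the average of the past by \<open>saddle_gap\<close>: the primal terms average out, and the dual
  terms form the derivative of \<open>|w|\<^sup>2 / 2\<close> plus the dissipation \<open>|w|\<^sup>2 / H\<close>, where \<open>w\<close> is the distance of \<open>q\<close> from its average.\<close>

lemma smoothed_value_increment:
  "H * (ema H \<beta> l (Suc k) - ema H \<beta> l k) \<ge> (norm (w (Suc k)))\<^sup>2 / 2 - (norm (w k))\<^sup>2 / 2
     + \<beta> k / H * (norm (w (Suc k)))\<^sup>2 - \<beta> k * (3 * P\<^sup>2 / H)"
proof -
  let ?k = "Suc k"
  have "ema H \<beta> (\<lambda>j. l ?k - l j) ?k \<ge> ema H \<beta> (\<lambda>j. b ?k \<bullet> (q ?k - q j) + a j \<bullet> (p ?k - p j)) ?k"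
    by (intro ema_mono[OF H \<beta>_pos] saddle_gap) simp
  also have "ema H \<beta> (\<lambda>j. l ?k - l j) ?k = l ?k - ema H \<beta> l ?k"
    by (simp only: ema_diff[OF H \<beta>_pos] ema_const[OF H \<beta>_pos])
  also have "ema H \<beta> (\<lambda>j. b ?k \<bullet> (q ?k - q j) + a j \<bullet> (p ?k - p j)) ?k
      = b ?k \<bullet> w ?k + ema H \<beta> (\<lambda>j. a j \<bullet> (p ?k - p j)) ?k"
    by (subst ema_add[OF H \<beta>_pos], subst ema_linear[OF H \<beta>_pos, where g = "\<lambda>y. b ?k \<bullet> y"])
       (auto intro!: linearI simp: algebra_simps ema_diff[OF H \<beta>_pos] ema_const[OF H \<beta>_pos] simp del: ema.simps)
  finally have "l ?k - ema H \<beta> l ?k \<ge> b ?k \<bullet> w ?k - 3 * P\<^sup>2 / H"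
    using smoothed_correction[OF p_le, of ?k ?k] by linarith
  then have "\<beta> k * (l ?k - ema H \<beta> l ?k) \<ge> \<beta> k * (b ?k \<bullet> w ?k - 3 * P\<^sup>2 / H)"
    using \<beta>_pos[of k] by (intro mult_left_mono) auto
  also have "\<beta> k * (l ?k - ema H \<beta> l ?k) = H * (ema H \<beta> l ?k - ema H \<beta> l k)"
    using ema_step[OF H \<beta>_pos, where f = l and k = k] by (simp only: real_scaleR_def)
  also have "\<beta> k * (b ?k \<bullet> w ?k - 3 * P\<^sup>2 / H) = (q ?k - q k) \<bullet> w ?k - \<beta> k * (3 * P\<^sup>2 / H)"
    by (simp only: q_step right_diff_distrib) (simp add: q_step del: ema.simps)
  also have "(q ?k - q k) \<bullet> w ?k = (w ?k - w k) \<bullet> w ?k + \<beta> k / H * (norm (w ?k))\<^sup>2"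
    unfolding w_step by (simp only: inner_add_left inner_scaleR_left power2_norm_eq_inner)
  finally show ?thesis
    using polar_diff[where y = "w ?k" and c = 0 and x = "w k"] by (simp only: diff_0_right)
qed

text \<open>The values \<open>l\<close> are bounded above, so the dissipation adds up to at most \<open>O(H\<^sup>2 + t)\<close>. In mean over times up
  to \<open>H\<^sup>2\<close>, the dual variable is thus at bounded distance from its average.\<close>

lemma smoothing_energy:
  "(\<Sum>k<n. \<beta> k * (norm (w (Suc k)))\<^sup>2) \<le> H\<^sup>2 * (max (l 0) (Fs + 2 * \<rho> * P) - l 0) + 3 * P\<^sup>2 * t n"
proof -
  have "(\<Sum>k<n. \<beta> k / H * (norm (w (Suc k)))\<^sup>2) + (norm (w n))\<^sup>2 / 2 \<le> H * (ema H \<beta> l n - l 0) + (3 * P\<^sup>2 / H) * t n"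
  proof (induction n)
    case (Suc n)
    then show ?case using smoothed_value_increment[of n]
      by (simp only: sum.lessThan_Suc t_Suc right_diff_distrib distrib_left distrib_right mult.commute[of _ "3 * P\<^sup>2 / H"])
  qed simp
  moreover have "ema H \<beta> l n \<le> max (l 0) (Fs + 2 * \<rho> * P)"
    using ema_mono[where H = H and \<beta> = \<beta> and k = n, OF H \<beta>_pos l_le] by (simp only: ema_const[OF H \<beta>_pos])
  then have "H * (ema H \<beta> l n - l 0) \<le> H * (max (l 0) (Fs + 2 * \<rho> * P) - l 0)"
    using H by (intro mult_left_mono) auto
  ultimately have "(\<Sum>k<n. \<beta> k / H * (norm (w (Suc k)))\<^sup>2) \<le> H * (max (l 0) (Fs + 2 * \<rho> * P) - l 0) + (3 * P\<^sup>2 / H) * t n"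
    using zero_le_power2[of "norm (w n)"] by linarith
  then have "H * (\<Sum>k<n. \<beta> k / H * (norm (w (Suc k)))\<^sup>2) \<le> H * (H * (max (l 0) (Fs + 2 * \<rho> * P) - l 0) + (3 * P\<^sup>2 / H) * t n)"
    using H by (intro mult_left_mono) auto
  also have "H * (\<Sum>k<n. \<beta> k / H * (norm (w (Suc k)))\<^sup>2) = (\<Sum>k<n. \<beta> k * (norm (w (Suc k)))\<^sup>2)"
    using H by (simp add: sum_distrib_left del: ema.simps)
  finally show ?thesis using H by (simp add: power2_eq_square distrib_left)
qed

end

text \<open>The first index at time \<open>m\<close>. The indices from \<open>\<kappa> m\<close> to \<open>\<kappa> (m + 1)\<close> form a block of duration about one.\<close>

definition \<kappa> :: "nat \<Rightarrow> nat" where "\<kappa> m = (LEAST k. real m \<le> t k)"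

lemma \<kappa>_ge: "real m \<le> t (\<kappa> m)"
  unfolding \<kappa>_def using t_unbounded by (rule LeastI_ex)

lemma \<kappa>_le: "t (\<kappa> m) \<le> real m + 1/2"
proof (cases "\<kappa> m")
  case (Suc k)
  then have "\<not> real m \<le> t k" unfolding \<kappa>_def using not_less_Least by (metis lessI)
  then show ?thesis using \<beta>_le[of k] by (simp add: Suc t_Suc)
qed simp

lemma \<kappa>_less: "\<kappa> m < \<kappa> (Suc m)"
  using \<kappa>_le[of m] \<kappa>_ge[of "Suc m"] by (intro t_less) simp

lemma \<kappa>_mono: "m \<le> n \<Longrightarrow> \<kappa> m \<le> \<kappa> n"
  using \<kappa>_less by (simp add: lift_Suc_mono_le less_imp_le)

lemma \<kappa>_0: "\<kappa> 0 = 0"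
  unfolding \<kappa>_def by (rule Least_equality) auto

lemma sum_blocks:
  fixes f :: "nat \<Rightarrow> real"
  shows "(\<Sum>m<M. sum f {\<kappa> (i + m)..<\<kappa> (Suc (i + m))}) = sum f {\<kappa> i..<\<kappa> (i + M)}"
proof (induction M)
  case (Suc M)
  then show ?case
    using sum.atLeastLessThan_concat[of "\<kappa> i" "\<kappa> (i + M)" "\<kappa> (Suc (i + M))" f]
      \<kappa>_mono[of i "i + M"] \<kappa>_less[of "i + M"] by simp
qed simp

text \<open>Take \<open>H = h\<close>. Among the first \<open>h\<^sup>2\<close> unit blocks, the energy bound leaves one block \<open>i\<close> such that the blocks \<open>i\<close> and
  \<open>i + m\<close> have bounded energy and the blocks between have energy \<open>O(h)\<close>. In the two end blocks \<open>q\<close> is at some moment close to its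
  average, and between them the average, which moves with speed \<open>|w| / h\<close>, moves a bounded amount.\<close>

lemma return_at_lag:
  "\<exists>C. \<forall>h m. 1 \<le> h \<longrightarrow> m \<le> h \<longrightarrow> (\<exists>k k'. k \<le> k' \<and> t k' \<le> real (h\<^sup>2 + h + 2) \<and>
     \<bar>t k' - t k - real m\<bar> \<le> 2 \<and> norm (q k' - q k) \<le> C)"
proof -
  define c where "c = max (l 0) (Fs + 2 * \<rho> * P) - l 0"
  define c2 where "c2 = c + 3 * P\<^sup>2"
  have c: "0 \<le> c" by (simp add: c_def)
  have c2: "0 \<le> c2" using c by (simp add: c2_def)
  \<comment> \<open>The mean of \<open>cost\<close> below is at most \<open>(4 + 4 + 8) c2\<close>.\<close>
  define K where "K = 16 * c2 + 1"
  define C where "C = 2 * (1 + 2 * K) + (3 + K)"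
  have K: "0 \<le> K" using c2 by (simp add: K_def)
  show ?thesis
  proof (intro exI[of _ C] allI impI)
    fix h m :: nat assume h: "1 \<le> h" and m: "m \<le> h"
    let ?H = "real h"
    have H: "0 < ?H" using h by simp
    define w' where "w' k = q k - ema ?H \<beta> q k" for k
    define W where "W k = (norm (w' (Suc k)))\<^sup>2" for k
    define G where "G i = (\<Sum>k\<in>{\<kappa> i..<\<kappa> (Suc i)}. \<beta> k * W k)" for i
    have W0: "0 \<le> W k" for k by (simp add: W_def)
    have bW: "0 \<le> \<beta> k * W k" for k using W0 \<beta>_pos[of k] by simp
    have G0: "0 \<le> G i" for i unfolding G_def by (intro sum_nonneg bW)
    have tot: "(\<Sum>k<n. \<beta> k * W k) \<le> c2 * (?H\<^sup>2 + t n)" for n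
    proof -
      have "(\<Sum>k<n. \<beta> k * W k) \<le> ?H\<^sup>2 * c + 3 * P\<^sup>2 * t n"
        using smoothing_energy[OF H, of n] by (simp only: W_def w'_def c_def)
      also have "\<dots> \<le> c2 * (?H\<^sup>2 + t n)"
        using c t_mono[of 0 n] by (simp add: c2_def algebra_simps)
      finally show ?thesis .
    qed
    define N where "N = h\<^sup>2 + h"
    have hh: "?H \<le> ?H\<^sup>2" "1 \<le> ?H\<^sup>2" using h by (simp_all add: self_le_power one_le_power)
    have totG: "(\<Sum>i<N. G i) \<le> 4 * c2 * ?H\<^sup>2"
    proof -
      have "(\<Sum>i<N. G i) = (\<Sum>k<\<kappa> N. \<beta> k * W k)"
        using sum_blocks[of "\<lambda>k. \<beta> k * W k" 0 N] by (simp add: G_def \<kappa>_0 lessThan_atLeast0)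
      also have "\<dots> \<le> c2 * (?H\<^sup>2 + t (\<kappa> N))" by (rule tot)
      also have "\<dots> \<le> c2 * (4 * ?H\<^sup>2)"
      proof (intro mult_left_mono c2)
        have "t (\<kappa> N) \<le> ?H\<^sup>2 + ?H + 1/2" using \<kappa>_le[of N] by (simp add: N_def)
        then show "?H\<^sup>2 + t (\<kappa> N) \<le> 4 * ?H\<^sup>2" using hh by linarith
      qed
      finally show ?thesis by simp
    qed
    have shift: "(\<Sum>i<h\<^sup>2. G (i + j)) \<le> 4 * c2 * ?H\<^sup>2" if "j \<le> h" for j
    proof -
      have "(\<Sum>i<h\<^sup>2. G (i + j)) = sum G {j..<h\<^sup>2 + j}"
        by (simp add: sum.shift_bounds_nat_ivl[of G 0 j "h\<^sup>2", simplified] lessThan_atLeast0)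
      also have "\<dots> \<le> sum G {..<N}" using that G0 by (intro sum_mono2) (auto simp: N_def)
      finally show ?thesis using totG by linarith
    qed
    define cost where "cost i = G i + G (i + m) + (1 / ?H) * (\<Sum>j\<le>m. G (i + j))" for i
    have "\<exists>i<h\<^sup>2. cost i \<le> K"
    proof (rule ccontr)
      assume "\<not> ?thesis"
      then have "real (card {..<h\<^sup>2}) * K \<le> sum cost {..<h\<^sup>2}"
        by (intro sum_bounded_below) (auto simp: not_le less_imp_le)
      also have "sum cost {..<h\<^sup>2} = (\<Sum>i<h\<^sup>2. G (i + 0)) + (\<Sum>i<h\<^sup>2. G (i + m)) + (1 / ?H) * (\<Sum>j\<le>m. \<Sum>i<h\<^sup>2. G (i + j))"
        by (simp add: cost_def sum.distrib sum_distrib_left) (rule sum.swap)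
      also have "\<dots> \<le> 4 * c2 * ?H\<^sup>2 + 4 * c2 * ?H\<^sup>2 + (1 / ?H) * (\<Sum>j\<le>m. 4 * c2 * ?H\<^sup>2)"
        using m H by (intro add_mono mult_left_mono sum_mono shift) auto
      also have "(1 / ?H) * (\<Sum>j\<le>m. 4 * c2 * ?H\<^sup>2) = (real (Suc m) / ?H) * (4 * c2 * ?H\<^sup>2)"
        by simp
      also have "\<dots> \<le> 2 * (4 * c2 * ?H\<^sup>2)"
        using m h c2 by (intro mult_right_mono) (auto simp: field_simps)
      finally have "?H\<^sup>2 * K \<le> 16 * c2 * ?H\<^sup>2" by simp
      then show False using hh by (simp add: K_def algebra_simps)
    qed
    then obtain i where i: "i < h\<^sup>2" "cost i \<le> K" by blast
    have Gs: "0 \<le> (1 / ?H) * (\<Sum>j\<le>m. G (i + j))" using G0 H by (intro mult_nonneg_nonneg sum_nonneg) auto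
    have Gi: "G i \<le> K" "G (i + m) \<le> K" "(\<Sum>j\<le>m. G (i + j)) \<le> K * ?H"
    proof -
      show "G i \<le> K" "G (i + m) \<le> K"
        using i(2) G0[of i] G0[of "i + m"] Gs unfolding cost_def by linarith+
      have "(1 / ?H) * (\<Sum>j\<le>m. G (i + j)) \<le> K"
        using i(2) G0[of i] G0[of "i + m"] unfolding cost_def by linarith
      then show "(\<Sum>j\<le>m. G (i + j)) \<le> K * ?H" using H by (simp add: field_simps)
    qed
    have pick: "\<exists>k\<in>{\<kappa> j..<\<kappa> (Suc j)}. norm (w' (Suc k)) \<le> 1 + 2 * K" if "G j \<le> K" for j
    proof (rule ccontr)
      assume neg: "\<not> ?thesis"
      have "\<beta> k * (2 * K + 1) \<le> \<beta> k * W k" if k: "k \<in> {\<kappa> j..<\<kappa> (Suc j)}" for k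
      proof -
        have gt: "1 + 2 * K < norm (w' (Suc k))" using neg k by (auto simp: not_le)
        then have "1 * (1 + 2 * K) \<le> norm (w' (Suc k)) * norm (w' (Suc k))"
          using K by (intro mult_mono) auto
        then show ?thesis
          using \<beta>_pos[of k] by (intro mult_left_mono) (auto simp: W_def power2_eq_square)
      qed
      then have "(\<Sum>k\<in>{\<kappa> j..<\<kappa> (Suc j)}. \<beta> k * (2 * K + 1)) \<le> G j"
        unfolding G_def by (rule sum_mono)
      moreover have "(\<Sum>k\<in>{\<kappa> j..<\<kappa> (Suc j)}. \<beta> k * (2 * K + 1)) = (t (\<kappa> (Suc j)) - t (\<kappa> j)) * (2 * K + 1)"
        by (simp add: sum_distrib_right[symmetric] sum_\<beta> \<kappa>_mono)
      moreover have "(1/2) * (2 * K + 1) \<le> (t (\<kappa> (Suc j)) - t (\<kappa> j)) * (2 * K + 1)"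
        using \<kappa>_le[of j] \<kappa>_ge[of "Suc j"] K by (intro mult_right_mono) auto
      ultimately have "(1/2) * (2 * K + 1) \<le> K" using that by linarith
      then show False by simp
    qed
    obtain k where k: "\<kappa> i \<le> k" "k < \<kappa> (Suc i)" "norm (w' (Suc k)) \<le> 1 + 2 * K"
      using pick[OF Gi(1)] by auto
    obtain k1 where k1: "\<kappa> (i + m) \<le> k1" "k1 < \<kappa> (Suc (i + m))" "norm (w' (Suc k1)) \<le> 1 + 2 * K"
      using pick[OF Gi(2)] by auto
    \<comment> \<open>For \<open>m = 0\<close> the two choices from the same block may come in the wrong order.\<close>
    define k' where "k' = (if m = 0 then k else k1)"
    have k': "\<kappa> (i + m) \<le> k'" "k' < \<kappa> (Suc (i + m))" "norm (w' (Suc k')) \<le> 1 + 2 * K"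
      using k k1 by (auto simp: k'_def)
    have kk': "k \<le> k'"
    proof (cases "m = 0")
      case False
      then have "\<kappa> (Suc i) \<le> \<kappa> (i + m)" by (intro \<kappa>_mono) simp
      then show ?thesis using k k' by linarith
    qed (simp add: k'_def)
    have times: "real i \<le> t (Suc k)" "t (Suc k) \<le> real i + 3/2"
        "real (i + m) \<le> t (Suc k')" "t (Suc k') \<le> real (i + m) + 3/2"
      using t_mono[of "\<kappa> i" "Suc k"] t_mono[of "Suc k" "\<kappa> (Suc i)"]
        t_mono[of "\<kappa> (i + m)" "Suc k'"] t_mono[of "Suc k'" "\<kappa> (Suc (i + m))"] k k'
        \<kappa>_ge[of i] \<kappa>_le[of "Suc i"] \<kappa>_ge[of "i + m"] \<kappa>_le[of "Suc (i + m)"] by auto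
    have drift: "norm (ema ?H \<beta> q (Suc k') - ema ?H \<beta> q (Suc k)) \<le> 3 + K"
    proof -
      have sm: "norm (ema ?H \<beta> q (Suc j) - ema ?H \<beta> q j) \<le> (1 / ?H) * (\<beta> j + \<beta> j * W j)" for j
      proof -
        have "?H * norm (ema ?H \<beta> q (Suc j) - ema ?H \<beta> q j) = norm (?H *\<^sub>R (ema ?H \<beta> q (Suc j) - ema ?H \<beta> q j))"
          using H by (simp del: ema.simps)
        also have "\<dots> = \<beta> j * norm (w' (Suc j))"
          unfolding ema_step[OF H \<beta>_pos] w'_def using \<beta>_pos[of j] by (simp del: ema.simps)
        also have "\<dots> \<le> \<beta> j * (1 + W j)"
        proof (intro mult_left_mono)
          have "0 \<le> (norm (w' (Suc j)) - 1)\<^sup>2" by simp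
          then have "2 * norm (w' (Suc j)) \<le> 1 + W j" by (simp add: W_def power2_diff)
          then show "norm (w' (Suc j)) \<le> 1 + W j" using norm_ge_zero[of "w' (Suc j)"] by linarith
        qed (use \<beta>_pos[of j] in simp)
        finally show ?thesis using H by (simp add: field_simps del: ema.simps)
      qed
      have "ema ?H \<beta> q (Suc k') - ema ?H \<beta> q (Suc k) = (\<Sum>j\<in>{Suc k..<Suc k'}. ema ?H \<beta> q (Suc j) - ema ?H \<beta> q j)"
        using kk' by (subst sum_Suc_diff') auto
      then have "norm (ema ?H \<beta> q (Suc k') - ema ?H \<beta> q (Suc k)) \<le> (\<Sum>j\<in>{Suc k..<Suc k'}. (1 / ?H) * (\<beta> j + \<beta> j * W j))"
        by (simp only:) (intro order.trans[OF norm_sum] sum_mono sm)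
      also have "\<dots> = (1 / ?H) * (\<Sum>j\<in>{Suc k..<Suc k'}. \<beta> j + \<beta> j * W j)"
        by (rule sum_distrib_left[symmetric])
      also have "\<dots> \<le> (1 / ?H) * (\<Sum>j\<in>{\<kappa> i..<\<kappa> (i + Suc m)}. \<beta> j + \<beta> j * W j)"
        using k k' H bW \<beta>_pos by (intro mult_left_mono sum_mono2) (auto simp: less_imp_le add_nonneg_nonneg)
      also have "(\<Sum>j\<in>{\<kappa> i..<\<kappa> (i + Suc m)}. \<beta> j + \<beta> j * W j)
          = (t (\<kappa> (i + Suc m)) - t (\<kappa> i)) + (\<Sum>j<Suc m. G (i + j))"
        unfolding sum.distrib G_def by (simp only: sum_blocks sum_\<beta>[OF \<kappa>_mono[of i "i + Suc m"]] le_add1)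
      also have "(1 / ?H) * \<dots> \<le> (1 / ?H) * ((real m + 3/2) + K * ?H)"
        using \<kappa>_le[of "i + Suc m"] \<kappa>_ge[of i] Gi(3) H
        by (intro mult_left_mono add_mono) (auto simp: lessThan_Suc_atMost)
      also have "\<dots> \<le> 3 + K" using m h by (simp add: field_simps)
      finally show ?thesis .
    qed
    have "q (Suc k') - q (Suc k) = w' (Suc k') + (ema ?H \<beta> q (Suc k') - ema ?H \<beta> q (Suc k)) - w' (Suc k)"
      by (simp add: w'_def del: ema.simps)
    then have "norm (q (Suc k') - q (Suc k)) \<le> norm (w' (Suc k')) + norm (ema ?H \<beta> q (Suc k') - ema ?H \<beta> q (Suc k)) + norm (w' (Suc k))"
      by (simp only:) (intro order.trans[OF norm_triangle_ineq4] add_right_mono norm_triangle_ineq)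
    then have "norm (q (Suc k') - q (Suc k)) \<le> (1 + 2 * K) + (3 + K) + (1 + 2 * K)"
      by (rule order.trans) (intro add_mono drift k(3) k'(3))
    then have "norm (q (Suc k') - q (Suc k)) \<le> C" by (simp add: C_def)
    moreover have "i + m + 2 \<le> h\<^sup>2 + h + 2" using i(1) m by simp
    then have "real (i + m + 2) \<le> real (h\<^sup>2 + h + 2)" by (simp only: of_nat_le_iff)
    with times(4) have "t (Suc k') \<le> real (h\<^sup>2 + h + 2)" by (simp only: of_nat_add)
    moreover have "\<bar>t (Suc k') - t (Suc k) - real m\<bar> \<le> 2" using times by auto
    ultimately show "\<exists>k k'. k \<le> k' \<and> t k' \<le> real (h\<^sup>2 + h + 2) \<and> \<bar>t k' - t k - real m\<bar> \<le> 2 \<and> norm (q k' - q k) \<le> C"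
      using kk' by (intro exI[of _ "Suc k"] exI[of _ "Suc k'"]) auto
  qed
qed

text \<open>Apply \<open>proximal_path_distance\<close> to the path and its delayed copy, from the two times of \<open>return_at_lag\<close>
  until \<open>n'\<close> and \<open>n\<close>: the elapsed times differ by a bounded amount, and initially the distance is bounded.\<close>

lemma window_displacement:
  "\<exists>C. \<forall>h n n'. 1 \<le> h \<longrightarrow> real (h\<^sup>2 + h + 2) \<le> t n \<longrightarrow> n \<le> n' \<longrightarrow> t n' - t n \<le> real h \<longrightarrow>
     norm (q n' - q n) \<le> C"
proof -
  obtain C where C: "\<And>h m. 1 \<le> h \<Longrightarrow> m \<le> h \<Longrightarrow> (\<exists>k k'. k \<le> k' \<and> t k' \<le> real (h\<^sup>2 + h + 2) \<and>
     \<bar>t k' - t k - real m\<bar> \<le> 2 \<and> norm (q k' - q k) \<le> C)"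
    using return_at_lag by blast
  define C' where "C' = 2 * P + C + \<rho> * (3 + sqrt (2 * S))"
  show ?thesis
  proof (intro exI[of _ C'] allI impI)
    fix h n n' :: nat
    assume h: "1 \<le> h" and tn: "real (h\<^sup>2 + h + 2) \<le> t n" and n: "n \<le> n'" and lag: "t n' - t n \<le> real h"
    define m where "m = nat \<lfloor>t n' - t n\<rfloor>"
    have lag0: "0 \<le> t n' - t n" using t_mono[OF n] by simp
    have m: "real m \<le> t n' - t n" "t n' - t n < real m + 1"
      using lag0 by (auto simp: m_def)
    then have "m \<le> h" using lag by simp
    then obtain k k' where k: "k \<le> k'" "t k' \<le> real (h\<^sup>2 + h + 2)" "\<bar>t k' - t k - real m\<bar> \<le> 2" "norm (q k' - q k) \<le> C"
      using C[OF h] by blast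
    have "t k' < t (Suc n)" using k(2) tn t_Suc[of n] \<beta>_pos[of n] by linarith
    then have "k' \<le> n" using t_less by fastforce
    then have le: "k' \<le> n'" "k \<le> n" using n k(1) by auto
    define u where "u i = (p i, q i)" for i
    define v where "v i = (a i, - b i)" for i
    have S: "(\<Sum>i\<in>{j..<j'}. (\<beta> i)\<^sup>2) \<le> S" for j j'
      by (rule order.trans[OF sum_mono2 \<beta>_sq[of j']]) auto
    have S0: "0 \<le> S" using \<beta>_sq[of 0] by simp
    have "norm (u n' - u n) \<le> norm (u k' - u k) + \<rho> * sqrt ((sum \<beta> {k'..<n'} - sum \<beta> {k..<n})\<^sup>2
        + (\<Sum>k\<in>{k'..<n'}. (\<beta> k)\<^sup>2) + (\<Sum>k\<in>{k..<n}. (\<beta> k)\<^sup>2))"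
    proof (rule proximal_path_distance[where v = v])
      show "u (Suc i) = u i - \<beta> i *\<^sub>R v (Suc i)" for i by (simp add: u_def v_def p_step q_step)
      show "0 \<le> (v (Suc i) - v (Suc j)) \<bullet> (u (Suc i) - u (Suc j))" for i j
        using shift_mono[of i j] by (simp add: u_def v_def inner_diff_left algebra_simps)
      show "norm (v (Suc i)) \<le> \<rho>" for i using v_le[of i] by (simp add: v_def norm_prod_def)
    qed (use \<beta>_pos le in auto)
    also have "\<dots> \<le> (2 * P + C) + \<rho> * (3 + sqrt (2 * S))"
    proof (intro add_mono mult_left_mono \<rho>_nonneg)
      have "norm (u k' - u k) \<le> norm (p k' - p k) + norm (q k' - q k)"
        by (simp add: u_def norm_Pair_le)
      also have "norm (p k' - p k) \<le> P + P"
        by (intro order.trans[OF norm_triangle_ineq4] add_mono p_le)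
      finally show "norm (u k' - u k) \<le> 2 * P + C" using k(4) by linarith
      define D where "D = sum \<beta> {k'..<n'} - sum \<beta> {k..<n}"
      have D: "\<bar>D\<bar> \<le> 3" using k(3) m le by (auto simp: D_def sum_\<beta>)
      have "sqrt (D\<^sup>2 + (\<Sum>k\<in>{k'..<n'}. (\<beta> k)\<^sup>2) + (\<Sum>k\<in>{k..<n}. (\<beta> k)\<^sup>2)) \<le> sqrt (D\<^sup>2 + 2 * S)"
        using S[of k' n'] S[of k n] by simp
      also have "\<dots> \<le> sqrt (D\<^sup>2) + sqrt (2 * S)" using S0 by (intro sqrt_add_le_add_sqrt) auto
      finally show "sqrt ((sum \<beta> {k'..<n'} - sum \<beta> {k..<n})\<^sup>2 + (\<Sum>k\<in>{k'..<n'}. (\<beta> k)\<^sup>2) + (\<Sum>k\<in>{k..<n}. (\<beta> k)\<^sup>2)) \<le> 3 + sqrt (2 * S)"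
        using D unfolding D_def by simp
    qed
    finally have "norm (u n' - u n) \<le> C'" by (simp add: C'_def)
    moreover have "norm (q n' - q n) \<le> norm (u n' - u n)"
      by (simp add: u_def norm_snd_le)
    ultimately show "norm (q n' - q n) \<le> C'" by linarith
  qed
qed

lemma polar_step:
  fixes x y c d :: "'a::real_inner"
  assumes "y = x + r *\<^sub>R d"
  shows "(norm (y - c))\<^sup>2 / 2 - (norm (x - c))\<^sup>2 / 2 \<le> r * (d \<bullet> (y - c))"
  using polar_diff[where x = x and y = y and c = c] assms by simp

text \<open>The squared distance to \<open>(ps, y)\<close> would decrease if \<open>y\<close> were an optimal multiplier. An error \<open>\<eta>\<close> in the value of
  \<open>y\<close> costs \<open>\<eta>\<close> per unit of time.\<close>

lemma dual_growth:
  assumes "\<And>i. Fs - \<eta> \<le> \<L> (p i) y" "m \<le> n"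
  shows "(norm (p n - ps))\<^sup>2 / 2 + (norm (q n - y))\<^sup>2 / 2 + (\<Sum>k\<in>{m..<n}. \<beta> k * B (Suc k))
    \<le> (norm (p m - ps))\<^sup>2 / 2 + (norm (q m - y))\<^sup>2 / 2 + \<eta> * (t n - t m)"
  using \<open>m \<le> n\<close>
proof (induction n rule: dec_induct)
  case (step n)
  let ?k = "Suc n"
  have "(norm (p ?k - ps))\<^sup>2 / 2 - (norm (p n - ps))\<^sup>2 / 2 \<le> \<beta> n * ((- a ?k) \<bullet> (p ?k - ps))"
    by (rule polar_step) (simp add: p_step)
  moreover have "(norm (q ?k - y))\<^sup>2 / 2 - (norm (q n - y))\<^sup>2 / 2 \<le> \<beta> n * (b ?k \<bullet> (q ?k - y))"
    by (rule polar_step) (simp add: q_step)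
  moreover have "(- a ?k) \<bullet> (p ?k - ps) + b ?k \<bullet> (q ?k - y) \<le> \<eta> - B ?k"
    using opt_primal[of n] super[of n y] assms(1)[of ?k] by (simp add: inner_diff_right)
  then have "\<beta> n * ((- a ?k) \<bullet> (p ?k - ps)) + \<beta> n * (b ?k \<bullet> (q ?k - y)) \<le> \<beta> n * (\<eta> - B ?k)"
    unfolding distrib_left[symmetric] using \<beta>_pos[of n] by (intro mult_left_mono) auto
  ultimately show ?case using step by (simp add: t_Suc algebra_simps)
qed simp

text \<open>Let \<open>s = sqrt (t n)\<close>. Choose a dual point \<open>y\<close> which is optimal up to \<open>\<eta>\<close>; by \<open>dual_growth\<close>
  its distance to \<open>q n\<close> is at most \<open>O(1) + \<theta> s\<close> with \<open>\<theta>\<^sup>2 = 2 \<eta>\<close>. Over a window of length \<open>T \<ge> s / 4\<close> the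
  squared distance of \<open>q\<close> to \<open>y\<close> changes by at most a multiple of this distance, because \<open>q\<close> moves a bounded amount. Dividing by \<open>T\<close>, the average of
  \<open>q\<close> over the window is optimal up to a multiple of \<open>\<theta>\<close> and an error that tends to zero.\<close>

lemma near_optimal_dual:
  "\<exists>C. \<forall>\<epsilon>>0. \<exists>\<tau>. \<forall>n. \<tau> \<le> t n \<longrightarrow> (\<exists>Q. norm (q n - Q) \<le> C \<and> (\<forall>i. Fs - \<epsilon> \<le> \<L> (p i) Q))"
proof -
  obtain C where C: "\<And>h n n'. 1 \<le> h \<Longrightarrow> real (h\<^sup>2 + h + 2) \<le> t n \<Longrightarrow> n \<le> n' \<Longrightarrow> t n' - t n \<le> real h \<Longrightarrow>
     norm (q n' - q n) \<le> C"
    using window_displacement by blast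
  have C0: "0 \<le> C"
  proof -
    obtain n where "4 \<le> t n" using t_unbounded by blast
    then show ?thesis using C[of 1 n n] by simp
  qed
  show ?thesis
  proof (rule exI[of _ C], intro allI impI)
    fix \<epsilon> :: real assume \<epsilon>: "0 < \<epsilon>"
    define \<theta> where "\<theta> = min 1 (\<epsilon> / (2 * (1 + 4 * C)))"
    define \<eta> where "\<eta> = \<theta>\<^sup>2 / 2"
    have \<theta>: "0 < \<theta>" "\<theta> \<le> 1" "\<theta> * (1 + 4 * C) \<le> \<epsilon> / 2"
    proof -
      show "0 < \<theta>" "\<theta> \<le> 1" using \<epsilon> C0 by (auto simp: \<theta>_def)
      have "\<theta> * (1 + 4 * C) \<le> \<epsilon> / (2 * (1 + 4 * C)) * (1 + 4 * C)"
        using C0 by (intro mult_right_mono) (auto simp: \<theta>_def)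
      also have "\<dots> = \<epsilon> / 2" using C0 by (simp add: divide_simps) (simp add: algebra_simps)?
      finally show "\<theta> * (1 + 4 * C) \<le> \<epsilon> / 2" by simp
    qed
    have \<eta>: "0 < \<eta>" "\<eta> \<le> \<theta>"
    proof -
      show "0 < \<eta>" using \<theta> by (simp add: \<eta>_def)
      have "\<theta> * \<theta> \<le> 1 * \<theta>" using \<theta> by (intro mult_right_mono) auto
      then show "\<eta> \<le> \<theta>" using \<theta> by (simp add: \<eta>_def power2_eq_square)
    qed
    obtain y where y: "\<And>i. Fs - \<eta> \<le> \<L> (p i) y" using approx_dual[OF \<eta>(1)] by blast
    define V where "V = (norm (p 0 - ps))\<^sup>2 + (norm (q 0 - y))\<^sup>2"
    have V: "0 \<le> V" by (simp add: V_def)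
    define K where "K = 4 * C * sqrt V + 8 * P\<^sup>2"
    have K: "0 \<le> K" using C0 V by (simp add: K_def)
    define \<tau> where "\<tau> = (max 8 (2 * K / \<epsilon>))\<^sup>2"
    show "\<exists>\<tau>. \<forall>n. \<tau> \<le> t n \<longrightarrow> (\<exists>Q. norm (q n - Q) \<le> C \<and> (\<forall>i. Fs - \<epsilon> \<le> \<L> (p i) Q))"
    proof (intro exI[of _ \<tau>] allI impI)
      fix n assume tn: "\<tau> \<le> t n"
      define s where "s = sqrt (t n)"
      have tn0: "0 \<le> t n" using t_mono[of 0 n] by simp
      have s2: "s\<^sup>2 = t n" using tn0 by (simp add: s_def)
      have "max 8 (2 * K / \<epsilon>) \<le> s"
        unfolding s_def using tn by (intro real_le_rsqrt) (simp add: \<tau>_def)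
      then have s: "8 \<le> s" "2 * K / \<epsilon> \<le> s" by auto
      \<comment> \<open>The window has to be so short that \<open>window_displacement\<close> applies from time \<open>s\<^sup>2\<close> on, and of length proportional to \<open>s\<close>.\<close>
      define h where "h = nat \<lfloor>s / 2\<rfloor>"
      have "real h = of_int \<lfloor>s / 2\<rfloor>" using s by (simp add: h_def)
      then have h: "real h \<le> s / 2" "s / 2 < real h + 1" by linarith+
      have h1: "1 \<le> h" using h s by linarith
      have hh: "real (h\<^sup>2 + h + 2) \<le> t n"
      proof -
        have "(real h)\<^sup>2 \<le> (s / 2)\<^sup>2" using h by (intro power_mono) auto
        moreover have "8 * s \<le> s\<^sup>2" using s by (simp add: power2_eq_square mult_right_mono)
        ultimately show ?thesis using h s unfolding s2[symmetric] by (simp add: power_divide)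
      qed
      obtain n' where n': "t n + (real h - 1) \<le> t n'" "t n' \<le> t n + real h"
      proof -
        define n' where "n' = (LEAST k. t n + (real h - 1) \<le> t k)"
        have 1: "t n + (real h - 1) \<le> t n'" unfolding n'_def using t_unbounded by (rule LeastI_ex)
        have "t n' \<le> t n + real h"
        proof (cases n')
          case (Suc k)
          then have "\<not> t n + (real h - 1) \<le> t k" unfolding n'_def using not_less_Least by (metis lessI)
          then show ?thesis using \<beta>_le[of k] by (simp add: Suc t_Suc)
        qed (use tn0 in simp)
        with 1 show ?thesis using that by blast
      qed
      define T where "T = t n' - t n"
      have T: "s / 4 \<le> T" using n' h s by (simp add: T_def)
      then have T0: "0 < T" using s by linarith
      have nn': "n < n'" using T0 by (intro t_less) (simp add: T_def)
      have disp: "norm (q k - q n) \<le> C" if "n \<le> k" "k \<le> n'" for k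
        using that n' t_mono[OF that(2)] by (intro C[OF h1 hh]) auto
      define I where "I = {n..<n'}"
      have I: "finite I" "I \<noteq> {}" using nn' by (auto simp: I_def)
      define r where "r k = \<beta> k / T" for k
      have r: "0 \<le> r k" for k using \<beta>_pos[of k] T0 by (simp add: r_def)
      have r1: "sum r I = 1"
        using T0 nn' by (simp add: r_def sum_divide_distrib[symmetric] I_def sum_\<beta> T_def)
      define Q where "Q = (\<Sum>k\<in>I. r k *\<^sub>R q (Suc k))"
      have "norm (q n - Q) \<le> C"
      proof -
        have "Q - q n = (\<Sum>k\<in>I. r k *\<^sub>R (q (Suc k) - q n))"
          by (simp add: Q_def scaleR_right_diff_distrib sum_subtractf scaleR_left.sum[symmetric] r1)
        also have "norm \<dots> \<le> (\<Sum>k\<in>I. r k * C)"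
          using r by (intro sum_norm_le) (auto simp: I_def intro!: mult_left_mono disp)
        finally show ?thesis by (simp add: sum_distrib_right[symmetric] r1 norm_minus_commute)
      qed
      moreover have "Fs - \<epsilon> \<le> \<L> (p i) Q" for i
      proof -
        have "- \<L> (p i) Q \<le> (\<Sum>k\<in>I. r k * - \<L> (p i) (q (Suc k)))"
          unfolding Q_def by (rule convex_on_sum[where C = UNIV]) (use I r r1 concave in auto)
        then have "T * - \<L> (p i) Q \<le> T * (\<Sum>k\<in>I. r k * - \<L> (p i) (q (Suc k)))"
          using T0 by (intro mult_left_mono) auto
        also have "\<dots> = - (\<Sum>k\<in>I. \<beta> k * \<L> (p i) (q (Suc k)))"
          using T0 by (simp add: sum_distrib_left sum_negf r_def)
        finally have "(\<Sum>k\<in>I. \<beta> k * \<L> (p i) (q (Suc k))) \<le> T * \<L> (p i) Q" by simp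
        moreover have "(\<Sum>k\<in>I. \<beta> k * (Fs - \<eta>) + ((norm (q (Suc k) - y))\<^sup>2 / 2 - (norm (q k - y))\<^sup>2 / 2)
            + ((norm (p (Suc k) - p i))\<^sup>2 / 2 - (norm (p k - p i))\<^sup>2 / 2)) \<le> (\<Sum>k\<in>I. \<beta> k * \<L> (p i) (q (Suc k)))"
        proof (rule sum_mono)
          fix k assume "k \<in> I"
          have "(norm (q (Suc k) - y))\<^sup>2 / 2 - (norm (q k - y))\<^sup>2 / 2 \<le> \<beta> k * (b (Suc k) \<bullet> (q (Suc k) - y))"
            by (rule polar_step) (simp add: q_step)
          moreover have "(norm (p (Suc k) - p i))\<^sup>2 / 2 - (norm (p k - p i))\<^sup>2 / 2 \<le> \<beta> k * ((- a (Suc k)) \<bullet> (p (Suc k) - p i))"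
            by (rule polar_step) (simp add: p_step)
          moreover have "(Fs - \<eta>) + b (Suc k) \<bullet> (q (Suc k) - y) + (- a (Suc k)) \<bullet> (p (Suc k) - p i) \<le> \<L> (p i) (q (Suc k))"
            using sub[of "Suc k" i] super[of k y] y[of "Suc k"] by (simp add: inner_diff_right)
          then have "\<beta> k * ((Fs - \<eta>) + b (Suc k) \<bullet> (q (Suc k) - y) + (- a (Suc k)) \<bullet> (p (Suc k) - p i)) \<le> \<beta> k * \<L> (p i) (q (Suc k))"
            using \<beta>_pos[of k] by (intro mult_left_mono) auto
          ultimately show "\<beta> k * (Fs - \<eta>) + ((norm (q (Suc k) - y))\<^sup>2 / 2 - (norm (q k - y))\<^sup>2 / 2)
            + ((norm (p (Suc k) - p i))\<^sup>2 / 2 - (norm (p k - p i))\<^sup>2 / 2) \<le> \<beta> k * \<L> (p i) (q (Suc k))"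
            unfolding distrib_left by linarith
        qed
        moreover have "(\<Sum>k\<in>I. \<beta> k * (Fs - \<eta>) + ((norm (q (Suc k) - y))\<^sup>2 / 2 - (norm (q k - y))\<^sup>2 / 2)
            + ((norm (p (Suc k) - p i))\<^sup>2 / 2 - (norm (p k - p i))\<^sup>2 / 2))
          = T * (Fs - \<eta>) + ((norm (q n' - y))\<^sup>2 / 2 - (norm (q n - y))\<^sup>2 / 2)
            + ((norm (p n' - p i))\<^sup>2 / 2 - (norm (p n - p i))\<^sup>2 / 2)"
          using nn' unfolding sum.distrib I_def
          by (subst (1 2) sum_Suc_diff') (auto simp: sum_distrib_right[symmetric] sum_\<beta> T_def)
        moreover have "norm (p n - p i) \<le> 2 * P"
          using norm_triangle_ineq4[of "p n" "p i"] p_le[of n] p_le[of i] by linarith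
        then have "(norm (p n - p i))\<^sup>2 \<le> 4 * P\<^sup>2"
          using power_mono[of "norm (p n - p i)" "2 * P" 2] by (simp add: power_mult_distrib)
        moreover have "(norm (q n' - y))\<^sup>2 / 2 - (norm (q n - y))\<^sup>2 / 2 \<ge> - (C * norm (q n - y))"
        proof -
          have "(norm (q n' - y))\<^sup>2 = (norm (q n - y))\<^sup>2 + 2 * ((q n' - q n) \<bullet> (q n - y)) + (norm (q n' - q n))\<^sup>2"
            by (simp add: power2_norm_eq_inner algebra_simps inner_commute)
          moreover have "\<bar>(q n' - q n) \<bullet> (q n - y)\<bar> \<le> C * norm (q n - y)"
            using disp[of n'] nn' by (intro order.trans[OF Cauchy_Schwarz_ineq2] mult_right_mono) auto
          ultimately show ?thesis
            using zero_le_power2[of "norm (q n' - q n)"] unfolding abs_le_iff by linarith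
        qed
        moreover have "norm (q n - y) \<le> sqrt V + \<theta> * s"
        proof -
          have "0 \<le> (\<Sum>k\<in>{0..<n}. \<beta> k * B (Suc k))"
            using \<beta>_pos B_nonneg by (intro sum_nonneg) (simp add: less_imp_le)
          then have "(norm (q n - y))\<^sup>2 \<le> V + 2 * \<eta> * t n"
            using dual_growth[OF y, of 0 n] zero_le_power2[of "norm (p n - ps)"]
            unfolding V_def t_0 diff_0_right by linarith
          also have "\<dots> = (sqrt V)\<^sup>2 + (\<theta> * s)\<^sup>2" using V by (simp add: \<eta>_def power_mult_distrib s2)
          also have "\<dots> \<le> (sqrt V + \<theta> * s)\<^sup>2" using V \<theta> s by (simp add: power2_sum)
          finally show ?thesis by (rule power2_le_imp_le) (use V \<theta> s in auto)
        qed
        then have "C * norm (q n - y) \<le> C * (sqrt V + \<theta> * s)" using C0 by (intro mult_left_mono)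
        ultimately have "T * (Fs - \<eta>) - C * (sqrt V + \<theta> * s) - 2 * P\<^sup>2 \<le> T * \<L> (p i) Q"
          using zero_le_power2[of "norm (p n' - p i)"] by linarith
        moreover have "C * (sqrt V + \<theta> * s) + 2 * P\<^sup>2 \<le> T * (\<epsilon> - \<eta>)"
        proof -
          have "4 * (C * (sqrt V + \<theta> * s) + 2 * P\<^sup>2) = K + s * (4 * C * \<theta>)" by (simp add: K_def algebra_simps)
          also have "K \<le> s * (\<epsilon> / 2)" using s \<epsilon> by (simp add: field_simps)
          also have "s * (\<epsilon> / 2) + s * (4 * C * \<theta>) = s * (\<epsilon> / 2 + 4 * C * \<theta>)" by (simp add: algebra_simps)
          also have "\<dots> \<le> s * (\<epsilon> - \<eta>)" using \<theta>(3) \<eta>(2) s by (intro mult_left_mono) (auto simp: algebra_simps)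
          also have "\<dots> \<le> (4 * T) * (\<epsilon> - \<eta>)"
          proof (intro mult_right_mono)
            have "0 \<le> \<theta> * (4 * C)" using \<theta>(1) C0 by simp
            moreover have "\<theta> * (1 + 4 * C) = \<theta> + \<theta> * (4 * C)" by (simp add: distrib_left)
            ultimately have "\<theta> \<le> \<epsilon> / 2" using \<theta>(3) by linarith
            then show "0 \<le> \<epsilon> - \<eta>" using \<eta>(2) \<epsilon> by linarith
          qed (use T in simp)
          finally show ?thesis by simp
        qed
        ultimately have "T * (Fs - \<epsilon>) \<le> T * \<L> (p i) Q" by (simp add: algebra_simps)
        then show ?thesis using T0 by simp
      qed
      ultimately show "\<exists>Q. norm (q n - Q) \<le> C \<and> (\<forall>i. Fs - \<epsilon> \<le> \<L> (p i) Q)" by blast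
    qed
  qed
qed

text \<open>Use \<open>dual_growth\<close> with the point of \<open>near_optimal_dual\<close>, which may depend on the window, in place of a multiplier.\<close>

theorem window_bound:
  "\<exists>C\<ge>0. \<forall>\<epsilon>>0. \<exists>\<tau>. \<forall>n n'. \<tau> \<le> t n \<longrightarrow> n \<le> n' \<longrightarrow>
     (\<Sum>k\<in>{n..<n'}. \<beta> k * B (Suc k)) \<le> C + \<epsilon> * (t n' - t n)"
proof -
  obtain C where C: "\<And>\<epsilon>. 0 < \<epsilon> \<Longrightarrow> \<exists>\<tau>. \<forall>n. \<tau> \<le> t n \<longrightarrow> (\<exists>Q. norm (q n - Q) \<le> C \<and> (\<forall>i. Fs - \<epsilon> \<le> \<L> (p i) Q))"
    using near_optimal_dual by blast
  show ?thesis
  proof (rule exI[of _ "(2 * P)\<^sup>2 / 2 + C\<^sup>2 / 2"], intro conjI allI impI)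
    fix \<epsilon> :: real assume "0 < \<epsilon>"
    then obtain \<tau> where \<tau>: "\<And>n. \<tau> \<le> t n \<Longrightarrow> \<exists>Q. norm (q n - Q) \<le> C \<and> (\<forall>i. Fs - \<epsilon> \<le> \<L> (p i) Q)"
      using C by blast
    show "\<exists>\<tau>. \<forall>n n'. \<tau> \<le> t n \<longrightarrow> n \<le> n' \<longrightarrow>
      (\<Sum>k\<in>{n..<n'}. \<beta> k * B (Suc k)) \<le> (2 * P)\<^sup>2 / 2 + C\<^sup>2 / 2 + \<epsilon> * (t n' - t n)"
    proof (intro exI[of _ \<tau>] allI impI)
      fix n n' assume "\<tau> \<le> t n" "n \<le> n'"
      then obtain Q where Q: "norm (q n - Q) \<le> C" "\<And>i. Fs - \<epsilon> \<le> \<L> (p i) Q" using \<tau> by blast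
      have "norm (p n - ps) \<le> 2 * P"
        using norm_triangle_ineq4[of "p n" ps] p_le[of n] ps_le by linarith
      then have "(norm (p n - ps))\<^sup>2 \<le> (2 * P)\<^sup>2" "(norm (q n - Q))\<^sup>2 \<le> C\<^sup>2"
        using Q(1) by (simp_all only: power_mono norm_ge_zero)
      then show "(\<Sum>k\<in>{n..<n'}. \<beta> k * B (Suc k)) \<le> (2 * P)\<^sup>2 / 2 + C\<^sup>2 / 2 + \<epsilon> * (t n' - t n)"
        using dual_growth[OF Q(2) \<open>n \<le> n'\<close>] zero_le_power2[of "norm (p n' - ps)"]
          zero_le_power2[of "norm (q n' - Q)"] by linarith
    qed
  qed simp
qed

text \<open>On a window of fixed length, \<open>g\<close> is almost constant, since \<open>speed_decrease\<close> makes the sum of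
  \<open>|g (k + 1) - g k|\<^sup>2 / \<beta> k\<close> finite. Its squared distance to \<open>gs\<close> is at most the mean over the window up to a
  factor, and by \<open>window_bound\<close> this mean is small when the window is long.\<close>

theorem gradients_converge: "g \<longlonglongrightarrow> gs"
proof (rule LIMSEQ_I)
  fix e :: real assume e: "0 < e"
  obtain C where C: "0 \<le> C" "\<And>\<epsilon>. 0 < \<epsilon> \<Longrightarrow> \<exists>\<tau>. \<forall>n n'. \<tau> \<le> t n \<longrightarrow> n \<le> n' \<longrightarrow>
     (\<Sum>k\<in>{n..<n'}. \<beta> k * B (Suc k)) \<le> C + \<epsilon> * (t n' - t n)"
    using window_bound by blast
  \<comment> \<open>The constants are such that the constant \<open>C\<close>, the slope \<open>\<epsilon>\<close> and the variation \<open>\<omega>\<close> of \<open>g\<close> contribute \<open>e\<^sup>2 / 4\<close>, \<open>e\<^sup>2 / 4\<close> and \<open>2 e\<^sup>2 / 9\<close>.\<close>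
  define h where "h = 8 * (C + 1) / (\<gamma> * e\<^sup>2)"
  have h: "0 < h" using C(1) \<gamma>_pos e by (simp add: h_def)
  define \<epsilon> where "\<epsilon> = \<gamma> * e\<^sup>2 / 8"
  have \<epsilon>: "0 < \<epsilon>" using \<gamma>_pos e by (simp add: \<epsilon>_def)
  define \<omega> where "\<omega> = e / 3"
  define \<theta> where "\<theta> = \<omega> / (2 * (h + 1))"
  have \<omega>: "0 < \<omega>" and \<theta>: "0 < \<theta>" using e h by (auto simp: \<omega>_def \<theta>_def)
  obtain \<tau> where \<tau>: "\<And>n n'. \<tau> \<le> t n \<Longrightarrow> n \<le> n' \<Longrightarrow>
     (\<Sum>k\<in>{n..<n'}. \<beta> k * B (Suc k)) \<le> C + \<epsilon> * (t n' - t n)"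
    using C(2)[OF \<epsilon>] by blast
  obtain n0 where n0: "\<tau> \<le> t n0" using t_unbounded by blast
  define f where "f k = (norm (g (Suc k) - g k))\<^sup>2 / \<beta> k" for k
  have f0: "0 \<le> f k" for k using \<beta>_pos[of k] by (simp add: f_def)
  have "summable (\<lambda>k. f (Suc k))"
    by (rule summableI_nonneg_bounded[where x = "\<rho>\<^sup>2 / (4 * \<gamma>)"]) (use f0 g_increments in \<open>auto simp: f_def\<close>)
  then have "summable f" by (simp only: summable_Suc_iff)
  then obtain n1 where n1: "\<And>m n. n1 \<le> m \<Longrightarrow> norm (sum f {m..<n}) < 2 * \<theta> * \<omega>"
    unfolding summable_Cauchy using \<theta> \<omega> by (metis mult_pos_pos zero_less_numeral)
  show "\<exists>no. \<forall>n\<ge>no. norm (g n - gs) < e"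
  proof (intro exI[of _ "max n0 n1"] allI impI)
    fix n assume n: "max n0 n1 \<le> n"
    define n' where "n' = (LEAST k. t n + h \<le> t k)"
    have T1: "t n + h \<le> t n'" unfolding n'_def using t_unbounded by (rule LeastI_ex)
    have nn': "n < n'" using T1 h by (intro t_less) simp
    have T2: "t n' \<le> t n + h + 1/2"
    proof (cases n')
      case (Suc k)
      then have "\<not> t n + h \<le> t k" unfolding n'_def using not_less_Least by (metis lessI)
      then show ?thesis using \<beta>_le[of k] by (simp add: Suc t_Suc)
    qed (use nn' in simp)
    define T where "T = t n' - t n"
    have frozen: "norm (g k - g n) \<le> \<omega>" if k: "n \<le> k" "k \<le> n'" for k
    proof -
      have step: "norm (g (Suc i) - g i) \<le> \<theta> * \<beta> i + f i / (4 * \<theta>)" for i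
      proof -
        let ?x = "norm (g (Suc i) - g i)"
        have "0 \<le> (2 * \<theta> * \<beta> i - ?x)\<^sup>2" by simp
        then have "4 * \<theta> * \<beta> i * ?x \<le> 4 * \<theta>\<^sup>2 * (\<beta> i)\<^sup>2 + ?x\<^sup>2"
          by (simp add: power2_diff power_mult_distrib)
        then have "?x \<le> (4 * \<theta>\<^sup>2 * (\<beta> i)\<^sup>2 + ?x\<^sup>2) / (4 * \<theta> * \<beta> i)"
          using \<theta> \<beta>_pos[of i] by (simp add: pos_le_divide_eq mult.commute)
        also have "\<dots> = \<theta> * \<beta> i + f i / (4 * \<theta>)"
          using \<theta> \<beta>_pos[of i] by (simp add: f_def add_divide_distrib power2_eq_square)
        finally show ?thesis .
      qed
      have "g k - g n = (\<Sum>i\<in>{n..<k}. g (Suc i) - g i)" using k by (simp add: sum_Suc_diff')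
      also have "norm \<dots> \<le> (\<Sum>i\<in>{n..<k}. \<theta> * \<beta> i + f i / (4 * \<theta>))"
        by (intro order.trans[OF norm_sum] sum_mono step)
      also have "\<dots> = \<theta> * (t k - t n) + sum f {n..<k} / (4 * \<theta>)"
        using k by (simp add: sum.distrib sum_distrib_left[symmetric] sum_divide_distrib[symmetric] sum_\<beta>)
      also have "\<dots> \<le> \<theta> * (h + 1) + (2 * \<theta> * \<omega>) / (4 * \<theta>)"
        using T2 t_mono[OF k(2)] \<theta> n1[of n k] n by (intro add_mono mult_left_mono divide_right_mono) auto
      also have "\<dots> = \<theta> * (h + 1) + \<omega> / 2" using \<theta> by simp
      also have "\<theta> * (h + 1) = \<omega> / 2" using h by (simp add: \<theta>_def divide_simps)
      also have "\<omega> / 2 + \<omega> / 2 = \<omega>" by simp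
      finally show ?thesis .
    qed
    have "T * (norm (gs - g n))\<^sup>2 = (\<Sum>k\<in>{n..<n'}. \<beta> k * (norm (gs - g n))\<^sup>2)"
      using nn' by (simp add: T_def sum_distrib_right[symmetric] sum_\<beta>)
    also have "\<dots> \<le> (\<Sum>k\<in>{n..<n'}. \<beta> k * (2 / \<gamma> * B (Suc k) + 2 * \<omega>\<^sup>2))"
    proof (intro sum_mono mult_left_mono)
      fix k assume k: "k \<in> {n..<n'}"
      have "norm (gs - g n) \<le> norm (gs - g (Suc k)) + norm (g (Suc k) - g n)"
        using norm_triangle_ineq[of "gs - g (Suc k)" "g (Suc k) - g n"] by simp
      also have "\<dots> \<le> norm (gs - g (Suc k)) + \<omega>" using frozen[of "Suc k"] k by simp
      finally have "(norm (gs - g n))\<^sup>2 \<le> (norm (gs - g (Suc k)) + \<omega>)\<^sup>2" by (intro power_mono) auto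
      also have "\<dots> \<le> 2 * (norm (gs - g (Suc k)))\<^sup>2 + 2 * \<omega>\<^sup>2"
        using sum_squares_bound[of "norm (gs - g (Suc k))" \<omega>] by (simp add: power2_sum)
      also have "2 * (norm (gs - g (Suc k)))\<^sup>2 = 2 / \<gamma> * B (Suc k)" using \<gamma>_pos by (simp add: B_def)
      finally show "(norm (gs - g n))\<^sup>2 \<le> 2 / \<gamma> * B (Suc k) + 2 * \<omega>\<^sup>2" .
    qed (use \<beta>_pos in \<open>auto simp: less_imp_le\<close>)
    also have "\<dots> = 2 / \<gamma> * (\<Sum>k\<in>{n..<n'}. \<beta> k * B (Suc k)) + 2 * \<omega>\<^sup>2 * T"
    proof -
      have "2 * \<omega>\<^sup>2 * T = (\<Sum>k\<in>{n..<n'}. \<beta> k * (2 * \<omega>\<^sup>2))"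
        using nn' by (simp add: T_def sum_\<beta>[symmetric] sum_distrib_right[symmetric])
      then show ?thesis by (simp add: distrib_left sum.distrib sum_distrib_left mult_ac)
    qed
    also have "\<dots> \<le> 2 / \<gamma> * (C + \<epsilon> * T) + 2 * \<omega>\<^sup>2 * T"
      using \<tau>[of n n'] n0 t_mono[of n0 n] n nn' \<gamma>_pos unfolding T_def
      by (intro add_right_mono mult_left_mono) auto
    also have "2 / \<gamma> * C \<le> e\<^sup>2 / 4 * T"
    proof -
      have "2 / \<gamma> * C \<le> 2 / \<gamma> * (C + 1)" using \<gamma>_pos by (intro mult_left_mono) auto
      also have "\<dots> = e\<^sup>2 / 4 * h" using \<gamma>_pos e by (simp add: h_def divide_simps)
      also have "\<dots> \<le> e\<^sup>2 / 4 * T" using T1 by (intro mult_left_mono) (auto simp: T_def)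
      finally show ?thesis .
    qed
    then have "2 / \<gamma> * (C + \<epsilon> * T) + 2 * \<omega>\<^sup>2 * T \<le> T * (e\<^sup>2 / 4 + e\<^sup>2 / 4 + 2 * (e\<^sup>2 / 9))"
      using \<gamma>_pos by (simp add: \<epsilon>_def \<omega>_def power_divide algebra_simps)
    finally have "T * (norm (gs - g n))\<^sup>2 \<le> T * (e\<^sup>2 / 4 + e\<^sup>2 / 4 + 2 * (e\<^sup>2 / 9))" .
    moreover have "0 < T" using T1 h by (simp add: T_def)
    ultimately have "(norm (gs - g n))\<^sup>2 \<le> e\<^sup>2 / 4 + e\<^sup>2 / 4 + 2 * (e\<^sup>2 / 9)" by simp
    also have "\<dots> < e\<^sup>2" using e by simp
    finally have "norm (gs - g n) < e" by (rule power2_less_imp_less) (use e in simp)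
    then show "norm (g n - gs) < e" by (simp add: norm_minus_commute)
  qed
qed

end

section \<open>Convex programs with a linear constraint\<close>

text \<open>The program minimizes \<open>F X\<close> over \<open>X \<in> C\<close> subject to \<open>D - X \<in> range K\<close>. For the Laplacian this constraint is the
  resource equation.\<close>

locale linear_constraint =
  fixes F :: "'v::euclidean_space \<Rightarrow> real" and gF K :: "'v \<Rightarrow> 'v" and C :: "'v set" and D xs :: 'v
    and \<gamma> lg :: real
  assumes C_compact: "compact C" and C_convex: "convex C" and xs_C: "xs \<in> C"
    and xs_feasible: "D - xs \<in> range K"
    and xs_optimal: "\<And>X. X \<in> C \<Longrightarrow> D - X \<in> range K \<Longrightarrow> F xs \<le> F X"
    and F_convex: "convex_on UNIV F" and F_cont: "continuous_on C F"
    and \<gamma>_pos: "0 < \<gamma>"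
    and bregman: "\<And>X Y. F X + gF X \<bullet> (Y - X) + \<gamma> * (norm (gF Y - gF X))\<^sup>2 \<le> F Y"
    and gF_lipschitz: "\<And>X Y. norm (gF X - gF Y) \<le> lg * norm (X - Y)"
    and gF_inj: "\<And>X. X \<in> C \<Longrightarrow> gF X = gF xs \<Longrightarrow> X = xs"
    and K_linear: "linear K" and K_sym: "\<And>x y. K x \<bullet> y = x \<bullet> K y"
    and K_nonneg: "\<And>x. 0 \<le> x \<bullet> K x"
begin

lemmas K_simps = linear_add[OF K_linear] linear_diff[OF K_linear] linear_scale[OF K_linear]
  linear_0[OF K_linear] linear_neg[OF K_linear]

lemma range_K: "subspace (range K)" "closed (range K)"
  using linear_subspace_image[OF K_linear subspace_UNIV] closed_subspace by blast+

text \<open>The multiplier is the normal of a hyperplane that separates the points \<open>(D - X - K Z, w)\<close> with \<open>w \<ge> F X\<close> from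
  \<open>(0, F xs - \<eta>)\<close>. Compactness of \<open>C\<close> keeps the latter out of the closure, so
  a strict separation exists; for \<open>\<eta> = 0\<close> it may fail. The hyperplane is not vertical, for it passes below the optimum \<open>xs\<close>.\<close>

theorem strong_duality:
  assumes \<eta>: "0 < \<eta>"
  shows "\<exists>y. K y = 0 \<and> (\<forall>X\<in>C. F xs - \<eta> \<le> F X + y \<bullet> (D - X))"
proof -
  define E where "E = {(D - X - K Z, w) | X Z w. X \<in> C \<and> F X \<le> w}"
  have "convex E"
  proof (rule convexI)
    fix x y :: "'v \<times> real" and u v :: real
    assume "x \<in> E" "y \<in> E" and uv: "0 \<le> u" "0 \<le> v" "u + v = 1"
    then obtain X Z w X' Z' w' where x: "x = (D - X - K Z, w)" "X \<in> C" "F X \<le> w"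
      and y: "y = (D - X' - K Z', w')" "X' \<in> C" "F X' \<le> w'" unfolding E_def by blast
    have "u *\<^sub>R X + v *\<^sub>R X' \<in> C" using C_convex x y uv by (simp add: convexD)
    moreover have "F (u *\<^sub>R X + v *\<^sub>R X') \<le> u * w + v * w'"
    proof -
      have "F (u *\<^sub>R X + v *\<^sub>R X') \<le> u * F X + v * F X'"
        using F_convex uv unfolding convex_on_def by blast
      also have "\<dots> \<le> u * w + v * w'" using x y uv by (intro add_mono mult_left_mono) auto
      finally show ?thesis .
    qed
    moreover have "u *\<^sub>R x + v *\<^sub>R y = (D - (u *\<^sub>R X + v *\<^sub>R X') - K (u *\<^sub>R Z + v *\<^sub>R Z'), u * w + v * w')"
    proof -
      have "u *\<^sub>R D + v *\<^sub>R D = D" using uv(3) by (simp add: scaleR_left_distrib[symmetric])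
      then show ?thesis unfolding x y by (simp add: K_simps algebra_simps)
    qed
    ultimately show "u *\<^sub>R x + v *\<^sub>R y \<in> E" unfolding E_def by blast
  qed
  then have conv: "convex (closure E)" by (rule convex_closure)
  have "(0, F xs - \<eta>) \<notin> closure E"
  proof
    assume "(0, F xs - \<eta>) \<in> closure E"
    then obtain e where e: "\<And>n. e n \<in> E" "e \<longlonglongrightarrow> (0, F xs - \<eta>)" unfolding closure_sequential by blast
    have "\<forall>n. \<exists>X Z w. e n = (D - X - K Z, w) \<and> X \<in> C \<and> F X \<le> w" using e(1) unfolding E_def by blast
    then obtain X Z w where XZ: "\<And>n. e n = (D - X n - K (Z n), w n)" "\<And>n. X n \<in> C" "\<And>n. F (X n) \<le> w n" by metis
    obtain Xl r where r: "Xl \<in> C" "strict_mono (r :: nat \<Rightarrow> nat)" "(X \<circ> r) \<longlonglongrightarrow> Xl"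
      using C_compact XZ(2) unfolding compact_def by blast
    have er: "(e \<circ> r) \<longlonglongrightarrow> (0, F xs - \<eta>)" by (rule LIMSEQ_subseq_LIMSEQ[OF e(2) r(2)])
    have f1: "(\<lambda>n. fst ((e \<circ> r) n)) \<longlonglongrightarrow> 0" and f2: "(\<lambda>n. snd ((e \<circ> r) n)) \<longlonglongrightarrow> F xs - \<eta>"
      using tendsto_fst[OF er] tendsto_snd[OF er] by simp_all
    have "(\<lambda>n. D - (X \<circ> r) n - fst ((e \<circ> r) n)) \<longlonglongrightarrow> D - Xl - 0"
      by (intro tendsto_diff tendsto_const r f1)
    moreover have "D - (X \<circ> r) n - fst ((e \<circ> r) n) = K (Z (r n))" for n by (simp add: XZ(1))
    ultimately have "(\<lambda>n. K (Z (r n))) \<longlonglongrightarrow> D - Xl" by simp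
    then have "D - Xl \<in> range K" by (rule closed_sequentially[OF range_K(2) rangeI])
    then have "F xs \<le> F Xl" using xs_optimal r(1) by blast
    moreover have "(\<lambda>n. F ((X \<circ> r) n)) \<longlonglongrightarrow> F Xl"
      by (rule continuous_on_tendsto_compose[OF F_cont r(3) r(1)]) (simp add: XZ(2))
    then have "F Xl \<le> F xs - \<eta>"
      by (rule LIMSEQ_le[OF _ f2]) (use XZ in auto)
    ultimately show False using \<eta> by linarith
  qed
  then obtain ac b where sep: "ac \<bullet> (0, F xs - \<eta>) < b" "\<And>x. x \<in> closure E \<Longrightarrow> b < ac \<bullet> x"
    using separating_hyperplane_closed_point[OF conv closed_closure] by blast
  obtain a c where ac: "ac = (a, c)" by (cases ac)
  have s1: "c * (F xs - \<eta>) < b" using sep(1) by (simp add: ac)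
  have s2: "b < a \<bullet> (D - X - K Z) + c * w" if "X \<in> C" "F X \<le> w" for X Z w
  proof -
    have "(D - X - K Z, w) \<in> E" using that unfolding E_def by blast
    then show ?thesis using sep(2)[of "(D - X - K Z, w)"] closure_subset by (auto simp: ac)
  qed
  obtain Zs where Zs: "D - xs = K Zs" using xs_feasible by blast
  have "b < c * F xs" using s2[OF xs_C order_refl, of Zs] by (simp add: Zs)
  with s1 have "0 < c * \<eta>" by (simp add: algebra_simps)
  then have c: "0 < c" using \<eta> by (simp add: zero_less_mult_iff)
  have aK: "a \<bullet> K Y = 0" for Y
  proof (rule ccontr)
    assume nz: "a \<bullet> K Y \<noteq> 0"
    define s where "s = (c * F xs - b) / (a \<bullet> K Y)"
    have "b < a \<bullet> (D - xs - K (Zs + s *\<^sub>R Y)) + c * F xs" by (rule s2[OF xs_C order_refl])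
    then show False using nz by (simp add: Zs K_simps inner_diff_right inner_add_right s_def)
  qed
  have "K a \<bullet> K a = 0" using aK[of "K a"] by (simp add: K_sym)
  then have "K ((1 / c) *\<^sub>R a) = 0" by (simp add: K_simps)
  moreover have "F xs - \<eta> \<le> F X + ((1 / c) *\<^sub>R a) \<bullet> (D - X)" if "X \<in> C" for X
  proof -
    have "c * (F xs - \<eta>) < a \<bullet> (D - X - K 0) + c * F X" using s1 s2[OF that order_refl, of 0] by linarith
    also have "\<dots> = c * (F X + ((1 / c) *\<^sub>R a) \<bullet> (D - X))" using c by (simp add: K_simps distrib_left)
    finally show ?thesis using c by simp
  qed
  ultimately show ?thesis by blast
qed

text \<open>An implicit step is a fixed point of a map whose Lipschitz constant is proportional to the step size.\<close>

lemma proximal_step_exists: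
  "\<exists>\<delta>>0. \<forall>h X Z \<Lambda>. 0 < h \<longrightarrow> h \<le> \<delta> \<longrightarrow> (\<exists>X' Z' \<Lambda>'. X' = closest_point C (X - h *\<^sub>R (gF X' - \<Lambda>')) \<and>
     Z' = Z + h *\<^sub>R K \<Lambda>' \<and> \<Lambda>' = \<Lambda> + h *\<^sub>R (D - X' - K \<Lambda>' - K Z'))"
proof -
  obtain bK where bK: "0 < bK" "\<And>x. norm (K x) \<le> bK * norm x"
    using linear_bounded_pos[OF K_linear] by blast
  define Lp where "Lp = \<bar>lg\<bar> + 2 + 3 * bK"
  have Lp: "0 < Lp" using bK by (simp add: Lp_def)
  define \<delta> where "\<delta> = 1 / (2 * Lp)"
  show ?thesis
  proof (intro exI[of _ \<delta>] conjI allI impI)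
    show "0 < \<delta>" using Lp by (simp add: \<delta>_def)
    fix h :: real and X Z \<Lambda> :: 'v assume h: "0 < h" "h \<le> \<delta>"
    define \<Phi> where "\<Phi> = (\<lambda>u :: ('v \<times> 'v) \<times> 'v. case u of ((X', Z'), \<Lambda>') \<Rightarrow>
      ((closest_point C (X - h *\<^sub>R (gF X' - \<Lambda>')), Z + h *\<^sub>R K \<Lambda>'), \<Lambda> + h *\<^sub>R (D - X' - K \<Lambda>' - K Z')))"
    have "dist (\<Phi> u) (\<Phi> w) \<le> 1/2 * dist u w" for u w
    proof -
      obtain X1 Z1 \<Lambda>1 where u: "u = ((X1, Z1), \<Lambda>1)" by (metis prod.exhaust)
      obtain X2 Z2 \<Lambda>2 where w: "w = ((X2, Z2), \<Lambda>2)" by (metis prod.exhaust)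
      have n1: "norm (X1 - X2) \<le> norm (u - w)" and n2: "norm (Z1 - Z2) \<le> norm (u - w)"
        and n3: "norm (\<Lambda>1 - \<Lambda>2) \<le> norm (u - w)"
      proof -
        have "norm ((X1 - X2, Z1 - Z2)) \<le> norm (u - w)" using norm_fst_le[of "(X1 - X2, Z1 - Z2)" "\<Lambda>1 - \<Lambda>2"] by (simp add: u w)
        then show "norm (X1 - X2) \<le> norm (u - w)" "norm (Z1 - Z2) \<le> norm (u - w)"
          using norm_fst_le[of "X1 - X2" "Z1 - Z2"] norm_snd_le[of "Z1 - Z2" "X1 - X2"] by linarith+
        show "norm (\<Lambda>1 - \<Lambda>2) \<le> norm (u - w)" using norm_snd_le[of "\<Lambda>1 - \<Lambda>2" "(X1 - X2, Z1 - Z2)"] by (simp add: u w)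
      qed
      let ?n = "norm (u - w)"
      have kk: "norm (K x - K y) \<le> bK * ?n" if "norm (x - y) \<le> ?n" for x y
      proof -
        have "norm (K x - K y) \<le> bK * norm (x - y)" using bK(2)[of "x - y"] by (simp add: K_simps)
        also have "\<dots> \<le> bK * ?n" using that bK(1) by (intro mult_left_mono) auto
        finally show ?thesis .
      qed
      have "norm (closest_point C (X - h *\<^sub>R (gF X1 - \<Lambda>1)) - closest_point C (X - h *\<^sub>R (gF X2 - \<Lambda>2)))
          \<le> norm ((X - h *\<^sub>R (gF X1 - \<Lambda>1)) - (X - h *\<^sub>R (gF X2 - \<Lambda>2)))"
        using closest_point_lipschitz[OF C_convex compact_imp_closed[OF C_compact]] xs_C unfolding dist_norm by blast
      also have "\<dots> = norm (h *\<^sub>R (gF X2 - gF X1 + (\<Lambda>1 - \<Lambda>2)))" by (simp add: algebra_simps)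
      also have "\<dots> = h * norm (gF X2 - gF X1 + (\<Lambda>1 - \<Lambda>2))" using h by simp
      also have "\<dots> \<le> h * (\<bar>lg\<bar> * ?n + ?n)"
      proof (intro mult_left_mono order.trans[OF norm_triangle_ineq] add_mono n3)
        have "norm (gF X2 - gF X1) \<le> lg * norm (X2 - X1)" by (rule gF_lipschitz)
        also have "\<dots> \<le> \<bar>lg\<bar> * ?n" using n1 by (intro mult_mono) (auto simp: norm_minus_commute)
        finally show "norm (gF X2 - gF X1) \<le> \<bar>lg\<bar> * ?n" .
      qed (use h in simp)
      finally have c1: "norm (closest_point C (X - h *\<^sub>R (gF X1 - \<Lambda>1)) - closest_point C (X - h *\<^sub>R (gF X2 - \<Lambda>2))) \<le> h * (\<bar>lg\<bar> * ?n + ?n)" .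
      have c2: "norm ((Z + h *\<^sub>R K \<Lambda>1) - (Z + h *\<^sub>R K \<Lambda>2)) \<le> h * (bK * ?n)"
      proof -
        have "norm ((Z + h *\<^sub>R K \<Lambda>1) - (Z + h *\<^sub>R K \<Lambda>2)) = h * norm (K \<Lambda>1 - K \<Lambda>2)"
          using h by (simp add: scaleR_right_diff_distrib[symmetric])
        also have "\<dots> \<le> h * (bK * ?n)" using h kk[OF n3] by (intro mult_left_mono) auto
        finally show ?thesis .
      qed
      have c3: "norm ((\<Lambda> + h *\<^sub>R (D - X1 - K \<Lambda>1 - K Z1)) - (\<Lambda> + h *\<^sub>R (D - X2 - K \<Lambda>2 - K Z2))) \<le> h * (?n + bK * ?n + bK * ?n)"
      proof -
        have "(\<Lambda> + h *\<^sub>R (D - X1 - K \<Lambda>1 - K Z1)) - (\<Lambda> + h *\<^sub>R (D - X2 - K \<Lambda>2 - K Z2))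
            = - (h *\<^sub>R ((X1 - X2) + (K \<Lambda>1 - K \<Lambda>2) + (K Z1 - K Z2)))" by (simp add: algebra_simps)
        also have "norm \<dots> = h * norm ((X1 - X2) + (K \<Lambda>1 - K \<Lambda>2) + (K Z1 - K Z2))" using h by (simp only: norm_minus_cancel norm_scaleR abs_of_pos)
        also have "\<dots> \<le> h * (?n + bK * ?n + bK * ?n)"
          using h by (intro mult_left_mono order.trans[OF norm_triangle_ineq] add_mono n1 kk n2 n3) auto
        finally show ?thesis .
      qed
      have "norm (\<Phi> u - \<Phi> w) \<le> h * (\<bar>lg\<bar> * ?n + ?n) + h * (bK * ?n) + h * (?n + bK * ?n + bK * ?n)"
      proof -
        have "\<Phi> u - \<Phi> w = ((closest_point C (X - h *\<^sub>R (gF X1 - \<Lambda>1)) - closest_point C (X - h *\<^sub>R (gF X2 - \<Lambda>2)),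
            (Z + h *\<^sub>R K \<Lambda>1) - (Z + h *\<^sub>R K \<Lambda>2)),
            (\<Lambda> + h *\<^sub>R (D - X1 - K \<Lambda>1 - K Z1)) - (\<Lambda> + h *\<^sub>R (D - X2 - K \<Lambda>2 - K Z2)))"
          unfolding \<Phi>_def u w prod.case diff_Pair by (rule refl)
        then show ?thesis
          by (simp only:) (intro order.trans[OF norm_Pair_le] add_mono c1 c2 c3)
      qed
      also have "\<dots> = h * Lp * ?n" by (simp add: Lp_def algebra_simps)
      also have "\<dots> \<le> \<delta> * Lp * ?n" using h Lp by (intro mult_right_mono) auto
      also have "\<dots> = 1/2 * ?n" using Lp by (simp add: \<delta>_def)
      finally show ?thesis by (simp add: dist_norm)
    qed
    then have "\<exists>!u. \<Phi> u = u" by (intro banach_fix_type[of "1/2"]) auto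
    then obtain u where u: "\<Phi> u = u" by blast
    obtain X' Z' \<Lambda>' where "u = ((X', Z'), \<Lambda>')" by (metis prod.exhaust)
    with u have "X' = closest_point C (X - h *\<^sub>R (gF X' - \<Lambda>')) \<and>
     Z' = Z + h *\<^sub>R K \<Lambda>' \<and> \<Lambda>' = \<Lambda> + h *\<^sub>R (D - X' - K \<Lambda>' - K Z')" by (simp add: \<Phi>_def)
    then show "\<exists>X' Z' \<Lambda>'. X' = closest_point C (X - h *\<^sub>R (gF X' - \<Lambda>')) \<and>
     Z' = Z + h *\<^sub>R K \<Lambda>' \<and> \<Lambda>' = \<Lambda> + h *\<^sub>R (D - X' - K \<Lambda>' - K Z')" by blast
  qed
qed

definition Lag :: "'v \<times> 'v \<Rightarrow> 'v \<Rightarrow> real" where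
  "Lag p y = F (fst p) + y \<bullet> (D - fst p) - (y \<bullet> K y) / 2 - y \<bullet> K (snd p)"

lemma Lag_concave: "convex_on UNIV (\<lambda>y. - Lag p y)"
proof (rule convex_onI)
  fix t :: real and x y :: 'v assume t: "0 < t" "t < 1"
  let ?z = "(1 - t) *\<^sub>R x + t *\<^sub>R y"
  have "(1 - t) * - Lag p x + t * - Lag p y - - Lag p ?z = (t * (1 - t)) / 2 * ((x - y) \<bullet> K (x - y))"
    by (simp add: Lag_def K_simps inner_add_left inner_add_right inner_diff_left inner_diff_right
      K_sym[of y x, symmetric] inner_commute[of "K y" x] field_simps)
  moreover have "0 \<le> (t * (1 - t)) / 2 * ((x - y) \<bullet> K (x - y))" using t K_nonneg by simp
  ultimately show "- Lag p ?z \<le> (1 - t) * - Lag p x + t * - Lag p y" by linarith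
qed simp

lemma Lag_supergradient: "Lag (X, Z) y \<le> Lag (X, Z) \<Lambda> + (D - X - K \<Lambda> - K Z) \<bullet> (y - \<Lambda>)"
proof -
  have "(D - X - K \<Lambda> - K Z) \<bullet> (y - \<Lambda>) = y \<bullet> (D - X) - \<Lambda> \<bullet> (D - X) - y \<bullet> K \<Lambda> + \<Lambda> \<bullet> K \<Lambda> - y \<bullet> K Z + \<Lambda> \<bullet> K Z"
    by (simp add: inner_diff_left inner_diff_right inner_commute[of y] inner_commute[of \<Lambda>])
  moreover have "(y - \<Lambda>) \<bullet> K (y - \<Lambda>) = y \<bullet> K y - 2 * (y \<bullet> K \<Lambda>) + \<Lambda> \<bullet> K \<Lambda>"
    using K_sym[of y \<Lambda>] by (simp add: K_simps inner_diff_left inner_diff_right inner_commute)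
  ultimately have "Lag (X, Z) \<Lambda> + (D - X - K \<Lambda> - K Z) \<bullet> (y - \<Lambda>) - Lag (X, Z) y = ((y - \<Lambda>) \<bullet> K (y - \<Lambda>)) / 2"
    unfolding Lag_def fst_conv snd_conv by linarith
  then show ?thesis using K_nonneg[of "y - \<Lambda>"] by linarith
qed

lemma Lag_subgradient:
  "Lag (X, Z) \<Lambda> + (gF X - \<Lambda>) \<bullet> (X' - X) - K \<Lambda> \<bullet> (Z' - Z) + \<gamma> * (norm (gF X' - gF X))\<^sup>2 \<le> Lag (X', Z') \<Lambda>"
  using bregman[of X X'] by (simp add: Lag_def K_simps K_sym inner_diff_left inner_diff_right)

text \<open>The path is the proximal path of \<open>Lag\<close>, begun at \<open>(xs, 0, 0)\<close> at a time when the steps are short enough. Besides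
  convergence, two bounds are used later: the velocity is bounded, and so are \<open>K \<Lambda>\<close> and \<open>K Z\<close>, which are parts of the velocity.\<close>

theorem proximal_path:
  fixes \<alpha> :: "nat \<Rightarrow> real"
  assumes \<alpha>_pos: "\<And>k. 0 < \<alpha> k"
    and \<alpha>_div: "filterlim (\<lambda>n. sum \<alpha> {..<n}) at_top sequentially"
    and \<alpha>_sq: "summable (\<lambda>k. (\<alpha> k)\<^sup>2)"
  obtains k0 r X Z \<Lambda> where
    "\<And>k. k0 \<le> k \<Longrightarrow> X (Suc k) = closest_point C (X k - \<alpha> k *\<^sub>R (gF (X (Suc k)) - \<Lambda> (Suc k)))"
    "\<And>k. k0 \<le> k \<Longrightarrow> Z (Suc k) = Z k + \<alpha> k *\<^sub>R K (\<Lambda> (Suc k))"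
    "\<And>k. k0 \<le> k \<Longrightarrow> \<Lambda> (Suc k) = \<Lambda> k + \<alpha> k *\<^sub>R (D - X (Suc k) - K (\<Lambda> (Suc k)) - K (Z (Suc k)))"
    "\<And>k. k0 \<le> k \<Longrightarrow> norm (((X (Suc k), Z (Suc k)), \<Lambda> (Suc k)) - ((X k, Z k), \<Lambda> k)) \<le> r * \<alpha> k"
    "\<And>k. k0 < k \<Longrightarrow> norm (K (\<Lambda> k)) \<le> r" "\<And>k. k0 < k \<Longrightarrow> norm (K (Z k)) \<le> r" "\<And>k. k0 < k \<Longrightarrow> X k \<in> C"
    "X \<longlonglongrightarrow> xs"
proof -
  obtain \<delta> where \<delta>: "0 < \<delta>" "\<And>h X Z \<Lambda>. 0 < h \<Longrightarrow> h \<le> \<delta> \<Longrightarrow> (\<exists>X' Z' \<Lambda>'. X' = closest_point C (X - h *\<^sub>R (gF X' - \<Lambda>')) \<and>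
     Z' = Z + h *\<^sub>R K \<Lambda>' \<and> \<Lambda>' = \<Lambda> + h *\<^sub>R (D - X' - K \<Lambda>' - K Z'))"
    using proximal_step_exists by blast
  have "(\<lambda>k. (\<alpha> k)\<^sup>2) \<longlonglongrightarrow> 0" using \<alpha>_sq by (rule summable_LIMSEQ_zero)
  then have "(\<lambda>k. sqrt ((\<alpha> k)\<^sup>2)) \<longlonglongrightarrow> sqrt 0" by (rule tendsto_real_sqrt)
  then have "\<alpha> \<longlonglongrightarrow> 0" using \<alpha>_pos by (simp add: less_imp_le abs_of_pos)
  then have "\<forall>\<^sub>F k in sequentially. \<alpha> k < min \<delta> (1/2)"
    by (rule order_tendstoD) (use \<delta> in auto)
  then obtain k0 where k0: "\<And>k. k0 \<le> k \<Longrightarrow> \<alpha> k < min \<delta> (1/2)" unfolding eventually_sequentially by blast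
  define \<beta> where "\<beta> k = \<alpha> (k0 + k)" for k
  have \<beta>: "0 < \<beta> k" "\<beta> k \<le> \<delta>" "\<beta> k \<le> 1/2" for k
    using k0[of "k0 + k"] \<alpha>_pos[of "k0 + k"] by (auto simp: \<beta>_def)
  define step where "step k u u' \<longleftrightarrow> fst (fst u') = closest_point C (fst (fst u) - \<beta> k *\<^sub>R (gF (fst (fst u')) - snd u')) \<and>
     snd (fst u') = snd (fst u) + \<beta> k *\<^sub>R K (snd u') \<and>
     snd u' = snd u + \<beta> k *\<^sub>R (D - fst (fst u') - K (snd u') - K (snd (fst u')))"
    for k and u u' :: "('v \<times> 'v) \<times> 'v"
  have "\<exists>u'. step k u u'" for k u
    unfolding step_def using \<delta>(2)[OF \<beta>(1)[of k] \<beta>(2)[of k], of "fst (fst u)" "snd (fst u)" "snd u"]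
    by (metis fst_conv snd_conv)
  then have "\<exists>nxt. \<forall>k u. step k u (nxt k u)" by metis
  then obtain nxt where nxt: "\<And>k u. step k u (nxt k u)" by blast
  define u where "u = rec_nat ((xs, 0), 0) nxt"
  have u_Suc: "u (Suc k) = nxt k (u k)" for k by (simp add: u_def)
  define X Z \<Lambda> where "X k = fst (fst (u k))" and "Z k = snd (fst (u k))" and "\<Lambda> k = snd (u k)" for k
  have X_Suc: "X (Suc k) = closest_point C (X k - \<beta> k *\<^sub>R (gF (X (Suc k)) - \<Lambda> (Suc k)))" for k
    using nxt[of k "u k"] unfolding step_def X_def \<Lambda>_def u_Suc by blast
  have Z_Suc: "Z (Suc k) = Z k + \<beta> k *\<^sub>R K (\<Lambda> (Suc k))" for k
    using nxt[of k "u k"] unfolding step_def Z_def \<Lambda>_def u_Suc by blast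
  have \<Lambda>_Suc: "\<Lambda> (Suc k) = \<Lambda> k + \<beta> k *\<^sub>R (D - X (Suc k) - K (\<Lambda> (Suc k)) - K (Z (Suc k)))" for k
    using nxt[of k "u k"] unfolding step_def X_def Z_def \<Lambda>_def u_Suc by blast
  have u_0: "X 0 = xs" "Z 0 = 0" "\<Lambda> 0 = 0" by (simp_all add: X_def Z_def \<Lambda>_def u_def)
  have C_closed: "closed C" using C_compact by (rule compact_imp_closed)
  have X_C: "X k \<in> C" for k
  proof (cases k)
    case (Suc n)
    show ?thesis unfolding Suc by (subst X_Suc) (use C_closed xs_C in \<open>auto intro!: closest_point_in_set\<close>)
  qed (simp add: u_0 xs_C)
  obtain R where R: "\<And>x. x \<in> C \<Longrightarrow> norm x \<le> R" using compact_imp_bounded[OF C_compact] bounded_iff by metis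
  define p q where "p k = (X k, Z k)" and "q = \<Lambda>" for k
  define a where "a k = (case k of 0 \<Rightarrow> 0 | Suc n \<Rightarrow> ((1 / \<beta> n) *\<^sub>R (X n - X (Suc n)), - K (\<Lambda> (Suc n))))" for k
  define b where "b k = D - X k - K (\<Lambda> k) - K (Z k)" for k
  \<comment> \<open>A lower bound for \<open>F\<close> on \<open>C\<close>, by the gradient inequality at \<open>xs\<close>; at \<open>\<Lambda> = 0\<close> the function \<open>Lag\<close> is \<open>F\<close>.\<close>
  define l where "l k = (case k of 0 \<Rightarrow> F xs - norm (gF xs) * (R + R) | Suc n \<Rightarrow> Lag (p k) (q k))" for k
  define g where "g k = gF (X k)" for k
  interpret saddle_path \<beta> p a q b Lag l g \<gamma>
  proof
    show "0 < \<beta> k" for k by (rule \<beta>)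
    show "p (Suc k) = p k - \<beta> k *\<^sub>R a (Suc k)" for k
      using \<beta>(1)[of k] Z_Suc[of k] by (simp add: p_def a_def)
    show "q (Suc k) = q k + \<beta> k *\<^sub>R b (Suc k)" for k using \<Lambda>_Suc[of k] by (simp add: q_def b_def)
    show "a 0 = 0" by (simp add: a_def)
    show "l 0 \<le> Lag (p i) (q 0)" for i
    proof -
      have "norm (X i - xs) \<le> R + R"
        using norm_triangle_ineq4[of "X i" xs] R[OF X_C[of i]] R[OF xs_C] by linarith
      then have "\<bar>gF xs \<bullet> (X i - xs)\<bar> \<le> norm (gF xs) * (R + R)"
        by (intro order.trans[OF Cauchy_Schwarz_ineq2] mult_left_mono) auto
      moreover have "0 \<le> \<gamma> * (norm (gF (X i) - gF xs))\<^sup>2" using \<gamma>_pos by simp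
      ultimately show ?thesis using bregman[of xs "X i"] by (simp add: l_def p_def q_def u_0 Lag_def)
    qed
    show "0 < \<gamma>" by (rule \<gamma>_pos)
    show "l (Suc k) + a (Suc k) \<bullet> (p i - p (Suc k)) + \<gamma> * (norm (g i - g (Suc k)))\<^sup>2 \<le> Lag (p i) (q (Suc k))" for k i
    proof -
      let ?G = "gF (X (Suc k)) - \<Lambda> (Suc k)"
      have "((X k - \<beta> k *\<^sub>R ?G) - X (Suc k)) \<bullet> (X i - X (Suc k)) \<le> 0"
        using closest_point_dot[OF C_convex C_closed X_C[of i], of "X k - \<beta> k *\<^sub>R ?G"] X_Suc[of k] by simp
      then have "(X k - X (Suc k)) \<bullet> (X i - X (Suc k)) \<le> \<beta> k * (?G \<bullet> (X i - X (Suc k)))"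
        by (simp only: inner_diff_left[of _ _ "X i - X (Suc k)"] inner_scaleR_left)
      then have "(1 / \<beta> k) * ((X k - X (Suc k)) \<bullet> (X i - X (Suc k))) \<le> ?G \<bullet> (X i - X (Suc k))"
        using \<beta>(1)[of k] by (simp add: divide_le_eq mult.commute)
      then have "a (Suc k) \<bullet> (p i - p (Suc k)) \<le> ?G \<bullet> (X i - X (Suc k)) - K (\<Lambda> (Suc k)) \<bullet> (Z i - Z (Suc k))"
        by (simp add: a_def p_def)
      then show ?thesis
        using Lag_subgradient[of "X (Suc k)" "Z (Suc k)" "\<Lambda> (Suc k)" "X i" "Z i"] by (simp add: l_def p_def q_def g_def)
    qed
    show "Lag (p (Suc k)) y \<le> l (Suc k) + b (Suc k) \<bullet> (y - q (Suc k))" for k y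
      using Lag_supergradient[of "X (Suc k)" "Z (Suc k)" y "\<Lambda> (Suc k)"] by (simp add: l_def p_def q_def b_def)
  qed
  have K\<Lambda>: "norm (K (\<Lambda> (Suc k))) \<le> \<rho>" for k
    using norm_snd_le[of "snd (a (Suc k))" "fst (a (Suc k))"] a_le[of "Suc k"] by (simp add: a_def)
  define M where "M = norm D + R + 2 * \<rho>"
  have KZ: "norm (K (Z (Suc k))) \<le> M" for k
  proof -
    have "K (Z (Suc k)) = (D - X (Suc k)) - K (\<Lambda> (Suc k)) - b (Suc k)" by (simp add: b_def)
    also have "norm \<dots> \<le> (norm D + R) + \<rho> + \<rho>"
      by (intro order.trans[OF norm_triangle_ineq4] add_mono K\<Lambda> b_le R X_C order_refl)
    finally show ?thesis by (simp add: M_def)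
  qed
  \<comment> \<open>\<open>Z\<close> stays in the range of \<open>K\<close>, on which the symmetric map \<open>K\<close> is injective; so the bound on \<open>K Z\<close> bounds \<open>Z\<close>.\<close>
  have Z_range: "Z k \<in> range K" for k
  proof (induction k)
    case 0
    show ?case using range_K(1) by (simp add: u_0 subspace_0)
  next
    case (Suc k)
    have "\<beta> k *\<^sub>R K (\<Lambda> (Suc k)) \<in> range K" using range_K(1) by (intro subspace_scale) auto
    then show ?case using Suc range_K(1) unfolding Z_Suc by (simp add: subspace_add)
  qed
  have "\<forall>x\<in>range K. K x = 0 \<longrightarrow> x = 0"
  proof (intro ballI impI)
    fix x assume "x \<in> range K" and 0: "K x = 0"
    then obtain y where y: "x = K y" by blast
    have "x \<bullet> x = y \<bullet> K x" unfolding y K_sym ..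
    then show "x = 0" using 0 by simp
  qed
  then obtain e where e: "0 < e" "\<And>x. x \<in> range K \<Longrightarrow> e * norm x \<le> norm (K x)"
    using injective_imp_isometric[OF range_K(2,1) linear_conv_bounded_linear[THEN iffD1, OF K_linear]] by (auto simp: mult.commute)
  have M0: "0 \<le> M" using KZ[of 0] norm_ge_zero order.trans by blast
  have Zb: "norm (Z k) \<le> M / e" for k
  proof (cases k)
    case (Suc n)
    have "e * norm (Z k) \<le> M" using e(2)[OF Z_range[of k]] KZ[of n] unfolding Suc by linarith
    then show ?thesis using e(1) by (simp add: field_simps)
  qed (use M0 e in \<open>simp add: u_0\<close>)
  obtain Zs where Zs: "D - xs = K Zs" using xs_feasible by blast
  define P where "P = max (R + M / e) (norm (xs, Zs))"
  interpret saddle_descent \<beta> p a q b Lag l g \<gamma> "(xs, Zs)" "F xs" P "suminf (\<lambda>k. (\<alpha> k)\<^sup>2)" "gF xs"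
  proof
    show "\<beta> k \<le> 1/2" for k by (rule \<beta>)
    have sums: "sum \<beta> {..<n} = sum \<alpha> {..<n + k0} - sum \<alpha> {..<k0}" for n
    proof -
      have "sum \<beta> {..<n} = sum \<alpha> {k0..<n + k0}"
        using sum.shift_bounds_nat_ivl[of \<alpha> 0 k0 n] by (simp add: \<beta>_def lessThan_atLeast0 add.commute)
      then show ?thesis by (simp add: sum_lessThan_split)
    qed
    have "filterlim (\<lambda>n. - sum \<alpha> {..<k0} + sum \<alpha> {..<n + k0}) at_top sequentially"
      by (rule filterlim_tendsto_add_at_top[OF tendsto_const])
        (rule filterlim_compose[OF \<alpha>_div filterlim_add_const_nat_at_top])
    then show "filterlim (\<lambda>n. sum \<beta> {..<n}) at_top sequentially" by (simp add: sums)
    show "(\<Sum>k<n. (\<beta> k)\<^sup>2) \<le> (\<Sum>k. (\<alpha> k)\<^sup>2)" for n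
    proof -
      have "(\<Sum>k<n. (\<beta> k)\<^sup>2) = (\<Sum>k\<in>{k0..<n + k0}. (\<alpha> k)\<^sup>2)"
        using sum.shift_bounds_nat_ivl[of "\<lambda>k. (\<alpha> k)\<^sup>2" 0 k0 n] by (simp add: \<beta>_def lessThan_atLeast0 add.commute)
      also have "\<dots> \<le> (\<Sum>k. (\<alpha> k)\<^sup>2)" by (rule sum_le_suminf[OF \<alpha>_sq]) auto
      finally show ?thesis .
    qed
    show "convex_on UNIV (\<lambda>y. - Lag (p i) y)" for i by (rule Lag_concave)
    show "norm (p k) \<le> P" for k
      using norm_Pair_le[of "X k" "Z k"] R[OF X_C[of k]] Zb[of k] by (simp add: p_def P_def)
    show "norm (xs, Zs) \<le> P" by (simp add: P_def)
    show "l (Suc k) + a (Suc k) \<bullet> ((xs, Zs) - p (Suc k)) + \<gamma> * (norm (gF xs - g (Suc k)))\<^sup>2 \<le> F xs" for k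
    proof -
      let ?G = "gF (X (Suc k)) - \<Lambda> (Suc k)"
      have "((X k - \<beta> k *\<^sub>R ?G) - X (Suc k)) \<bullet> (xs - X (Suc k)) \<le> 0"
        using closest_point_dot[OF C_convex C_closed xs_C, of "X k - \<beta> k *\<^sub>R ?G"] X_Suc[of k] by simp
      then have "(X k - X (Suc k)) \<bullet> (xs - X (Suc k)) \<le> \<beta> k * (?G \<bullet> (xs - X (Suc k)))"
        by (simp only: inner_diff_left[of _ _ "xs - X (Suc k)"] inner_scaleR_left)
      then have "(1 / \<beta> k) * ((X k - X (Suc k)) \<bullet> (xs - X (Suc k))) \<le> ?G \<bullet> (xs - X (Suc k))"
        using \<beta>(1)[of k] by (simp add: divide_le_eq mult.commute)
      then have "a (Suc k) \<bullet> ((xs, Zs) - p (Suc k)) \<le> ?G \<bullet> (xs - X (Suc k)) - K (\<Lambda> (Suc k)) \<bullet> (Zs - Z (Suc k))"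
        by (simp add: a_def p_def)
      then have "l (Suc k) + a (Suc k) \<bullet> ((xs, Zs) - p (Suc k)) + \<gamma> * (norm (gF xs - g (Suc k)))\<^sup>2 \<le> Lag (xs, Zs) (\<Lambda> (Suc k))"
        using Lag_subgradient[of "X (Suc k)" "Z (Suc k)" "\<Lambda> (Suc k)" xs Zs] by (simp add: l_def p_def q_def g_def)
      also have "\<dots> \<le> F xs" using K_nonneg[of "\<Lambda> (Suc k)"] by (simp add: Lag_def Zs)
      finally show ?thesis .
    qed
    show "\<exists>y. \<forall>i. F xs - \<eta> \<le> Lag (p i) y" if \<eta>: "0 < \<eta>" for \<eta>
    proof -
      obtain y where y: "K y = 0" "\<And>X. X \<in> C \<Longrightarrow> F xs - \<eta> \<le> F X + y \<bullet> (D - X)"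
        using strong_duality[OF \<eta>] by blast
      have "y \<bullet> K z = 0" for z using y(1) K_sym[of y z] by simp
      then have "F xs - \<eta> \<le> Lag (p i) y" for i using y(2)[OF X_C[of i]] by (simp add: Lag_def p_def y(1))
      then show ?thesis by blast
    qed
  qed
  have gX: "(\<lambda>k. gF (X k)) \<longlonglongrightarrow> gF xs"
  proof -
    have "g = (\<lambda>k. gF (X k))" by (simp add: g_def fun_eq_iff)
    then show ?thesis using gradients_converge by simp
  qed
  have gF_cont: "continuous_on UNIV gF"
  proof (rule continuous_onI)
    fix x :: 'v and e :: real assume "0 < e"
    then show "\<exists>d>0. \<forall>x'\<in>UNIV. dist x' x < d \<longrightarrow> dist (gF x') (gF x) \<le> e"
    proof (intro exI[of _ "e / (\<bar>lg\<bar> + 1)"] conjI ballI impI)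
      fix x' assume d: "dist x' x < e / (\<bar>lg\<bar> + 1)"
      have "norm (gF x' - gF x) \<le> lg * norm (x' - x)" by (rule gF_lipschitz)
      also have "\<dots> \<le> (\<bar>lg\<bar> + 1) * norm (x' - x)" by (intro mult_right_mono) auto
      also have "\<dots> \<le> e" using d by (simp add: dist_norm field_simps)
      finally show "dist (gF x') (gF x) \<le> e" by (simp add: dist_norm)
    qed auto
  qed
  have X_lim: "X \<longlonglongrightarrow> xs"
  proof (rule ccontr)
    assume "\<not> ?thesis"
    then obtain e where e: "0 < e" "\<And>n. \<exists>k\<ge>n. e \<le> dist (X k) xs"
      unfolding lim_sequentially by (auto simp: not_less)
    define A where "A = {x \<in> C. e \<le> dist x xs}"
    have "A = C \<inter> {x. e \<le> dist x xs}" by (auto simp: A_def)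
    then have "compact A" using C_compact
      by (simp add: compact_Int_closed closed_Collect_le continuous_intros)
    moreover have "A \<noteq> {}" using e(2)[of 0] X_C by (auto simp: A_def)
    moreover have "continuous_on A (\<lambda>x. dist (gF x) (gF xs))"
      by (intro continuous_intros continuous_on_subset[OF gF_cont]) auto
    ultimately obtain x where x: "x \<in> A" "\<And>y. y \<in> A \<Longrightarrow> dist (gF x) (gF xs) \<le> dist (gF y) (gF xs)"
      using continuous_attains_inf by metis
    have "gF x \<noteq> gF xs" using x(1) gF_inj[of x] e(1) by (auto simp: A_def)
    then have "0 < dist (gF x) (gF xs)" by simp
    with gX obtain n where n: "\<And>k. n \<le> k \<Longrightarrow> dist (gF (X k)) (gF xs) < dist (gF x) (gF xs)"
      unfolding lim_sequentially by blast
    obtain k where "n \<le> k" "e \<le> dist (X k) xs" using e(2) by blast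
    then show False using n[of k] x(2)[of "X k"] X_C[of k] by (auto simp: A_def)
  qed
  define r where "r = max (2 * \<rho>) M"
  show thesis
  proof (rule that[of k0 "\<lambda>k. X (k - k0)" "\<lambda>k. \<Lambda> (k - k0)" "\<lambda>k. Z (k - k0)" r])
    fix k assume k: "k0 \<le> k"
    have [simp]: "Suc k - k0 = Suc (k - k0)" "\<alpha> k = \<beta> (k - k0)" using k by (auto simp: \<beta>_def)
    show "X (Suc k - k0) = closest_point C (X (k - k0) - \<alpha> k *\<^sub>R (gF (X (Suc k - k0)) - \<Lambda> (Suc k - k0)))"
      using X_Suc[of "k - k0"] by simp
    show "Z (Suc k - k0) = Z (k - k0) + \<alpha> k *\<^sub>R K (\<Lambda> (Suc k - k0))" using Z_Suc[of "k - k0"] by simp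
    show "\<Lambda> (Suc k - k0) = \<Lambda> (k - k0) + \<alpha> k *\<^sub>R (D - X (Suc k - k0) - K (\<Lambda> (Suc k - k0)) - K (Z (Suc k - k0)))"
      using \<Lambda>_Suc[of "k - k0"] by simp
    let ?j = "k - k0"
    have "((X (Suc ?j), Z (Suc ?j)), \<Lambda> (Suc ?j)) - ((X ?j, Z ?j), \<Lambda> ?j) = \<beta> ?j *\<^sub>R (- a (Suc ?j), b (Suc ?j))"
      using p_step[of ?j] q_step[of ?j] by (simp add: p_def q_def)
    then have "norm (((X (Suc ?j), Z (Suc ?j)), \<Lambda> (Suc ?j)) - ((X ?j, Z ?j), \<Lambda> ?j)) = \<beta> ?j * norm (- a (Suc ?j), b (Suc ?j))"
      using \<beta>(1)[of ?j] by (simp only: norm_scaleR abs_of_pos)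
    also have "\<dots> \<le> \<beta> ?j * r"
    proof (intro mult_left_mono)
      have "norm (- a (Suc ?j), b (Suc ?j)) = norm (a (Suc ?j), b (Suc ?j))" by (simp add: norm_prod_def)
      then show "norm (- a (Suc ?j), b (Suc ?j)) \<le> r" using v_le[of ?j] \<rho>_nonneg unfolding r_def by linarith
    qed (use \<beta>(1)[of ?j] in simp)
    finally show "norm (((X (Suc k - k0), Z (Suc k - k0)), \<Lambda> (Suc k - k0)) - ((X (k - k0), Z (k - k0)), \<Lambda> (k - k0))) \<le> r * \<alpha> k"
      by (simp add: mult.commute)
  next
    fix k assume k: "k0 < k"
    then obtain j where j: "k - k0 = Suc j" by (metis Suc_diff_Suc)
    show "norm (K (\<Lambda> (k - k0))) \<le> r" using K\<Lambda>[of j] \<rho>_nonneg unfolding j r_def by linarith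
    show "norm (K (Z (k - k0))) \<le> r" using KZ[of j] unfolding j r_def by linarith
    show "X (k - k0) \<in> C" by (rule X_C)
  next
    have "(\<lambda>k. X (k + k0 - k0)) \<longlonglongrightarrow> xs" using X_lim by simp
    then show "(\<lambda>k. X (k - k0)) \<longlonglongrightarrow> xs" by (rule LIMSEQ_offset)
  qed
qed

end

section \<open>One perturbed forward step against one implicit step\<close>

lemma norm_le_one_plus_sq: "norm e \<le> 1 + (norm e)\<^sup>2" for e :: "'a::real_normed_vector"
proof -
  have "0 \<le> (norm e - 1)\<^sup>2" by simp
  then have "2 * norm e \<le> 1 + (norm e)\<^sup>2" by (simp add: power2_diff)
  then show ?thesis using norm_ge_zero[of e] by linarith
qed

lemma norm_add_sq_le: "(norm (x + y))\<^sup>2 \<le> 2 * (norm x)\<^sup>2 + 2 * (norm y)\<^sup>2" for x y :: "'a::real_inner"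
proof -
  have "2 * (norm x)\<^sup>2 + 2 * (norm y)\<^sup>2 - (norm (x + y))\<^sup>2 = (norm (x - y))\<^sup>2"
    by (simp add: power2_norm_eq_inner algebra_simps inner_commute)
  then show ?thesis using zero_le_power2[of "norm (x - y)"] by linarith
qed

locale monotone_step =
  fixes gF K :: "'v::euclidean_space \<Rightarrow> 'v" and \<gamma> lg bK :: real and Pr :: "'v \<Rightarrow> 'v"
  assumes \<gamma>_pos: "0 < \<gamma>" and lg_nonneg: "0 \<le> lg" and bK_nonneg: "0 \<le> bK"
    and gF_cocoercive: "2 * \<gamma> * (norm (gF X - gF Y))\<^sup>2 \<le> (gF X - gF Y) \<bullet> (X - Y)"
    and gF_lipschitz: "norm (gF X - gF Y) \<le> lg * norm (X - Y)"
    and K_linear: "linear K" and K_sym: "K x \<bullet> y = x \<bullet> K y" and K_nonneg: "0 \<le> x \<bullet> K x"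
    and K_bound: "norm (K x) \<le> bK * norm x"
    and Pr_nonexpansive: "norm (Pr x - Pr y) \<le> norm (x - y)"
begin

definition Lp :: real where "Lp = lg + 2 + 3 * bK"

definition Cst :: "real \<Rightarrow> real" where
  "Cst r = 2 * r * Lp * (1 + r) + 4 * Lp\<^sup>2 * (1 + r\<^sup>2)"

lemma Lp_pos: "0 < Lp" using lg_nonneg bK_nonneg by (simp add: Lp_def)

lemma Cst_nonneg: "0 \<le> r \<Longrightarrow> 0 \<le> Cst r" using Lp_pos by (simp add: Cst_def)

text \<open>Let \<open>E\<close> be the old difference of the states, \<open>V\<close> the difference after the implicit step only, and
  \<open>\<Delta>\<close> the difference of the operator at the two points that define \<open>V\<close>. The new difference is at most \<open>E - h (\<Delta> - N)\<close> in
  norm, since projections do not increase distances. Monotonicity bounds \<open>\<Delta> \<bullet> V\<close> from below, and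
  \<open>V\<close> differs from \<open>E\<close> by \<open>O(h)\<close> as the reference path has bounded speed; hence the error terms have
  the factor \<open>h\<^sup>2\<close>. The second estimate follows the \<open>X\<close> component alone. It is crude in the drift, but only the primal noise enters.\<close>

lemma perturbed_step:
  assumes h: "0 < h" "h \<le> 1" and r: "0 \<le> r"
    and ref: "x' = Pr (x + h *\<^sub>R (l' - gF x'))" "z' = z + h *\<^sub>R K l'" "l' = l + h *\<^sub>R (D - x' - K l' - K z')"
    and speed: "norm (((x', z'), l') - ((x, z), l)) \<le> r * h"
    and new: "Xn = Pr (X + h *\<^sub>R (\<Lambda> - gF X + nx))" "Zn = Z + h *\<^sub>R (K \<Lambda> + nz)"
      "\<Lambda>n = \<Lambda> + h *\<^sub>R (D - X - K \<Lambda> - K Z + nl)"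
  shows "(norm (((Xn, Zn), \<Lambda>n) - ((x', z'), l')))\<^sup>2 \<le> (norm (((X, Z), \<Lambda>) - ((x, z), l)))\<^sup>2
      + h * (2 * (((nx, nz), nl) \<bullet> (((X, Z), \<Lambda>) - ((x, z), l))))
      + h\<^sup>2 * (Cst r * (1 + (norm (((X, Z), \<Lambda>) - ((x, z), l)))\<^sup>2))
      + h\<^sup>2 * (2 * (norm ((nx, nz), nl))\<^sup>2) - h * (4 * \<gamma> * (norm (gF X - gF x'))\<^sup>2)"
    and "(norm (Xn - x'))\<^sup>2 \<le> (norm (X - x))\<^sup>2 + h * (2 * (nx \<bullet> (X - x)))
      + h * (4 * (lg + 1)\<^sup>2 * (1 + r)\<^sup>2 * (1 + (norm (((X, Z), \<Lambda>) - ((x, z), l)))\<^sup>2)\<^sup>2) + h\<^sup>2 * (2 * (norm nx)\<^sup>2)"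
proof -
  note Ks = linear_add[OF K_linear] linear_diff[OF K_linear] linear_scale[OF K_linear]
  define E where "E = ((X, Z), \<Lambda>) - ((x, z), l)"
  define V where "V = ((X, Z), \<Lambda>) - ((x', z'), l')"
  define N where "N = ((nx, nz), nl)"
  define \<Delta> where "\<Delta> = ((gF X - gF x' - (\<Lambda> - l'), - K (\<Lambda> - l')), (X - x') + K (\<Lambda> - l') + K (Z - z'))"
  have VE: "norm V \<le> norm E + h * r"
  proof -
    have "V = E - (((x', z'), l') - ((x, z), l))" by (simp add: V_def E_def)
    then show ?thesis using norm_triangle_ineq4[of E "((x', z'), l') - ((x, z), l)"] speed by (simp add: mult.commute)
  qed
  have VE': "norm V \<le> norm E + r"
  proof -
    have "h * r \<le> 1 * r" using h r by (intro mult_right_mono) auto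
    then show ?thesis using VE by simp
  qed
  have comp: "norm (X - x') \<le> norm V" "norm (Z - z') \<le> norm V" "norm (\<Lambda> - l') \<le> norm V"
  proof -
    have "norm (X - x', Z - z') \<le> norm V"
      using norm_fst_le[of "(X - x', Z - z')" "\<Lambda> - l'"] by (simp add: V_def)
    then show "norm (X - x') \<le> norm V" "norm (Z - z') \<le> norm V"
      using norm_fst_le[of "X - x'" "Z - z'"] norm_snd_le[of "Z - z'" "X - x'"] by linarith+
    show "norm (\<Lambda> - l') \<le> norm V" using norm_snd_le[of "\<Lambda> - l'" "(X - x', Z - z')"] by (simp add: V_def)
  qed
  have KV: "norm (K y) \<le> bK * norm V" if "norm y \<le> norm V" for y
    using K_bound[of y] mult_left_mono[OF that bK_nonneg] by linarith
  have gV: "norm (gF X - gF x') \<le> lg * norm V"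
    using gF_lipschitz[of X x'] mult_left_mono[OF comp(1) lg_nonneg] by linarith
  have \<Delta>_le: "norm \<Delta> \<le> Lp * norm V"
  proof -
    have "norm \<Delta> \<le> (lg * norm V + norm V) + bK * norm V + (norm V + bK * norm V + bK * norm V)"
      unfolding \<Delta>_def
      by (intro order.trans[OF norm_Pair_le] add_mono order.trans[OF norm_triangle_ineq4] order.trans[OF norm_triangle_ineq]
        gV comp KV) (simp_all add: KV comp)
    then show ?thesis by (simp add: Lp_def algebra_simps)
  qed
  have mono: "2 * \<gamma> * (norm (gF X - gF x'))\<^sup>2 \<le> \<Delta> \<bullet> V"
  proof -
    have "\<Delta> \<bullet> V = (gF X - gF x') \<bullet> (X - x') + (\<Lambda> - l') \<bullet> K (\<Lambda> - l')"
    proof -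
      define u dl dz dx where "u = gF X - gF x'" and "dl = \<Lambda> - l'" and "dz = Z - z'" and "dx = X - x'"
      have "\<Delta> \<bullet> V = (u - dl) \<bullet> dx + (- K dl) \<bullet> dz + (dx + K dl + K dz) \<bullet> dl"
        by (simp only: \<Delta>_def V_def diff_Pair inner_Pair u_def dl_def dz_def dx_def)
      moreover have "K dl \<bullet> dz = K dz \<bullet> dl" "K dl \<bullet> dl = dl \<bullet> K dl" "dx \<bullet> dl = dl \<bullet> dx"
        using K_sym[of dl dz] by (simp_all add: inner_commute)
      ultimately show ?thesis
        unfolding u_def[symmetric] dl_def[symmetric] dx_def[symmetric]
        by (simp add: inner_add_left inner_diff_left)
    qed
    then show ?thesis using gF_cocoercive[of X x'] K_nonneg[of "\<Lambda> - l'"] by linarith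
  qed
  have lower: "2 * \<gamma> * (norm (gF X - gF x'))\<^sup>2 - h * (r * Lp * (norm E + r)) \<le> \<Delta> \<bullet> E"
  proof -
    have e: "E = V + (((x', z'), l') - ((x, z), l))" by (simp add: V_def E_def)
    have "\<bar>\<Delta> \<bullet> (((x', z'), l') - ((x, z), l))\<bar> \<le> norm \<Delta> * norm (((x', z'), l') - ((x, z), l))"
      by (rule Cauchy_Schwarz_ineq2)
    also have "\<dots> \<le> (Lp * (norm E + r)) * (r * h)"
      using \<Delta>_le VE' Lp_pos speed r by (intro mult_mono order.trans[OF \<Delta>_le] mult_left_mono) auto
    finally show ?thesis using mono unfolding e inner_add_right by (simp add: abs_le_iff algebra_simps)
  qed
  have E2: "norm E \<le> 1 + (norm E)\<^sup>2" by (rule norm_le_one_plus_sq)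
  have bnd1: "norm E + r \<le> (1 + r) * (1 + (norm E)\<^sup>2)"
  proof -
    have "0 \<le> r * (norm E)\<^sup>2" using r by simp
    then show ?thesis using E2 by (simp add: algebra_simps)
  qed
  have bnd2: "(norm E + r)\<^sup>2 \<le> 2 * (1 + r\<^sup>2) * (1 + (norm E)\<^sup>2)"
  proof -
    have "(norm E + r)\<^sup>2 \<le> 2 * (norm E)\<^sup>2 + 2 * r\<^sup>2" using sum_squares_bound[of "norm E" r] by (simp add: power2_sum)
    also have "\<dots> \<le> 2 * (1 + r\<^sup>2) * (1 + (norm E)\<^sup>2)" by (simp add: algebra_simps)
    finally show ?thesis .
  qed
  have new_le: "(norm (((Xn, Zn), \<Lambda>n) - ((x', z'), l')))\<^sup>2 \<le> (norm (E - h *\<^sub>R (\<Delta> - N)))\<^sup>2"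
  proof -
    have 1: "norm (Xn - x') \<le> norm ((X - x) - h *\<^sub>R ((gF X - gF x' - (\<Lambda> - l')) - nx))"
    proof -
      have "norm (Xn - x') \<le> norm ((X + h *\<^sub>R (\<Lambda> - gF X + nx)) - (x + h *\<^sub>R (l' - gF x')))"
        unfolding new(1) by (subst ref(1)) (rule Pr_nonexpansive)
      also have "(X + h *\<^sub>R (\<Lambda> - gF X + nx)) - (x + h *\<^sub>R (l' - gF x')) = (X - x) - h *\<^sub>R ((gF X - gF x' - (\<Lambda> - l')) - nx)"
        by (simp add: algebra_simps)
      finally show ?thesis .
    qed
    have "Zn - z' = (Z + h *\<^sub>R (K \<Lambda> + nz)) - (z + h *\<^sub>R K l')" unfolding new(2) ref(2) ..
    also have "\<dots> = (Z - z) - h *\<^sub>R (- K (\<Lambda> - l') - nz)" by (simp add: Ks algebra_simps)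
    finally have 2: "Zn - z' = (Z - z) - h *\<^sub>R (- K (\<Lambda> - l') - nz)" .
    have "\<Lambda>n - l' = (\<Lambda> + h *\<^sub>R (D - X - K \<Lambda> - K Z + nl)) - (l + h *\<^sub>R (D - x' - K l' - K z'))"
      unfolding new(3) by (subst (1) ref(3)) (rule refl)
    also have "\<dots> = (\<Lambda> - l) - h *\<^sub>R ((X - x') + K (\<Lambda> - l') + K (Z - z') - nl)" by (simp add: Ks algebra_simps)
    finally have 3: "\<Lambda>n - l' = (\<Lambda> - l) - h *\<^sub>R ((X - x') + K (\<Lambda> - l') + K (Z - z') - nl)" .
    have sq: "(norm ((a, b), c))\<^sup>2 = (norm a)\<^sup>2 + (norm b)\<^sup>2 + (norm c)\<^sup>2" for a b c :: 'v
      by (simp add: norm_prod_def)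
    have "E - h *\<^sub>R (\<Delta> - N) = (((X - x) - h *\<^sub>R ((gF X - gF x' - (\<Lambda> - l')) - nx), (Z - z) - h *\<^sub>R (- K (\<Lambda> - l') - nz)),
        (\<Lambda> - l) - h *\<^sub>R ((X - x') + K (\<Lambda> - l') + K (Z - z') - nl))"
      by (simp only: E_def \<Delta>_def N_def diff_Pair scaleR_Pair)
    then show ?thesis unfolding diff_Pair
      by (simp only: sq 2[symmetric] 3[symmetric]) (intro add_mono power_mono 1, auto)
  qed
  have "(norm (E - h *\<^sub>R (\<Delta> - N)))\<^sup>2 = (norm E)\<^sup>2 - 2 * h * (\<Delta> \<bullet> E) + 2 * h * (N \<bullet> E) + h\<^sup>2 * (norm (\<Delta> + (- N)))\<^sup>2"
  proof -
    have *: "(norm (E - h *\<^sub>R d))\<^sup>2 = (norm E)\<^sup>2 - 2 * h * (d \<bullet> E) + h\<^sup>2 * (norm d)\<^sup>2" for d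
      unfolding power2_norm_eq_inner by (simp add: inner_diff_left inner_diff_right inner_commute power2_eq_square algebra_simps)
    show ?thesis unfolding * by (simp add: inner_diff_left right_diff_distrib)
  qed
  also have "h\<^sup>2 * (norm (\<Delta> + (- N)))\<^sup>2 \<le> h\<^sup>2 * (2 * (norm \<Delta>)\<^sup>2 + 2 * (norm N)\<^sup>2)"
    using norm_add_sq_le[of \<Delta> "- N"] by (intro mult_left_mono) auto
  also have "(norm \<Delta>)\<^sup>2 \<le> Lp\<^sup>2 * (2 * (1 + r\<^sup>2) * (1 + (norm E)\<^sup>2))"
  proof -
    have "norm \<Delta> \<le> Lp * (norm E + r)" using \<Delta>_le mult_left_mono[OF VE', of Lp] Lp_pos by linarith
    then have "(norm \<Delta>)\<^sup>2 \<le> (Lp * (norm E + r))\<^sup>2" by (intro power_mono) auto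
    also have "\<dots> = Lp\<^sup>2 * (norm E + r)\<^sup>2" by (rule power_mult_distrib)
    also have "\<dots> \<le> Lp\<^sup>2 * (2 * (1 + r\<^sup>2) * (1 + (norm E)\<^sup>2))" by (intro mult_left_mono bnd2) auto
    finally show ?thesis .
  qed
  finally have main: "(norm (E - h *\<^sub>R (\<Delta> - N)))\<^sup>2 \<le> (norm E)\<^sup>2 - 2 * h * (\<Delta> \<bullet> E) + 2 * h * (N \<bullet> E)
      + h\<^sup>2 * (2 * (Lp\<^sup>2 * (2 * (1 + r\<^sup>2) * (1 + (norm E)\<^sup>2))) + 2 * (norm N)\<^sup>2)" using h by simp
  have "2 * h * (2 * \<gamma> * (norm (gF X - gF x'))\<^sup>2 - h * (r * Lp * ((1 + r) * (1 + (norm E)\<^sup>2)))) \<le> 2 * h * (\<Delta> \<bullet> E)"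
  proof (rule mult_left_mono)
    have "h * (r * Lp * (norm E + r)) \<le> h * (r * Lp * ((1 + r) * (1 + (norm E)\<^sup>2)))"
      using h r Lp_pos by (intro mult_left_mono bnd1) auto
    then show "2 * \<gamma> * (norm (gF X - gF x'))\<^sup>2 - h * (r * Lp * ((1 + r) * (1 + (norm E)\<^sup>2))) \<le> \<Delta> \<bullet> E"
      using lower by linarith
  qed (use h in auto)
  then have "(norm (E - h *\<^sub>R (\<Delta> - N)))\<^sup>2 \<le> (norm E)\<^sup>2 + h * (2 * (N \<bullet> E)) + h\<^sup>2 * (Cst r * (1 + (norm E)\<^sup>2))
      + h\<^sup>2 * (2 * (norm N)\<^sup>2) - h * (4 * \<gamma> * (norm (gF X - gF x'))\<^sup>2)"
    using main unfolding Cst_def by (simp add: algebra_simps power2_eq_square)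
  with new_le show "(norm (((Xn, Zn), \<Lambda>n) - ((x', z'), l')))\<^sup>2 \<le> (norm (((X, Z), \<Lambda>) - ((x, z), l)))\<^sup>2
      + h * (2 * (((nx, nz), nl) \<bullet> (((X, Z), \<Lambda>) - ((x, z), l)))) + h\<^sup>2 * (Cst r * (1 + (norm (((X, Z), \<Lambda>) - ((x, z), l)))\<^sup>2))
      + h\<^sup>2 * (2 * (norm ((nx, nz), nl))\<^sup>2) - h * (4 * \<gamma> * (norm (gF X - gF x'))\<^sup>2)"
    unfolding E_def N_def by linarith
  show "(norm (Xn - x'))\<^sup>2 \<le> (norm (X - x))\<^sup>2 + h * (2 * (nx \<bullet> (X - x)))
      + h * (4 * (lg + 1)\<^sup>2 * (1 + r)\<^sup>2 * (1 + (norm (((X, Z), \<Lambda>) - ((x, z), l)))\<^sup>2)\<^sup>2) + h\<^sup>2 * (2 * (norm nx)\<^sup>2)"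
  proof -
    define w where "w = (\<Lambda> - l') - (gF X - gF x')"
    define b where "b = (lg + 1) * ((1 + r) * (1 + (norm E)\<^sup>2))"
    have w: "norm w \<le> b"
    proof -
      have "norm w \<le> norm V + lg * norm V" unfolding w_def
        by (intro order.trans[OF norm_triangle_ineq4] add_mono comp gV)
      also have "\<dots> = (lg + 1) * norm V" by (simp add: algebra_simps)
      also have "\<dots> \<le> b" unfolding b_def using lg_nonneg VE' bnd1 by (intro mult_left_mono) auto
      finally show ?thesis .
    qed
    have b0: "0 \<le> b" using w norm_ge_zero order.trans by blast
    have xE: "norm (X - x) \<le> b"
    proof -
      have "norm (X - x, Z - z) \<le> norm E" using norm_fst_le[of "(X - x, Z - z)" "\<Lambda> - l"] by (simp add: E_def)
      then have "norm (X - x) \<le> norm E" using norm_fst_le[of "X - x" "Z - z"] by linarith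
      also have "\<dots> \<le> 1 * ((1 + r) * (1 + (norm E)\<^sup>2))" using bnd1 r by linarith
      also have "\<dots> \<le> b" unfolding b_def using lg_nonneg r by (intro mult_right_mono) auto
      finally show ?thesis .
    qed
    have "norm (Xn - x') \<le> norm ((X + h *\<^sub>R (\<Lambda> - gF X + nx)) - (x + h *\<^sub>R (l' - gF x')))"
      unfolding new(1) by (subst ref(1)) (rule Pr_nonexpansive)
    also have "(X + h *\<^sub>R (\<Lambda> - gF X + nx)) - (x + h *\<^sub>R (l' - gF x')) = (X - x) + h *\<^sub>R (w + nx)"
      by (simp add: w_def algebra_simps)
    finally have "(norm (Xn - x'))\<^sup>2 \<le> (norm ((X - x) + h *\<^sub>R (w + nx)))\<^sup>2" by (intro power_mono) auto
    also have "\<dots> = (norm (X - x))\<^sup>2 + 2 * h * (w \<bullet> (X - x)) + 2 * h * (nx \<bullet> (X - x)) + h\<^sup>2 * (norm (w + nx))\<^sup>2"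
    proof -
      have *: "(norm (y + h *\<^sub>R d))\<^sup>2 = (norm y)\<^sup>2 + 2 * h * (d \<bullet> y) + h\<^sup>2 * (norm d)\<^sup>2" for y d :: 'v
        unfolding power2_norm_eq_inner
        by (simp add: inner_add_left inner_add_right inner_commute power2_eq_square algebra_simps)
      show ?thesis unfolding * by (simp add: inner_add_left distrib_left)
    qed
    also have "\<dots> \<le> (norm (X - x))\<^sup>2 + 2 * h * (b * b) + 2 * h * (nx \<bullet> (X - x)) + (h * (2 * b\<^sup>2) + h\<^sup>2 * (2 * (norm nx)\<^sup>2))"
    proof -
      have "w \<bullet> (X - x) \<le> norm w * norm (X - x)" by (rule norm_cauchy_schwarz)
      also have "\<dots> \<le> b * b" using w xE b0 by (intro mult_mono) auto
      finally have 1: "2 * h * (w \<bullet> (X - x)) \<le> 2 * h * (b * b)" using h by (intro mult_left_mono) auto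
      have "h\<^sup>2 * (norm (w + nx))\<^sup>2 \<le> h\<^sup>2 * (2 * (norm w)\<^sup>2 + 2 * (norm nx)\<^sup>2)"
        by (intro mult_left_mono norm_add_sq_le) auto
      also have "\<dots> = h\<^sup>2 * (2 * (norm w)\<^sup>2) + h\<^sup>2 * (2 * (norm nx)\<^sup>2)" by (simp add: distrib_left)
      also have "h\<^sup>2 * (2 * (norm w)\<^sup>2) \<le> h * (2 * b\<^sup>2)"
      proof (rule mult_mono)
        show "h\<^sup>2 \<le> h" using h by (simp add: power2_eq_square mult_left_le_one_le)
        show "2 * (norm w)\<^sup>2 \<le> 2 * b\<^sup>2" using w by (simp add: power_mono)
      qed (use h in auto)
      finally have 2: "h\<^sup>2 * (norm (w + nx))\<^sup>2 \<le> h * (2 * b\<^sup>2) + h\<^sup>2 * (2 * (norm nx)\<^sup>2)" by simp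
      show ?thesis using 1 2 by linarith
    qed
    also have "b\<^sup>2 = (lg + 1)\<^sup>2 * (1 + r)\<^sup>2 * (1 + (norm E)\<^sup>2)\<^sup>2" by (simp add: b_def power_mult_distrib)
    also have "b * b = (lg + 1)\<^sup>2 * (1 + r)\<^sup>2 * (1 + (norm E)\<^sup>2)\<^sup>2" by (simp add: b_def power_mult_distrib flip: power2_eq_square)
    finally show ?thesis unfolding E_def[symmetric] by (simp add: algebra_simps)
  qed
qed

end

text \<open>While \<open>D \<ge> e / 2\<close> the weighted sum of \<open>\<Phi>\<close> grows at least by \<open>c\<close> per unit of time, so only little time can be spent there; and in
  little time \<open>D\<close> cannot climb from \<open>e / 2\<close> to \<open>e\<close>.\<close>

lemma crossing:
  fixes D \<Phi> m \<alpha> :: "nat \<Rightarrow> real"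
  assumes D: "\<And>k. 0 \<le> D k" and step: "\<And>k. D (Suc k) \<le> D k + C * \<alpha> k + m k"
    and \<alpha>: "\<And>k. 0 < \<alpha> k" "\<alpha> \<longlonglongrightarrow> 0" "filterlim (\<lambda>n. sum \<alpha> {..<n}) at_top sequentially"
    and m: "summable m" and \<Phi>: "\<And>k. 0 \<le> \<Phi> k" "summable (\<lambda>k. \<alpha> k * \<Phi> k)"
    and away: "\<And>e. 0 < e \<Longrightarrow> \<exists>c>0. \<exists>n. \<forall>k\<ge>n. e \<le> D k \<longrightarrow> c \<le> \<Phi> k"
    and C: "0 \<le> C"
  shows "D \<longlonglongrightarrow> 0"
proof (rule LIMSEQ_I)
  fix e :: real assume e: "0 < e"
  \<comment> \<open>A climb is at most \<open>2 \<eta>\<close> by drift and \<open>\<eta>\<close> by \<open>m\<close>, which is less than \<open>e / 2\<close>.\<close>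
  define \<eta> where "\<eta> = e / 8"
  have \<eta>: "0 < \<eta>" using e by (simp add: \<eta>_def)
  obtain c n0 where c: "0 < c" "\<And>k. n0 \<le> k \<Longrightarrow> e / 2 \<le> D k \<Longrightarrow> c \<le> \<Phi> k" using away[of "e / 2"] e by auto
  obtain n1 where n1: "\<And>i n. n1 \<le> i \<Longrightarrow> norm (sum m {i..<n}) < \<eta>" using m \<eta> unfolding summable_Cauchy by blast
  have "0 < \<eta> * c / (C + 1)" using \<eta> c C by simp
  then obtain n2 where n2: "\<And>i n. n2 \<le> i \<Longrightarrow> norm (\<Sum>k\<in>{i..<n}. \<alpha> k * \<Phi> k) < \<eta> * c / (C + 1)"
    using \<Phi>(2) unfolding summable_Cauchy by blast
  have "0 < \<eta> / (C + 1)" using \<eta> C by simp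
  then obtain n3 where n3: "\<And>k. n3 \<le> k \<Longrightarrow> norm (\<alpha> k - 0) < \<eta> / (C + 1)" using LIMSEQ_D[OF \<alpha>(2)] by blast
  define n where "n = Max {n0, n1, n2, n3}"
  have n: "n0 \<le> n" "n1 \<le> n" "n2 \<le> n" "n3 \<le> n" by (auto simp: n_def)
  have bad: "sum \<alpha> {i..<j} \<le> \<eta> / (C + 1)" if "n \<le> i" "\<And>k. k \<in> {i..<j} \<Longrightarrow> e / 2 \<le> D k" for i j
  proof -
    have "c * sum \<alpha> {i..<j} = (\<Sum>k\<in>{i..<j}. \<alpha> k * c)" by (simp add: sum_distrib_left mult.commute)
    also have "\<dots> \<le> (\<Sum>k\<in>{i..<j}. \<alpha> k * \<Phi> k)"
      using \<alpha>(1) that n c(2) by (intro sum_mono mult_left_mono) (auto simp: less_imp_le)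
    also have "\<dots> \<le> \<eta> * c / (C + 1)" using n2[of i j] that(1) n by auto
    also have "\<dots> = c * (\<eta> / (C + 1))" by simp
    finally show ?thesis using c(1) by (simp only: mult_le_cancel_left_pos)
  qed
  have walk: "D j \<le> D i + C * sum \<alpha> {i..<j} + sum m {i..<j}" if "i \<le> j" for i j
    using that
  proof (induction j rule: dec_induct)
    case (step j)
    then show ?case using assms(2)[of j] by (simp add: algebra_simps)
  qed simp
  have "\<exists>i\<ge>n. D i < e / 2"
  proof (rule ccontr)
    assume "\<not> ?thesis"
    then have "sum \<alpha> {n..<j} \<le> \<eta> / (C + 1)" for j by (intro bad) (auto simp: not_less)
    then have b: "sum \<alpha> {..<j} \<le> sum \<alpha> {..<n} + \<eta> / (C + 1)" if "n \<le> j" for j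
      using that by (metis add_le_cancel_left lessThan_atLeast0 sum.atLeastLessThan_concat zero_le)
    have "\<forall>\<^sub>F j in sequentially. sum \<alpha> {..<n} + \<eta> / (C + 1) + 1 \<le> sum \<alpha> {..<j}"
      using \<alpha>(3) unfolding filterlim_at_top by blast
    then obtain j where "n \<le> j" "sum \<alpha> {..<n} + \<eta> / (C + 1) + 1 \<le> sum \<alpha> {..<j}"
      unfolding eventually_sequentially by (meson le_cases order_refl)
    then show False using b[of j] by linarith
  qed
  then obtain i0 where i0: "n \<le> i0" "D i0 < e / 2" by blast
  show "\<exists>no. \<forall>k\<ge>no. norm (D k - 0) < e"
  proof (intro exI[of _ i0] allI impI)
    fix k assume k: "i0 \<le> k"
    define j where "j = Max {i. i0 \<le> i \<and> i \<le> k \<and> D i < e / 2}"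
    have fin: "finite {i. i0 \<le> i \<and> i \<le> k \<and> D i < e / 2}" by (rule finite_subset[of _ "{..k}"]) auto
    have jm: "j \<in> {i. i0 \<le> i \<and> i \<le> k \<and> D i < e / 2}" unfolding j_def by (rule Max_in[OF fin]) (use i0 k in auto)
    then have j: "i0 \<le> j" "j \<le> k" "D j < e / 2" by auto
    have after: "e / 2 \<le> D i" if "j < i" "i \<le> k" for i
    proof (rule ccontr)
      assume "\<not> e / 2 \<le> D i"
      then have "i \<in> {i. i0 \<le> i \<and> i \<le> k \<and> D i < e / 2}" using that j by auto
      then have "i \<le> j" unfolding j_def by (rule Max_ge[OF fin])
      then show False using that by simp
    qed
    have s: "sum \<alpha> {j..<k} \<le> \<eta> / (C + 1) + \<eta> / (C + 1)"
    proof (cases "j < k")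
      case True
      have "sum \<alpha> {Suc j..<k} \<le> \<eta> / (C + 1)" by (rule bad) (use after j i0 in auto)
      moreover have "\<alpha> j \<le> \<eta> / (C + 1)" using n3[of j] j i0 n by auto
      ultimately show ?thesis using True by (simp add: sum.atLeast_Suc_lessThan)
    qed (use \<open>0 < \<eta> / (C + 1)\<close> in simp)
    have "C * sum \<alpha> {j..<k} \<le> C * (\<eta> / (C + 1) + \<eta> / (C + 1))" using s C by (intro mult_left_mono)
    also have "\<dots> = 2 * \<eta> * (C / (C + 1))" by simp
    also have "\<dots> \<le> 2 * \<eta> * 1" using C \<eta> by (intro mult_left_mono) auto
    finally have "C * sum \<alpha> {j..<k} \<le> 2 * \<eta>" by simp
    moreover have "sum m {j..<k} < \<eta>" using n1[of j k] j i0 n by auto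
    ultimately have "D k < e" using walk[OF j(2)] j(3) e by (simp add: \<eta>_def)
    then show "norm (D k - 0) < e" using D[of k] by simp
  qed
qed

section \<open>Martingales and almost supermartingales\<close>

lemma AE_summable_of_integral_bound:
  fixes f :: "nat \<Rightarrow> 'w \<Rightarrow> real"
  assumes int: "\<And>k. integrable M (f k)" and nonneg: "\<And>k \<omega>. \<omega> \<in> space M \<Longrightarrow> 0 \<le> f k \<omega>"
    and bound: "\<And>n. (\<Sum>k<n. integral\<^sup>L M (f k)) \<le> c"
  shows "AE \<omega> in M. summable (\<lambda>k. f k \<omega>)"
proof -
  have m[measurable]: "\<And>k. f k \<in> borel_measurable M" using int by auto
  have eq: "(\<integral>\<^sup>+\<omega>. ennreal (f k \<omega>) \<partial>M) = ennreal (integral\<^sup>L M (f k))" for k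
    by (rule nn_integral_eq_integral[OF int]) (use nonneg in auto)
  have nn: "0 \<le> integral\<^sup>L M (f k)" for k by (intro integral_nonneg_AE) (use nonneg in auto)
  have "(\<integral>\<^sup>+\<omega>. (\<Sum>k. ennreal (f k \<omega>)) \<partial>M) = (\<Sum>k. \<integral>\<^sup>+\<omega>. ennreal (f k \<omega>) \<partial>M)"
    by (rule nn_integral_suminf) auto
  also have "\<dots> = (\<Sum>k. ennreal (integral\<^sup>L M (f k)))" by (simp add: eq)
  also have "\<dots> \<le> ennreal c"
  proof (rule suminf_le_const)
    fix n show "(\<Sum>k<n. ennreal (integral\<^sup>L M (f k))) \<le> ennreal c"
      using bound[of n] nn by (simp add: ennreal_leI)
  qed auto
  finally have fin: "(\<integral>\<^sup>+\<omega>. (\<Sum>k. ennreal (f k \<omega>)) \<partial>M) \<noteq> \<infinity>"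
    using ennreal_less_top[of c] by (auto simp: top_unique)
  have "AE \<omega> in M. (\<Sum>k. ennreal (f k \<omega>)) \<noteq> \<infinity>"
    by (rule nn_integral_PInf_AE[OF _ fin]) auto
  then show ?thesis
  proof (rule AE_mp, intro AE_I2 impI)
    fix \<omega> assume "\<omega> \<in> space M" "(\<Sum>k. ennreal (f k \<omega>)) \<noteq> \<infinity>"
    then show "summable (\<lambda>k. f k \<omega>)" using nonneg by (intro summable_suminf_not_top) auto
  qed
qed

locale filtered_prob_space = prob_space M for M :: "'w measure" +
  fixes F :: "nat \<Rightarrow> 'w measure"
  assumes F_sub: "subalgebra M (F k)" and F_mono: "sets (F k) \<subseteq> sets (F (Suc k))"
begin

lemma F_space [simp]: "space (F k) = space M"
  using F_sub[of k] by (simp add: subalgebra_def)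

lemma F_sets: "A \<in> sets (F k) \<Longrightarrow> A \<in> sets M"
  using F_sub[of k] by (auto simp: subalgebra_def)

lemma F_le: "j \<le> k \<Longrightarrow> sets (F j) \<subseteq> sets (F k)"
  by (rule lift_Suc_mono_le[of "\<lambda>k. sets (F k)"]) (use F_mono in auto)

lemma F_measurable: "f \<in> measurable (F k) N \<Longrightarrow> f \<in> measurable M N"
  by (rule measurable_from_subalg[OF F_sub])

lemma F_measurable_le: "j \<le> k \<Longrightarrow> f \<in> measurable (F j) N \<Longrightarrow> f \<in> measurable (F k) N"
  by (rule measurable_from_subalg) (use F_le[of j k] in \<open>auto simp: subalgebra_def\<close>)

text \<open>Kolmogorov's argument: stopping the partial sums when they first exceed \<open>\<epsilon>\<close> does not increase their variance, so the probability of ever exceeding \<open>\<epsilon>\<close> after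
  time \<open>m\<close> is at most the tail of the variances divided by \<open>\<epsilon>\<^sup>2\<close>. Being a martingale difference is expressed by orthogonality to the square
  integrable past.\<close>

theorem square_integrable_martingale_converges:
  fixes \<xi> :: "nat \<Rightarrow> 'w \<Rightarrow> real"
  assumes adapted: "\<And>k. \<xi> k \<in> borel_measurable (F (Suc k))"
    and sq: "\<And>k. integrable M (\<lambda>\<omega>. (\<xi> k \<omega>)\<^sup>2)"
    and orth: "\<And>k Y. Y \<in> borel_measurable (F k) \<Longrightarrow> integrable M (\<lambda>\<omega>. (Y \<omega>)\<^sup>2) \<Longrightarrow> (\<integral>\<omega>. Y \<omega> * \<xi> k \<omega> \<partial>M) = 0"
    and summable: "summable (\<lambda>k. \<integral>\<omega>. (\<xi> k \<omega>)\<^sup>2 \<partial>M)"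
  shows "AE \<omega> in M. summable (\<lambda>k. \<xi> k \<omega>)"
proof -
  define e where "e k = (\<integral>\<omega>. (\<xi> k \<omega>)\<^sup>2 \<partial>M)" for k
  have e0: "0 \<le> e k" for k by (simp add: e_def)
  have \<xi>M[measurable]: "\<xi> k \<in> borel_measurable M" for k using adapted by (rule F_measurable)
  have ix: "integrable M (\<lambda>\<omega>. Y \<omega> * \<xi> k \<omega>)" if "Y \<in> borel_measurable M" "integrable M (\<lambda>\<omega>. (Y \<omega>)\<^sup>2)" for Y k
  proof (rule Bochner_Integration.integrable_bound)
    show "integrable M (\<lambda>\<omega>. (Y \<omega>)\<^sup>2 + (\<xi> k \<omega>)\<^sup>2)" using that sq by auto
    show "(\<lambda>\<omega>. Y \<omega> * \<xi> k \<omega>) \<in> borel_measurable M" using that by auto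
    have "\<bar>a * b\<bar> \<le> a\<^sup>2 + b\<^sup>2" for a b :: real
      using sum_squares_bound[of a b] sum_squares_bound[of a "-b"] zero_le_power2[of a] zero_le_power2[of b]
      by (auto simp: abs_if)
    then show "AE \<omega> in M. norm (Y \<omega> * \<xi> k \<omega>) \<le> norm ((Y \<omega>)\<^sup>2 + (\<xi> k \<omega>)\<^sup>2)" by (simp add: abs_mult)
  qed
  define S where "S m n \<omega> = (\<Sum>k\<in>{m..<n}. \<xi> k \<omega>)" for m n \<omega>
  have SF: "S m n \<in> borel_measurable (F n)" for m n
    unfolding S_def by (intro borel_measurable_sum F_measurable_le[OF _ adapted]) auto
  have maximal: "prob {\<omega> \<in> space M. \<exists>n\<in>{m..m + N}. \<epsilon> \<le> \<bar>S m n \<omega>\<bar>} \<le> (\<Sum>k\<in>{m..<m + N}. e k) / \<epsilon>\<^sup>2" if \<epsilon>: "0 < \<epsilon>" for m N \<epsilon>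
  proof -
    define B where "B k = {\<omega> \<in> space M. \<forall>j\<in>{m..k}. \<bar>S m j \<omega>\<bar> < \<epsilon>}" for k
    have B: "B k \<in> sets (F k)" for k
    proof -
      have "{\<omega> \<in> space (F k). \<forall>j\<in>{m..k}. \<bar>S m j \<omega>\<bar> < \<epsilon>} \<in> sets (F k)"
      proof (intro sets.sets_Collect_finite_All)
        fix j assume "j \<in> {m..k}"
        then have [measurable]: "S m j \<in> borel_measurable (F k)" by (intro F_measurable_le[OF _ SF]) auto
        show "{\<omega> \<in> space (F k). \<bar>S m j \<omega>\<bar> < \<epsilon>} \<in> sets (F k)" by measurable
      qed auto
      then show ?thesis by (simp add: B_def)
    qed
    have BM[measurable]: "B k \<in> sets M" for k using B by (rule F_sets)
    \<comment> \<open>the partial sums stopped when they first reach \<open>\<epsilon>\<close>\<close>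
    define T where "T n \<omega> = (\<Sum>k\<in>{m..<n}. indicator (B k) \<omega> * \<xi> k \<omega>)" for n \<omega>
    have TF: "T n \<in> borel_measurable (F n)" for n unfolding T_def
    proof (intro borel_measurable_sum borel_measurable_times)
      fix k assume k: "k \<in> {m..<n}"
      then show "indicator (B k) \<in> borel_measurable (F n)" using B F_le[of k n] by (intro borel_measurable_indicator) auto
      show "\<xi> k \<in> borel_measurable (F n)" using k by (intro F_measurable_le[OF _ adapted]) auto
    qed
    have TM[measurable]: "T n \<in> borel_measurable M" for n using TF by (rule F_measurable)
    have energy: "integrable M (\<lambda>\<omega>. (T (m + n) \<omega>)\<^sup>2) \<and> (\<integral>\<omega>. (T (m + n) \<omega>)\<^sup>2 \<partial>M) \<le> (\<Sum>k\<in>{m..<m + n}. e k)" for n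
    proof (induction n)
      case 0
      show ?case by (simp add: T_def)
    next
      case (Suc n)
      let ?k = "m + n"
      define Y where "Y \<omega> = T ?k \<omega> * indicator (B ?k) \<omega>" for \<omega>
      have YF: "Y \<in> borel_measurable (F ?k)" unfolding Y_def using TF B by (intro borel_measurable_times borel_measurable_indicator) auto
      have [measurable]: "Y \<in> borel_measurable M" using YF by (rule F_measurable)
      have Y2: "integrable M (\<lambda>\<omega>. (Y \<omega>)\<^sup>2)"
        by (rule Bochner_Integration.integrable_bound[OF conjunct1[OF Suc.IH]]) (auto simp: Y_def indicator_def)
      have i2: "integrable M (\<lambda>\<omega>. indicator (B ?k) \<omega> * (\<xi> ?k \<omega>)\<^sup>2)"
        by (rule Bochner_Integration.integrable_bound[OF sq[of ?k]]) (auto simp: indicator_def)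
      have exp: "(T (m + Suc n) \<omega>)\<^sup>2 = (T ?k \<omega>)\<^sup>2 + 2 * (Y \<omega> * \<xi> ?k \<omega>) + indicator (B ?k) \<omega> * (\<xi> ?k \<omega>)\<^sup>2" for \<omega>
        by (auto simp: T_def Y_def power2_eq_square indicator_def algebra_simps)
      have le: "(\<integral>\<omega>. indicator (B ?k) \<omega> * (\<xi> ?k \<omega>)\<^sup>2 \<partial>M) \<le> e ?k"
        unfolding e_def by (rule integral_mono[OF i2 sq]) (auto simp: indicator_def)
      have i3: "integrable M (\<lambda>\<omega>. 2 * (Y \<omega> * \<xi> ?k \<omega>))" using ix[of Y ?k] Y2 by auto
      have "(\<integral>\<omega>. (T (m + Suc n) \<omega>)\<^sup>2 \<partial>M) = (\<integral>\<omega>. (T ?k \<omega>)\<^sup>2 \<partial>M) + (\<integral>\<omega>. 2 * (Y \<omega> * \<xi> ?k \<omega>) \<partial>M) + (\<integral>\<omega>. indicator (B ?k) \<omega> * (\<xi> ?k \<omega>)\<^sup>2 \<partial>M)"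
        unfolding exp using Suc.IH i2 i3 by simp
      also have "(\<integral>\<omega>. 2 * (Y \<omega> * \<xi> ?k \<omega>) \<partial>M) = 0" using orth[OF YF Y2] by simp
      finally have "(\<integral>\<omega>. (T (m + Suc n) \<omega>)\<^sup>2 \<partial>M) \<le> (\<Sum>k\<in>{m..<m + Suc n}. e k)" using le Suc.IH by simp
      moreover have "integrable M (\<lambda>\<omega>. (T (m + Suc n) \<omega>)\<^sup>2)" unfolding exp using Suc.IH i2 i3 by auto
      ultimately show ?case by blast
    qed
    have "{\<omega> \<in> space M. \<exists>n\<in>{m..m + N}. \<epsilon> \<le> \<bar>S m n \<omega>\<bar>} \<subseteq> {\<omega> \<in> space M. \<epsilon>\<^sup>2 \<le> (T (m + N) \<omega>)\<^sup>2}"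
    proof
      fix \<omega> assume "\<omega> \<in> {\<omega> \<in> space M. \<exists>n\<in>{m..m + N}. \<epsilon> \<le> \<bar>S m n \<omega>\<bar>}"
      then have \<omega>: "\<omega> \<in> space M" "\<exists>n. n \<in> {m..m + N} \<and> \<epsilon> \<le> \<bar>S m n \<omega>\<bar>" by auto
      define j where "j = (LEAST n. n \<in> {m..m + N} \<and> \<epsilon> \<le> \<bar>S m n \<omega>\<bar>)"
      have j: "j \<in> {m..m + N}" "\<epsilon> \<le> \<bar>S m j \<omega>\<bar>" using LeastI_ex[OF \<omega>(2)] by (auto simp: j_def)
      have before: "\<bar>S m i \<omega>\<bar> < \<epsilon>" if "i \<in> {m..<j}" for i
        using not_less_Least[of i "\<lambda>n. n \<in> {m..m + N} \<and> \<epsilon> \<le> \<bar>S m n \<omega>\<bar>"] that j(1) by (auto simp: j_def)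
      have "T (m + N) \<omega> = (\<Sum>k\<in>{m..<j}. indicator (B k) \<omega> * \<xi> k \<omega>) + (\<Sum>k\<in>{j..<m + N}. indicator (B k) \<omega> * \<xi> k \<omega>)"
        unfolding T_def using j(1) by (intro sum.atLeastLessThan_concat[symmetric]) auto
      also have "(\<Sum>k\<in>{m..<j}. indicator (B k) \<omega> * \<xi> k \<omega>) = S m j \<omega>"
        unfolding S_def using before \<omega>(1) by (intro sum.cong) (auto simp: B_def indicator_def)
      also have "(\<Sum>k\<in>{j..<m + N}. indicator (B k) \<omega> * \<xi> k \<omega>) = 0"
      proof (intro sum.neutral ballI)
        fix k assume "k \<in> {j..<m + N}"
        then have "\<omega> \<notin> B k" using j by (auto simp: B_def not_less intro!: bexI[of _ j])
        then show "indicator (B k) \<omega> * \<xi> k \<omega> = 0" by simp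
      qed
      finally have "\<epsilon> \<le> \<bar>T (m + N) \<omega>\<bar>" using j(2) by simp
      then have "\<epsilon>\<^sup>2 \<le> \<bar>T (m + N) \<omega>\<bar>\<^sup>2" using \<epsilon> by (intro power_mono) auto
      then show "\<omega> \<in> {\<omega> \<in> space M. \<epsilon>\<^sup>2 \<le> (T (m + N) \<omega>)\<^sup>2}" using \<omega>(1) by simp
    qed
    then have "prob {\<omega> \<in> space M. \<exists>n\<in>{m..m + N}. \<epsilon> \<le> \<bar>S m n \<omega>\<bar>} \<le> prob {\<omega> \<in> space M. \<epsilon>\<^sup>2 \<le> (T (m + N) \<omega>)\<^sup>2}"
      by (intro finite_measure_mono) auto
    also have "\<dots> \<le> (\<integral>\<omega>. (T (m + N) \<omega>)\<^sup>2 \<partial>M) / \<epsilon>\<^sup>2"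
      using energy[of N] \<epsilon> by (intro integral_Markov_inequality_measure[where A = "{}"]) auto
    also have "\<dots> \<le> (\<Sum>k\<in>{m..<m + N}. e k) / \<epsilon>\<^sup>2"
      using energy[of N] by (intro divide_right_mono) auto
    finally show ?thesis .
  qed
  have AE_small: "AE \<omega> in M. \<exists>m. \<forall>n\<ge>m. \<bar>S m n \<omega>\<bar> < \<epsilon>" if \<epsilon>: "0 < \<epsilon>" for \<epsilon>
  proof -
    have SM[measurable]: "S m n \<in> borel_measurable M" for m n using SF by (rule F_measurable)
    define U where "U = {\<omega> \<in> space M. \<forall>m. \<exists>n\<ge>m. \<epsilon> \<le> \<bar>S m n \<omega>\<bar>}"
    have UM: "U \<in> sets M" unfolding U_def by measurable
    have "prob U \<le> \<eta>" if \<eta>: "0 < \<eta>" for \<eta>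
    proof -
      have sume: "summable e" using summable unfolding e_def[abs_def] .
      have "0 < \<eta> * \<epsilon>\<^sup>2" using \<eta> \<epsilon> by simp
      then obtain m where m: "\<And>n. norm (sum e {m..<n}) < \<eta> * \<epsilon>\<^sup>2"
        using sume unfolding summable_Cauchy by blast
      define D where "D N = {\<omega> \<in> space M. \<exists>n\<in>{m..m + N}. \<epsilon> \<le> \<bar>S m n \<omega>\<bar>}" for N
      have DM: "D N \<in> sets M" for N unfolding D_def by measurable
      have "prob (D N) \<le> \<eta>" for N
      proof -
        have "prob (D N) \<le> (\<Sum>k\<in>{m..<m + N}. e k) / \<epsilon>\<^sup>2" unfolding D_def by (rule maximal[OF \<epsilon>])
        also have "\<dots> \<le> \<eta>" using m[of "m + N"] \<epsilon> by (simp add: divide_le_eq abs_le_iff less_imp_le)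
        finally show ?thesis .
      qed
      moreover have "(\<lambda>N. prob (D N)) \<longlonglongrightarrow> prob (\<Union>N. D N)"
        by (rule finite_Lim_measure_incseq) (use DM in \<open>auto simp: D_def incseq_def\<close>)
      ultimately have "prob (\<Union>N. D N) \<le> \<eta>" by (intro LIMSEQ_le_const2) auto
      moreover have "U \<subseteq> (\<Union>N. D N)"
      proof
        fix \<omega> assume "\<omega> \<in> U"
        then obtain n where "\<omega> \<in> space M" "m \<le> n" "\<epsilon> \<le> \<bar>S m n \<omega>\<bar>" by (auto simp: U_def)
        then have "\<omega> \<in> D (n - m)" by (auto simp: D_def)
        then show "\<omega> \<in> (\<Union>N. D N)" by blast
      qed
      then have "prob U \<le> prob (\<Union>N. D N)" using DM by (intro finite_measure_mono) auto
      ultimately show ?thesis by linarith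
    qed
    then have "prob U \<le> 0" by (rule field_le_epsilon[of _ 0, simplified])
    then have "prob U = 0" by (simp add: measure_le_0_iff)
    then have "AE \<omega> in M. \<omega> \<notin> U" using UM prob_eq_0 by simp
    then show ?thesis using AE_space
    proof eventually_elim
      case (elim \<omega>)
      then have "\<not> (\<forall>m. \<exists>n\<ge>m. \<epsilon> \<le> \<bar>S m n \<omega>\<bar>)" by (auto simp: U_def)
      then show ?case by (meson not_le)
    qed
  qed
  have "AE \<omega> in M. \<forall>r::nat. \<exists>m. \<forall>n\<ge>m. \<bar>S m n \<omega>\<bar> < 1 / real (Suc r)"
    unfolding AE_all_countable by (intro allI AE_small) simp
  then show ?thesis
  proof (rule AE_mp, intro AE_I2 impI)
    fix \<omega> assume *: "\<forall>r::nat. \<exists>m. \<forall>n\<ge>m. \<bar>S m n \<omega>\<bar> < 1 / real (Suc r)"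
    show "summable (\<lambda>k. \<xi> k \<omega>)" unfolding summable_Cauchy
    proof (intro allI impI)
      fix d :: real assume "0 < d"
      then obtain r where r: "1 / real (Suc r) < d / 2" using nat_approx_posE[of "d / 2"] by auto
      obtain m where m: "\<And>n. m \<le> n \<Longrightarrow> \<bar>S m n \<omega>\<bar> < 1 / real (Suc r)" using * by blast
      show "\<exists>N. \<forall>m\<ge>N. \<forall>n. norm (\<Sum>k\<in>{m..<n}. \<xi> k \<omega>) < d"
      proof (intro exI[of _ m] allI impI)
        fix i n assume i: "m \<le> i"
        show "norm (\<Sum>k\<in>{i..<n}. \<xi> k \<omega>) < d"
        proof (cases "i \<le> n")
          case True
          have "(\<Sum>k\<in>{i..<n}. \<xi> k \<omega>) = S m n \<omega> - S m i \<omega>"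
            unfolding S_def using i True by (simp add: sum.atLeastLessThan_concat[of m i n, symmetric])
          then show ?thesis using m[OF i] m[of n] i True r by (simp add: abs_if split: if_splits)
        qed (use \<open>0 < d\<close> in simp)
      qed
    qed
  qed
qed

text \<open>The recursion of Robbins and Siegmund. All means are taken over events of the past on which \<open>W\<close> is bounded; there the martingale
  part \<open>N\<close> has mean zero and the quadratic part \<open>Q\<close> is controlled by \<open>W\<close>. On the events \<open>Ev\<close>, on which
  \<open>W\<close> starts below \<open>N0\<close> and has not exceeded \<open>R\<close>, the mean of \<open>W\<close> grows by summable factors. What leaves \<open>Ev\<close> takes the mean
  \<open>R\<close> with it, so the probability of ever exceeding \<open>R\<close> is \<open>O(1 / R)\<close>.\<close>

theorem almost_supermartingale:
  fixes W N Q \<Phi> :: "nat \<Rightarrow> 'w \<Rightarrow> real" and \<alpha> :: "nat \<Rightarrow> real"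
  assumes W_meas: "\<And>k. W k \<in> borel_measurable (F k)"
    and NQ_meas: "\<And>k. \<Phi> k \<in> borel_measurable M"
    and nonneg: "\<And>k \<omega>. \<omega> \<in> space M \<Longrightarrow> 0 \<le> W k \<omega>" "\<And>k \<omega>. \<omega> \<in> space M \<Longrightarrow> 0 \<le> Q k \<omega>"
      "\<And>k \<omega>. \<omega> \<in> space M \<Longrightarrow> 0 \<le> \<Phi> k \<omega>"
    and step: "\<And>k \<omega>. \<omega> \<in> space M \<Longrightarrow> W (Suc k) \<omega> \<le> W k \<omega> + \<alpha> k * N k \<omega> + (\<alpha> k)\<^sup>2 * (C * (1 + W k \<omega>))
       + (\<alpha> k)\<^sup>2 * Q k \<omega> - \<alpha> k * \<Phi> k \<omega>"
    and N: "\<And>k A R. A \<in> sets (F k) \<Longrightarrow> (\<And>\<omega>. \<omega> \<in> A \<Longrightarrow> W k \<omega> \<le> R) \<Longrightarrow>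
       integrable M (\<lambda>\<omega>. indicator A \<omega> * N k \<omega>) \<and> (\<integral>\<omega>. indicator A \<omega> * N k \<omega> \<partial>M) = 0"
    and Q: "\<And>k A R. A \<in> sets (F k) \<Longrightarrow> (\<And>\<omega>. \<omega> \<in> A \<Longrightarrow> W k \<omega> \<le> R) \<Longrightarrow>
       integrable M (\<lambda>\<omega>. indicator A \<omega> * Q k \<omega>) \<and>
       (\<integral>\<omega>. indicator A \<omega> * Q k \<omega> \<partial>M) \<le> C * (1 + (\<integral>\<omega>. indicator A \<omega> * W k \<omega> \<partial>M))"
    and \<alpha>: "\<And>k. 0 < \<alpha> k" "summable (\<lambda>k. (\<alpha> k)\<^sup>2)" and C: "0 \<le> C"
  shows "AE \<omega> in M. (\<exists>R. \<forall>k. W k \<omega> \<le> R) \<and> summable (\<lambda>k. \<alpha> k * \<Phi> k \<omega>) \<and> summable (\<lambda>k. (\<alpha> k)\<^sup>2 * Q k \<omega>)"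
proof -
  have [measurable]: "W k \<in> borel_measurable M" "\<Phi> k \<in> borel_measurable M" for k
    using F_measurable[OF W_meas] NQ_meas by auto
  have bdd: "integrable M (\<lambda>\<omega>. indicator A \<omega> * W k \<omega>)"
    if "A \<in> sets (F k)" "\<And>\<omega>. \<omega> \<in> A \<Longrightarrow> W k \<omega> \<le> R" for A k R
  proof (rule integrable_const_bound[where B = "\<bar>R\<bar>"])
    have [measurable]: "A \<in> sets M" using that(1) by (rule F_sets)
    show "(\<lambda>\<omega>. indicator A \<omega> * W k \<omega>) \<in> borel_measurable M" by measurable
    show "AE \<omega> in M. norm (indicator A \<omega> * W k \<omega>) \<le> \<bar>R\<bar>"
      using that(2) nonneg(1)[of _ k] by (intro AE_I2) (force simp: indicator_def)
  qed
  have one: "integrable M (\<lambda>\<omega>. indicator A \<omega> * W (Suc k) \<omega>) \<and> integrable M (\<lambda>\<omega>. indicator A \<omega> * \<Phi> k \<omega>) \<and>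
     (\<integral>\<omega>. indicator A \<omega> * W (Suc k) \<omega> \<partial>M) + \<alpha> k * (\<integral>\<omega>. indicator A \<omega> * \<Phi> k \<omega> \<partial>M)
       \<le> (1 + 2 * C * (\<alpha> k)\<^sup>2) * (\<integral>\<omega>. indicator A \<omega> * W k \<omega> \<partial>M) + 2 * C * (\<alpha> k)\<^sup>2"
    if A: "A \<in> sets (F k)" "\<And>\<omega>. \<omega> \<in> A \<Longrightarrow> W k \<omega> \<le> R" for A k R
  proof -
    have AM[measurable]: "A \<in> sets M" using A(1) by (rule F_sets)
    have A_space: "\<omega> \<in> A \<Longrightarrow> \<omega> \<in> space M" for \<omega> using AM sets.sets_into_space by blast
    note NA = N[OF A] and QA = Q[OF A] and WA = bdd[OF A]
    have iA: "integrable M (\<lambda>\<omega>. indicator A \<omega> :: real)"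
      by (rule integrable_const_bound[where B = 1]) (auto simp: indicator_def)
    define G where "G \<omega> = indicator A \<omega> * W k \<omega> + \<alpha> k * (indicator A \<omega> * N k \<omega>)
      + (\<alpha> k)\<^sup>2 * (C * (indicator A \<omega> + indicator A \<omega> * W k \<omega>)) + (\<alpha> k)\<^sup>2 * (indicator A \<omega> * Q k \<omega>)" for \<omega>
    have Gi: "integrable M G" unfolding G_def using NA QA WA iA by auto
    have GI: "integral\<^sup>L M G = (\<integral>\<omega>. indicator A \<omega> * W k \<omega> \<partial>M)
      + (\<alpha> k)\<^sup>2 * (C * (prob A + (\<integral>\<omega>. indicator A \<omega> * W k \<omega> \<partial>M))) + (\<alpha> k)\<^sup>2 * (\<integral>\<omega>. indicator A \<omega> * Q k \<omega> \<partial>M)"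
      unfolding G_def using NA QA WA iA by simp
    have G: "indicator A \<omega> * W (Suc k) \<omega> + \<alpha> k * (indicator A \<omega> * \<Phi> k \<omega>) \<le> G \<omega>" for \<omega>
      using step[of \<omega> k] A_space[of \<omega>] by (auto simp: G_def indicator_def algebra_simps)
    have n1: "0 \<le> indicator A \<omega> * W (Suc k) \<omega>" and n2: "0 \<le> \<alpha> k * (indicator A \<omega> * \<Phi> k \<omega>)" for \<omega>
      using nonneg(1)[of \<omega> "Suc k"] nonneg(3)[of \<omega> k] A_space[of \<omega>] \<alpha>(1)[of k] by (auto simp: indicator_def)
    have i1: "integrable M (\<lambda>\<omega>. indicator A \<omega> * W (Suc k) \<omega>)"
    proof (rule Bochner_Integration.integrable_bound[OF Gi])
      show "AE \<omega> in M. norm (indicator A \<omega> * W (Suc k) \<omega>) \<le> norm (G \<omega>)"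
        using G n1 n2 by (intro AE_I2) (smt (verit) real_norm_def)
    qed measurable
    have "integrable M (\<lambda>\<omega>. \<alpha> k * (indicator A \<omega> * \<Phi> k \<omega>))"
    proof (rule Bochner_Integration.integrable_bound[OF Gi])
      show "AE \<omega> in M. norm (\<alpha> k * (indicator A \<omega> * \<Phi> k \<omega>)) \<le> norm (G \<omega>)"
        using G n1 n2 by (intro AE_I2) (smt (verit) real_norm_def)
    qed measurable
    then have i2: "integrable M (\<lambda>\<omega>. indicator A \<omega> * \<Phi> k \<omega>)" using \<alpha>(1)[of k] by simp
    have "(\<integral>\<omega>. indicator A \<omega> * W (Suc k) \<omega> \<partial>M) + \<alpha> k * (\<integral>\<omega>. indicator A \<omega> * \<Phi> k \<omega> \<partial>M)
      = (\<integral>\<omega>. indicator A \<omega> * W (Suc k) \<omega> + \<alpha> k * (indicator A \<omega> * \<Phi> k \<omega>) \<partial>M)" using i1 i2 by simp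
    also have "\<dots> \<le> integral\<^sup>L M G" using i1 i2 Gi G by (intro integral_mono) auto
    also have "\<dots> \<le> (\<integral>\<omega>. indicator A \<omega> * W k \<omega> \<partial>M)
      + (\<alpha> k)\<^sup>2 * (C * (1 + (\<integral>\<omega>. indicator A \<omega> * W k \<omega> \<partial>M))) + (\<alpha> k)\<^sup>2 * (C * (1 + (\<integral>\<omega>. indicator A \<omega> * W k \<omega> \<partial>M)))"
      unfolding GI using QA C by (intro add_mono mult_left_mono) auto
    finally show ?thesis using i1 i2 by (simp add: algebra_simps)
  qed
  define S where "S = (\<Sum>k. (\<alpha> k)\<^sup>2)"
  define Ev where "Ev N0 R k = {\<omega> \<in> space M. W 0 \<omega> \<le> N0 \<and> (\<forall>j\<in>{..k}. W j \<omega> \<le> R)}" for N0 R :: real and k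
  have EvF: "Ev N0 R k \<in> sets (F k)" for N0 R k
  proof -
    have WF[measurable]: "W j \<in> borel_measurable (F k)" if "j \<le> k" for j using that by (rule F_measurable_le[OF _ W_meas])
    have "{\<omega> \<in> space (F k). W 0 \<omega> \<le> N0 \<and> (\<forall>j\<in>{..k}. W j \<omega> \<le> R)} \<in> sets (F k)"
    proof (intro sets.sets_Collect_conj sets.sets_Collect_finite_All)
      show "{\<omega> \<in> space (F k). W 0 \<omega> \<le> N0} \<in> sets (F k)" using WF[of 0] unfolding borel_measurable_iff_le by blast
      show "{\<omega> \<in> space (F k). W j \<omega> \<le> R} \<in> sets (F k)" if "j \<in> {..k}" for j using WF[of j] that unfolding borel_measurable_iff_le by blast
    qed auto
    then show ?thesis by (simp add: Ev_def)
  qed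
  have EvM[measurable]: "Ev N0 R k \<in> sets M" for N0 R k using EvF by (rule F_sets)
  have EvW: "W k \<omega> \<le> R" if "\<omega> \<in> Ev N0 R k" for \<omega> N0 R k using that by (auto simp: Ev_def)
  have oneE: "integrable M (\<lambda>\<omega>. indicator (Ev N0 R k) \<omega> * W (Suc k) \<omega>) \<and> integrable M (\<lambda>\<omega>. indicator (Ev N0 R k) \<omega> * \<Phi> k \<omega>) \<and>
     (\<integral>\<omega>. indicator (Ev N0 R k) \<omega> * W (Suc k) \<omega> \<partial>M) + \<alpha> k * (\<integral>\<omega>. indicator (Ev N0 R k) \<omega> * \<Phi> k \<omega> \<partial>M)
       \<le> (1 + 2 * C * (\<alpha> k)\<^sup>2) * (\<integral>\<omega>. indicator (Ev N0 R k) \<omega> * W k \<omega> \<partial>M) + 2 * C * (\<alpha> k)\<^sup>2" for N0 R k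
    using one[of "Ev N0 R k" k R] EvF EvW by blast
  have bddE: "integrable M (\<lambda>\<omega>. indicator (Ev N0 R k) \<omega> * W k \<omega>)" for N0 R k
    using bdd[of "Ev N0 R k" k R] EvF EvW by blast
  have QE: "integrable M (\<lambda>\<omega>. indicator (Ev N0 R k) \<omega> * Q k \<omega>) \<and>
       (\<integral>\<omega>. indicator (Ev N0 R k) \<omega> * Q k \<omega> \<partial>M) \<le> C * (1 + (\<integral>\<omega>. indicator (Ev N0 R k) \<omega> * W k \<omega> \<partial>M))" for N0 R k
    using Q[of "Ev N0 R k" k R] EvF EvW by blast
  have Ev_dec: "Ev N0 R (Suc k) \<subseteq> Ev N0 R k" for N0 R k by (auto simp: Ev_def)
  define c where "c N0 = exp (2 * C * S) * (1 + N0)" for N0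
  have main: "(\<integral>\<omega>. indicator (Ev N0 R n) \<omega> * W n \<omega> \<partial>M) + R * (prob (Ev N0 R 0) - prob (Ev N0 R n))
      + (\<Sum>k<n. \<alpha> k * (\<integral>\<omega>. indicator (Ev N0 R k) \<omega> * \<Phi> k \<omega> \<partial>M)) \<le> c N0"
    if N0: "0 \<le> N0" and R: "0 < R" for N0 R n
  proof -
    define w where "w k = (\<integral>\<omega>. indicator (Ev N0 R k) \<omega> * W k \<omega> \<partial>M)" for k
    define \<phi> where "\<phi> k = (\<integral>\<omega>. indicator (Ev N0 R k) \<omega> * \<Phi> k \<omega> \<partial>M)" for k
    define s where "s n = w n + R * (prob (Ev N0 R 0) - prob (Ev N0 R n)) + (\<Sum>k<n. \<alpha> k * \<phi> k)" for n
    have nn: "0 \<le> w k" "0 \<le> \<phi> k" for k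
      unfolding w_def \<phi>_def by (intro integral_nonneg_AE AE_I2; use nonneg in \<open>auto simp: indicator_def\<close>)+
    \<comment> \<open>On the paths that leave at this step, \<open>W\<close> exceeds \<open>R\<close>.\<close>
    have exit: "w (Suc k) + R * (prob (Ev N0 R k) - prob (Ev N0 R (Suc k))) \<le> (\<integral>\<omega>. indicator (Ev N0 R k) \<omega> * W (Suc k) \<omega> \<partial>M)" for k
    proof -
      have pd: "prob (Ev N0 R k) - prob (Ev N0 R (Suc k)) = prob (Ev N0 R k - Ev N0 R (Suc k))"
        using Ev_dec by (intro finite_measure_Diff[symmetric]) auto
      have iW: "integrable M (\<lambda>\<omega>. indicator (Ev N0 R (Suc k)) \<omega> * W (Suc k) \<omega>)" by (rule bddE)
      have iD: "integrable M (\<lambda>\<omega>. R * indicator (Ev N0 R k - Ev N0 R (Suc k)) \<omega>)"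
        by (intro integrable_mult_right integrable_const_bound[where B = 1]) (auto simp: indicator_def)
      have "w (Suc k) + R * (prob (Ev N0 R k) - prob (Ev N0 R (Suc k)))
          = (\<integral>\<omega>. indicator (Ev N0 R (Suc k)) \<omega> * W (Suc k) \<omega> + R * indicator (Ev N0 R k - Ev N0 R (Suc k)) \<omega> \<partial>M)"
        unfolding pd w_def using iW iD by (subst Bochner_Integration.integral_add) auto
      also have "\<dots> \<le> (\<integral>\<omega>. indicator (Ev N0 R k) \<omega> * W (Suc k) \<omega> \<partial>M)"
      proof (rule integral_mono)
        show "integrable M (\<lambda>\<omega>. indicator (Ev N0 R (Suc k)) \<omega> * W (Suc k) \<omega> + R * indicator (Ev N0 R k - Ev N0 R (Suc k)) \<omega>)"
          using iW iD by (rule Bochner_Integration.integrable_add)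
        show "integrable M (\<lambda>\<omega>. indicator (Ev N0 R k) \<omega> * W (Suc k) \<omega>)" using oneE by blast
        fix \<omega> assume \<omega>: "\<omega> \<in> space M"
        have "R \<le> W (Suc k) \<omega>" if "\<omega> \<in> Ev N0 R k - Ev N0 R (Suc k)"
          using that by (auto simp: Ev_def le_Suc_eq)
        then show "indicator (Ev N0 R (Suc k)) \<omega> * W (Suc k) \<omega> + R * indicator (Ev N0 R k - Ev N0 R (Suc k)) \<omega>
            \<le> indicator (Ev N0 R k) \<omega> * W (Suc k) \<omega>"
          using Ev_dec[of N0 R k] by (auto simp: indicator_def)
      qed
      finally show ?thesis .
    qed
    have pmono: "prob (Ev N0 R n) \<le> prob (Ev N0 R 0)" for n
      by (intro finite_measure_mono) (auto simp: Ev_def)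
    have "1 + s n \<le> exp (2 * C * (\<Sum>k<n. (\<alpha> k)\<^sup>2)) * (1 + N0)"
    proof (induction n)
      case 0
      have "w 0 \<le> (\<integral>\<omega>. N0 \<partial>M)" unfolding w_def
        using N0 by (intro integral_mono bddE) (auto simp: indicator_def Ev_def)
      then show ?case by (simp add: s_def prob_space)
    next
      case (Suc n)
      have "w (Suc n) + R * (prob (Ev N0 R n) - prob (Ev N0 R (Suc n))) + \<alpha> n * \<phi> n
          \<le> (1 + 2 * C * (\<alpha> n)\<^sup>2) * w n + 2 * C * (\<alpha> n)\<^sup>2"
        using exit[of n] oneE[of N0 R n] unfolding w_def \<phi>_def by linarith
      then have "1 + s (Suc n) \<le> (1 + s n) + 2 * C * (\<alpha> n)\<^sup>2 * (1 + w n)"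
        by (simp add: s_def algebra_simps)
      also have "\<dots> \<le> (1 + s n) + 2 * C * (\<alpha> n)\<^sup>2 * (1 + s n)"
      proof -
        have "w n \<le> s n" unfolding s_def using R pmono nn \<alpha>(1)
          by (simp add: sum_nonneg less_imp_le mult_nonneg_nonneg)
        then show ?thesis using C by (intro add_left_mono mult_left_mono) auto
      qed
      also have "\<dots> = (1 + 2 * C * (\<alpha> n)\<^sup>2) * (1 + s n)" by (simp add: algebra_simps)
      also have "\<dots> \<le> exp (2 * C * (\<alpha> n)\<^sup>2) * (exp (2 * C * (\<Sum>k<n. (\<alpha> k)\<^sup>2)) * (1 + N0))"
      proof (intro mult_mono Suc.IH)
        have "0 \<le> s n" unfolding s_def using R pmono nn \<alpha>(1)
          by (simp add: sum_nonneg less_imp_le mult_nonneg_nonneg)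
        then show "0 \<le> 1 + s n" by simp
      qed (use C in auto)
      also have "\<dots> = exp (2 * C * (\<Sum>k<Suc n. (\<alpha> k)\<^sup>2)) * (1 + N0)"
        by (simp add: distrib_left exp_add)
      finally show ?case .
    qed
    also have "\<dots> \<le> c N0" unfolding c_def S_def using C N0 \<alpha>(2)
      by (intro mult_right_mono) (auto intro!: mult_left_mono sum_le_suminf)
    finally show ?thesis unfolding s_def w_def \<phi>_def by linarith
  qed
  have w_nonneg: "0 \<le> (\<integral>\<omega>. indicator (Ev N0 R n) \<omega> * W n \<omega> \<partial>M)" for N0 R n
    by (intro integral_nonneg_AE AE_I2) (use nonneg in \<open>auto simp: indicator_def\<close>)
  have \<phi>_nonneg: "0 \<le> (\<integral>\<omega>. indicator (Ev N0 R n) \<omega> * \<Phi> n \<omega> \<partial>M)" for N0 R n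
    by (intro integral_nonneg_AE AE_I2) (use nonneg in \<open>auto simp: indicator_def\<close>)
  have bounded: "AE \<omega> in M. \<exists>R::nat. \<forall>k. W k \<omega> \<le> real R"
  proof -
    have "AE \<omega> in M. W 0 \<omega> \<le> real N0 \<longrightarrow> (\<exists>R::nat. \<forall>k. W k \<omega> \<le> real R)" for N0 :: nat
    proof -
      define U where "U = {\<omega> \<in> space M. W 0 \<omega> \<le> real N0 \<and> \<not> (\<exists>R::nat. \<forall>k. W k \<omega> \<le> real R)}"
      have UM: "U \<in> sets M" unfolding U_def by measurable
      have c0: "0 \<le> c (real N0)" by (simp add: c_def)
      have le: "real R * prob U \<le> c (real N0)" if R: "N0 < R" for R :: nat
      proof -
        let ?E = "Ev (real N0) (real R)"
        have "(\<lambda>n. prob (?E n)) \<longlonglongrightarrow> prob (\<Inter>n. ?E n)"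
          by (rule finite_Lim_measure_decseq) (auto simp: Ev_def decseq_def)
        then have "(\<lambda>n. real R * (prob (?E 0) - prob (?E n))) \<longlonglongrightarrow> real R * (prob (?E 0) - prob (\<Inter>n. ?E n))"
          by (intro tendsto_intros)
        moreover have "real R * (prob (?E 0) - prob (?E n)) \<le> c (real N0)" for n
        proof -
          have "0 \<le> (\<Sum>k<n. \<alpha> k * (\<integral>\<omega>. indicator (?E k) \<omega> * \<Phi> k \<omega> \<partial>M))"
            using \<phi>_nonneg \<alpha>(1) by (intro sum_nonneg mult_nonneg_nonneg) (auto simp: less_imp_le)
          then show ?thesis using main[of "real N0" "real R" n] w_nonneg[of "real N0" "real R" n] R by simp
        qed
        ultimately have "real R * (prob (?E 0) - prob (\<Inter>n. ?E n)) \<le> c (real N0)" by (intro LIMSEQ_le_const2) auto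
        moreover have "prob (?E 0) - prob (\<Inter>n. ?E n) = prob (?E 0 - (\<Inter>n. ?E n))"
          by (intro finite_measure_Diff[symmetric]) auto
        moreover have "U \<subseteq> ?E 0 - (\<Inter>n. ?E n)"
        proof
          fix \<omega> assume "\<omega> \<in> U"
          then have \<omega>: "\<omega> \<in> space M" "W 0 \<omega> \<le> real N0" "\<not> (\<forall>k. W k \<omega> \<le> real R)" unfolding U_def by blast+
          then obtain n where "\<not> W n \<omega> \<le> real R" by blast
          then have "\<omega> \<notin> ?E n" by (auto simp: Ev_def)
          moreover have "\<omega> \<in> ?E 0" using \<omega>(1,2) R by (simp add: Ev_def)
          ultimately show "\<omega> \<in> ?E 0 - (\<Inter>n. ?E n)" by blast
        qed
        then have "prob U \<le> prob (?E 0 - (\<Inter>n. ?E n))" by (intro finite_measure_mono) auto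
        then have "real R * prob U \<le> real R * prob (?E 0 - (\<Inter>n. ?E n))" by (intro mult_left_mono) auto
        ultimately show ?thesis by simp
      qed
      have "prob U = 0"
      proof (rule ccontr)
        assume "prob U \<noteq> 0"
        then have pos: "0 < prob U" by (simp add: zero_less_measure_iff)
        obtain R :: nat where R: "c (real N0) / prob U < real R" using reals_Archimedean2 by blast
        have "c (real N0) < real (max R (Suc N0)) * prob U"
        proof -
          have "c (real N0) < real R * prob U" using R pos by (simp add: divide_less_eq)
          also have "\<dots> \<le> real (max R (Suc N0)) * prob U" using pos by (intro mult_right_mono) auto
          finally show ?thesis .
        qed
        moreover have "N0 < max R (Suc N0)" by (simp add: less_max_iff_disj)
        ultimately show False using le[of "max R (Suc N0)"] by linarith
      qed
      then have "AE \<omega> in M. \<omega> \<notin> U" using UM prob_eq_0 by simp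
      then show ?thesis by (rule AE_mp) (auto simp: U_def)
    qed
    then have "AE \<omega> in M. \<forall>N0::nat. W 0 \<omega> \<le> real N0 \<longrightarrow> (\<exists>R::nat. \<forall>k. W k \<omega> \<le> real R)"
      unfolding AE_all_countable by blast
    then show ?thesis
    proof eventually_elim
      case (elim \<omega>)
      obtain N0 :: nat where "W 0 \<omega> \<le> real N0" using real_arch_simple by blast
      then show ?case using elim by blast
    qed
  qed
  have sum\<Phi>: "AE \<omega> in M. \<forall>R::nat. summable (\<lambda>k. \<alpha> k * (indicator (Ev (real (Suc R)) (real (Suc R)) k) \<omega> * \<Phi> k \<omega>))"
    unfolding AE_all_countable
  proof
    fix R :: nat
    let ?R = "real (Suc R)" and ?E = "Ev (real (Suc R)) (real (Suc R))"
    show "AE \<omega> in M. summable (\<lambda>k. \<alpha> k * (indicator (?E k) \<omega> * \<Phi> k \<omega>))"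
    proof (rule AE_summable_of_integral_bound[where c = "c ?R"])
      show "integrable M (\<lambda>\<omega>. \<alpha> k * (indicator (?E k) \<omega> * \<Phi> k \<omega>))" for k
        using oneE[of ?R ?R k] by auto
      show "0 \<le> \<alpha> k * (indicator (?E k) \<omega> * \<Phi> k \<omega>)" if "\<omega> \<in> space M" for k \<omega>
        using that nonneg(3)[of \<omega> k] \<alpha>(1)[of k] by (simp add: indicator_def)
      show "(\<Sum>k<n. \<integral>\<omega>. \<alpha> k * (indicator (?E k) \<omega> * \<Phi> k \<omega>) \<partial>M) \<le> c ?R" for n
      proof -
        have "prob (?E n) \<le> prob (?E 0)" by (intro finite_measure_mono) (auto simp: Ev_def)
        then have "0 \<le> ?R * (prob (?E 0) - prob (?E n))" by simp
        moreover have "(\<Sum>k<n. \<integral>\<omega>. \<alpha> k * (indicator (?E k) \<omega> * \<Phi> k \<omega>) \<partial>M)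
            = (\<Sum>k<n. \<alpha> k * (\<integral>\<omega>. indicator (?E k) \<omega> * \<Phi> k \<omega> \<partial>M))" by simp
        ultimately show ?thesis using main[of ?R ?R n] w_nonneg[of ?R ?R n] by linarith
      qed
    qed
  qed
  have sumQ: "AE \<omega> in M. \<forall>R::nat. summable (\<lambda>k. (\<alpha> k)\<^sup>2 * (indicator (Ev (real (Suc R)) (real (Suc R)) k) \<omega> * Q k \<omega>))"
    unfolding AE_all_countable
  proof
    fix R :: nat
    let ?E = "Ev (real (Suc R)) (real (Suc R))"
    show "AE \<omega> in M. summable (\<lambda>k. (\<alpha> k)\<^sup>2 * (indicator (?E k) \<omega> * Q k \<omega>))"
    proof (rule AE_summable_of_integral_bound[where c = "S * (C * (1 + real (Suc R)))"])
      show "integrable M (\<lambda>\<omega>. (\<alpha> k)\<^sup>2 * (indicator (?E k) \<omega> * Q k \<omega>))" for k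
        using QE[of "real (Suc R)" "real (Suc R)" k] by auto
      show "0 \<le> (\<alpha> k)\<^sup>2 * (indicator (?E k) \<omega> * Q k \<omega>)" if "\<omega> \<in> space M" for k \<omega>
        using that nonneg(2)[of \<omega> k] by (simp add: indicator_def)
      have "(\<integral>\<omega>. indicator (?E k) \<omega> * Q k \<omega> \<partial>M) \<le> C * (1 + real (Suc R))" for k
      proof -
        have "(\<integral>\<omega>. indicator (?E k) \<omega> * W k \<omega> \<partial>M) \<le> (\<integral>\<omega>. real (Suc R) \<partial>M)"
          by (intro integral_mono bddE) (auto simp: indicator_def Ev_def)
        then have "C * (1 + (\<integral>\<omega>. indicator (?E k) \<omega> * W k \<omega> \<partial>M)) \<le> C * (1 + real (Suc R))"
          using C by (intro mult_left_mono) (auto simp: prob_space)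
        then show ?thesis using QE[of "real (Suc R)" "real (Suc R)" k] by linarith
      qed
      then have "(\<Sum>k<n. (\<alpha> k)\<^sup>2 * (\<integral>\<omega>. indicator (?E k) \<omega> * Q k \<omega> \<partial>M)) \<le> (\<Sum>k<n. (\<alpha> k)\<^sup>2 * (C * (1 + real (Suc R))))" for n
        by (intro sum_mono mult_left_mono) auto
      also have "(\<Sum>k<n. (\<alpha> k)\<^sup>2 * (C * (1 + real (Suc R)))) \<le> S * (C * (1 + real (Suc R)))" for n
        unfolding sum_distrib_right[symmetric] S_def using \<alpha>(2) C by (intro mult_right_mono sum_le_suminf) auto
      finally show "(\<Sum>k<n. \<integral>\<omega>. (\<alpha> k)\<^sup>2 * (indicator (?E k) \<omega> * Q k \<omega>) \<partial>M) \<le> S * (C * (1 + real (Suc R)))" for n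
        by simp
    qed
  qed
  show ?thesis
    using bounded sum\<Phi> sumQ AE_space
  proof eventually_elim
    case (elim \<omega>)
    then obtain R :: nat where R: "\<And>k. W k \<omega> \<le> real R" by blast
    have "W k \<omega> \<le> real (Suc R)" for k using R[of k] by simp
    then have "\<omega> \<in> Ev (real (Suc R)) (real (Suc R)) k" for k using elim by (simp add: Ev_def del: of_nat_Suc)
    then show ?case using elim(2)[rule_format, of R] elim(3)[rule_format, of R] R by auto
  qed
qed

end

section \<open>The allocation problem and its reference path\<close>

lemma continuous_on_laplacian: "continuous_on UNIV (laplacian :: real^'n^'n \<Rightarrow> real^'n^'n)"
  unfolding laplacian_def
proof (intro continuous_on_diff continuous_on_vec_lambda continuous_on_id)
  fix i j :: 'n
  show "continuous_on UNIV (\<lambda>A :: real^'n^'n. if i = j then \<Sum>l\<in>UNIV. A $ i $ l else 0)"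
    by (cases "i = j") (auto intro!: continuous_intros)
qed

lemma measurable_entry:
  "Y \<in> borel_measurable N \<Longrightarrow> (\<lambda>\<omega>. (Y \<omega> :: ('a::euclidean_space)^'n) $ i) \<in> borel_measurable N"
  by (rule measurable_compose[OF _ borel_measurable_continuous_onI]) (auto intro!: continuous_intros)

locale stochastic_allocation = prob_space M for M :: "'w measure" +
  fixes f :: "'n::finite \<Rightarrow> real^'m \<Rightarrow> real" and d :: "'n \<Rightarrow> real^'m" and \<Omega> :: "'n \<Rightarrow> (real^'m) set"
    and A L :: "nat \<Rightarrow> 'w \<Rightarrow> real^'n^'n" and Lbar :: "real^'n^'n" and \<alpha> :: "nat \<Rightarrow> real"
    and x lam z :: "'n \<Rightarrow> nat \<Rightarrow> 'w \<Rightarrow> real^'m" and \<nu> \<delta> :: "'n \<Rightarrow> nat \<Rightarrow> 'w \<Rightarrow> real^'m"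
    and \<zeta> \<epsilon> :: "'n \<Rightarrow> 'n \<Rightarrow> nat \<Rightarrow> 'w \<Rightarrow> real^'m" and \<F> \<F>' :: "nat \<Rightarrow> 'w measure"
    and l\<^sub>c \<mu> c :: real and xstar :: "'n \<Rightarrow> real^'m"
  assumes A_meas: "\<And>k. A k \<in> borel_measurable M"
    and A_01: "\<And>k \<omega> i j. \<omega> \<in> space M \<Longrightarrow> A k \<omega> $ i $ j \<in> {0, 1}"
    and A_diag: "\<And>k \<omega> i. \<omega> \<in> space M \<Longrightarrow> A k \<omega> $ i $ i = 0"
    and L: "\<And>k \<omega>. L k \<omega> = laplacian (A k \<omega>)"
    and \<alpha>_pos: "\<And>k. \<alpha> k > 0"
    and \<alpha>_sum: "filterlim (\<lambda>K. \<Sum>k=1..K. \<alpha> k) at_top sequentially"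
    and \<alpha>_sq: "summable (\<lambda>k. (\<alpha> (Suc k))\<^sup>2)"
    and noise_meas: "\<And>i k. \<nu> i k \<in> borel_measurable M" "\<And>i k. \<delta> i k \<in> borel_measurable M"
      "\<And>i j k. \<zeta> i j k \<in> borel_measurable M" "\<And>i j k. \<epsilon> i j k \<in> borel_measurable M"
    and init_meas: "\<And>i. x i 0 \<in> borel_measurable M" "\<And>i. lam i 0 \<in> borel_measurable M"
      "\<And>i. z i 0 \<in> borel_measurable M"
    and x_step: "\<And>i k \<omega>. \<omega> \<in> space M \<Longrightarrow>
      x i (Suc k) \<omega> = closest_point (\<Omega> i)
        (x i k \<omega> + \<alpha> k *\<^sub>R (- (gradient (f i) (x i k \<omega>) + \<nu> i k \<omega>) + lam i k \<omega>))"
    and lam_step: "\<And>i k \<omega>. \<omega> \<in> space M \<Longrightarrow>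
      lam i (Suc k) \<omega> = lam i k \<omega> + \<alpha> k *\<^sub>R
        ((d i + \<delta> i k \<omega>) - x i k \<omega>
         - (\<Sum>j\<in>UNIV. A k \<omega> $ i $ j *\<^sub>R (lam i k \<omega> - (lam j k \<omega> + \<zeta> i j k \<omega>)))
         - (\<Sum>j\<in>UNIV. A k \<omega> $ i $ j *\<^sub>R (z i k \<omega> - (z j k \<omega> + \<epsilon> i j k \<omega>))))"
    and z_step: "\<And>i k \<omega>. \<omega> \<in> space M \<Longrightarrow>
      z i (Suc k) \<omega> = z i k \<omega> + \<alpha> k *\<^sub>R
        (\<Sum>j\<in>UNIV. A k \<omega> $ i $ j *\<^sub>R (lam i k \<omega> - (lam j k \<omega> + \<zeta> i j k \<omega>)))"
    and \<F>: "\<And>k. \<F> k = past M (\<lambda>i. x i 0) (\<lambda>i. lam i 0) (\<lambda>i. z i 0) L \<nu> \<delta> \<zeta> \<epsilon> k"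
    and \<F>': "\<And>k. \<F>' k = past_graph M (\<lambda>i. x i 0) (\<lambda>i. lam i 0) (\<lambda>i. z i 0) L \<nu> \<delta> \<zeta> \<epsilon> k"
    and A1_diff: "\<And>i y. f i differentiable (at y)"
    and A1_convex: "\<And>i. strictly_convex_on UNIV (f i)"
    and A1_lc: "l\<^sub>c > 0"
    and A1_lipschitz: "\<And>i y y'. norm (gradient (f i) y - gradient (f i) y') \<le> l\<^sub>c * norm (y - y')"
    and A2_set: "\<And>i. closed (\<Omega> i)" "\<And>i. convex (\<Omega> i)"
    and A3_iid: "iid M L"
    and A3_mean: "\<And>k. Lbar = integral\<^sup>L M (L k)"
    and A3_sym: "transpose Lbar = Lbar"
    and A3_s2: "second_smallest_eigenvalue Lbar > 0"
    and A4_iid: "\<And>i. iid M (\<delta> i)"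
    and A4_mean: "\<And>i k. integral\<^sup>L M (\<delta> i k) = 0"
    and A4_moment: "\<And>i k. integrable M (\<lambda>\<omega>. (norm (\<delta> i k \<omega>))\<^sup>2)"
    and A5_i: "\<And>i j k. AE \<omega> in M. vec_cond_exp M (\<F>' k) (\<zeta> i j k) \<omega> = 0"
              "\<And>i j k. AE \<omega> in M. vec_cond_exp M (\<F>' k) (\<epsilon> i j k) \<omega> = 0"
    and A5_ii: "\<And>i j k. AE \<omega> in M.
                  nn_cond_exp M (\<F>' k) (\<lambda>\<omega>. ennreal ((norm (\<zeta> i j k \<omega>))\<^sup>2)) \<omega> \<le> ennreal (\<mu>\<^sup>2)"
               "\<And>i j k. AE \<omega> in M.
                  nn_cond_exp M (\<F>' k) (\<lambda>\<omega>. ennreal ((norm (\<epsilon> i j k \<omega>))\<^sup>2)) \<omega> \<le> ennreal (\<mu>\<^sup>2)"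
    and A5_c: "c > 0"
    and A5_iii: "\<And>i k. AE \<omega> in M. vec_cond_exp M (\<F> k) (\<nu> i k) \<omega> = 0"
                "\<And>i k. AE \<omega> in M.
                  nn_cond_exp M (\<F> k) (\<lambda>\<omega>. ennreal ((norm (\<nu> i k \<omega>))\<^sup>2)) \<omega>
                    \<le> ennreal (c * (1 + (norm (x i k \<omega>))\<^sup>2))"
    and A5_iv_past: "\<And>k. prob_space.indep_set M
                  (sigma_sets (space M) (events_of M (L k) \<union> (\<Union>i. events_of M (\<delta> i k))))
                  (sets (\<F> k))"
    and optimal: "ra_optimal f d \<Omega> xstar"
begin

lemma \<alpha>_square_summable: "summable (\<lambda>k. (\<alpha> k)\<^sup>2)"
  using \<alpha>_sq summable_Suc_iff[of "\<lambda>k. (\<alpha> k)\<^sup>2"] by simp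

lemma \<alpha>_diverges: "filterlim (\<lambda>n. sum \<alpha> {..<n}) at_top sequentially"
proof -
  have "sum \<alpha> {..<Suc n} = \<alpha> 0 + (\<Sum>k=1..n. \<alpha> k)" for n
    by (simp add: lessThan_Suc_atMost atMost_atLeast0 sum.atLeast_Suc_atMost[of 0])
  moreover have "filterlim (\<lambda>n. \<alpha> 0 + (\<Sum>k=1..n. \<alpha> k)) at_top sequentially"
    by (rule filterlim_tendsto_add_at_top[OF tendsto_const \<alpha>_sum])
  ultimately have "filterlim (\<lambda>n. sum \<alpha> {..<Suc n}) at_top sequentially" by simp
  then show ?thesis by (rule filterlim_sequentially_Suc[THEN iffD1])
qed

lemma \<alpha>_tendsto_0: "\<alpha> \<longlonglongrightarrow> 0"
proof -
  have "(\<lambda>k. sqrt ((\<alpha> k)\<^sup>2)) \<longlonglongrightarrow> sqrt 0"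
    by (rule tendsto_real_sqrt[OF summable_LIMSEQ_zero[OF \<alpha>_square_summable]])
  then show ?thesis using \<alpha>_pos by (simp add: abs_of_pos)
qed

subsection \<open>Step sizes and Laplacians\<close>

lemma L_entry: "L k \<omega> $ i $ j = (if i = j then (\<Sum>l\<in>UNIV. A k \<omega> $ i $ l) else 0) - A k \<omega> $ i $ j"
  by (simp add: L laplacian_def)

lemma L_meas: "L k \<in> borel_measurable M"
proof -
  have "L k = (\<lambda>\<omega>. laplacian (A k \<omega>))" by (simp add: fun_eq_iff L)
  then show ?thesis
    using measurable_compose[OF A_meas borel_measurable_continuous_onI[OF continuous_on_laplacian]] by simp
qed

lemma L_entry_meas[measurable]: "(\<lambda>\<omega>. L k \<omega> $ i $ j) \<in> borel_measurable M"
  by (intro measurable_entry L_meas)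

lemma A_entry_meas[measurable]: "(\<lambda>\<omega>. A k \<omega> $ i $ j) \<in> borel_measurable M"
  by (intro measurable_entry A_meas)

lemma A_abs: "\<omega> \<in> space M \<Longrightarrow> 0 \<le> A k \<omega> $ i $ j" "\<omega> \<in> space M \<Longrightarrow> A k \<omega> $ i $ j \<le> 1"
  using A_01[of \<omega> k i j] by auto

lemma L_entry_bound: "\<bar>L k \<omega> $ i $ j\<bar> \<le> real CARD('n) + 1" if "\<omega> \<in> space M"
proof -
  have "0 \<le> (\<Sum>l\<in>UNIV. A k \<omega> $ i $ l)" "(\<Sum>l\<in>UNIV. A k \<omega> $ i $ l) \<le> (\<Sum>l\<in>(UNIV :: 'n set). 1)"
    by (rule sum_nonneg, simp add: A_abs[OF that]) (rule sum_mono, rule A_abs(2)[OF that])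
  then show ?thesis using A_abs[OF that, of k i j] by (auto simp: L_entry abs_if)
qed

lemma L_rows: "(\<Sum>j\<in>UNIV. L k \<omega> $ i $ j) = 0"
  by (simp add: L_entry sum_subtractf)

lemma L_off: "\<omega> \<in> space M \<Longrightarrow> i \<noteq> j \<Longrightarrow> L k \<omega> $ i $ j \<le> 0"
  using A_abs by (simp add: L_entry)

lemma L_entry_integrable: "integrable M (\<lambda>\<omega>. L k \<omega> $ i $ j)"
  by (rule integrable_const_bound[where B = "real CARD('n) + 1"]) (use L_entry_bound in auto)

lemma L_integrable: "integrable M (L k)"
proof (rule integrable_const_bound[where B = "\<Sum>i\<in>(UNIV::'n set). \<Sum>j\<in>(UNIV::'n set). real CARD('n) + 1"])
  show "AE \<omega> in M. norm (L k \<omega>) \<le> (\<Sum>i\<in>(UNIV::'n set). \<Sum>j\<in>(UNIV::'n set). real CARD('n) + 1)"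
  proof (intro AE_I2)
    fix \<omega> assume \<omega>: "\<omega> \<in> space M"
    have "norm (L k \<omega>) \<le> (\<Sum>i\<in>UNIV. norm (L k \<omega> $ i))" by (simp add: norm_vec_def L2_set_le_sum)
    also have "\<dots> \<le> (\<Sum>i\<in>UNIV. \<Sum>j\<in>UNIV. \<bar>L k \<omega> $ i $ j\<bar>)" by (intro sum_mono norm_le_l1_cart)
    also have "\<dots> \<le> (\<Sum>i\<in>(UNIV::'n set). \<Sum>j\<in>(UNIV::'n set). real CARD('n) + 1)"
      by (intro sum_mono L_entry_bound \<omega>)
    finally show "norm (L k \<omega>) \<le> (\<Sum>i\<in>(UNIV::'n set). \<Sum>j\<in>(UNIV::'n set). real CARD('n) + 1)" .
  qed
qed (rule L_meas)

lemma Lbar_entry: "Lbar $ i $ j = (\<integral>\<omega>. L k \<omega> $ i $ j \<partial>M)"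
proof -
  have "bounded_linear (\<lambda>B :: real^'n^'n. B $ i $ j)"
    by (rule bounded_linear_compose[OF bounded_linear_vec_nth bounded_linear_vec_nth])
  from integral_bounded_linear[OF this L_integrable[of k]] show ?thesis using A3_mean[of k] by simp
qed

sublocale mean: laplacian_matrix Lbar
proof
  show "Lbar $ i $ j = Lbar $ j $ i" for i j
    using arg_cong[OF A3_sym, of "\<lambda>B. B $ j $ i"] by (simp add: transpose_def)
  show "(\<Sum>j\<in>UNIV. Lbar $ i $ j) = 0" for i
    unfolding Lbar_entry[of _ _ 0] by (subst Bochner_Integration.integral_sum[symmetric]) (auto simp: L_entry_integrable L_rows)
  show "Lbar $ i $ j \<le> 0" if ij: "i \<noteq> j" for i j
  proof -
    have "(\<integral>\<omega>. L 0 \<omega> $ i $ j \<partial>M) \<le> (\<integral>\<omega>. 0 \<partial>M)"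
      using L_off ij by (intro integral_mono L_entry_integrable) auto
    then show ?thesis by (simp add: Lbar_entry[of i j 0])
  qed
qed

abbreviation K :: "real^'m^'n \<Rightarrow> real^'m^'n" where "K X \<equiv> Lbar ** X"

lemma K_range: "D \<in> range K \<longleftrightarrow> (\<Sum>i\<in>UNIV. D $ i) = 0"
  using mean.range_action[OF A3_s2] by blast

subsection \<open>Objective and reference path\<close>

definition F :: "real^'m^'n \<Rightarrow> real" where "F X = (\<Sum>i\<in>UNIV. f i (X $ i))"
definition gF :: "real^'m^'n \<Rightarrow> real^'m^'n" where "gF X = (\<chi> i. gradient (f i) (X $ i))"
definition XS :: "real^'m^'n" where "XS = (\<chi> i. xstar i)"
definition Dv :: "real^'m^'n" where "Dv = (\<chi> i. d i)"

lemma f_convex: "convex_on UNIV (f i)"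
  using A1_convex by (rule strictly_convex_on_imp_convex_on)

lemma f_grad: "GDERIV (f i) y :> gradient (f i) y"
  using A1_diff by (rule GDERIV_gradient)

lemma F_bregman: "F X + gF X \<bullet> (Y - X) + 1 / (4 * l\<^sub>c) * (norm (gF Y - gF X))\<^sup>2 \<le> F Y"
proof -
  have "(\<Sum>i\<in>UNIV. f i (X $ i) + gradient (f i) (X $ i) \<bullet> (Y $ i - X $ i)
      + 1 / (4 * l\<^sub>c) * (norm (gradient (f i) (Y $ i) - gradient (f i) (X $ i)))\<^sup>2) \<le> (\<Sum>i\<in>UNIV. f i (Y $ i))"
    by (intro sum_mono gradient_cocoercive f_convex f_grad A1_lipschitz A1_lc)
  then show ?thesis
    by (simp add: F_def gF_def norm_vec_sq inner_vec_def sum.distrib sum_distrib_left)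
qed

lemma gF_lipschitz: "norm (gF X - gF Y) \<le> l\<^sub>c * norm (X - Y)"
proof -
  have "(norm (gF X - gF Y))\<^sup>2 \<le> (\<Sum>i\<in>UNIV. (l\<^sub>c * norm (X $ i - Y $ i))\<^sup>2)"
    unfolding norm_vec_sq[of "gF X - gF Y"] by (intro sum_mono power_mono) (auto simp: gF_def A1_lipschitz)
  also have "\<dots> = (l\<^sub>c * norm (X - Y))\<^sup>2"
    by (simp add: power_mult_distrib sum_distrib_left norm_vec_sq[of "X - Y"])
  finally show ?thesis by (rule power2_le_imp_le) (use A1_lc in simp)
qed

lemma gF_inj: "gF X = gF Y \<Longrightarrow> X = Y"
proof -
  assume eq: "gF X = gF Y"
  have "X $ i = Y $ i" for i
  proof (rule strictly_convex_gradient_inj[OF A1_convex f_grad])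
    have "gradient (f i) (X $ i) = gradient (f i) (Y $ i)"
      using arg_cong[OF eq, of "\<lambda>u. u $ i"] by (simp add: gF_def)
    then show "GDERIV (f i) (Y $ i) :> gradient (f i) (X $ i)" using f_grad[of i "Y $ i"] by simp
  qed
  then show "X = Y" by (simp add: vec_eq_iff)
qed

lemma K_bound: "0 \<le> onorm K" "norm (K X) \<le> onorm K * norm X" for X :: "real^'m^'n"
proof -
  have "bounded_linear K" by (rule linear_conv_bounded_linear[THEN iffD1, OF linear_matrix_mult])
  then show "0 \<le> onorm K" "norm (K X) \<le> onorm K * norm X" by (rule onorm_pos_le, rule onorm)
qed

lemma \<Omega>_nonempty: "\<Omega> i \<noteq> {}"
  using optimal by (auto simp: ra_optimal_def ra_feasible_def)

definition Pr :: "real^'m^'n \<Rightarrow> real^'m^'n" where "Pr = closest_point (vec_product \<Omega>)"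

lemma Pr_nth: "Pr X $ i = closest_point (\<Omega> i) (X $ i)"
  unfolding Pr_def by (subst closest_point_vec_product) (auto simp: A2_set \<Omega>_nonempty)

lemma Pr_nonexpansive: "norm (Pr X - Pr Y) \<le> norm (X - Y)"
proof -
  have "vec_product \<Omega> \<noteq> {}" using closest_point_in_set[OF A2_set(1) \<Omega>_nonempty]
    by (auto simp: vec_product_def intro!: exI[of _ "Pr 0"] simp: Pr_nth)
  then show ?thesis unfolding Pr_def dist_norm[symmetric]
    by (intro closest_point_lipschitz) (auto intro: convex_vec_product closed_vec_product A2_set)
qed

text \<open>The program is first restricted to the compact product of the sets \<open>\<Omega> i \<inter> cball (xstar i) 1\<close>. Its proximal path converges
  to the optimum, and from the time \<open>k1\<close> on, when it is within distance one, the balls no longer affect the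
  projections.\<close>

lemma reference_path:
  obtains k1 r and X Z \<Lambda> :: "nat \<Rightarrow> real^'m^'n" where
    "\<And>k. k1 \<le> k \<Longrightarrow> X (Suc k) = Pr (X k + \<alpha> k *\<^sub>R (\<Lambda> (Suc k) - gF (X (Suc k))))"
    "\<And>k. k1 \<le> k \<Longrightarrow> Z (Suc k) = Z k + \<alpha> k *\<^sub>R K (\<Lambda> (Suc k))"
    "\<And>k. k1 \<le> k \<Longrightarrow> \<Lambda> (Suc k) = \<Lambda> k + \<alpha> k *\<^sub>R (Dv - X (Suc k) - K (\<Lambda> (Suc k)) - K (Z (Suc k)))"
    "\<And>k. k1 \<le> k \<Longrightarrow> norm (((X (Suc k), Z (Suc k)), \<Lambda> (Suc k)) - ((X k, Z k), \<Lambda> k)) \<le> r * \<alpha> k"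
    "\<And>k. k1 \<le> k \<Longrightarrow> norm (K (\<Lambda> k)) \<le> r" "\<And>k. k1 \<le> k \<Longrightarrow> norm (K (Z k)) \<le> r"
    "X \<longlonglongrightarrow> XS" "\<And>k. k1 \<le> k \<Longrightarrow> \<alpha> k \<le> 1"
proof -
  define C where "C = vec_product (\<lambda>i. \<Omega> i \<inter> cball (xstar i) 1)"
  have feas: "(\<Sum>i\<in>UNIV. xstar i) = (\<Sum>i\<in>UNIV. d i)" "\<And>i. xstar i \<in> \<Omega> i"
    using optimal by (auto simp: ra_optimal_def ra_feasible_def)
  interpret linear_constraint F gF K C Dv XS "1 / (4 * l\<^sub>c)" l\<^sub>c
  proof (rule linear_constraint.intro)
    show "compact C" unfolding C_def by (intro compact_vec_product closed_Int_compact A2_set compact_cball)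
    show "convex C" unfolding C_def by (intro convex_vec_product convex_Int A2_set convex_cball)
    show "XS \<in> C" using feas by (simp add: C_def XS_def vec_product_def)
    show "Dv - XS \<in> range K" using feas by (simp add: K_range Dv_def XS_def sum_subtractf)
    show "F XS \<le> F X" if "X \<in> C" "Dv - X \<in> range K" for X
    proof -
      have "ra_feasible d \<Omega> (\<lambda>i. X $ i)"
        using that by (simp add: K_range Dv_def sum_subtractf ra_feasible_def C_def vec_product_def)
      then show ?thesis using optimal by (simp add: ra_optimal_def F_def XS_def)
    qed
    show "convex_on UNIV F"
    proof (rule convex_onI)
      fix t :: real and X Y :: "real^'m^'n" assume t: "0 < t" "t < 1"
      have "F ((1 - t) *\<^sub>R X + t *\<^sub>R Y) \<le> (\<Sum>i\<in>UNIV. (1 - t) * f i (X $ i) + t * f i (Y $ i))"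
        unfolding F_def using t convex_onD[OF f_convex, of t] by (intro sum_mono) simp
      then show "F ((1 - t) *\<^sub>R X + t *\<^sub>R Y) \<le> (1 - t) * F X + t * F Y"
        by (simp add: F_def sum.distrib sum_distrib_left)
    qed simp
    have "continuous_on UNIV (f i)" for i
      using A1_diff by (intro differentiable_imp_continuous_on) (simp add: differentiable_on_def differentiable_at_withinI)
    then have fc: "continuous_on C (\<lambda>X. f i (X $ i))" for i
      by (rule continuous_on_compose2) (auto intro!: continuous_intros)
    show "continuous_on C F" unfolding F_def
      by (intro continuous_on_sum fc)
    show "0 < 1 / (4 * l\<^sub>c)" using A1_lc by simp
    show "F X + gF X \<bullet> (Y - X) + 1 / (4 * l\<^sub>c) * (norm (gF Y - gF X))\<^sup>2 \<le> F Y" for X Y by (rule F_bregman)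
    show "norm (gF X - gF Y) \<le> l\<^sub>c * norm (X - Y)" for X Y by (rule gF_lipschitz)
    show "X = XS" if "gF X = gF XS" for X using that by (rule gF_inj)
    show "linear K" by (rule linear_matrix_mult)
    show "K X \<bullet> Y = X \<bullet> K Y" for X Y by (rule mean.action_sym)
    show "0 \<le> X \<bullet> K X" for X by (rule mean.action_nonneg)
  qed
  obtain k0 X \<Lambda> Z r where ref:
    "\<And>k. k0 \<le> k \<Longrightarrow> X (Suc k) = closest_point C (X k - \<alpha> k *\<^sub>R (gF (X (Suc k)) - \<Lambda> (Suc k)))"
    "\<And>k. k0 \<le> k \<Longrightarrow> Z (Suc k) = Z k + \<alpha> k *\<^sub>R K (\<Lambda> (Suc k))"
    "\<And>k. k0 \<le> k \<Longrightarrow> \<Lambda> (Suc k) = \<Lambda> k + \<alpha> k *\<^sub>R (Dv - X (Suc k) - K (\<Lambda> (Suc k)) - K (Z (Suc k)))"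
    "\<And>k. k0 \<le> k \<Longrightarrow> norm (((X (Suc k), Z (Suc k)), \<Lambda> (Suc k)) - ((X k, Z k), \<Lambda> k)) \<le> r * \<alpha> k"
    "\<And>k. k0 < k \<Longrightarrow> norm (K (\<Lambda> k)) \<le> r" "\<And>k. k0 < k \<Longrightarrow> norm (K (Z k)) \<le> r" "\<And>k. k0 < k \<Longrightarrow> X k \<in> C"
    "X \<longlonglongrightarrow> XS"
    by (rule proximal_path[OF \<alpha>_pos \<alpha>_diverges \<alpha>_square_summable]) (rule that, assumption+)
  have "\<forall>\<^sub>F k in sequentially. dist (X k) XS < 1" using ref(8) by (rule tendstoD) simp
  moreover have "\<forall>\<^sub>F k in sequentially. \<alpha> k < 1" using \<alpha>_tendsto_0 by (rule order_tendstoD) simp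
  moreover have "\<forall>\<^sub>F k in sequentially. k0 < k" by (rule eventually_gt_at_top)
  ultimately have "\<forall>\<^sub>F k in sequentially. dist (X k) XS < 1 \<and> \<alpha> k < 1 \<and> k0 < k" by eventually_elim simp
  then obtain k1 where k1: "\<And>k. k1 \<le> k \<Longrightarrow> dist (X k) XS < 1 \<and> \<alpha> k < 1 \<and> k0 < k"
    unfolding eventually_sequentially by blast
  show thesis
  proof (rule that[of k1 X \<Lambda> Z r])
    fix k assume k: "k1 \<le> k"
    then have k0: "k0 < k" "k0 \<le> k" "k0 < Suc k" using k1[of k] by auto
    show "X (Suc k) = Pr (X k + \<alpha> k *\<^sub>R (\<Lambda> (Suc k) - gF (X (Suc k))))"
      unfolding vec_eq_iff[of "X (Suc k)"]
    proof
      fix i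
      let ?Y = "X k - \<alpha> k *\<^sub>R (gF (X (Suc k)) - \<Lambda> (Suc k))"
      have Y: "?Y = X k + \<alpha> k *\<^sub>R (\<Lambda> (Suc k) - gF (X (Suc k)))" by (simp add: algebra_simps)
      have "closest_point C ?Y = (\<chi> i. closest_point (\<Omega> i \<inter> cball (xstar i) 1) (?Y $ i))"
        unfolding C_def
      proof (rule closest_point_vec_product)
        fix i
        have "xstar i \<in> \<Omega> i \<inter> cball (xstar i) 1" using feas(2) by simp
        then show "\<Omega> i \<inter> cball (xstar i) 1 \<noteq> {}" by blast
      qed (auto intro!: convex_Int closed_Int A2_set)
      then have "closest_point C ?Y $ i = closest_point (\<Omega> i \<inter> cball (xstar i) 1) (?Y $ i)"
        by (simp only: vec_lambda_beta)
      then have 1: "X (Suc k) $ i = closest_point (\<Omega> i \<inter> cball (xstar i) 1) (?Y $ i)"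
        by (simp only: ref(1)[OF k0(2), symmetric])
      have "dist (X (Suc k) $ i) (XS $ i) \<le> dist (X (Suc k)) XS" by (rule dist_vec_nth_le)
      also have "\<dots> < 1" using k1[of "Suc k"] k by simp
      finally have "dist (xstar i) (X (Suc k) $ i) < 1" by (simp add: XS_def dist_commute)
      moreover have "X (Suc k) $ i \<in> \<Omega> i" using ref(7)[OF k0(3)] by (simp add: C_def vec_product_def)
      ultimately have "X (Suc k) $ i = closest_point (\<Omega> i) (?Y $ i)"
        by (intro closest_point_Int_ball[OF A2_set(2,1) 1])
      then show "X (Suc k) $ i = Pr (X k + \<alpha> k *\<^sub>R (\<Lambda> (Suc k) - gF (X (Suc k)))) $ i"
        unfolding Pr_nth Y .
    qed
    show "Z (Suc k) = Z k + \<alpha> k *\<^sub>R K (\<Lambda> (Suc k))" by (rule ref(2)[OF k0(2)])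
    show "\<Lambda> (Suc k) = \<Lambda> k + \<alpha> k *\<^sub>R (Dv - X (Suc k) - K (\<Lambda> (Suc k)) - K (Z (Suc k)))" by (rule ref(3)[OF k0(2)])
    show "norm (((X (Suc k), Z (Suc k)), \<Lambda> (Suc k)) - ((X k, Z k), \<Lambda> k)) \<le> r * \<alpha> k" by (rule ref(4)[OF k0(2)])
    show "norm (K (\<Lambda> k)) \<le> r" "norm (K (Z k)) \<le> r" by (rule ref(5,6)[OF k0(1)])+
    show "\<alpha> k \<le> 1" using k1[OF k] by simp
  qed (rule ref(8))
qed

subsection \<open>The filtration\<close>

definition gen :: "nat \<Rightarrow> 'w set set" where
  "gen k = ((\<Union>i. events_of M (x i 0) \<union> events_of M (lam i 0) \<union> events_of M (z i 0)) \<union>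
      (\<Union>t<k. events_of M (L t) \<union>
         (\<Union>i. events_of M (\<nu> i t) \<union> events_of M (\<delta> i t)) \<union>
         (\<Union>i j. events_of M (\<zeta> i j t) \<union> events_of M (\<epsilon> i j t))))"

lemma events_of_sets: "Y \<in> borel_measurable M \<Longrightarrow> events_of M Y \<subseteq> sets M"
  by (auto simp: events_of_def measurable_sets)

lemma gen_sets: "gen k \<subseteq> sets M"
  unfolding gen_def by (intro Un_least UN_least events_of_sets init_meas L_meas noise_meas)

lemma gen_Pow: "gen k \<subseteq> Pow (space M)"
  using gen_sets sets.sets_into_space by blast

lemma \<F>_sets: "sets (\<F> k) = sigma_sets (space M) (gen k)" and \<F>_space: "space (\<F> k) = space M"
  using gen_Pow[of k] by (simp_all add: \<F> past_def gen_def)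

lemma \<F>_sub: "subalgebra M (\<F> k)"
  unfolding subalgebra_def \<F>_sets \<F>_space using sets.sigma_sets_subset[OF gen_sets] by simp

lemma \<F>_mono: "sets (\<F> k) \<subseteq> sets (\<F> (Suc k))"
  unfolding \<F>_sets by (intro sigma_sets_mono') (auto simp: gen_def)

sublocale filt: filtered_prob_space M \<F>
  by unfold_locales (rule \<F>_sub \<F>_mono)+

lemma \<F>_measurable_of_events: "events_of M Y \<subseteq> sets (\<F> k) \<Longrightarrow> Y \<in> borel_measurable (\<F> k)"
  by (rule measurableI) (auto simp: \<F>_space events_of_def)

lemma gen_in: "E \<subseteq> gen k \<Longrightarrow> E \<subseteq> sets (\<F> k)"
  unfolding \<F>_sets by (auto intro: sigma_sets.Basic)

lemma initial_adapted: "x i 0 \<in> borel_measurable (\<F> k)" "lam i 0 \<in> borel_measurable (\<F> k)" "z i 0 \<in> borel_measurable (\<F> k)"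
  by (intro \<F>_measurable_of_events gen_in; force simp: gen_def)+

lemma noise_adapted:
  "L k \<in> borel_measurable (\<F> (Suc k))" "\<nu> i k \<in> borel_measurable (\<F> (Suc k))" "\<delta> i k \<in> borel_measurable (\<F> (Suc k))"
  "\<zeta> i j k \<in> borel_measurable (\<F> (Suc k))" "\<epsilon> i j k \<in> borel_measurable (\<F> (Suc k))"
  by (intro \<F>_measurable_of_events gen_in; force simp: gen_def)+

lemma A_from_L: "\<omega> \<in> space M \<Longrightarrow> A k \<omega> $ i $ j = (if i = j then 0 else - L k \<omega> $ i $ j)"
  using A_diag by (simp add: L_entry)

lemma gradient_continuous: "continuous_on UNIV (gradient (f i))"
proof (rule continuous_onI)
  fix y :: "real^'m" and e :: real assume "0 < e"
  then show "\<exists>d>0. \<forall>y'\<in>UNIV. dist y' y < d \<longrightarrow> dist (gradient (f i) y') (gradient (f i) y) \<le> e"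
  proof (intro exI[of _ "e / l\<^sub>c"] conjI ballI impI)
    fix y' assume "dist y' y < e / l\<^sub>c"
    then have "l\<^sub>c * dist y' y \<le> e" using A1_lc by (simp add: field_simps)
    then show "dist (gradient (f i) y') (gradient (f i) y) \<le> e"
      using A1_lipschitz[of i y' y] by (simp add: dist_norm)
  qed (use A1_lc in simp)
qed

lemma adapted: "(\<forall>i. x i k \<in> borel_measurable (\<F> k)) \<and> (\<forall>i. lam i k \<in> borel_measurable (\<F> k)) \<and> (\<forall>i. z i k \<in> borel_measurable (\<F> k))"
proof (induction k)
  case (Suc k)
  have m: "Y \<in> borel_measurable (\<F> k) \<Longrightarrow> Y \<in> borel_measurable (\<F> (Suc k))" for Y :: "'w \<Rightarrow> real^'m"
    by (rule filt.F_measurable_le[of k "Suc k"]) auto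
  have [measurable]: "x i k \<in> borel_measurable (\<F> (Suc k))" "lam i k \<in> borel_measurable (\<F> (Suc k))" "z i k \<in> borel_measurable (\<F> (Suc k))" for i
    using Suc m by blast+
  note noise_adapted[measurable]
  have cp: "closest_point (\<Omega> i) \<in> borel_measurable borel" for i
    by (intro borel_measurable_continuous_onI continuous_on_closest_point) (auto simp: A2_set \<Omega>_nonempty)
  have gr: "gradient (f i) \<in> borel_measurable borel" for i
    by (intro borel_measurable_continuous_onI gradient_continuous)
  have [measurable]: "(\<lambda>\<omega>. gradient (f i) (x i k \<omega>)) \<in> borel_measurable (\<F> (Suc k))" for i
    by (rule measurable_compose[OF _ gr]) measurable
  have Am[measurable]: "(\<lambda>\<omega>. A k \<omega> $ i $ j) \<in> borel_measurable (\<F> (Suc k))" for i j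
  proof (rule measurable_cong[THEN iffD1])
    show "(if i = j then 0 else - L k \<omega> $ i $ j) = A k \<omega> $ i $ j" if "\<omega> \<in> space (\<F> (Suc k))" for \<omega>
      using that A_from_L[of \<omega> k i j] by (simp add: \<F>_space)
    have "(\<lambda>\<omega>. L k \<omega> $ i $ j) \<in> borel_measurable (\<F> (Suc k))" by (intro measurable_entry noise_adapted)
    then show "(\<lambda>\<omega>. if i = j then 0 else - L k \<omega> $ i $ j) \<in> borel_measurable (\<F> (Suc k))" by (cases "i = j") auto
  qed
  have "x i (Suc k) \<in> borel_measurable (\<F> (Suc k))" for i
  proof (rule measurable_cong[THEN iffD2, OF x_step])
    show "(\<lambda>\<omega>. closest_point (\<Omega> i) (x i k \<omega> + \<alpha> k *\<^sub>R (- (gradient (f i) (x i k \<omega>) + \<nu> i k \<omega>) + lam i k \<omega>))) \<in> borel_measurable (\<F> (Suc k))"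
      by (rule measurable_compose[OF _ cp]) measurable
  qed (simp add: \<F>_space)
  moreover have "lam i (Suc k) \<in> borel_measurable (\<F> (Suc k))" for i
    by (rule measurable_cong[THEN iffD2, OF lam_step]) (simp add: \<F>_space, measurable)
  moreover have "z i (Suc k) \<in> borel_measurable (\<F> (Suc k))" for i
    by (rule measurable_cong[THEN iffD2, OF z_step]) (simp add: \<F>_space, measurable)
  ultimately show ?case by blast
qed (use initial_adapted in blast)

end

section \<open>Centred noise\<close>

lemma (in sigma_finite_subalgebra) integral_conditionally_centered:
  fixes Y :: "'a \<Rightarrow> real^'m" and h :: "'a \<Rightarrow> real^'m"
  assumes zero: "AE \<omega> in M. vec_cond_exp M F Y \<omega> = 0" and Y: "Y \<in> borel_measurable M"
    and h: "h \<in> borel_measurable F" and int: "\<And>l. integrable M (\<lambda>\<omega>. h \<omega> $ l * Y \<omega> $ l)"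
  shows "integrable M (\<lambda>\<omega>. Y \<omega> \<bullet> h \<omega>) \<and> (\<integral>\<omega>. Y \<omega> \<bullet> h \<omega> \<partial>M) = 0"
proof -
  have "(\<integral>\<omega>. h \<omega> $ l * Y \<omega> $ l \<partial>M) = 0" for l
  proof -
    have "(\<integral>\<omega>. h \<omega> $ l * Y \<omega> $ l \<partial>M) = (\<integral>\<omega>. h \<omega> $ l * real_cond_exp M F (\<lambda>\<omega>. Y \<omega> $ l) \<omega> \<partial>M)"
      by (rule real_cond_exp_intg(2)[symmetric]) (intro int measurable_entry h Y)+
    also have "\<dots> = (\<integral>\<omega>. 0 \<partial>M)"
    proof (rule integral_cong_AE)
      show "AE \<omega> in M. h \<omega> $ l * real_cond_exp M F (\<lambda>\<omega>. Y \<omega> $ l) \<omega> = 0"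
        using zero by eventually_elim (simp add: vec_cond_exp_def vec_eq_iff)
      show "(\<lambda>\<omega>. h \<omega> $ l * real_cond_exp M F (\<lambda>\<omega>. Y \<omega> $ l) \<omega>) \<in> borel_measurable M"
        by (intro borel_measurable_times borel_measurable_cond_exp2 measurable_entry measurable_from_subalg[OF subalg h])
    qed simp
    finally show ?thesis by simp
  qed
  moreover have "Y \<omega> \<bullet> h \<omega> = (\<Sum>l\<in>UNIV. h \<omega> $ l * Y \<omega> $ l)" for \<omega>
    by (simp add: inner_vec_def mult.commute)
  ultimately show ?thesis using int by simp
qed

lemma (in sigma_finite_subalgebra) conditional_square_bound:
  fixes Y :: "'a \<Rightarrow> 'b::euclidean_space"
  assumes bound: "AE \<omega> in M. nn_cond_exp M F (\<lambda>\<omega>. ennreal ((norm (Y \<omega>))\<^sup>2)) \<omega> \<le> ennreal (b \<omega>)"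
    and Y[measurable]: "Y \<in> borel_measurable M" and A: "A \<in> sets F"
    and b: "\<And>\<omega>. 0 \<le> b \<omega>" "integrable M (\<lambda>\<omega>. indicator A \<omega> * b \<omega>)"
  shows "integrable M (\<lambda>\<omega>. indicator A \<omega> * (norm (Y \<omega>))\<^sup>2) \<and>
    (\<integral>\<omega>. indicator A \<omega> * (norm (Y \<omega>))\<^sup>2 \<partial>M) \<le> (\<integral>\<omega>. indicator A \<omega> * b \<omega> \<partial>M)"
proof -
  have AM[measurable]: "A \<in> sets M" using A subalg by (auto simp: subalgebra_def)
  have "(\<integral>\<^sup>+\<omega>. ennreal (indicator A \<omega> * (norm (Y \<omega>))\<^sup>2) \<partial>M) = (\<integral>\<^sup>+\<omega>. indicator A \<omega> * ennreal ((norm (Y \<omega>))\<^sup>2) \<partial>M)"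
    by (intro nn_integral_cong) (auto simp: indicator_def)
  also have "\<dots> = (\<integral>\<^sup>+\<omega>. indicator A \<omega> * nn_cond_exp M F (\<lambda>\<omega>. ennreal ((norm (Y \<omega>))\<^sup>2)) \<omega> \<partial>M)"
    by (rule nn_cond_exp_intg[symmetric]) (use A in auto)
  also have "\<dots> \<le> (\<integral>\<^sup>+\<omega>. ennreal (indicator A \<omega> * b \<omega>) \<partial>M)"
    by (rule nn_integral_mono_AE) (use bound in eventually_elim, auto simp: indicator_def)
  also have "\<dots> = ennreal (\<integral>\<omega>. indicator A \<omega> * b \<omega> \<partial>M)"
    by (rule nn_integral_eq_integral[OF b(2)]) (simp add: b(1))
  finally have le: "(\<integral>\<^sup>+\<omega>. ennreal (indicator A \<omega> * (norm (Y \<omega>))\<^sup>2) \<partial>M) \<le> ennreal (\<integral>\<omega>. indicator A \<omega> * b \<omega> \<partial>M)" .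
  have int: "integrable M (\<lambda>\<omega>. indicator A \<omega> * (norm (Y \<omega>))\<^sup>2)"
  proof (rule integrableI_nonneg)
    show "(\<integral>\<^sup>+\<omega>. ennreal (indicator A \<omega> * (norm (Y \<omega>))\<^sup>2) \<partial>M) < \<infinity>"
      using le ennreal_less_top[of "\<integral>\<omega>. indicator A \<omega> * b \<omega> \<partial>M"] by (simp add: le_less_trans)
  qed auto
  have "ennreal (\<integral>\<omega>. indicator A \<omega> * (norm (Y \<omega>))\<^sup>2 \<partial>M) = (\<integral>\<^sup>+\<omega>. ennreal (indicator A \<omega> * (norm (Y \<omega>))\<^sup>2) \<partial>M)"
    by (rule nn_integral_eq_integral[symmetric, OF int]) simp
  with le have "ennreal (\<integral>\<omega>. indicator A \<omega> * (norm (Y \<omega>))\<^sup>2 \<partial>M) \<le> ennreal (\<integral>\<omega>. indicator A \<omega> * b \<omega> \<partial>M)" by simp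
  then have "(\<integral>\<omega>. indicator A \<omega> * (norm (Y \<omega>))\<^sup>2 \<partial>M) \<le> (\<integral>\<omega>. indicator A \<omega> * b \<omega> \<partial>M)"
    by (subst (asm) ennreal_le_iff) (intro integral_nonneg_AE AE_I2, simp add: b(1))
  with int show ?thesis by blast
qed

lemma norm_matrix_mult_le:
  fixes B :: "real^'n^'n" and Y :: "real^'m^'n"
  assumes "\<And>i j. \<bar>B $ i $ j\<bar> \<le> b" "0 \<le> b"
  shows "norm (B ** Y) \<le> (real CARD('n))\<^sup>2 * b * norm Y"
proof -
  have "norm (B ** Y) \<le> (\<Sum>i\<in>UNIV. norm ((B ** Y) $ i))" by (simp add: norm_vec_def L2_set_le_sum)
  also have "\<dots> \<le> (\<Sum>i\<in>(UNIV::'n set). \<Sum>j\<in>(UNIV::'n set). b * norm Y)"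
    unfolding matrix_mult_row
    by (intro sum_mono order.trans[OF norm_sum])
      (auto intro!: mult_mono assms Finite_Cartesian_Product.norm_nth_le)
  also have "\<dots> = (real CARD('n))\<^sup>2 * b * norm Y" by (simp add: power2_eq_square)
  finally show ?thesis .
qed

text \<open>Every noise term will be shown to be \<open>centered\<close> after multiplication by a bounded function of the past; testing
  against such functions expresses that the conditional mean is zero.\<close>

definition (in prob_space) centered :: "('a \<Rightarrow> real) \<Rightarrow> bool" where
  "centered g \<longleftrightarrow> integrable M g \<and> integral\<^sup>L M g = 0"

context prob_space begin

lemma centered_add: "centered g \<Longrightarrow> centered h \<Longrightarrow> centered (\<lambda>\<omega>. g \<omega> + h \<omega>)"
  and centered_diff: "centered g \<Longrightarrow> centered h \<Longrightarrow> centered (\<lambda>\<omega>. g \<omega> - h \<omega>)"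
  and centered_scale: "centered g \<Longrightarrow> centered (\<lambda>\<omega>. a * g \<omega>)"
  and centered_sum: "(\<And>i. i \<in> I \<Longrightarrow> centered (\<lambda>\<omega>. G i \<omega>)) \<Longrightarrow> centered (\<lambda>\<omega>. \<Sum>i\<in>I. G i \<omega>)"
  by (auto simp: centered_def)

end

context stochastic_allocation begin

lemma sigma_finite_\<F>: "sigma_finite_subalgebra M (\<F> k)"
  by (rule finite_measure_subalgebra_is_sigma_finite) (unfold_locales, rule \<F>_sub)

lemma \<F>'_sets: "sets (\<F>' k) = sigma_sets (space M) (sets (\<F> k) \<union> events_of M (L k))"
  and \<F>'_space: "space (\<F>' k) = space M"
proof -
  have "sets (\<F> k) \<union> events_of M (L k) \<subseteq> Pow (space M)"
    using filt.F_sets sets.sets_into_space by (fastforce simp: events_of_def)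
  then show "sets (\<F>' k) = sigma_sets (space M) (sets (\<F> k) \<union> events_of M (L k))" "space (\<F>' k) = space M"
    unfolding \<F>' past_graph_def by (simp_all add: \<F>)
qed

lemma \<F>'_sub: "subalgebra M (\<F>' k)"
  unfolding subalgebra_def \<F>'_sets \<F>'_space
  using sets.sigma_sets_subset[of "sets (\<F> k) \<union> events_of M (L k)" M] filt.F_sets events_of_sets[OF L_meas] by blast

lemma sigma_finite_\<F>': "sigma_finite_subalgebra M (\<F>' k)"
  by (rule finite_measure_subalgebra_is_sigma_finite) (unfold_locales, rule \<F>'_sub)

lemma \<F>_le_\<F>': "sets (\<F> k) \<subseteq> sets (\<F>' k)"
  unfolding \<F>'_sets by (auto intro: sigma_sets.Basic)

lemma \<F>'_measurable: "h \<in> borel_measurable (\<F> k) \<Longrightarrow> h \<in> borel_measurable (\<F>' k)"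
  by (rule measurable_from_subalg) (auto simp: subalgebra_def \<F>_le_\<F>'[THEN subsetD] \<F>_space \<F>'_space)

lemma A_entry_\<F>': "(\<lambda>\<omega>. A k \<omega> $ i $ j) \<in> borel_measurable (\<F>' k)"
proof (rule measurable_cong[THEN iffD1])
  show "(if i = j then 0 else - L k \<omega> $ i $ j) = A k \<omega> $ i $ j" if "\<omega> \<in> space (\<F>' k)" for \<omega>
    using that A_from_L[of \<omega> k i j] by (simp add: \<F>'_space)
  have "L k \<in> borel_measurable (\<F>' k)"
    by (rule measurableI) (auto simp: \<F>'_space \<F>'_sets events_of_def intro!: sigma_sets.Basic)
  then have "(\<lambda>\<omega>. L k \<omega> $ i $ j) \<in> borel_measurable (\<F>' k)" by (intro measurable_entry)
  then show "(\<lambda>\<omega>. if i = j then 0 else - L k \<omega> $ i $ j) \<in> borel_measurable (\<F>' k)" by (cases "i = j") auto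
qed

lemma entry_product_integrable:
  fixes Y h :: "'w \<Rightarrow> real^'m"
  assumes "integrable M (\<lambda>\<omega>. indicator B \<omega> * (norm (Y \<omega>))\<^sup>2)" "integrable M (\<lambda>\<omega>. (norm (h \<omega>))\<^sup>2)"
    and Y: "Y \<in> borel_measurable M" and h: "h \<in> borel_measurable M"
    and supp: "\<And>\<omega>. \<omega> \<in> space M \<Longrightarrow> \<omega> \<notin> B \<Longrightarrow> h \<omega> = 0"
  shows "integrable M (\<lambda>\<omega>. h \<omega> $ l * Y \<omega> $ l)"
proof (rule Bochner_Integration.integrable_bound)
  show "integrable M (\<lambda>\<omega>. indicator B \<omega> * (norm (Y \<omega>))\<^sup>2 + (norm (h \<omega>))\<^sup>2)" using assms by simp
  show "(\<lambda>\<omega>. h \<omega> $ l * Y \<omega> $ l) \<in> borel_measurable M" by (intro borel_measurable_times measurable_entry h Y)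
  show "AE \<omega> in M. norm (h \<omega> $ l * Y \<omega> $ l) \<le> norm (indicator B \<omega> * (norm (Y \<omega>))\<^sup>2 + (norm (h \<omega>))\<^sup>2)"
  proof (intro AE_I2)
    fix \<omega> assume \<omega>: "\<omega> \<in> space M"
    show "norm (h \<omega> $ l * Y \<omega> $ l) \<le> norm (indicator B \<omega> * (norm (Y \<omega>))\<^sup>2 + (norm (h \<omega>))\<^sup>2)"
    proof (cases "\<omega> \<in> B")
      case True
      have "\<bar>h \<omega> $ l\<bar> * \<bar>Y \<omega> $ l\<bar> \<le> norm (h \<omega>) * norm (Y \<omega>)"
        by (intro mult_mono component_le_norm_cart) auto
      also have "\<dots> \<le> (norm (Y \<omega>))\<^sup>2 + (norm (h \<omega>))\<^sup>2"
        using sum_squares_bound[of "norm (h \<omega>)" "norm (Y \<omega>)"] zero_le_power2[of "norm (Y \<omega>)"] zero_le_power2[of "norm (h \<omega>)"]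
          mult_nonneg_nonneg[of "norm (h \<omega>)" "norm (Y \<omega>)"] by linarith
      finally show ?thesis using True by (simp add: abs_mult)
    qed (use supp[OF \<omega>] in simp)
  qed
qed

text \<open>The conditional variance of \<open>\<nu>\<close> may be unbounded, so \<open>h\<close> has to vanish outside an event on which
  \<open>\<nu>\<close> is square integrable.\<close>

lemma centered_\<nu>:
  assumes B: "B \<in> sets (\<F> k)" and sq: "integrable M (\<lambda>\<omega>. indicator B \<omega> * (norm (\<nu> i k \<omega>))\<^sup>2)"
    and h: "h \<in> borel_measurable (\<F> k)" "integrable M (\<lambda>\<omega>. (norm (h \<omega>))\<^sup>2)"
    and supp: "\<And>\<omega>. \<omega> \<in> space M \<Longrightarrow> \<omega> \<notin> B \<Longrightarrow> h \<omega> = 0"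
  shows "centered (\<lambda>\<omega>. \<nu> i k \<omega> \<bullet> h \<omega>)"
proof -
  interpret S: sigma_finite_subalgebra M "\<F> k" by (rule sigma_finite_\<F>)
  show ?thesis unfolding centered_def
    by (rule S.integral_conditionally_centered[OF A5_iii(1) noise_meas(1) h(1)])
       (rule entry_product_integrable[OF sq h(2) noise_meas(1) filt.F_measurable[OF h(1)] supp])
qed

lemma square_integrable_noise:
  "integrable M (\<lambda>\<omega>. (norm (\<zeta> i j k \<omega>))\<^sup>2)" "(\<integral>\<omega>. (norm (\<zeta> i j k \<omega>))\<^sup>2 \<partial>M) \<le> \<mu>\<^sup>2"
  "integrable M (\<lambda>\<omega>. (norm (\<epsilon> i j k \<omega>))\<^sup>2)" "(\<integral>\<omega>. (norm (\<epsilon> i j k \<omega>))\<^sup>2 \<partial>M) \<le> \<mu>\<^sup>2"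
proof -
  interpret S: sigma_finite_subalgebra M "\<F>' k" by (rule sigma_finite_\<F>')
  have sp: "space M \<in> sets (\<F>' k)" using sets.top[of "\<F>' k"] by (simp add: \<F>'_space)
  have i: "integrable M (\<lambda>\<omega>. indicator (space M) \<omega> * \<mu>\<^sup>2)"
    by (intro integrable_mult_left integrable_const_bound[where B = 1]) (auto simp: indicator_def)
  have cong: "integrable M (\<lambda>\<omega>. indicator (space M) \<omega> * g \<omega>) = integrable M g"
    "(\<integral>\<omega>. indicator (space M) \<omega> * g \<omega> \<partial>M) = integral\<^sup>L M g" for g :: "'w \<Rightarrow> real"
    by (intro Bochner_Integration.integrable_cong Bochner_Integration.integral_cong; simp)+
  show "integrable M (\<lambda>\<omega>. (norm (\<zeta> i j k \<omega>))\<^sup>2)" "(\<integral>\<omega>. (norm (\<zeta> i j k \<omega>))\<^sup>2 \<partial>M) \<le> \<mu>\<^sup>2"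
    using S.conditional_square_bound[OF A5_ii(1) noise_meas(3) sp _ i] by (auto simp: cong prob_space)
  show "integrable M (\<lambda>\<omega>. (norm (\<epsilon> i j k \<omega>))\<^sup>2)" "(\<integral>\<omega>. (norm (\<epsilon> i j k \<omega>))\<^sup>2 \<partial>M) \<le> \<mu>\<^sup>2"
    using S.conditional_square_bound[OF A5_ii(2) noise_meas(4) sp _ i] by (auto simp: cong prob_space)
qed

text \<open>The link noises are centred given the graph at the same time, so the adjacency entries may be absorbed into the factor \<open>h\<close>.\<close>

lemma centered_link_noise:
  assumes h: "h \<in> borel_measurable (\<F> k)" "\<And>\<omega>. \<omega> \<in> space M \<Longrightarrow> norm (h \<omega>) \<le> cst"
  shows "centered (\<lambda>\<omega>. A k \<omega> $ i $ j * (\<zeta> i j k \<omega> \<bullet> h \<omega>))" "centered (\<lambda>\<omega>. A k \<omega> $ i $ j * (\<epsilon> i j k \<omega> \<bullet> h \<omega>))"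
proof -
  interpret S: sigma_finite_subalgebra M "\<F>' k" by (rule sigma_finite_\<F>')
  define h' where "h' \<omega> = A k \<omega> $ i $ j *\<^sub>R h \<omega>" for \<omega>
  have h': "h' \<in> borel_measurable (\<F>' k)"
    unfolding h'_def by (intro borel_measurable_scaleR A_entry_\<F>' \<F>'_measurable h)
  have h'M[measurable]: "h' \<in> borel_measurable M" by (rule measurable_from_subalg[OF \<F>'_sub h'])
  have i: "integrable M (\<lambda>\<omega>. (norm (h' \<omega>))\<^sup>2)"
  proof (rule integrable_const_bound[where B = "cst\<^sup>2"])
    show "AE \<omega> in M. norm ((norm (h' \<omega>))\<^sup>2) \<le> cst\<^sup>2"
    proof (intro AE_I2)
      fix \<omega> assume \<omega>: "\<omega> \<in> space M"
      have "norm (h' \<omega>) \<le> 1 * norm (h \<omega>)"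
        unfolding h'_def norm_scaleR using A_abs[OF \<omega>, of k i j] by (intro mult_right_mono) auto
      then have "norm (h' \<omega>) \<le> cst" using h(2)[OF \<omega>] by simp
      then show "norm ((norm (h' \<omega>))\<^sup>2) \<le> cst\<^sup>2" by (simp add: power_mono)
    qed
  qed measurable
  have sp: "integrable M (\<lambda>\<omega>. indicator (space M) \<omega> * g \<omega>)" if "integrable M g" for g :: "'w \<Rightarrow> real"
    using that by (subst Bochner_Integration.integrable_cong[where g = g]) auto
  have "centered (\<lambda>\<omega>. \<zeta> i j k \<omega> \<bullet> h' \<omega>)" unfolding centered_def
    by (rule S.integral_conditionally_centered[OF A5_i(1) noise_meas(3) h'])
       (rule entry_product_integrable[OF sp[OF square_integrable_noise(1)] i noise_meas(3) h'M], simp)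
  then show "centered (\<lambda>\<omega>. A k \<omega> $ i $ j * (\<zeta> i j k \<omega> \<bullet> h \<omega>))" by (simp add: h'_def)
  have "centered (\<lambda>\<omega>. \<epsilon> i j k \<omega> \<bullet> h' \<omega>)" unfolding centered_def
    by (rule S.integral_conditionally_centered[OF A5_i(2) noise_meas(4) h'])
       (rule entry_product_integrable[OF sp[OF square_integrable_noise(3)] i noise_meas(4) h'M], simp)
  then show "centered (\<lambda>\<omega>. A k \<omega> $ i $ j * (\<epsilon> i j k \<omega> \<bullet> h \<omega>))" by (simp add: h'_def)
qed

text \<open>The Laplacian and the resource noises at time \<open>k\<close> are jointly independent of the past.\<close>

lemma independent_product:
  fixes Y h :: "'w \<Rightarrow> real"
  assumes Y: "Y \<in> borel_measurable (sigma (space M) (events_of M (L k) \<union> (\<Union>i. events_of M (\<delta> i k))))"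
    and iY: "integrable M Y" and h: "h \<in> borel_measurable (\<F> k)" and ih: "integrable M h"
  shows "integrable M (\<lambda>\<omega>. Y \<omega> * h \<omega>)" "(\<integral>\<omega>. Y \<omega> * h \<omega> \<partial>M) = integral\<^sup>L M Y * integral\<^sup>L M h"
proof -
  let ?G = "events_of M (L k) \<union> (\<Union>i. events_of M (\<delta> i k))"
  have G: "?G \<subseteq> Pow (space M)" by (auto simp: events_of_def)
  have "indep_var borel Y borel h"
    unfolding indep_var_eq
  proof (intro conjI)
    show "random_variable borel Y" "random_variable borel h" using iY ih by auto
    have 1: "sigma_sets (space M) {Y -` B \<inter> space M |B. B \<in> sets borel} \<subseteq> sigma_sets (space M) ?G"
    proof (rule sigma_sets_mono, rule subsetI)
      fix E assume "E \<in> {Y -` B \<inter> space M |B. B \<in> sets borel}"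
      then obtain B where E: "E = Y -` B \<inter> space M" "B \<in> sets borel" by blast
      have "Y -` B \<inter> space (sigma (space M) ?G) \<in> sets (sigma (space M) ?G)" by (rule measurable_sets[OF Y E(2)])
      then show "E \<in> sigma_sets (space M) ?G" using G by (simp add: E(1))
    qed
    have 2: "sigma_sets (space M) {h -` B \<inter> space M |B. B \<in> sets borel} \<subseteq> sets (\<F> k)"
    proof -
      have "{h -` B \<inter> space M |B. B \<in> sets borel} \<subseteq> sets (\<F> k)"
        using measurable_sets[OF h] by (auto simp: \<F>_space)
      then show ?thesis using sets.sigma_sets_subset[of _ "\<F> k"] by (simp add: \<F>_space)
    qed
    show "indep_set (sigma_sets (space M) {Y -` B \<inter> space M |B. B \<in> sets borel}) (sigma_sets (space M) {h -` B \<inter> space M |B. B \<in> sets borel})"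
      unfolding indep_set_def
      by (rule indep_sets_mono_sets[OF A5_iv_past[of k, unfolded indep_set_def]]) (use 1 2 in \<open>auto split: bool.split\<close>)
  qed
  then show "integrable M (\<lambda>\<omega>. Y \<omega> * h \<omega>)" "(\<integral>\<omega>. Y \<omega> * h \<omega> \<partial>M) = integral\<^sup>L M Y * integral\<^sup>L M h"
    using indep_var_integrable[OF _ iY ih] indep_var_lebesgue_integral[OF _ iY ih] by blast+
qed

lemma \<delta>_entry_integrable: "integrable M (\<lambda>\<omega>. \<delta> i k \<omega> $ l)" and \<delta>_entry_mean: "(\<integral>\<omega>. \<delta> i k \<omega> $ l \<partial>M) = 0"
proof -
  have "integrable M (\<delta> i k)"
  proof (rule Bochner_Integration.integrable_bound)
    show "integrable M (\<lambda>\<omega>. 1 + (norm (\<delta> i k \<omega>))\<^sup>2)" using A4_moment[of i k] by simp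
    show "AE \<omega> in M. norm (\<delta> i k \<omega>) \<le> norm (1 + (norm (\<delta> i k \<omega>))\<^sup>2)"
    proof (intro AE_I2)
      fix \<omega>
      have "0 \<le> (norm (\<delta> i k \<omega>) - 1)\<^sup>2" by simp
      then have "2 * norm (\<delta> i k \<omega>) \<le> 1 + (norm (\<delta> i k \<omega>))\<^sup>2" by (simp add: power2_diff)
      then show "norm (\<delta> i k \<omega>) \<le> norm (1 + (norm (\<delta> i k \<omega>))\<^sup>2)" using norm_ge_zero[of "\<delta> i k \<omega>"]
        unfolding real_norm_def by linarith
    qed
  qed (rule noise_meas)
  then show "integrable M (\<lambda>\<omega>. \<delta> i k \<omega> $ l)" "(\<integral>\<omega>. \<delta> i k \<omega> $ l \<partial>M) = 0"
    using integrable_bounded_linear[OF bounded_linear_vec_nth, of M "\<delta> i k" l]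
      integral_bounded_linear[OF bounded_linear_vec_nth, of M "\<delta> i k" l] A4_mean[of i k] by simp_all
qed

lemma fresh_measurable:
  "L k \<in> borel_measurable (sigma (space M) (events_of M (L k) \<union> (\<Union>i. events_of M (\<delta> i k))))"
  "\<delta> i k \<in> borel_measurable (sigma (space M) (events_of M (L k) \<union> (\<Union>i. events_of M (\<delta> i k))))"
proof -
  have G: "events_of M (L k) \<union> (\<Union>i. events_of M (\<delta> i k)) \<subseteq> Pow (space M)" by (auto simp: events_of_def)
  show "L k \<in> borel_measurable (sigma (space M) (events_of M (L k) \<union> (\<Union>i. events_of M (\<delta> i k))))"
    "\<delta> i k \<in> borel_measurable (sigma (space M) (events_of M (L k) \<union> (\<Union>i. events_of M (\<delta> i k))))"
    using G by (intro measurableI; force simp: events_of_def intro!: sigma_sets.Basic)+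
qed

lemma centered_\<delta>:
  assumes h: "h \<in> borel_measurable (\<F> k)" "\<And>\<omega>. \<omega> \<in> space M \<Longrightarrow> norm (h \<omega>) \<le> cst"
  shows "centered (\<lambda>\<omega>. \<delta> i k \<omega> \<bullet> h \<omega>)"
proof -
  have "centered (\<lambda>\<omega>. \<delta> i k \<omega> $ l * h \<omega> $ l)" for l
  proof -
    have m: "(\<lambda>\<omega>. h \<omega> $ l) \<in> borel_measurable (\<F> k)" by (intro measurable_entry h)
    have i: "integrable M (\<lambda>\<omega>. h \<omega> $ l)"
    proof (rule integrable_const_bound[where B = cst])
      show "AE \<omega> in M. norm (h \<omega> $ l) \<le> cst"
      proof (intro AE_I2)
        fix \<omega> assume "\<omega> \<in> space M"
        then show "norm (h \<omega> $ l) \<le> cst" using h(2)[of \<omega>] component_le_norm_cart[of "h \<omega>" l] by simp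
      qed
    qed (rule filt.F_measurable[OF m])
    show ?thesis unfolding centered_def
      using independent_product[OF measurable_entry[OF fresh_measurable(2)] \<delta>_entry_integrable m i] by (simp add: \<delta>_entry_mean)
  qed
  then have "centered (\<lambda>\<omega>. \<Sum>l\<in>UNIV. \<delta> i k \<omega> $ l * h \<omega> $ l)" by (intro centered_sum)
  then show ?thesis by (simp add: inner_vec_def)
qed

lemma centered_L:
  assumes h: "h \<in> borel_measurable (\<F> k)" "\<And>\<omega>. \<omega> \<in> space M \<Longrightarrow> \<bar>h \<omega>\<bar> \<le> cst"
  shows "centered (\<lambda>\<omega>. (L k \<omega> $ i $ j - Lbar $ i $ j) * h \<omega>)"
proof -
  have i: "integrable M h"
    by (rule integrable_const_bound[where B = cst]) (use filt.F_measurable[OF h(1)] h(2) in auto)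
  have Y: "(\<lambda>\<omega>. L k \<omega> $ i $ j - Lbar $ i $ j) \<in> borel_measurable (sigma (space M) (events_of M (L k) \<union> (\<Union>i. events_of M (\<delta> i k))))"
    by (intro borel_measurable_diff measurable_entry fresh_measurable) auto
  have iY: "integrable M (\<lambda>\<omega>. L k \<omega> $ i $ j - Lbar $ i $ j)" using L_entry_integrable by simp
  have "(\<integral>\<omega>. L k \<omega> $ i $ j - Lbar $ i $ j \<partial>M) = 0"
    using L_entry_integrable[of k i j] Lbar_entry[of i j k] by (simp add: prob_space)
  then show ?thesis unfolding centered_def using independent_product[OF Y iY h(1) i] by simp
qed

lemma \<delta>_moment: "(\<integral>\<omega>. (norm (\<delta> i k \<omega>))\<^sup>2 \<partial>M) = (\<integral>\<omega>. (norm (\<delta> i 0 \<omega>))\<^sup>2 \<partial>M)"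
proof -
  have "distr M borel (\<delta> i k) = distr M borel (\<delta> i 0)" using A4_iid by (simp add: iid_def)
  then have "integral\<^sup>L (distr M borel (\<delta> i k)) (\<lambda>y. (norm y)\<^sup>2) = integral\<^sup>L (distr M borel (\<delta> i 0)) (\<lambda>y. (norm y)\<^sup>2)" by simp
  then show ?thesis by (simp add: integral_distr[OF noise_meas(2)])
qed

end

section \<open>Comparison with the reference path\<close>

locale referenced_allocation = stochastic_allocation M f d \<Omega> A L Lbar \<alpha> x lam z \<nu> \<delta> \<zeta> \<epsilon> \<F> \<F>' l\<^sub>c \<mu> c xstar
  for M :: "'w measure" and f :: "'n::finite \<Rightarrow> real^'m \<Rightarrow> real" and d \<Omega> A L Lbar \<alpha> x lam z \<nu> \<delta> \<zeta> \<epsilon> \<F> \<F>' l\<^sub>c \<mu> c xstar +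
  fixes k1 :: nat and r :: real and xh zh lh :: "nat \<Rightarrow> real^'m^'n"
  assumes xh_step: "\<And>k. k1 \<le> k \<Longrightarrow> xh (Suc k) = Pr (xh k + \<alpha> k *\<^sub>R (lh (Suc k) - gF (xh (Suc k))))"
    and zh_step: "\<And>k. k1 \<le> k \<Longrightarrow> zh (Suc k) = zh k + \<alpha> k *\<^sub>R K (lh (Suc k))"
    and lh_step: "\<And>k. k1 \<le> k \<Longrightarrow> lh (Suc k) = lh k + \<alpha> k *\<^sub>R (Dv - xh (Suc k) - K (lh (Suc k)) - K (zh (Suc k)))"
    and ref_speed: "\<And>k. k1 \<le> k \<Longrightarrow> norm (((xh (Suc k), zh (Suc k)), lh (Suc k)) - ((xh k, zh k), lh k)) \<le> r * \<alpha> k"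
    and ref_K: "\<And>k. k1 \<le> k \<Longrightarrow> norm (K (lh k)) \<le> r" "\<And>k. k1 \<le> k \<Longrightarrow> norm (K (zh k)) \<le> r"
    and xh_lim: "xh \<longlonglongrightarrow> XS" and \<alpha>_le: "\<And>k. k1 \<le> k \<Longrightarrow> \<alpha> k \<le> 1"
begin

definition Xv :: "nat \<Rightarrow> 'w \<Rightarrow> real^'m^'n" where "Xv k \<omega> = (\<chi> i. x i k \<omega>)"
definition Lv :: "nat \<Rightarrow> 'w \<Rightarrow> real^'m^'n" where "Lv k \<omega> = (\<chi> i. lam i k \<omega>)"
definition Zv :: "nat \<Rightarrow> 'w \<Rightarrow> real^'m^'n" where "Zv k \<omega> = (\<chi> i. z i k \<omega>)"
definition E :: "nat \<Rightarrow> 'w \<Rightarrow> ((real^'m^'n) \<times> (real^'m^'n)) \<times> (real^'m^'n)" where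
  "E k \<omega> = ((Xv k \<omega>, Zv k \<omega>), Lv k \<omega>) - ((xh k, zh k), lh k)"
text \<open>The noises that agent \<open>i\<close> receives over its links.\<close>

definition link :: "('n \<Rightarrow> 'n \<Rightarrow> nat \<Rightarrow> 'w \<Rightarrow> real^'m) \<Rightarrow> nat \<Rightarrow> 'w \<Rightarrow> real^'m^'n" where
  "link Y k \<omega> = (\<chi> i. \<Sum>j\<in>UNIV. A k \<omega> $ i $ j *\<^sub>R Y i j k \<omega>)"
text \<open>The total noise in the three update rules. The fluctuation of the Laplacian counts as noise.\<close>

definition nx :: "nat \<Rightarrow> 'w \<Rightarrow> real^'m^'n" where "nx k \<omega> = (\<chi> i. - \<nu> i k \<omega>)"
definition nz :: "nat \<Rightarrow> 'w \<Rightarrow> real^'m^'n" where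
  "nz k \<omega> = (L k \<omega> - Lbar) ** Lv k \<omega> - link \<zeta> k \<omega>"
definition nl :: "nat \<Rightarrow> 'w \<Rightarrow> real^'m^'n" where
  "nl k \<omega> = (\<chi> i. \<delta> i k \<omega>) + link \<zeta> k \<omega> + link \<epsilon> k \<omega> - (L k \<omega> - Lbar) ** (Lv k \<omega> + Zv k \<omega>)"

lemma r_nonneg: "0 \<le> r" using ref_K(1)[of k1] norm_ge_zero order.trans by blast

lemma laplacian_action: "(\<Sum>j\<in>UNIV. A k \<omega> $ i $ j *\<^sub>R (y i - y j)) = (L k \<omega> ** (\<chi> j. y j)) $ i"
  for y :: "'n \<Rightarrow> real^'m"
proof -
  have "(L k \<omega> ** (\<chi> j. y j)) $ i = (\<Sum>j\<in>UNIV. (if i = j then (\<Sum>l\<in>UNIV. A k \<omega> $ i $ l) *\<^sub>R y j else 0) - A k \<omega> $ i $ j *\<^sub>R y j)"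
    unfolding matrix_mult_row L_entry by (intro sum.cong) (auto simp: scaleR_left_diff_distrib)
  also have "\<dots> = (\<Sum>j\<in>UNIV. A k \<omega> $ i $ j *\<^sub>R (y i - y j))"
    by (simp add: sum_subtractf scaleR_right_diff_distrib scaleR_left.sum)
  finally show ?thesis ..
qed

lemma laplacian_action': "(\<Sum>j\<in>UNIV. A k \<omega> $ i $ j *\<^sub>R (y i - (y j + e j))) = (L k \<omega> ** (\<chi> j. y j)) $ i - (\<Sum>j\<in>UNIV. A k \<omega> $ i $ j *\<^sub>R e j)"
  for y e :: "'n \<Rightarrow> real^'m"
proof -
  have "(\<Sum>j\<in>UNIV. A k \<omega> $ i $ j *\<^sub>R (y i - (y j + e j))) = (\<Sum>j\<in>UNIV. A k \<omega> $ i $ j *\<^sub>R (y i - y j) - A k \<omega> $ i $ j *\<^sub>R e j)"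
    by (intro sum.cong) (auto simp: scaleR_right_diff_distrib scaleR_right_distrib)
  then show ?thesis by (simp add: sum_subtractf laplacian_action)
qed

lemma mult_diff: "(B - C) ** Y = B ** Y - C ** Y" for B C :: "real^'n^'n" and Y :: "real^'m^'n"
  by (simp add: vec_eq_iff matrix_mult_row scaleR_left_diff_distrib sum_subtractf)

lemma mult_add: "B ** (Y + Y') = B ** Y + B ** Y'" for B :: "real^'n^'n" and Y Y' :: "real^'m^'n"
  by (rule linear_add[OF linear_matrix_mult])

lemma X_update: "\<omega> \<in> space M \<Longrightarrow> Xv (Suc k) \<omega> = Pr (Xv k \<omega> + \<alpha> k *\<^sub>R (Lv k \<omega> - gF (Xv k \<omega>) + nx k \<omega>))"
  unfolding vec_eq_iff[of "Xv (Suc k) \<omega>"] Pr_nth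
  by (simp add: Xv_def Lv_def gF_def nx_def x_step algebra_simps)

lemma Z_update: "\<omega> \<in> space M \<Longrightarrow> Zv (Suc k) \<omega> = Zv k \<omega> + \<alpha> k *\<^sub>R (K (Lv k \<omega>) + nz k \<omega>)"
proof -
  assume \<omega>: "\<omega> \<in> space M"
  have "Zv (Suc k) \<omega> $ i = (Zv k \<omega> + \<alpha> k *\<^sub>R (L k \<omega> ** Lv k \<omega> - link \<zeta> k \<omega>)) $ i" for i
    using z_step[OF \<omega>, of i k] laplacian_action'[of k \<omega> i "\<lambda>j. lam j k \<omega>" "\<lambda>j. \<zeta> i j k \<omega>"]
    by (simp add: Zv_def Lv_def link_def)
  then show ?thesis by (simp add: nz_def mult_diff vec_eq_iff[of "Zv (Suc k) \<omega>"])
qed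

lemma L_update: "\<omega> \<in> space M \<Longrightarrow> Lv (Suc k) \<omega> = Lv k \<omega> + \<alpha> k *\<^sub>R (Dv - Xv k \<omega> - K (Lv k \<omega>) - K (Zv k \<omega>) + nl k \<omega>)"
proof -
  assume \<omega>: "\<omega> \<in> space M"
  have "Lv (Suc k) \<omega> $ i = (Lv k \<omega> + \<alpha> k *\<^sub>R (Dv + (\<chi> i. \<delta> i k \<omega>) - Xv k \<omega> - (L k \<omega> ** Lv k \<omega> - link \<zeta> k \<omega>) - (L k \<omega> ** Zv k \<omega> - link \<epsilon> k \<omega>))) $ i" for i
    using lam_step[OF \<omega>, of i k] laplacian_action'[of k \<omega> i "\<lambda>j. lam j k \<omega>" "\<lambda>j. \<zeta> i j k \<omega>"]
      laplacian_action'[of k \<omega> i "\<lambda>j. z j k \<omega>" "\<lambda>j. \<epsilon> i j k \<omega>"]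
    by (simp add: Zv_def Xv_def Dv_def Lv_def link_def)
  then have "Lv (Suc k) \<omega> = Lv k \<omega> + \<alpha> k *\<^sub>R (Dv + (\<chi> i. \<delta> i k \<omega>) - Xv k \<omega> - (L k \<omega> ** Lv k \<omega> - link \<zeta> k \<omega>) - (L k \<omega> ** Zv k \<omega> - link \<epsilon> k \<omega>))"
    unfolding vec_eq_iff[of "Lv (Suc k) \<omega>"] by blast
  also have "Dv + (\<chi> i. \<delta> i k \<omega>) - Xv k \<omega> - (L k \<omega> ** Lv k \<omega> - link \<zeta> k \<omega>) - (L k \<omega> ** Zv k \<omega> - link \<epsilon> k \<omega>)
    = Dv - Xv k \<omega> - K (Lv k \<omega>) - K (Zv k \<omega>) + nl k \<omega>"
    by (simp add: nl_def mult_diff mult_add)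
  finally show ?thesis .
qed

subsection \<open>Size of the noise\<close>

lemma entry_bound: "\<omega> \<in> space M \<Longrightarrow> \<bar>(L k \<omega> - Lbar) $ i $ j\<bar> \<le> 2 * (real CARD('n) + 1)"
proof -
  assume \<omega>: "\<omega> \<in> space M"
  have "\<bar>\<integral>\<omega>. L k \<omega> $ i $ j \<partial>M\<bar> \<le> (\<integral>\<omega>. \<bar>L k \<omega> $ i $ j\<bar> \<partial>M)" by (rule integral_abs_bound)
  also have "\<dots> \<le> (\<integral>\<omega>. real CARD('n) + 1 \<partial>M)"
    using L_entry_integrable L_entry_bound by (intro integral_mono) auto
  finally have "\<bar>Lbar $ i $ j\<bar> \<le> real CARD('n) + 1" by (simp add: Lbar_entry[of i j k] prob_space)
  then show ?thesis using L_entry_bound[OF \<omega>, of k i j] by (simp add: abs_if split: if_splits)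
qed

definition cM :: real where "cM = (real CARD('n))\<^sup>2 * (2 * (real CARD('n) + 1))"

lemma cM_nonneg: "0 \<le> cM" by (simp add: cM_def)

lemma fluctuation_bound: "\<omega> \<in> space M \<Longrightarrow> norm ((L k \<omega> - Lbar) ** Y) \<le> cM * norm Y" for Y :: "real^'m^'n"
  unfolding cM_def by (rule norm_matrix_mult_le) (use entry_bound in auto)

text \<open>A Laplacian does not see the mean of a state, and the deviation from the mean is controlled by \<open>K\<close>, which
  is injective on states of sum zero. So the bounds on \<open>K \<Lambda>\<close> and \<open>K Z\<close> along the path suffice, although \<open>\<Lambda>\<close> itself may be unbounded.\<close>

lemma fluctuation_bound_reference:
  "\<exists>cR\<ge>0. \<forall>k j. \<forall>\<omega>\<in>space M. k1 \<le> j \<longrightarrow> norm ((L k \<omega> - Lbar) ** lh j) \<le> cR \<and> norm ((L k \<omega> - Lbar) ** zh j) \<le> cR"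
proof -
  have S: "subspace (range K)" "closed (range K)"
    using linear_subspace_image[OF linear_matrix_mult subspace_UNIV] closed_subspace by blast+
  have inj: "\<forall>Y\<in>range K. K Y = 0 \<longrightarrow> Y = 0"
  proof (intro ballI impI)
    fix Y assume "Y \<in> range K" and 0: "K Y = 0"
    then obtain V where V: "Y = K V" by blast
    have "Y \<bullet> Y = V \<bullet> K Y" unfolding V mean.action_sym ..
    then show "Y = 0" using 0 by simp
  qed
  obtain e where e: "0 < e" "\<And>Y. Y \<in> range K \<Longrightarrow> e * norm Y \<le> norm (K Y)"
    using injective_imp_isometric[OF S(2,1) linear_conv_bounded_linear[THEN iffD1, OF linear_matrix_mult] inj] by (auto simp: mult.commute)
  have main: "norm ((L k \<omega> - Lbar) ** Y) \<le> cM * (r / e)" if \<omega>: "\<omega> \<in> space M" and Y: "norm (K Y) \<le> r" for k \<omega> and Y :: "real^'m^'n"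
  proof -
    define u where "u = (1 / real CARD('n)) *\<^sub>R (\<Sum>i\<in>UNIV. Y $ i)"
    define V where "V = Y - (\<chi> i. u)"
    have const: "B ** (\<chi> i. u) = 0" if "\<And>i. (\<Sum>j\<in>UNIV. B $ i $ j) = 0" for B :: "real^'n^'n"
      using that by (simp add: vec_eq_iff[of "B ** _"] matrix_mult_row scaleR_left.sum[symmetric])
    have "(\<Sum>i\<in>UNIV. V $ i) = 0" by (simp add: V_def sum_subtractf u_def sum_constant_scaleR del: sum_constant)
    then have "V \<in> range K" by (simp add: K_range)
    moreover have "K V = K Y" using const[OF mean.rows] by (simp add: V_def linear_diff[OF linear_matrix_mult])
    ultimately have "e * norm V \<le> r" using e(2)[of V] Y by simp
    then have nV: "norm V \<le> r / e" using e(1) by (simp add: pos_le_divide_eq mult.commute)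
    have "(L k \<omega> - Lbar) ** Y = (L k \<omega> - Lbar) ** V"
      using const[of "L k \<omega> - Lbar"] by (simp add: V_def linear_diff[OF linear_matrix_mult] sum_subtractf L_rows mean.rows)
    then have "norm ((L k \<omega> - Lbar) ** Y) \<le> cM * norm V" using fluctuation_bound[OF \<omega>, of k V] by simp
    also have "\<dots> \<le> cM * (r / e)" using nV cM_nonneg by (rule mult_left_mono)
    finally show ?thesis .
  qed
  then show ?thesis using ref_K cM_nonneg e(1) r_nonneg by (intro exI[of _ "cM * (r / e)"]) auto
qed

definition Sq :: "nat \<Rightarrow> 'w \<Rightarrow> real" where
  "Sq k \<omega> = (\<Sum>i\<in>UNIV. (norm (\<nu> i k \<omega>))\<^sup>2) + (\<Sum>i\<in>UNIV. (norm (\<delta> i k \<omega>))\<^sup>2)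
    + (\<Sum>i\<in>UNIV. \<Sum>j\<in>UNIV. (norm (\<zeta> i j k \<omega>))\<^sup>2) + (\<Sum>i\<in>UNIV. \<Sum>j\<in>UNIV. (norm (\<epsilon> i j k \<omega>))\<^sup>2)"

lemma Sq_nonneg: "0 \<le> Sq k \<omega>"
  unfolding Sq_def by (intro add_nonneg_nonneg sum_nonneg) auto

lemma E_components: "norm (Xv k \<omega> - xh k) \<le> norm (E k \<omega>)" "norm (Zv k \<omega> - zh k) \<le> norm (E k \<omega>)" "norm (Lv k \<omega> - lh k) \<le> norm (E k \<omega>)"
proof -
  have "norm (Xv k \<omega> - xh k, Zv k \<omega> - zh k) \<le> norm (E k \<omega>)"
    using norm_fst_le[of "(Xv k \<omega> - xh k, Zv k \<omega> - zh k)" "Lv k \<omega> - lh k"] by (simp add: E_def)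
  then show "norm (Xv k \<omega> - xh k) \<le> norm (E k \<omega>)" "norm (Zv k \<omega> - zh k) \<le> norm (E k \<omega>)"
    using norm_fst_le[of "Xv k \<omega> - xh k" "Zv k \<omega> - zh k"] norm_snd_le[of "Zv k \<omega> - zh k" "Xv k \<omega> - xh k"] by linarith+
  show "norm (Lv k \<omega> - lh k) \<le> norm (E k \<omega>)"
    using norm_snd_le[of "Lv k \<omega> - lh k" "(Xv k \<omega> - xh k, Zv k \<omega> - zh k)"] by (simp add: E_def)
qed

lemma norm_add5_sq_le: "(norm ((v1 + (v2 + v3)) + (v4 + v5)))\<^sup>2
    \<le> 2 * (2 * (norm v1)\<^sup>2 + 2 * (2 * (norm v2)\<^sup>2 + 2 * (norm v3)\<^sup>2)) + 2 * (2 * (norm v4)\<^sup>2 + 2 * (norm v5)\<^sup>2)"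
  for v1 v2 v3 v4 v5 :: "'b::real_inner"
  using norm_add_sq_le[of "v1 + (v2 + v3)" "v4 + v5"] norm_add_sq_le[of v1 "v2 + v3"] norm_add_sq_le[of v2 v3] norm_add_sq_le[of v4 v5]
  unfolding distrib_left by linarith

lemma link_bound: "\<omega> \<in> space M \<Longrightarrow> (norm (link Y k \<omega>))\<^sup>2 \<le> real CARD('n) * (\<Sum>i\<in>UNIV. \<Sum>j\<in>UNIV. (norm (Y i j k \<omega>))\<^sup>2)"
proof -
  assume \<omega>: "\<omega> \<in> space M"
  have "(norm (\<Sum>j\<in>UNIV. A k \<omega> $ i $ j *\<^sub>R Y i j k \<omega>))\<^sup>2 \<le> (\<Sum>j\<in>UNIV. (norm (Y i j k \<omega>))\<^sup>2) * real CARD('n)" for i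
  proof -
    have "norm (\<Sum>j\<in>UNIV. A k \<omega> $ i $ j *\<^sub>R Y i j k \<omega>) \<le> (\<Sum>j\<in>UNIV. 1 * norm (Y i j k \<omega>))"
      using A_abs[OF \<omega>] by (intro order.trans[OF norm_sum] sum_mono) (auto intro!: mult_right_mono simp: mult_left_le_one_le)
    then have "(norm (\<Sum>j\<in>UNIV. A k \<omega> $ i $ j *\<^sub>R Y i j k \<omega>))\<^sup>2 \<le> (\<Sum>j\<in>UNIV. norm (Y i j k \<omega>))\<^sup>2"
      by (intro power_mono) auto
    also have "\<dots> \<le> (\<Sum>j\<in>UNIV. (norm (Y i j k \<omega>))\<^sup>2) * real CARD('n)" by (rule sum_squared_le_sum_of_squares)
    finally show ?thesis .
  qed
  then have "(\<Sum>i\<in>UNIV. (norm (\<Sum>j\<in>UNIV. A k \<omega> $ i $ j *\<^sub>R Y i j k \<omega>))\<^sup>2) \<le> (\<Sum>i\<in>UNIV. (\<Sum>j\<in>UNIV. (norm (Y i j k \<omega>))\<^sup>2) * real CARD('n))"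
    by (intro sum_mono)
  then show ?thesis unfolding norm_vec_sq[of "link Y k \<omega>"] by (simp add: link_def sum_distrib_left mult.commute)
qed

lemma nx_sq: "(norm (nx k \<omega>))\<^sup>2 = (\<Sum>i\<in>UNIV. (norm (\<nu> i k \<omega>))\<^sup>2)"
  unfolding norm_vec_sq[of "nx k \<omega>"] by (simp add: nx_def)

text \<open>The dual states that multiply the fluctuation of the Laplacian are split into the reference path
  and the distance to it.\<close>

lemma noise_bound:
  "\<exists>cQ\<ge>0. \<forall>k \<omega>. k1 \<le> k \<longrightarrow> \<omega> \<in> space M \<longrightarrow> 2 * (norm ((nx k \<omega>, nz k \<omega>), nl k \<omega>))\<^sup>2 \<le> cQ * (1 + (norm (E k \<omega>))\<^sup>2 + Sq k \<omega>)"
proof -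
  obtain cR where cR: "0 \<le> cR" "\<And>k j \<omega>. \<omega> \<in> space M \<Longrightarrow> k1 \<le> j \<Longrightarrow> norm ((L k \<omega> - Lbar) ** lh j) \<le> cR \<and> norm ((L k \<omega> - Lbar) ** zh j) \<le> cR"
    using fluctuation_bound_reference by blast
  define n where "n = real CARD('n)"
  have n: "0 \<le> n" by (simp add: n_def)
  define cF where "cF = 2 * cM\<^sup>2 + 2 * cR\<^sup>2"
  define cQ where "cQ = 2 * (1 + 20 * n + 20 + 20 * cF)"
  have cF: "0 \<le> cF" by (simp add: cF_def)
  show ?thesis
  proof (intro exI[of _ cQ] conjI allI impI)
    show "0 \<le> cQ" using n cF by (simp add: cQ_def)
    fix k \<omega> assume k: "k1 \<le> k" and \<omega>: "\<omega> \<in> space M"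
    let ?W = "(norm (E k \<omega>))\<^sup>2" and ?S = "Sq k \<omega>"
    have fl: "(norm ((L k \<omega> - Lbar) ** V))\<^sup>2 \<le> cF * (1 + ?W)"
      if "norm (V - v) \<le> norm (E k \<omega>)" "norm ((L k \<omega> - Lbar) ** v) \<le> cR" for V v :: "real^'m^'n"
    proof -
      have "(L k \<omega> - Lbar) ** V = (L k \<omega> - Lbar) ** (V - v) + (L k \<omega> - Lbar) ** v" by (simp add: mult_add[symmetric])
      then have "(norm ((L k \<omega> - Lbar) ** V))\<^sup>2 \<le> 2 * (norm ((L k \<omega> - Lbar) ** (V - v)))\<^sup>2 + 2 * (norm ((L k \<omega> - Lbar) ** v))\<^sup>2"
        using norm_add_sq_le by simp
      also have "\<dots> \<le> 2 * (cM\<^sup>2 * ?W) + 2 * cR\<^sup>2"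
      proof (intro add_mono mult_left_mono)
        have "norm ((L k \<omega> - Lbar) ** (V - v)) \<le> cM * norm (E k \<omega>)"
          using fluctuation_bound[OF \<omega>, of k "V - v"] mult_left_mono[OF that(1) cM_nonneg] by linarith
        then have "(norm ((L k \<omega> - Lbar) ** (V - v)))\<^sup>2 \<le> (cM * norm (E k \<omega>))\<^sup>2" by (intro power_mono) auto
        then show "(norm ((L k \<omega> - Lbar) ** (V - v)))\<^sup>2 \<le> cM\<^sup>2 * ?W" by (simp add: power_mult_distrib)
        show "(norm ((L k \<omega> - Lbar) ** v))\<^sup>2 \<le> cR\<^sup>2" using that(2) by (intro power_mono) auto
      qed auto
      also have "\<dots> \<le> cF * (1 + ?W)" by (simp add: cF_def algebra_simps)
      finally show ?thesis .
    qed
    have fL: "(norm ((L k \<omega> - Lbar) ** Lv k \<omega>))\<^sup>2 \<le> cF * (1 + ?W)"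
      using fl[OF E_components(3)] cR(2)[OF \<omega> k] by blast
    have fZ: "(norm ((L k \<omega> - Lbar) ** Zv k \<omega>))\<^sup>2 \<le> cF * (1 + ?W)"
      using fl[OF E_components(2)] cR(2)[OF \<omega> k] by blast
    have parts: "0 \<le> (\<Sum>i\<in>UNIV. (norm (\<nu> i k \<omega>))\<^sup>2)" "0 \<le> (\<Sum>i\<in>UNIV. (norm (\<delta> i k \<omega>))\<^sup>2)"
      "0 \<le> (\<Sum>i\<in>UNIV. \<Sum>j\<in>UNIV. (norm (\<zeta> i j k \<omega>))\<^sup>2)" "0 \<le> (\<Sum>i\<in>UNIV. \<Sum>j\<in>UNIV. (norm (\<epsilon> i j k \<omega>))\<^sup>2)"
      by (auto intro!: sum_nonneg)
    have lz: "(norm (link \<zeta> k \<omega>))\<^sup>2 \<le> n * ?S"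
      using link_bound[OF \<omega>, of \<zeta> k] parts n unfolding Sq_def n_def
      by (elim order.trans, intro mult_left_mono) auto
    have le: "(norm (link \<epsilon> k \<omega>))\<^sup>2 \<le> n * ?S"
      using link_bound[OF \<omega>, of \<epsilon> k] parts n unfolding Sq_def n_def
      by (elim order.trans, intro mult_left_mono) auto
    have ld: "(norm (\<chi> i. \<delta> i k \<omega>))\<^sup>2 \<le> ?S"
      unfolding norm_vec_sq[of "\<chi> i. \<delta> i k \<omega>"] Sq_def using parts by simp
    have lx: "(norm (nx k \<omega>))\<^sup>2 \<le> ?S" unfolding nx_sq Sq_def using parts by simp
    have "(norm (nz k \<omega>))\<^sup>2 \<le> 2 * (norm ((L k \<omega> - Lbar) ** Lv k \<omega>))\<^sup>2 + 2 * (norm (link \<zeta> k \<omega>))\<^sup>2"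
      unfolding nz_def using norm_add_sq_le[of "(L k \<omega> - Lbar) ** Lv k \<omega>" "- link \<zeta> k \<omega>"] by simp
    then have z: "(norm (nz k \<omega>))\<^sup>2 \<le> 2 * (cF * (1 + ?W)) + 2 * (n * ?S)" using fL lz by linarith
    have nleq: "nl k \<omega> = ((\<chi> i. \<delta> i k \<omega>) + (link \<zeta> k \<omega> + link \<epsilon> k \<omega>)) + ((- ((L k \<omega> - Lbar) ** Lv k \<omega>)) + (- ((L k \<omega> - Lbar) ** Zv k \<omega>)))"
      by (simp add: nl_def mult_add)
    have "(norm (nl k \<omega>))\<^sup>2 \<le> 2 * (2 * (norm (\<chi> i. \<delta> i k \<omega>))\<^sup>2 + 2 * (2 * (norm (link \<zeta> k \<omega>))\<^sup>2 + 2 * (norm (link \<epsilon> k \<omega>))\<^sup>2))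
        + 2 * (2 * (norm ((L k \<omega> - Lbar) ** Lv k \<omega>))\<^sup>2 + 2 * (norm ((L k \<omega> - Lbar) ** Zv k \<omega>))\<^sup>2)"
      unfolding nleq
      using norm_add5_sq_le[of "\<chi> i. \<delta> i k \<omega>" "link \<zeta> k \<omega>" "link \<epsilon> k \<omega>" "- ((L k \<omega> - Lbar) ** Lv k \<omega>)" "- ((L k \<omega> - Lbar) ** Zv k \<omega>)"]
      unfolding norm_minus_cancel .
    then have l: "(norm (nl k \<omega>))\<^sup>2 \<le> 4 * ?S + 16 * (n * ?S) + 8 * (cF * (1 + ?W))" using ld lz le fL fZ unfolding distrib_left by linarith
    have "2 * (norm ((nx k \<omega>, nz k \<omega>), nl k \<omega>))\<^sup>2 = 2 * ((norm (nx k \<omega>))\<^sup>2 + (norm (nz k \<omega>))\<^sup>2 + (norm (nl k \<omega>))\<^sup>2)"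
      by (simp add: norm_prod_def)
    also have "\<dots> \<le> 2 * (5 * ?S + 18 * (n * ?S) + 10 * (cF * (1 + ?W)))" using lx z l unfolding distrib_left by linarith
    also have "\<dots> \<le> cQ * (1 + ?W + ?S)"
    proof -
      have "0 \<le> n * ?W" "0 \<le> cF * ?S" "0 \<le> n * ?S" "0 \<le> cF * ?W"
        using n cF Sq_nonneg[of k \<omega>] by auto
      then show ?thesis unfolding cQ_def using n cF Sq_nonneg[of k \<omega>] zero_le_power2[of "norm (E k \<omega>)"]
        by (simp add: algebra_simps)
    qed
    finally show "2 * (norm ((nx k \<omega>, nz k \<omega>), nl k \<omega>))\<^sup>2 \<le> cQ * (1 + ?W + ?S)" .
  qed
qed

subsection \<open>Measurability and moments\<close>

lemma vec_lambda_measurable: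
  fixes Y :: "'n \<Rightarrow> 'w \<Rightarrow> real^'m"
  assumes "\<And>i. Y i \<in> borel_measurable N"
  shows "(\<lambda>\<omega>. \<chi> i. Y i \<omega>) \<in> borel_measurable N"
proof -
  have "(\<lambda>\<omega>. \<chi> i. Y i \<omega>) = (\<lambda>\<omega>. \<Sum>i\<in>UNIV. axis i (Y i \<omega>))"
    by (simp add: fun_eq_iff vec_eq_iff axis_def if_distrib[of "\<lambda>u. u $ _"] sum.delta cong: if_cong)
  moreover have "axis i \<in> borel_measurable (borel :: (real^'m) measure)" for i :: 'n
  proof -
    have "continuous_on UNIV (\<lambda>v::real^'m. if l = i then v else 0)" for l by (cases "l = i") (auto intro: continuous_on_id)
    then show ?thesis unfolding axis_def by (intro borel_measurable_continuous_onI continuous_on_vec_lambda)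
  qed
  then have "(\<lambda>\<omega>. axis i (Y i \<omega>)) \<in> borel_measurable N" for i :: 'n
    using assms by (intro measurable_compose[of "Y i" N borel "axis i"]) auto
  ultimately show ?thesis by simp
qed

lemma state_measurable: "Xv k \<in> borel_measurable (\<F> k)" "Lv k \<in> borel_measurable (\<F> k)" "Zv k \<in> borel_measurable (\<F> k)"
  unfolding Xv_def[abs_def] Lv_def[abs_def] Zv_def[abs_def] using adapted by (auto intro!: vec_lambda_measurable)

lemma E_measurable: "E k \<in> borel_measurable (\<F> k)"
proof -
  have "E k = (\<lambda>\<omega>. ((Xv k \<omega>, Zv k \<omega>), Lv k \<omega>) - ((xh k, zh k), lh k))" by (simp add: fun_eq_iff E_def)
  then show ?thesis using state_measurable by simp
qed

lemma xh_bounded: obtains b where "\<And>k. norm (xh k) \<le> b"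
proof -
  obtain b where "\<forall>v\<in>range xh. norm v \<le> b" using convergent_imp_bounded[OF xh_lim] unfolding bounded_iff by blast
  then show ?thesis by (intro that[of b]) blast
qed

text \<open>The variance of \<open>\<nu>\<close> grows with the square of the state, hence at most with the squared distance to
  the reference path, which is bounded. The other noises have bounded variances.\<close>

lemma Sq_moment:
  "\<exists>cS\<ge>0. \<forall>k B R. B \<in> sets (\<F> k) \<longrightarrow> (\<forall>\<omega>\<in>B. (norm (E k \<omega>))\<^sup>2 \<le> R) \<longrightarrow>
     (\<forall>i. integrable M (\<lambda>\<omega>. indicator B \<omega> * (norm (\<nu> i k \<omega>))\<^sup>2)) \<and>
     integrable M (\<lambda>\<omega>. indicator B \<omega> * (norm (E k \<omega>))\<^sup>2) \<and>
     integrable M (\<lambda>\<omega>. indicator B \<omega> * Sq k \<omega>) \<and>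
     (\<integral>\<omega>. indicator B \<omega> * Sq k \<omega> \<partial>M) \<le> cS * (1 + (\<integral>\<omega>. indicator B \<omega> * (norm (E k \<omega>))\<^sup>2 \<partial>M))"
proof -
  obtain b where b: "\<And>k. norm (xh k) \<le> b" using xh_bounded by blast
  have b0: "0 \<le> b" using b norm_ge_zero order.trans by blast
  define n where "n = real CARD('n)"
  define c\<nu> where "c\<nu> = c * (1 + 2 * b\<^sup>2) + 2 * c"
  define \<sigma> where "\<sigma> = (\<Sum>i\<in>UNIV. \<integral>\<omega>. (norm (\<delta> i 0 \<omega>))\<^sup>2 \<partial>M)"
  define cS where "cS = n * c\<nu> + \<sigma> + 2 * (n * n * \<mu>\<^sup>2)"
  have \<sigma>0: "0 \<le> \<sigma>" unfolding \<sigma>_def by (intro sum_nonneg integral_nonneg_AE) auto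
  have c\<nu>0: "0 \<le> c\<nu>" using A5_c by (simp add: c\<nu>_def)
  have n0: "0 \<le> n" by (simp add: n_def)
  show ?thesis
  proof (rule exI[of _ cS], intro conjI allI impI)
    show "0 \<le> cS" unfolding cS_def using n0 c\<nu>0 \<sigma>0 by simp
  next
    fix k B R and i :: 'n assume B: "B \<in> sets (\<F> k)" and R: "\<forall>\<omega>\<in>B. (norm (E k \<omega>))\<^sup>2 \<le> R"
    interpret S: sigma_finite_subalgebra M "\<F> k" by (rule sigma_finite_\<F>)
    have BM[measurable]: "B \<in> sets M" using B by (rule filt.F_sets)
    have [measurable]: "E k \<in> borel_measurable M" using E_measurable by (rule filt.F_measurable)
    have [measurable]: "x i k \<in> borel_measurable M" for i using adapted filt.F_measurable by blast
    note noise_meas[measurable]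
    let ?W = "\<lambda>\<omega>. (norm (E k \<omega>))\<^sup>2"
    have iW: "integrable M (\<lambda>\<omega>. indicator B \<omega> * ?W \<omega>)"
      by (rule integrable_const_bound[where B = "\<bar>R\<bar>"]) (use R in \<open>force simp: indicator_def intro!: AE_I2\<close>, measurable)
    have iB: "integrable M (\<lambda>\<omega>. indicator B \<omega> :: real)"
      by (rule integrable_const_bound[where B = 1]) (auto simp: indicator_def)
    define w where "w = (\<integral>\<omega>. indicator B \<omega> * ?W \<omega> \<partial>M)"
    have w0: "0 \<le> w" unfolding w_def by (intro integral_nonneg_AE AE_I2) (auto simp: indicator_def)
    have x_le: "c * (1 + (norm (x i k \<omega>))\<^sup>2) \<le> c * (1 + 2 * b\<^sup>2) + 2 * c * ?W \<omega>" for i \<omega>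
    proof -
      have "norm (x i k \<omega>) \<le> norm (Xv k \<omega>)" using Finite_Cartesian_Product.norm_nth_le[of "Xv k \<omega>" i] by (simp add: Xv_def)
      also have "\<dots> \<le> norm (E k \<omega>) + b"
        using norm_triangle_ineq[of "Xv k \<omega> - xh k" "xh k"] E_components(1)[of k \<omega>] b[of k] by simp
      finally have "(norm (x i k \<omega>))\<^sup>2 \<le> (norm (E k \<omega>) + b)\<^sup>2" by (intro power_mono) auto
      also have "\<dots> \<le> 2 * ?W \<omega> + 2 * b\<^sup>2" using sum_squares_bound[of "norm (E k \<omega>)" b] by (simp add: power2_sum)
      finally have "c * (1 + (norm (x i k \<omega>))\<^sup>2) \<le> c * (1 + (2 * ?W \<omega> + 2 * b\<^sup>2))" using A5_c by (intro mult_left_mono) auto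
      then show ?thesis by (simp add: algebra_simps)
    qed
    have ib: "integrable M (\<lambda>\<omega>. indicator B \<omega> * (c * (1 + 2 * b\<^sup>2) + 2 * c * ?W \<omega>))"
      and Ib: "(\<integral>\<omega>. indicator B \<omega> * (c * (1 + 2 * b\<^sup>2) + 2 * c * ?W \<omega>) \<partial>M) \<le> c\<nu> * (1 + w)"
    proof -
      have eq: "indicator B \<omega> * (c * (1 + 2 * b\<^sup>2) + 2 * c * ?W \<omega>) = c * (1 + 2 * b\<^sup>2) * indicator B \<omega> + 2 * c * (indicator B \<omega> * ?W \<omega>)" for \<omega>
        by (simp add: algebra_simps)
      show "integrable M (\<lambda>\<omega>. indicator B \<omega> * (c * (1 + 2 * b\<^sup>2) + 2 * c * ?W \<omega>))"
        unfolding eq by (intro Bochner_Integration.integrable_add integrable_mult_right iB iW)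
      have "(\<integral>\<omega>. indicator B \<omega> * (c * (1 + 2 * b\<^sup>2) + 2 * c * ?W \<omega>) \<partial>M) = c * (1 + 2 * b\<^sup>2) * prob B + 2 * c * w"
        unfolding eq w_def by (subst Bochner_Integration.integral_add) (use iB iW in auto)
      also have "\<dots> \<le> c * (1 + 2 * b\<^sup>2) * 1 + 2 * c * w" using A5_c by (intro add_right_mono mult_left_mono) auto
      also have "\<dots> \<le> c\<nu> * (1 + w)"
      proof -
        have "0 \<le> c * (1 + 2 * b\<^sup>2) * w" "0 \<le> 2 * c" using A5_c w0 by auto
        then show ?thesis by (simp add: c\<nu>_def algebra_simps)
      qed
      finally show "(\<integral>\<omega>. indicator B \<omega> * (c * (1 + 2 * b\<^sup>2) + 2 * c * ?W \<omega>) \<partial>M) \<le> c\<nu> * (1 + w)" .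
    qed
    have \<nu>: "integrable M (\<lambda>\<omega>. indicator B \<omega> * (norm (\<nu> i k \<omega>))\<^sup>2) \<and>
      (\<integral>\<omega>. indicator B \<omega> * (norm (\<nu> i k \<omega>))\<^sup>2 \<partial>M) \<le> (\<integral>\<omega>. indicator B \<omega> * (c * (1 + 2 * b\<^sup>2) + 2 * c * ?W \<omega>) \<partial>M)" for i
    proof (rule S.conditional_square_bound[OF _ noise_meas(1) B _ ib])
      show "AE \<omega> in M. nn_cond_exp M (\<F> k) (\<lambda>\<omega>. ennreal ((norm (\<nu> i k \<omega>))\<^sup>2)) \<omega> \<le> ennreal (c * (1 + 2 * b\<^sup>2) + 2 * c * ?W \<omega>)"
        using A5_iii(2)[where i=i and k=k] by eventually_elim (erule order.trans, intro ennreal_leI x_le)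
      show "0 \<le> c * (1 + 2 * b\<^sup>2) + 2 * c * ?W \<omega>" for \<omega> using A5_c by simp
    qed
    have cut: "integrable M (\<lambda>\<omega>. indicator B \<omega> * g \<omega>) \<and> (\<integral>\<omega>. indicator B \<omega> * g \<omega> \<partial>M) \<le> integral\<^sup>L M g"
      if g: "integrable M g" "\<And>\<omega>. 0 \<le> g \<omega>" for g :: "'w \<Rightarrow> real"
    proof -
      have i: "integrable M (\<lambda>\<omega>. indicator B \<omega> * g \<omega>)"
        by (rule Bochner_Integration.integrable_bound[OF g(1)]) (use g in \<open>auto simp: indicator_def\<close>)
      then show ?thesis using integral_mono[OF i g(1)] g(2) by (auto simp: indicator_def)
    qed
    have split: "indicator B \<omega> * Sq k \<omega> = (\<Sum>i\<in>UNIV. indicator B \<omega> * (norm (\<nu> i k \<omega>))\<^sup>2) + (\<Sum>i\<in>UNIV. indicator B \<omega> * (norm (\<delta> i k \<omega>))\<^sup>2)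
      + (\<Sum>i\<in>UNIV. \<Sum>j\<in>UNIV. indicator B \<omega> * (norm (\<zeta> i j k \<omega>))\<^sup>2) + (\<Sum>i\<in>UNIV. \<Sum>j\<in>UNIV. indicator B \<omega> * (norm (\<epsilon> i j k \<omega>))\<^sup>2)" for \<omega>
      by (simp add: Sq_def distrib_left sum_distrib_left)
    have each: "integrable M (\<lambda>\<omega>. indicator B \<omega> * (norm (\<nu> i k \<omega>))\<^sup>2)" "integrable M (\<lambda>\<omega>. indicator B \<omega> * (norm (\<delta> i k \<omega>))\<^sup>2)"
      "integrable M (\<lambda>\<omega>. indicator B \<omega> * (norm (\<zeta> i j k \<omega>))\<^sup>2)" "integrable M (\<lambda>\<omega>. indicator B \<omega> * (norm (\<epsilon> i j k \<omega>))\<^sup>2)" for i j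
      using \<nu>[of i] cut[OF A4_moment[where i=i and k=k]] cut[OF square_integrable_noise(1)[where i=i and j=j and k=k]]
        cut[OF square_integrable_noise(3)[where i=i and j=j and k=k]] by simp_all
    note each = each Bochner_Integration.integrable_sum[OF each(3)] Bochner_Integration.integrable_sum[OF each(4)]
    have ints: "integrable M (\<lambda>\<omega>. \<Sum>i\<in>UNIV. indicator B \<omega> * (norm (\<nu> i k \<omega>))\<^sup>2)"
      "integrable M (\<lambda>\<omega>. \<Sum>i\<in>UNIV. indicator B \<omega> * (norm (\<delta> i k \<omega>))\<^sup>2)"
      "integrable M (\<lambda>\<omega>. \<Sum>i\<in>UNIV. \<Sum>j\<in>UNIV. indicator B \<omega> * (norm (\<zeta> i j k \<omega>))\<^sup>2)"
      "integrable M (\<lambda>\<omega>. \<Sum>i\<in>UNIV. \<Sum>j\<in>UNIV. indicator B \<omega> * (norm (\<epsilon> i j k \<omega>))\<^sup>2)"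
      by (rule Bochner_Integration.integrable_sum, rule each)+
    show "integrable M (\<lambda>\<omega>. indicator B \<omega> * (norm (\<nu> i k \<omega>))\<^sup>2)" using \<nu> by blast
    show "integrable M (\<lambda>\<omega>. indicator B \<omega> * ?W \<omega>)" by (rule iW)
    show "integrable M (\<lambda>\<omega>. indicator B \<omega> * Sq k \<omega>)" unfolding split
      by (simp only: Bochner_Integration.integrable_add ints)
    have "(\<integral>\<omega>. indicator B \<omega> * Sq k \<omega> \<partial>M) = (\<Sum>i\<in>UNIV. \<integral>\<omega>. indicator B \<omega> * (norm (\<nu> i k \<omega>))\<^sup>2 \<partial>M) + (\<Sum>i\<in>UNIV. \<integral>\<omega>. indicator B \<omega> * (norm (\<delta> i k \<omega>))\<^sup>2 \<partial>M)
      + (\<Sum>i\<in>UNIV. \<Sum>j\<in>UNIV. \<integral>\<omega>. indicator B \<omega> * (norm (\<zeta> i j k \<omega>))\<^sup>2 \<partial>M) + (\<Sum>i\<in>UNIV. \<Sum>j\<in>UNIV. \<integral>\<omega>. indicator B \<omega> * (norm (\<epsilon> i j k \<omega>))\<^sup>2 \<partial>M)"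
      unfolding split
      by (simp only: Bochner_Integration.integral_add Bochner_Integration.integral_sum Bochner_Integration.integrable_add ints each)
    also have "\<dots> \<le> (\<Sum>i\<in>(UNIV::'n set). c\<nu> * (1 + w)) + \<sigma> + (\<Sum>i\<in>(UNIV::'n set). \<Sum>j\<in>(UNIV::'n set). \<mu>\<^sup>2) + (\<Sum>i\<in>(UNIV::'n set). \<Sum>j\<in>(UNIV::'n set). \<mu>\<^sup>2)"
      unfolding \<sigma>_def
    proof (intro add_mono sum_mono)
      show "(\<integral>\<omega>. indicator B \<omega> * (norm (\<nu> i k \<omega>))\<^sup>2 \<partial>M) \<le> c\<nu> * (1 + w)" for i using \<nu>[of i] Ib by linarith
      show "(\<integral>\<omega>. indicator B \<omega> * (norm (\<delta> i k \<omega>))\<^sup>2 \<partial>M) \<le> (\<integral>\<omega>. (norm (\<delta> i 0 \<omega>))\<^sup>2 \<partial>M)" for i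
        using cut[OF A4_moment[where i=i and k=k]] \<delta>_moment[where i=i and k=k] by simp
      show "(\<integral>\<omega>. indicator B \<omega> * (norm (\<zeta> i j k \<omega>))\<^sup>2 \<partial>M) \<le> \<mu>\<^sup>2" for i j
        using cut[OF square_integrable_noise(1)[where i=i and j=j and k=k]] square_integrable_noise(2)[where i=i and j=j and k=k] by simp
      show "(\<integral>\<omega>. indicator B \<omega> * (norm (\<epsilon> i j k \<omega>))\<^sup>2 \<partial>M) \<le> \<mu>\<^sup>2" for i j
        using cut[OF square_integrable_noise(3)[where i=i and j=j and k=k]] square_integrable_noise(4)[where i=i and j=j and k=k] by simp
    qed
    also have "\<dots> = n * c\<nu> * (1 + w) + \<sigma> + 2 * (n * n * \<mu>\<^sup>2)" by (simp add: n_def)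
    also have "\<dots> \<le> cS * (1 + w)"
    proof -
      have "0 \<le> \<sigma> * w" "0 \<le> n * n * \<mu>\<^sup>2 * w" using \<sigma>0 w0 n0 by auto
      then show ?thesis by (simp add: cS_def algebra_simps)
    qed
    finally show "(\<integral>\<omega>. indicator B \<omega> * Sq k \<omega> \<partial>M) \<le> cS * (1 + (\<integral>\<omega>. indicator B \<omega> * ?W \<omega> \<partial>M))" unfolding w_def .
  qed
qed

end

context referenced_allocation
begin

sublocale step: monotone_step gF K "1 / (4 * l\<^sub>c)" l\<^sub>c "onorm K" Pr
proof (rule monotone_step.intro)
  show "0 < 1 / (4 * l\<^sub>c)" "0 \<le> l\<^sub>c" using A1_lc by simp_all
  show "2 * (1 / (4 * l\<^sub>c)) * (norm (gF X - gF Y))\<^sup>2 \<le> (gF X - gF Y) \<bullet> (X - Y)" for X Y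
    using F_bregman[of X Y] F_bregman[of Y X] by (simp add: inner_diff_left inner_diff_right norm_minus_commute)
qed (rule K_bound gF_lipschitz Pr_nonexpansive mean.action_sym mean.action_nonneg linear_matrix_mult)+

abbreviation N :: "nat \<Rightarrow> 'w \<Rightarrow> real" where "N k \<omega> \<equiv> ((nx k \<omega>, nz k \<omega>), nl k \<omega>) \<bullet> E k \<omega>"

lemma energy_step:
  assumes k: "k1 \<le> k" and \<omega>: "\<omega> \<in> space M"
  shows "(norm (E (Suc k) \<omega>))\<^sup>2 \<le> (norm (E k \<omega>))\<^sup>2 + \<alpha> k * (2 * N k \<omega>)
      + (\<alpha> k)\<^sup>2 * (step.Cst r * (1 + (norm (E k \<omega>))\<^sup>2)) + (\<alpha> k)\<^sup>2 * (2 * (norm ((nx k \<omega>, nz k \<omega>), nl k \<omega>))\<^sup>2)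
      - \<alpha> k * (4 * (1 / (4 * l\<^sub>c)) * (norm (gF (Xv k \<omega>) - gF (xh (Suc k))))\<^sup>2)"
    and "(norm (Xv (Suc k) \<omega> - xh (Suc k)))\<^sup>2 \<le> (norm (Xv k \<omega> - xh k))\<^sup>2 + \<alpha> k * (2 * (nx k \<omega> \<bullet> (Xv k \<omega> - xh k)))
      + \<alpha> k * (4 * (l\<^sub>c + 1)\<^sup>2 * (1 + r)\<^sup>2 * (1 + (norm (E k \<omega>))\<^sup>2)\<^sup>2) + (\<alpha> k)\<^sup>2 * (2 * (norm (nx k \<omega>))\<^sup>2)"
  unfolding E_def
  using step.perturbed_step[OF \<alpha>_pos \<alpha>_le[OF k] r_nonneg xh_step[OF k] zh_step[OF k] lh_step[OF k] ref_speed[OF k]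
    X_update[OF \<omega>] Z_update[OF \<omega>] L_update[OF \<omega>]] by blast+

lemma action_inner:
  "((B - C) ** V) \<bullet> T = (\<Sum>i\<in>UNIV. \<Sum>j\<in>UNIV. (B $ i $ j - C $ i $ j) * (V $ j \<bullet> T $ i))" for B C :: "real^'n^'n" and V T :: "real^'m^'n"
  unfolding inner_vec_def[of "(B - C) ** V"] matrix_mult_row by (simp add: inner_sum_left)

lemma link_inner: "link Y k \<omega> \<bullet> T = (\<Sum>i\<in>UNIV. \<Sum>j\<in>UNIV. A k \<omega> $ i $ j * (Y i j k \<omega> \<bullet> T $ i))" for T :: "real^'m^'n"
  unfolding inner_vec_def[of "link Y k \<omega>"] by (simp add: link_def inner_sum_left)

lemma noise_expansion:
  fixes T P H :: "real^'m^'n"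
  shows "((nx k \<omega>, nz k \<omega>), nl k \<omega>) \<bullet> ((T, P), H) =
    (\<Sum>i\<in>UNIV. (-1) * (\<nu> i k \<omega> \<bullet> T $ i)) + (\<Sum>i\<in>UNIV. \<delta> i k \<omega> \<bullet> H $ i)
    + (\<Sum>i\<in>UNIV. \<Sum>j\<in>UNIV. A k \<omega> $ i $ j * (\<zeta> i j k \<omega> \<bullet> (H - P) $ i))
    + (\<Sum>i\<in>UNIV. \<Sum>j\<in>UNIV. A k \<omega> $ i $ j * (\<epsilon> i j k \<omega> \<bullet> H $ i))
    + (\<Sum>i\<in>UNIV. \<Sum>j\<in>UNIV. (L k \<omega> $ i $ j - Lbar $ i $ j) * (Lv k \<omega> $ j \<bullet> P $ i))
    - (\<Sum>i\<in>UNIV. \<Sum>j\<in>UNIV. (L k \<omega> $ i $ j - Lbar $ i $ j) * ((Lv k \<omega> + Zv k \<omega>) $ j \<bullet> H $ i))"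
proof -
  have "((nx k \<omega>, nz k \<omega>), nl k \<omega>) \<bullet> ((T, P), H) = nx k \<omega> \<bullet> T + (\<chi> i. \<delta> i k \<omega>) \<bullet> H + link \<zeta> k \<omega> \<bullet> (H - P) + link \<epsilon> k \<omega> \<bullet> H
    + ((L k \<omega> - Lbar) ** Lv k \<omega>) \<bullet> P - ((L k \<omega> - Lbar) ** (Lv k \<omega> + Zv k \<omega>)) \<bullet> H"
    by (simp add: nz_def nl_def inner_add_left inner_diff_left inner_diff_right)
  moreover have "nx k \<omega> \<bullet> T = (\<Sum>i\<in>UNIV. (-1) * (\<nu> i k \<omega> \<bullet> T $ i))"
    unfolding inner_vec_def[of "nx k \<omega>"] by (simp add: nx_def)
  moreover have "(\<chi> i. \<delta> i k \<omega>) \<bullet> H = (\<Sum>i\<in>UNIV. \<delta> i k \<omega> \<bullet> H $ i)"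
    unfolding inner_vec_def[of "\<chi> i. \<delta> i k \<omega>"] by simp
  ultimately show ?thesis unfolding link_inner action_inner by simp
qed

lemma norm_E_le: "(norm (E k \<omega>))\<^sup>2 \<le> R \<Longrightarrow> norm (E k \<omega>) \<le> 1 + \<bar>R\<bar>"
  using norm_le_one_plus_sq[of "E k \<omega>"] by linarith

text \<open>In each noise term of \<open>N\<close> the other factors belong to the past and are bounded on \<open>B\<close>.\<close>

lemma noise_centered:
  assumes B: "B \<in> sets (\<F> k)" and R: "\<And>\<omega>. \<omega> \<in> B \<Longrightarrow> (norm (E k \<omega>))\<^sup>2 \<le> R"
  shows "centered (\<lambda>\<omega>. indicator B \<omega> * N k \<omega>)"
proof -
  have sm: "Xv k \<in> borel_measurable (\<F> k)" "Lv k \<in> borel_measurable (\<F> k)" "Zv k \<in> borel_measurable (\<F> k)" by (rule state_measurable)+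
  note [measurable] = sm B
  define ind :: "'w \<Rightarrow> real" where "ind = indicator B"
  have ind[measurable]: "ind \<in> borel_measurable (\<F> k)" unfolding ind_def by measurable
  have ind_le: "\<bar>ind \<omega>\<bar> \<le> 1" for \<omega> by (simp add: ind_def indicator_def)
  define b where "b = 1 + \<bar>R\<bar>"
  have b0: "0 \<le> b" by (simp add: b_def)
  define T P H where "T = (\<lambda>\<omega>. ind \<omega> *\<^sub>R (Xv k \<omega> - xh k))" and "P = (\<lambda>\<omega>. ind \<omega> *\<^sub>R (Zv k \<omega> - zh k))"
    and "H = (\<lambda>\<omega>. ind \<omega> *\<^sub>R (Lv k \<omega> - lh k))"
  have [measurable]: "T \<in> borel_measurable (\<F> k)" "P \<in> borel_measurable (\<F> k)" "H \<in> borel_measurable (\<F> k)"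
    unfolding T_def P_def H_def by measurable
  have off: "T \<omega> = 0 \<and> P \<omega> = 0 \<and> H \<omega> = 0" if "\<omega> \<notin> B" for \<omega> using that by (simp add: T_def P_def H_def ind_def)
  have on: "norm (T \<omega>) \<le> b \<and> norm (P \<omega>) \<le> b \<and> norm (H \<omega>) \<le> b \<and> norm (Lv k \<omega>) \<le> b + norm (lh k) \<and> norm (Zv k \<omega>) \<le> b + norm (zh k)"
    if \<omega>: "\<omega> \<in> B" for \<omega>
  proof -
    have "norm (E k \<omega>) \<le> b" unfolding b_def by (rule norm_E_le[OF R[OF \<omega>]])
    then show ?thesis using E_components[of k \<omega>] \<omega> norm_triangle_ineq[of "Lv k \<omega> - lh k" "lh k"] norm_triangle_ineq[of "Zv k \<omega> - zh k" "zh k"]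
      by (simp add: T_def P_def H_def ind_def)
  qed
  have nT: "norm (T \<omega>) \<le> b" "norm (P \<omega>) \<le> b" "norm (H \<omega>) \<le> b" for \<omega>
    using on[of \<omega>] off[of \<omega>] b0 by (cases "\<omega> \<in> B"; simp)+
  have row: "norm (V $ i) \<le> norm V" for V :: "real^'m^'n" and i by (rule Finite_Cartesian_Product.norm_nth_le)
  have cL: "centered (\<lambda>\<omega>. (L k \<omega> $ i $ j - Lbar $ i $ j) * (V \<omega> $ j \<bullet> S \<omega> $ i))"
    if V: "V \<in> borel_measurable (\<F> k)" and S: "S \<in> borel_measurable (\<F> k)" and bd: "\<And>\<omega>. \<omega> \<in> B \<Longrightarrow> norm (V \<omega>) \<le> ub"
      and S0: "\<And>\<omega>. \<omega> \<notin> B \<Longrightarrow> S \<omega> = 0" and S1: "\<And>\<omega>. norm (S \<omega>) \<le> b" and v: "0 \<le> ub" for V S :: "'w \<Rightarrow> real^'m^'n" and ub :: real and i j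
  proof (rule centered_L)
    show "(\<lambda>\<omega>. V \<omega> $ j \<bullet> S \<omega> $ i) \<in> borel_measurable (\<F> k)"
      by (intro borel_measurable_inner measurable_entry V S)
    fix \<omega> show "\<bar>V \<omega> $ j \<bullet> S \<omega> $ i\<bar> \<le> ub * b"
    proof (cases "\<omega> \<in> B")
      case True
      have "\<bar>V \<omega> $ j \<bullet> S \<omega> $ i\<bar> \<le> norm (V \<omega> $ j) * norm (S \<omega> $ i)" by (rule Cauchy_Schwarz_ineq2)
      also have "\<dots> \<le> ub * b"
        using row[of "V \<omega>" j] row[of "S \<omega>" i] bd[OF True] S1[of \<omega>] v by (intro mult_mono) auto
      finally show ?thesis .
    qed (use S0 v b0 in simp)
  qed
  have "indicator B \<omega> * N k \<omega> = ((nx k \<omega>, nz k \<omega>), nl k \<omega>) \<bullet> ((T \<omega>, P \<omega>), H \<omega>)" for \<omega>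
    by (simp add: E_def T_def P_def H_def ind_def algebra_simps)
  then have eq: "(\<lambda>\<omega>. indicator B \<omega> * N k \<omega>) = (\<lambda>\<omega>.
    (\<Sum>i\<in>UNIV. (-1) * (\<nu> i k \<omega> \<bullet> T \<omega> $ i)) + (\<Sum>i\<in>UNIV. \<delta> i k \<omega> \<bullet> H \<omega> $ i)
    + (\<Sum>i\<in>UNIV. \<Sum>j\<in>UNIV. A k \<omega> $ i $ j * (\<zeta> i j k \<omega> \<bullet> (H \<omega> - P \<omega>) $ i))
    + (\<Sum>i\<in>UNIV. \<Sum>j\<in>UNIV. A k \<omega> $ i $ j * (\<epsilon> i j k \<omega> \<bullet> H \<omega> $ i))
    + (\<Sum>i\<in>UNIV. \<Sum>j\<in>UNIV. (L k \<omega> $ i $ j - Lbar $ i $ j) * (Lv k \<omega> $ j \<bullet> P \<omega> $ i))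
    - (\<Sum>i\<in>UNIV. \<Sum>j\<in>UNIV. (L k \<omega> $ i $ j - Lbar $ i $ j) * ((Lv k \<omega> + Zv k \<omega>) $ j \<bullet> H \<omega> $ i)))"
    unfolding noise_expansion by (rule ext)
  obtain cS where cS: "\<forall>k B R. B \<in> sets (\<F> k) \<longrightarrow> (\<forall>\<omega>\<in>B. (norm (E k \<omega>))\<^sup>2 \<le> R) \<longrightarrow>
     (\<forall>i. integrable M (\<lambda>\<omega>. indicator B \<omega> * (norm (\<nu> i k \<omega>))\<^sup>2)) \<and>
     integrable M (\<lambda>\<omega>. indicator B \<omega> * (norm (E k \<omega>))\<^sup>2) \<and>
     integrable M (\<lambda>\<omega>. indicator B \<omega> * Sq k \<omega>) \<and>
     (\<integral>\<omega>. indicator B \<omega> * Sq k \<omega> \<partial>M) \<le> cS * (1 + (\<integral>\<omega>. indicator B \<omega> * (norm (E k \<omega>))\<^sup>2 \<partial>M))"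
    using Sq_moment by blast
  have sq\<nu>: "integrable M (\<lambda>\<omega>. indicator B \<omega> * (norm (\<nu> i k \<omega>))\<^sup>2)" for i using cS B R by blast
  show ?thesis unfolding eq
  proof (intro centered_add centered_diff centered_sum centered_scale)
    fix i j :: 'n
    show "centered (\<lambda>\<omega>. \<nu> i k \<omega> \<bullet> T \<omega> $ i)"
    proof (rule centered_\<nu>[OF B sq\<nu>])
      show m: "(\<lambda>\<omega>. T \<omega> $ i) \<in> borel_measurable (\<F> k)" by (intro measurable_entry) measurable
      have "(\<lambda>\<omega>. (norm (T \<omega> $ i))\<^sup>2) \<in> borel_measurable (\<F> k)" using m by measurable
      then show "integrable M (\<lambda>\<omega>. (norm (T \<omega> $ i))\<^sup>2)"
      proof (intro integrable_const_bound[where B = "b\<^sup>2"] AE_I2)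
        show "norm ((norm (T \<omega> $ i))\<^sup>2) \<le> b\<^sup>2" for \<omega>
          using order.trans[OF row nT(1), of \<omega> i] by (simp add: power_mono)
      qed (rule filt.F_measurable)
      show "T \<omega> $ i = 0" if "\<omega> \<notin> B" for \<omega> using off[OF that] by simp
    qed
    show "centered (\<lambda>\<omega>. \<delta> i k \<omega> \<bullet> H \<omega> $ i)"
      by (rule centered_\<delta>[where cst = b]) (intro measurable_entry, measurable, rule order.trans[OF row nT(3)])
    have HP: "norm ((H \<omega> - P \<omega>) $ i) \<le> b + b" for \<omega>
      using row[of "H \<omega> - P \<omega>" i] norm_triangle_ineq4[of "H \<omega>" "P \<omega>"] nT[of \<omega>] by linarith
    show "centered (\<lambda>\<omega>. A k \<omega> $ i $ j * (\<zeta> i j k \<omega> \<bullet> (H \<omega> - P \<omega>) $ i))"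
      by (rule centered_link_noise(1)[where cst = "b + b"]) (intro measurable_entry, measurable, rule HP)
    show "centered (\<lambda>\<omega>. A k \<omega> $ i $ j * (\<epsilon> i j k \<omega> \<bullet> H \<omega> $ i))"
      by (rule centered_link_noise(2)[where cst = b]) (intro measurable_entry, measurable, rule order.trans[OF row nT(3)])
    show "centered (\<lambda>\<omega>. (L k \<omega> $ i $ j - Lbar $ i $ j) * (Lv k \<omega> $ j \<bullet> P \<omega> $ i))"
    proof (rule cL)
      show "norm (Lv k \<omega>) \<le> b + norm (lh k)" if "\<omega> \<in> B" for \<omega> using on[OF that] by blast
    qed (use off nT b0 sm in auto)
    show "centered (\<lambda>\<omega>. (L k \<omega> $ i $ j - Lbar $ i $ j) * ((Lv k \<omega> + Zv k \<omega>) $ j \<bullet> H \<omega> $ i))"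
    proof (rule cL)
      show "norm (Lv k \<omega> + Zv k \<omega>) \<le> (b + norm (lh k)) + (b + norm (zh k))" if "\<omega> \<in> B" for \<omega>
        using on[OF that] norm_triangle_ineq[of "Lv k \<omega>" "Zv k \<omega>"] by linarith
    qed (use off nT b0 sm in auto)
  qed
qed

end

section \<open>Almost sure convergence\<close>

context referenced_allocation
begin

interpretation tail: filtered_prob_space M "\<lambda>k. \<F> (k1 + k)"
  by unfold_locales (use \<F>_sub \<F>_mono in auto)

definition G :: "nat \<Rightarrow> 'w \<Rightarrow> real" where "G k \<omega> = (norm (gF (Xv k \<omega>) - gF (xh (Suc k))))\<^sup>2"

lemma gF_continuous: "continuous_on UNIV gF"
  unfolding gF_def[abs_def]
  by (intro continuous_on_vec_lambda continuous_on_compose2[OF gradient_continuous]) (auto intro!: continuous_intros)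

lemma noise_moment:
  obtains cS where "0 \<le> cS"
    "\<And>k B R i. B \<in> sets (\<F> k) \<Longrightarrow> (\<And>\<omega>. \<omega> \<in> B \<Longrightarrow> (norm (E k \<omega>))\<^sup>2 \<le> R) \<Longrightarrow> integrable M (\<lambda>\<omega>. indicator B \<omega> * (norm (\<nu> i k \<omega>))\<^sup>2)"
    "\<And>k B R. B \<in> sets (\<F> k) \<Longrightarrow> (\<And>\<omega>. \<omega> \<in> B \<Longrightarrow> (norm (E k \<omega>))\<^sup>2 \<le> R) \<Longrightarrow> integrable M (\<lambda>\<omega>. indicator B \<omega> * (norm (E k \<omega>))\<^sup>2)"
    "\<And>k B R. B \<in> sets (\<F> k) \<Longrightarrow> (\<And>\<omega>. \<omega> \<in> B \<Longrightarrow> (norm (E k \<omega>))\<^sup>2 \<le> R) \<Longrightarrow> integrable M (\<lambda>\<omega>. indicator B \<omega> * Sq k \<omega>)"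
    "\<And>k B R. B \<in> sets (\<F> k) \<Longrightarrow> (\<And>\<omega>. \<omega> \<in> B \<Longrightarrow> (norm (E k \<omega>))\<^sup>2 \<le> R) \<Longrightarrow>
       (\<integral>\<omega>. indicator B \<omega> * Sq k \<omega> \<partial>M) \<le> cS * (1 + (\<integral>\<omega>. indicator B \<omega> * (norm (E k \<omega>))\<^sup>2 \<partial>M))"
proof -
  obtain cS where cS: "0 \<le> cS" "\<forall>k B R. B \<in> sets (\<F> k) \<longrightarrow> (\<forall>\<omega>\<in>B. (norm (E k \<omega>))\<^sup>2 \<le> R) \<longrightarrow>
     (\<forall>i. integrable M (\<lambda>\<omega>. indicator B \<omega> * (norm (\<nu> i k \<omega>))\<^sup>2)) \<and>
     integrable M (\<lambda>\<omega>. indicator B \<omega> * (norm (E k \<omega>))\<^sup>2) \<and>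
     integrable M (\<lambda>\<omega>. indicator B \<omega> * Sq k \<omega>) \<and>
     (\<integral>\<omega>. indicator B \<omega> * Sq k \<omega> \<partial>M) \<le> cS * (1 + (\<integral>\<omega>. indicator B \<omega> * (norm (E k \<omega>))\<^sup>2 \<partial>M))"
    using Sq_moment by blast
  show ?thesis by (rule that[OF cS(1)]) (use cS(2) in blast)+
qed

lemma energy_bounded:
  "AE \<omega> in M. (\<exists>R. \<forall>k. (norm (E (k1 + k) \<omega>))\<^sup>2 \<le> R) \<and> summable (\<lambda>k. \<alpha> (k1 + k) * G (k1 + k) \<omega>)
     \<and> summable (\<lambda>k. (\<alpha> (k1 + k))\<^sup>2 * (2 * (norm (nx (k1 + k) \<omega>))\<^sup>2))"
proof -
  obtain cQ where cQ: "0 \<le> cQ" and noise_le: "\<forall>k \<omega>. k1 \<le> k \<longrightarrow> \<omega> \<in> space M \<longrightarrow>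
      2 * (norm ((nx k \<omega>, nz k \<omega>), nl k \<omega>))\<^sup>2 \<le> cQ * (1 + (norm (E k \<omega>))\<^sup>2 + Sq k \<omega>)"
    using noise_bound by blast
  obtain cS where cS: "0 \<le> cS"
    and iW: "\<And>k B R. B \<in> sets (\<F> k) \<Longrightarrow> (\<And>\<omega>. \<omega> \<in> B \<Longrightarrow> (norm (E k \<omega>))\<^sup>2 \<le> R) \<Longrightarrow> integrable M (\<lambda>\<omega>. indicator B \<omega> * (norm (E k \<omega>))\<^sup>2)"
    and iS: "\<And>k B R. B \<in> sets (\<F> k) \<Longrightarrow> (\<And>\<omega>. \<omega> \<in> B \<Longrightarrow> (norm (E k \<omega>))\<^sup>2 \<le> R) \<Longrightarrow> integrable M (\<lambda>\<omega>. indicator B \<omega> * Sq k \<omega>)"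
    and Sle: "\<And>k B R. B \<in> sets (\<F> k) \<Longrightarrow> (\<And>\<omega>. \<omega> \<in> B \<Longrightarrow> (norm (E k \<omega>))\<^sup>2 \<le> R) \<Longrightarrow>
       (\<integral>\<omega>. indicator B \<omega> * Sq k \<omega> \<partial>M) \<le> cS * (1 + (\<integral>\<omega>. indicator B \<omega> * (norm (E k \<omega>))\<^sup>2 \<partial>M))"
    by (rule noise_moment) blast
  define Q where "Q k \<omega> = cQ * (1 + (norm (E k \<omega>))\<^sup>2 + Sq k \<omega>)" for k \<omega>
  define Ct where "Ct = step.Cst r + cQ * (1 + cS)"
  have Cst: "0 \<le> step.Cst r" by (rule step.Cst_nonneg[OF r_nonneg])
  have Ct0: "0 \<le> Ct" using Cst cQ cS by (simp add: Ct_def)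
  have l0: "0 < l\<^sub>c" by (rule A1_lc)
  have Q_int: "integrable M (\<lambda>\<omega>. indicator B \<omega> * Q k \<omega>) \<and>
      (\<integral>\<omega>. indicator B \<omega> * Q k \<omega> \<partial>M) \<le> Ct * (1 + (\<integral>\<omega>. indicator B \<omega> * (norm (E k \<omega>))\<^sup>2 \<partial>M))"
    if B: "B \<in> sets (\<F> k)" and R: "\<And>\<omega>. \<omega> \<in> B \<Longrightarrow> (norm (E k \<omega>))\<^sup>2 \<le> R" for k B R
  proof -
    have BM[measurable]: "B \<in> sets M" using B by (rule filt.F_sets)
    have iB: "integrable M (\<lambda>\<omega>. indicator B \<omega> :: real)"
      by (rule integrable_const_bound[where B = 1]) (auto simp: indicator_def)
    define w where "w = (\<integral>\<omega>. indicator B \<omega> * (norm (E k \<omega>))\<^sup>2 \<partial>M)"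
    have w0: "0 \<le> w" unfolding w_def by (intro integral_nonneg_AE AE_I2) (auto simp: indicator_def)
    have eq: "indicator B \<omega> * Q k \<omega> = cQ * (indicator B \<omega> + indicator B \<omega> * (norm (E k \<omega>))\<^sup>2 + indicator B \<omega> * Sq k \<omega>)" for \<omega>
      by (simp add: Q_def algebra_simps)
    have "(\<integral>\<omega>. indicator B \<omega> * Q k \<omega> \<partial>M) = cQ * (prob B + w + (\<integral>\<omega>. indicator B \<omega> * Sq k \<omega> \<partial>M))"
      unfolding eq w_def using iB iW[OF B R] iS[OF B R] by simp
    also have "\<dots> \<le> cQ * (1 + w + cS * (1 + w))"
      using Sle[OF B R] cQ by (intro mult_left_mono add_mono) (auto simp: w_def)
    also have "\<dots> \<le> Ct * (1 + w)" using Cst w0 by (simp add: Ct_def algebra_simps)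
    finally show ?thesis unfolding w_def[symmetric] unfolding eq using iB iW[OF B R] iS[OF B R] by simp
  qed
  have main: "AE \<omega> in M. (\<exists>R. \<forall>k. (norm (E (k1 + k) \<omega>))\<^sup>2 \<le> R)
     \<and> summable (\<lambda>k. \<alpha> (k1 + k) * (4 * (1 / (4 * l\<^sub>c)) * G (k1 + k) \<omega>)) \<and> summable (\<lambda>k. (\<alpha> (k1 + k))\<^sup>2 * Q (k1 + k) \<omega>)"
  proof (rule tail.almost_supermartingale[where N = "\<lambda>k \<omega>. 2 * N (k1 + k) \<omega>" and C = Ct])
    fix k
    have [measurable]: "E (k1 + k) \<in> borel_measurable (\<F> (k1 + k))" by (rule E_measurable)
    show "(\<lambda>\<omega>. (norm (E (k1 + k) \<omega>))\<^sup>2) \<in> borel_measurable (\<F> (k1 + k))" by measurable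
    have "(\<lambda>\<omega>. gF (Xv (k1 + k) \<omega>)) \<in> borel_measurable M"
      by (rule measurable_compose[OF filt.F_measurable[OF state_measurable(1)] borel_measurable_continuous_onI[OF gF_continuous]])
    then show "(\<lambda>\<omega>. 4 * (1 / (4 * l\<^sub>c)) * G (k1 + k) \<omega>) \<in> borel_measurable M" unfolding G_def by measurable
    show "0 < \<alpha> (k1 + k)" by (rule \<alpha>_pos)
    show "summable (\<lambda>k. (\<alpha> (k1 + k))\<^sup>2)"
      using summable_ignore_initial_segment[OF \<alpha>_square_summable, of k1] by (simp add: add.commute)
    show "0 \<le> Ct" by (rule Ct0)
  next
    fix k \<omega> assume \<omega>: "\<omega> \<in> space M"
    show "0 \<le> (norm (E (k1 + k) \<omega>))\<^sup>2" by simp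
    show "0 \<le> Q (k1 + k) \<omega>" using cQ Sq_nonneg by (auto simp: Q_def)
    show "0 \<le> 4 * (1 / (4 * l\<^sub>c)) * G (k1 + k) \<omega>" using l0 by (simp add: G_def)
    let ?W = "(norm (E (k1 + k) \<omega>))\<^sup>2"
    have "(\<alpha> (k1 + k))\<^sup>2 * (2 * (norm ((nx (k1 + k) \<omega>, nz (k1 + k) \<omega>), nl (k1 + k) \<omega>))\<^sup>2) \<le> (\<alpha> (k1 + k))\<^sup>2 * Q (k1 + k) \<omega>"
      using noise_le \<omega> unfolding Q_def by (intro mult_left_mono) auto
    moreover have "(\<alpha> (k1 + k))\<^sup>2 * (step.Cst r * (1 + ?W)) \<le> (\<alpha> (k1 + k))\<^sup>2 * (Ct * (1 + ?W))"
      using cQ cS by (intro mult_left_mono mult_right_mono) (auto simp: Ct_def)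
    ultimately show "(norm (E (k1 + Suc k) \<omega>))\<^sup>2 \<le> ?W + \<alpha> (k1 + k) * (2 * N (k1 + k) \<omega>)
        + (\<alpha> (k1 + k))\<^sup>2 * (Ct * (1 + ?W)) + (\<alpha> (k1 + k))\<^sup>2 * Q (k1 + k) \<omega> - \<alpha> (k1 + k) * (4 * (1 / (4 * l\<^sub>c)) * G (k1 + k) \<omega>)"
      using energy_step(1)[of "k1 + k" \<omega>] \<omega> unfolding G_def by simp
  next
    fix k B R assume B: "B \<in> sets (\<F> (k1 + k))" and R: "\<And>\<omega>. \<omega> \<in> B \<Longrightarrow> (norm (E (k1 + k) \<omega>))\<^sup>2 \<le> R"
    have "centered (\<lambda>\<omega>. 2 * (indicator B \<omega> * N (k1 + k) \<omega>))" by (rule centered_scale[OF noise_centered[OF B R]])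
    moreover have "(\<lambda>\<omega>. 2 * (indicator B \<omega> * N (k1 + k) \<omega>)) = (\<lambda>\<omega>. indicator B \<omega> * (2 * N (k1 + k) \<omega>))" by (simp add: fun_eq_iff)
    ultimately show "integrable M (\<lambda>\<omega>. indicator B \<omega> * (2 * N (k1 + k) \<omega>)) \<and> (\<integral>\<omega>. indicator B \<omega> * (2 * N (k1 + k) \<omega>) \<partial>M) = 0"
      unfolding centered_def by metis
    show "integrable M (\<lambda>\<omega>. indicator B \<omega> * Q (k1 + k) \<omega>) \<and>
       (\<integral>\<omega>. indicator B \<omega> * Q (k1 + k) \<omega> \<partial>M) \<le> Ct * (1 + (\<integral>\<omega>. indicator B \<omega> * (norm (E (k1 + k) \<omega>))\<^sup>2 \<partial>M))"
      by (rule Q_int[OF B R])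
  qed
  then show ?thesis
  proof (rule AE_mp, intro AE_I2 impI, elim conjE, intro conjI)
    fix \<omega> assume \<omega>: "\<omega> \<in> space M" and s: "summable (\<lambda>k. \<alpha> (k1 + k) * (4 * (1 / (4 * l\<^sub>c)) * G (k1 + k) \<omega>))"
      and q: "summable (\<lambda>k. (\<alpha> (k1 + k))\<^sup>2 * Q (k1 + k) \<omega>)"
    show "summable (\<lambda>k. \<alpha> (k1 + k) * G (k1 + k) \<omega>)"
      using summable_mult[OF s, of l\<^sub>c] l0 by simp
    show "summable (\<lambda>k. (\<alpha> (k1 + k))\<^sup>2 * (2 * (norm (nx (k1 + k) \<omega>))\<^sup>2))"
    proof (rule summable_comparison_test'[OF q])
      fix k
      have "2 * (norm (nx (k1 + k) \<omega>))\<^sup>2 \<le> 2 * (norm ((nx (k1 + k) \<omega>, nz (k1 + k) \<omega>), nl (k1 + k) \<omega>))\<^sup>2" by (simp add: norm_prod_def)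
      also have "\<dots> \<le> Q (k1 + k) \<omega>" using noise_le \<omega> unfolding Q_def by auto
      finally show "norm ((\<alpha> (k1 + k))\<^sup>2 * (2 * (norm (nx (k1 + k) \<omega>))\<^sup>2)) \<le> (\<alpha> (k1 + k))\<^sup>2 * Q (k1 + k) \<omega>"
        by (simp add: mult_left_mono)
    qed
  qed
qed

text \<open>Truncation: \<open>E\<close> is bounded on almost every path, but not uniformly, and the martingale theorem requires finite variances.\<close>

definition bounded_so_far :: "nat \<Rightarrow> nat \<Rightarrow> 'w set" where
  "bounded_so_far R k = {\<omega> \<in> space M. \<forall>j\<in>{..k}. (norm (E (k1 + j) \<omega>))\<^sup>2 \<le> real R}"

lemma bounded_so_far_sets: "bounded_so_far R k \<in> sets (\<F> (k1 + k))"
proof -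
  have m: "{\<omega> \<in> space (\<F> (k1 + k)). (norm (E (k1 + j) \<omega>))\<^sup>2 \<le> real R} \<in> sets (\<F> (k1 + k))" if "j \<in> {..k}" for j
  proof -
    have [measurable]: "E (k1 + j) \<in> borel_measurable (\<F> (k1 + k))"
      by (rule filt.F_measurable_le[OF _ E_measurable]) (use that in simp)
    show ?thesis by measurable
  qed
  have "{\<omega> \<in> space (\<F> (k1 + k)). \<forall>j\<in>{..k}. (norm (E (k1 + j) \<omega>))\<^sup>2 \<le> real R} \<in> sets (\<F> (k1 + k))"
    using m by (intro sets.sets_Collect_finite_All') auto
  then show ?thesis by (simp add: bounded_so_far_def \<F>_space)
qed

lemma truncated_noise_summable:
  "AE \<omega> in M. summable (\<lambda>k. \<alpha> (k1 + k) * (indicator (bounded_so_far R k) \<omega> * (2 * (nx (k1 + k) \<omega> \<bullet> (Xv (k1 + k) \<omega> - xh (k1 + k))))))"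
proof (rule tail.square_integrable_martingale_converges)
  obtain cS where cS: "0 \<le> cS"
    and i\<nu>: "\<And>k B R i. B \<in> sets (\<F> k) \<Longrightarrow> (\<And>\<omega>. \<omega> \<in> B \<Longrightarrow> (norm (E k \<omega>))\<^sup>2 \<le> R) \<Longrightarrow> integrable M (\<lambda>\<omega>. indicator B \<omega> * (norm (\<nu> i k \<omega>))\<^sup>2)"
    and iW: "\<And>k B R. B \<in> sets (\<F> k) \<Longrightarrow> (\<And>\<omega>. \<omega> \<in> B \<Longrightarrow> (norm (E k \<omega>))\<^sup>2 \<le> R) \<Longrightarrow> integrable M (\<lambda>\<omega>. indicator B \<omega> * (norm (E k \<omega>))\<^sup>2)"
    and iS: "\<And>k B R. B \<in> sets (\<F> k) \<Longrightarrow> (\<And>\<omega>. \<omega> \<in> B \<Longrightarrow> (norm (E k \<omega>))\<^sup>2 \<le> R) \<Longrightarrow> integrable M (\<lambda>\<omega>. indicator B \<omega> * Sq k \<omega>)"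
    and Sle: "\<And>k B R. B \<in> sets (\<F> k) \<Longrightarrow> (\<And>\<omega>. \<omega> \<in> B \<Longrightarrow> (norm (E k \<omega>))\<^sup>2 \<le> R) \<Longrightarrow>
       (\<integral>\<omega>. indicator B \<omega> * Sq k \<omega> \<partial>M) \<le> cS * (1 + (\<integral>\<omega>. indicator B \<omega> * (norm (E k \<omega>))\<^sup>2 \<partial>M))"
    by (rule noise_moment) blast
  let ?B = "bounded_so_far R"
  define \<xi> where "\<xi> k \<omega> = \<alpha> (k1 + k) * (indicator (?B k) \<omega> * (2 * (nx (k1 + k) \<omega> \<bullet> (Xv (k1 + k) \<omega> - xh (k1 + k)))))" for k \<omega>
  have bd: "(norm (E (k1 + k) \<omega>))\<^sup>2 \<le> real R" if "\<omega> \<in> ?B k" for k \<omega> using that by (auto simp: bounded_so_far_def)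
  have meas: "(\<lambda>\<omega>. \<xi> k \<omega>) \<in> borel_measurable (\<F> (k1 + Suc k))" for k
  proof -
    have up: "k1 + k \<le> k1 + Suc k" by simp
    have [measurable]: "?B k \<in> sets (\<F> (k1 + Suc k))" using filt.F_le[OF up] bounded_so_far_sets by blast
    have [measurable]: "Xv (k1 + k) \<in> borel_measurable (\<F> (k1 + Suc k))" by (rule filt.F_measurable_le[OF up state_measurable(1)])
    have "\<nu> i (k1 + k) \<in> borel_measurable (\<F> (Suc (k1 + k)))" for i by (rule noise_adapted)
    then have [measurable]: "nx (k1 + k) \<in> borel_measurable (\<F> (k1 + Suc k))"
      unfolding nx_def[abs_def] by (intro vec_lambda_measurable) simp
    show ?thesis unfolding \<xi>_def by measurable
  qed
  have sq_le: "(\<xi> k \<omega>)\<^sup>2 \<le> (\<alpha> (k1 + k))\<^sup>2 * (4 * real R * (indicator (?B k) \<omega> * Sq (k1 + k) \<omega>))" for k \<omega>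
  proof (cases "\<omega> \<in> ?B k")
    case True
    let ?v = "nx (k1 + k) \<omega>" and ?t = "Xv (k1 + k) \<omega> - xh (k1 + k)"
    have "(?v \<bullet> ?t)\<^sup>2 \<le> (norm ?v)\<^sup>2 * (norm ?t)\<^sup>2"
      using power_mono[OF Cauchy_Schwarz_ineq2[of ?v ?t], of 2] by (simp add: power_mult_distrib)
    also have "\<dots> \<le> Sq (k1 + k) \<omega> * real R"
    proof (intro mult_mono)
      have "0 \<le> (\<Sum>i\<in>UNIV. (norm (\<delta> i (k1 + k) \<omega>))\<^sup>2)" "0 \<le> (\<Sum>i\<in>UNIV. \<Sum>j\<in>UNIV. (norm (\<zeta> i j (k1 + k) \<omega>))\<^sup>2)"
        "0 \<le> (\<Sum>i\<in>UNIV. \<Sum>j\<in>UNIV. (norm (\<epsilon> i j (k1 + k) \<omega>))\<^sup>2)" by (auto intro!: sum_nonneg)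
      then show "(norm ?v)\<^sup>2 \<le> Sq (k1 + k) \<omega>" unfolding nx_sq Sq_def by linarith
      have "(norm ?t)\<^sup>2 \<le> (norm (E (k1 + k) \<omega>))\<^sup>2" using E_components(1) by (intro power_mono) auto
      then show "(norm ?t)\<^sup>2 \<le> real R" using bd[OF True] by linarith
    qed (auto simp: Sq_nonneg)
    finally have "(\<alpha> (k1 + k))\<^sup>2 * (4 * (?v \<bullet> ?t)\<^sup>2) \<le> (\<alpha> (k1 + k))\<^sup>2 * (4 * (Sq (k1 + k) \<omega> * real R))"
      by (intro mult_left_mono) auto
    then show ?thesis using True by (simp add: \<xi>_def power_mult_distrib mult_ac)
  next
    case False then show ?thesis by (simp add: \<xi>_def)
  qed
  have iSk: "integrable M (\<lambda>\<omega>. (\<alpha> (k1 + k))\<^sup>2 * (4 * real R * (indicator (?B k) \<omega> * Sq (k1 + k) \<omega>)))" for k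
    by (intro integrable_mult_right iS[OF bounded_so_far_sets bd])
  have sq: "integrable M (\<lambda>\<omega>. (\<xi> k \<omega>)\<^sup>2)" for k
  proof (rule Bochner_Integration.integrable_bound[OF iSk])
    have [measurable]: "(\<lambda>\<omega>. \<xi> k \<omega>) \<in> borel_measurable M" by (rule filt.F_measurable[OF meas])
    show "(\<lambda>\<omega>. (\<xi> k \<omega>)\<^sup>2) \<in> borel_measurable M" by measurable
    show "AE \<omega> in M. norm ((\<xi> k \<omega>)\<^sup>2) \<le> norm ((\<alpha> (k1 + k))\<^sup>2 * (4 * real R * (indicator (?B k) \<omega> * Sq (k1 + k) \<omega>)))"
      using sq_le by (intro AE_I2) (simp add: Sq_nonneg abs_mult)
  qed
  show "(\<lambda>\<omega>. \<alpha> (k1 + k) * (indicator (?B k) \<omega> * (2 * (nx (k1 + k) \<omega> \<bullet> (Xv (k1 + k) \<omega> - xh (k1 + k)))))) \<in> borel_measurable (\<F> (k1 + Suc k))" for k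
    using meas unfolding \<xi>_def .
  show "integrable M (\<lambda>\<omega>. (\<alpha> (k1 + k) * (indicator (?B k) \<omega> * (2 * (nx (k1 + k) \<omega> \<bullet> (Xv (k1 + k) \<omega> - xh (k1 + k))))))\<^sup>2)" for k
    using sq unfolding \<xi>_def .
  show "summable (\<lambda>k. \<integral>\<omega>. (\<alpha> (k1 + k) * (indicator (?B k) \<omega> * (2 * (nx (k1 + k) \<omega> \<bullet> (Xv (k1 + k) \<omega> - xh (k1 + k))))))\<^sup>2 \<partial>M)"
    unfolding \<xi>_def[symmetric]
  proof (rule summable_comparison_test')
    have "summable (\<lambda>k. (\<alpha> (k1 + k))\<^sup>2)"
      using summable_ignore_initial_segment[OF \<alpha>_square_summable, of k1] by (simp add: add.commute)
    then show "summable (\<lambda>k. (\<alpha> (k1 + k))\<^sup>2 * (4 * real R * (cS * (1 + real R))))" by (rule summable_mult2)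
    fix k
    have "(\<integral>\<omega>. (\<xi> k \<omega>)\<^sup>2 \<partial>M) \<le> (\<integral>\<omega>. (\<alpha> (k1 + k))\<^sup>2 * (4 * real R * (indicator (?B k) \<omega> * Sq (k1 + k) \<omega>)) \<partial>M)"
      using sq_le by (intro integral_mono[OF sq iSk])
    also have "\<dots> = (\<alpha> (k1 + k))\<^sup>2 * (4 * real R * (\<integral>\<omega>. indicator (?B k) \<omega> * Sq (k1 + k) \<omega> \<partial>M))" by simp
    also have "\<dots> \<le> (\<alpha> (k1 + k))\<^sup>2 * (4 * real R * (cS * (1 + real R)))"
    proof (intro mult_left_mono)
      have "(\<integral>\<omega>. indicator (?B k) \<omega> * (norm (E (k1 + k) \<omega>))\<^sup>2 \<partial>M) \<le> (\<integral>\<omega>. real R \<partial>M)"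
        by (rule integral_mono[OF iW[OF bounded_so_far_sets bd]]) (use bd in \<open>auto simp: indicator_def\<close>)
      then have "cS * (1 + (\<integral>\<omega>. indicator (?B k) \<omega> * (norm (E (k1 + k) \<omega>))\<^sup>2 \<partial>M)) \<le> cS * (1 + real R)"
        using cS by (intro mult_left_mono) (auto simp: prob_space)
      then show "(\<integral>\<omega>. indicator (?B k) \<omega> * Sq (k1 + k) \<omega> \<partial>M) \<le> cS * (1 + real R)"
        using Sle[OF bounded_so_far_sets bd] by (rule order.trans[rotated])
    qed auto
    finally show "norm (\<integral>\<omega>. (\<xi> k \<omega>)\<^sup>2 \<partial>M) \<le> (\<alpha> (k1 + k))\<^sup>2 * (4 * real R * (cS * (1 + real R)))"
      by (simp add: integral_nonneg_AE)
  qed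
  fix k and Y :: "'w \<Rightarrow> real" assume Y: "Y \<in> borel_measurable (\<F> (k1 + k))" "integrable M (\<lambda>\<omega>. (Y \<omega>)\<^sup>2)"
  define h where "h i \<omega> = (Y \<omega> * indicator (?B k) \<omega>) *\<^sub>R (Xv (k1 + k) \<omega> $ i - xh (k1 + k) $ i)" for i \<omega>
  have "centered (\<lambda>\<omega>. \<Sum>i\<in>UNIV. (- 2 * \<alpha> (k1 + k)) * (\<nu> i (k1 + k) \<omega> \<bullet> h i \<omega>))"
  proof (rule centered_sum, rule centered_scale, rule centered_\<nu>[OF bounded_so_far_sets i\<nu>[OF bounded_so_far_sets bd]])
    fix i :: 'n
    note Y(1)[measurable] and state_measurable(1)[measurable] and bounded_so_far_sets[measurable]
    have "(\<lambda>\<omega>. Xv (k1 + k) \<omega> $ i) \<in> borel_measurable (\<F> (k1 + k))" by (rule measurable_entry[OF state_measurable(1)])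
    then show h: "h i \<in> borel_measurable (\<F> (k1 + k))" unfolding h_def[abs_def] by measurable
    show "integrable M (\<lambda>\<omega>. (norm (h i \<omega>))\<^sup>2)"
    proof (rule Bochner_Integration.integrable_bound[OF integrable_mult_right[OF Y(2), of "real R"]])
      have "(\<lambda>\<omega>. (norm (h i \<omega>))\<^sup>2) \<in> borel_measurable (\<F> (k1 + k))" using h by measurable
      then show "(\<lambda>\<omega>. (norm (h i \<omega>))\<^sup>2) \<in> borel_measurable M" by (rule filt.F_measurable)
      show "AE \<omega> in M. norm ((norm (h i \<omega>))\<^sup>2) \<le> norm (real R * (Y \<omega>)\<^sup>2)"
      proof (rule AE_I2)
        fix \<omega>
        show "norm ((norm (h i \<omega>))\<^sup>2) \<le> norm (real R * (Y \<omega>)\<^sup>2)"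
        proof (cases "\<omega> \<in> ?B k")
          case True
          have "norm ((Xv (k1 + k) \<omega> - xh (k1 + k)) $ i) \<le> norm (E (k1 + k) \<omega>)"
            by (rule order.trans[OF Finite_Cartesian_Product.norm_nth_le E_components(1)])
          then have "(norm ((Xv (k1 + k) \<omega> - xh (k1 + k)) $ i))\<^sup>2 \<le> (norm (E (k1 + k) \<omega>))\<^sup>2" by (intro power_mono) auto
          then have "(norm (Xv (k1 + k) \<omega> $ i - xh (k1 + k) $ i))\<^sup>2 \<le> real R"
            using order.trans[OF _ bd[OF True]] unfolding vector_minus_component by blast
          then have "(Y \<omega>)\<^sup>2 * (norm (Xv (k1 + k) \<omega> $ i - xh (k1 + k) $ i))\<^sup>2 \<le> (Y \<omega>)\<^sup>2 * real R" by (rule mult_left_mono) simp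
          then show ?thesis using True by (simp add: h_def power_mult_distrib mult.commute abs_mult)
        qed (simp add: h_def)
      qed
    qed
    show "h i \<omega> = 0" if "\<omega> \<notin> ?B k" for \<omega> using that by (simp add: h_def)
  qed
  moreover have "(\<Sum>i\<in>UNIV. (- 2 * \<alpha> (k1 + k)) * (\<nu> i (k1 + k) \<omega> \<bullet> h i \<omega>)) = Y \<omega> * \<xi> k \<omega>" for \<omega>
  proof -
    have "nx (k1 + k) \<omega> \<bullet> (Xv (k1 + k) \<omega> - xh (k1 + k)) = (\<Sum>i\<in>UNIV. - (\<nu> i (k1 + k) \<omega> \<bullet> (Xv (k1 + k) \<omega> $ i - xh (k1 + k) $ i)))"
      unfolding inner_vec_def[of "nx (k1 + k) \<omega>"] by (simp add: nx_def)
    then show ?thesis unfolding \<xi>_def h_def by (simp add: sum_distrib_left sum_negf mult_ac)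
  qed
  ultimately show "(\<integral>\<omega>. Y \<omega> * (\<alpha> (k1 + k) * (indicator (?B k) \<omega> * (2 * (nx (k1 + k) \<omega> \<bullet> (Xv (k1 + k) \<omega> - xh (k1 + k)))))) \<partial>M) = 0"
    unfolding \<xi>_def[symmetric] by (simp add: centered_def)
qed

lemma step_sums_diverge: "filterlim (\<lambda>n. \<Sum>k<n. \<alpha> (k1 + k)) at_top sequentially"
proof -
  have eq: "(\<Sum>k<n. \<alpha> (k1 + k)) = - sum \<alpha> {..<k1} + sum \<alpha> {..<n + k1}" for n
    by (induction n) (auto simp: add.commute)
  have "filterlim (\<lambda>n. sum \<alpha> {..<n + k1}) at_top sequentially"
    by (rule filterlim_compose[OF \<alpha>_diverges filterlim_add_const_nat_at_top])
  then show ?thesis unfolding eq by (rule filterlim_tendsto_add_at_top[OF tendsto_const])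
qed

text \<open>The gradient separates the optimum from all points of a bounded set at a given distance from it, and the
  reference path is eventually close to the optimum.\<close>

lemma gradient_gap:
  assumes e: "0 < e" and \<rho>: "\<And>k. norm (X k) \<le> \<rho>"
  shows "\<exists>c0>0. \<exists>n. \<forall>k\<ge>n. e \<le> (norm (X k - xh (k1 + k)))\<^sup>2 \<longrightarrow> c0 \<le> (norm (gF (X k) - gF (xh (Suc (k1 + k)))))\<^sup>2"
proof -
  define S where "S = cball 0 \<rho> \<inter> {Y. sqrt e / 2 \<le> norm (Y - XS)}"
  have S: "compact S" unfolding S_def by (intro compact_Int_closed compact_cball closed_Collect_le continuous_intros)
  have "\<exists>c0>0. \<forall>Y\<in>S. c0 \<le> norm (gF Y - gF XS)"
  proof (cases "S = {}")
    case True then show ?thesis by (intro exI[of _ 1]) simp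
  next
    case False
    have "continuous_on S (\<lambda>Y. norm (gF Y - gF XS))"
      by (intro continuous_intros continuous_on_subset[OF gF_continuous]) simp
    then obtain Y0 where Y0: "Y0 \<in> S" "\<And>Y. Y \<in> S \<Longrightarrow> norm (gF Y0 - gF XS) \<le> norm (gF Y - gF XS)"
      using continuous_attains_inf[OF S False] by blast
    have "Y0 \<noteq> XS" using Y0(1) e by (auto simp: S_def)
    then have "gF Y0 \<noteq> gF XS" using gF_inj by blast
    then show ?thesis using Y0(2) by (intro exI[of _ "norm (gF Y0 - gF XS)"]) auto
  qed
  then obtain c0 where c0: "0 < c0" "\<And>Y. Y \<in> S \<Longrightarrow> c0 \<le> norm (gF Y - gF XS)" by blast
  have l: "0 < l\<^sub>c" by (rule A1_lc)
  have "0 < min (sqrt e / 2) (c0 / (2 * l\<^sub>c))" using e c0 l by simp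
  then obtain n where n: "\<And>k. n \<le> k \<Longrightarrow> norm (xh k - XS) < min (sqrt e / 2) (c0 / (2 * l\<^sub>c))"
    using LIMSEQ_D[OF xh_lim] by blast
  show ?thesis
  proof (rule exI[of _ "(c0 / 2)\<^sup>2"], intro conjI exI[of _ n] allI impI)
    show "0 < (c0 / 2)\<^sup>2" using c0 by simp
    fix k assume k: "n \<le> k" and far: "e \<le> (norm (X k - xh (k1 + k)))\<^sup>2"
    have "sqrt e \<le> norm (X k - xh (k1 + k))" using real_sqrt_le_mono[OF far] by simp
    also have "\<dots> \<le> norm (X k - XS) + norm (xh (k1 + k) - XS)" using norm_triangle_ineq4[of "X k - XS" "xh (k1 + k) - XS"] by simp
    finally have "sqrt e / 2 \<le> norm (X k - XS)" using n[of "k1 + k"] k by simp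
    then have "c0 \<le> norm (gF (X k) - gF XS)" using \<rho>[of k] by (intro c0(2)) (simp add: S_def)
    also have "\<dots> \<le> norm (gF (X k) - gF (xh (Suc (k1 + k)))) + norm (gF (xh (Suc (k1 + k))) - gF XS)"
      using norm_triangle_ineq[of "gF (X k) - gF (xh (Suc (k1 + k)))" "gF (xh (Suc (k1 + k))) - gF XS"] by simp
    finally have sum: "c0 \<le> norm (gF (X k) - gF (xh (Suc (k1 + k)))) + norm (gF (xh (Suc (k1 + k))) - gF XS)" .
    have "norm (gF (xh (Suc (k1 + k))) - gF XS) \<le> l\<^sub>c * norm (xh (Suc (k1 + k)) - XS)" by (rule gF_lipschitz)
    also have "\<dots> \<le> l\<^sub>c * (c0 / (2 * l\<^sub>c))" using n[of "Suc (k1 + k)"] k l by (intro mult_left_mono) auto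
    also have "\<dots> = c0 / 2" using l by simp
    finally have "c0 / 2 \<le> norm (gF (X k) - gF (xh (Suc (k1 + k))))" using sum by linarith
    then show "(c0 / 2)\<^sup>2 \<le> (norm (gF (X k) - gF (xh (Suc (k1 + k)))))\<^sup>2" using c0 by (intro power_mono) auto
  qed
qed

lemma pathwise_convergence:
  assumes \<omega>: "\<omega> \<in> space M" and R: "\<And>k. (norm (E (k1 + k) \<omega>))\<^sup>2 \<le> R"
    and G: "summable (\<lambda>k. \<alpha> (k1 + k) * G (k1 + k) \<omega>)"
    and sq: "summable (\<lambda>k. (\<alpha> (k1 + k))\<^sup>2 * (2 * (norm (nx (k1 + k) \<omega>))\<^sup>2))"
    and mart: "summable (\<lambda>k. \<alpha> (k1 + k) * (2 * (nx (k1 + k) \<omega> \<bullet> (Xv (k1 + k) \<omega> - xh (k1 + k)))))"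
  shows "(\<lambda>k. Xv k \<omega>) \<longlonglongrightarrow> XS"
proof -
  have R0: "0 \<le> R" using order.trans[OF zero_le_power2 R] .
  obtain b where b: "\<And>k. norm (xh k) \<le> b" using xh_bounded by blast
  have Xb: "norm (Xv (k1 + k) \<omega>) \<le> (1 + \<bar>R\<bar>) + b" for k
    using norm_E_le[OF R, of k] E_components(1)[of "k1 + k" \<omega>] b[of "k1 + k"]
      norm_triangle_ineq[of "Xv (k1 + k) \<omega> - xh (k1 + k)" "xh (k1 + k)"] by simp
  let ?C = "4 * (l\<^sub>c + 1)\<^sup>2 * (1 + r)\<^sup>2 * (1 + R)\<^sup>2"
  have "(\<lambda>k. (norm (Xv (k1 + k) \<omega> - xh (k1 + k)))\<^sup>2) \<longlonglongrightarrow> 0"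
  proof (rule crossing[where C = ?C and \<alpha> = "\<lambda>k. \<alpha> (k1 + k)" and \<Phi> = "\<lambda>k. G (k1 + k) \<omega>"])
    fix k
    have "\<alpha> (k1 + k) * (4 * (l\<^sub>c + 1)\<^sup>2 * (1 + r)\<^sup>2 * (1 + (norm (E (k1 + k) \<omega>))\<^sup>2)\<^sup>2) \<le> \<alpha> (k1 + k) * ?C"
      using R[of k] \<alpha>_pos[of "k1 + k"] by (intro mult_left_mono power_mono add_left_mono) auto
    then show "(norm (Xv (k1 + Suc k) \<omega> - xh (k1 + Suc k)))\<^sup>2 \<le> (norm (Xv (k1 + k) \<omega> - xh (k1 + k)))\<^sup>2 + ?C * \<alpha> (k1 + k)
       + (\<alpha> (k1 + k) * (2 * (nx (k1 + k) \<omega> \<bullet> (Xv (k1 + k) \<omega> - xh (k1 + k)))) + (\<alpha> (k1 + k))\<^sup>2 * (2 * (norm (nx (k1 + k) \<omega>))\<^sup>2))"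
      using energy_step(2)[OF le_add1 \<omega>, of k] unfolding mult.commute[of ?C] add_Suc_right by linarith
    show "0 < \<alpha> (k1 + k)" by (rule \<alpha>_pos)
    show "0 \<le> G (k1 + k) \<omega>" by (simp add: G_def)
  next
    fix e :: real assume "0 < e"
    then show "\<exists>c>0. \<exists>n. \<forall>k\<ge>n. e \<le> (norm (Xv (k1 + k) \<omega> - xh (k1 + k)))\<^sup>2 \<longrightarrow> c \<le> G (k1 + k) \<omega>"
      using gradient_gap[of e "\<lambda>k. Xv (k1 + k) \<omega>"] Xb unfolding G_def by blast
  next
    show "(\<lambda>k. \<alpha> (k1 + k)) \<longlonglongrightarrow> 0"
      using LIMSEQ_ignore_initial_segment[OF \<alpha>_tendsto_0, of k1] by (simp add: add.commute)
  qed (use step_sums_diverge G summable_add[OF mart sq] in auto)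
  then have "(\<lambda>k. sqrt ((norm (Xv (k1 + k) \<omega> - xh (k1 + k)))\<^sup>2)) \<longlonglongrightarrow> sqrt 0" by (rule tendsto_real_sqrt)
  then have "(\<lambda>k. Xv (k1 + k) \<omega> - xh (k1 + k)) \<longlonglongrightarrow> 0" by (simp add: tendsto_norm_zero_iff)
  moreover have "(\<lambda>k. xh (k1 + k)) \<longlonglongrightarrow> XS" using LIMSEQ_ignore_initial_segment[OF xh_lim, of k1] by (simp add: add.commute)
  ultimately have "(\<lambda>k. (Xv (k1 + k) \<omega> - xh (k1 + k)) + xh (k1 + k)) \<longlonglongrightarrow> 0 + XS" by (rule tendsto_add)
  then have "(\<lambda>k. Xv (k + k1) \<omega>) \<longlonglongrightarrow> XS" by (simp add: add.commute)
  then show ?thesis by (rule LIMSEQ_offset)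
qed

theorem almost_sure_convergence: "AE \<omega> in M. \<forall>i. (\<lambda>k. x i k \<omega>) \<longlonglongrightarrow> xstar i"
proof -
  have "AE \<omega> in M. \<forall>R. summable (\<lambda>k. \<alpha> (k1 + k) * (indicator (bounded_so_far R k) \<omega> * (2 * (nx (k1 + k) \<omega> \<bullet> (Xv (k1 + k) \<omega> - xh (k1 + k))))))"
    unfolding AE_all_countable using truncated_noise_summable by blast
  from AE_conjI[OF energy_bounded this] show ?thesis
  proof (rule AE_mp, intro AE_I2 impI allI, elim conjE exE)
    fix \<omega> i R
    assume \<omega>: "\<omega> \<in> space M" and R: "\<forall>k. (norm (E (k1 + k) \<omega>))\<^sup>2 \<le> R"
      and G: "summable (\<lambda>k. \<alpha> (k1 + k) * G (k1 + k) \<omega>)"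
      and sq: "summable (\<lambda>k. (\<alpha> (k1 + k))\<^sup>2 * (2 * (norm (nx (k1 + k) \<omega>))\<^sup>2))"
      and mart: "\<forall>R. summable (\<lambda>k. \<alpha> (k1 + k) * (indicator (bounded_so_far R k) \<omega> * (2 * (nx (k1 + k) \<omega> \<bullet> (Xv (k1 + k) \<omega> - xh (k1 + k))))))"
    obtain R' :: nat where R': "R \<le> real R'" using real_arch_simple by blast
    have "\<omega> \<in> bounded_so_far R' k" for k
      unfolding bounded_so_far_def using \<omega> R R' order.trans by blast
    then have "summable (\<lambda>k. \<alpha> (k1 + k) * (2 * (nx (k1 + k) \<omega> \<bullet> (Xv (k1 + k) \<omega> - xh (k1 + k)))))"
      using spec[OF mart, of R'] by simp
    then have "(\<lambda>k. Xv k \<omega>) \<longlonglongrightarrow> XS" using R by (intro pathwise_convergence[OF \<omega> _ G sq]) auto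
    then have "(\<lambda>k. Xv k \<omega> $ i) \<longlonglongrightarrow> XS $ i" by (rule tendsto_vec_nth)
    then show "(\<lambda>k. x i k \<omega>) \<longlonglongrightarrow> xstar i" by (simp add: Xv_def XS_def)
  qed
qed

end

theorem (in stochastic_allocation) iterates_converge: "AE \<omega> in M. \<forall>i. (\<lambda>k. x i k \<omega>) \<longlonglongrightarrow> xstar i"
proof (rule reference_path)
  fix k1 r and X Z \<Lambda> :: "nat \<Rightarrow> real^'m^'n"
  assume ref: "\<And>k. k1 \<le> k \<Longrightarrow> X (Suc k) = Pr (X k + \<alpha> k *\<^sub>R (\<Lambda> (Suc k) - gF (X (Suc k))))"
    "\<And>k. k1 \<le> k \<Longrightarrow> Z (Suc k) = Z k + \<alpha> k *\<^sub>R K (\<Lambda> (Suc k))"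
    "\<And>k. k1 \<le> k \<Longrightarrow> \<Lambda> (Suc k) = \<Lambda> k + \<alpha> k *\<^sub>R (Dv - X (Suc k) - K (\<Lambda> (Suc k)) - K (Z (Suc k)))"
    "\<And>k. k1 \<le> k \<Longrightarrow> norm (((X (Suc k), Z (Suc k)), \<Lambda> (Suc k)) - ((X k, Z k), \<Lambda> k)) \<le> r * \<alpha> k"
    "\<And>k. k1 \<le> k \<Longrightarrow> norm (K (\<Lambda> k)) \<le> r" "\<And>k. k1 \<le> k \<Longrightarrow> norm (K (Z k)) \<le> r"
    "X \<longlonglongrightarrow> XS" "\<And>k. k1 \<le> k \<Longrightarrow> \<alpha> k \<le> 1"
  interpret referenced_allocation M f d \<Omega> A L Lbar \<alpha> x lam z \<nu> \<delta> \<zeta> \<epsilon> \<F> \<F>' l\<^sub>c \<mu> c xstar k1 r X Z \<Lambda>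
    by unfold_locales (fact ref)+
  show ?thesis by (rule almost_sure_convergence)
qed

theorem theorem3p5:
  fixes M :: "'w measure"
    and f :: "'n::finite \<Rightarrow> real^'m \<Rightarrow> real"
    and d :: "'n \<Rightarrow> real^'m"
    and p :: "'n \<Rightarrow> nat"
    and q :: "'n \<Rightarrow> nat \<Rightarrow> real^'m \<Rightarrow> real"
    and \<Omega> :: "'n \<Rightarrow> (real^'m) set"
    and A L :: "nat \<Rightarrow> 'w \<Rightarrow> real^'n^'n"
    and Lbar :: "real^'n^'n"
    and \<alpha> :: "nat \<Rightarrow> real"
    and x lam z :: "'n \<Rightarrow> nat \<Rightarrow> 'w \<Rightarrow> real^'m"
    and \<nu> \<delta> :: "'n \<Rightarrow> nat \<Rightarrow> 'w \<Rightarrow> real^'m"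
    and \<zeta> \<epsilon> :: "'n \<Rightarrow> 'n \<Rightarrow> nat \<Rightarrow> 'w \<Rightarrow> real^'m"
    and \<F> \<F>' :: "nat \<Rightarrow> 'w measure"
    and l\<^sub>c \<mu> c :: real
    and xstar :: "'n \<Rightarrow> real^'m"
  assumes prob: "prob_space M"
    \<comment> \<open>problem data\<close>
    and \<Omega>: "\<And>i. \<Omega> i = constraint_set (p i) (q i)"
    and q_C1: "\<And>i j y. j \<in> {1..p i} \<Longrightarrow> q i j differentiable (at y)"
              "\<And>i j. j \<in> {1..p i} \<Longrightarrow> continuous_on UNIV (gradient (q i j))"
    and q_convex: "\<And>i j. j \<in> {1..p i} \<Longrightarrow> convex_on UNIV (q i j)"
    \<comment> \<open>random graphs without self-loops\<close>
    and A_meas: "\<And>k. A k \<in> borel_measurable M"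
    and A_01: "\<And>k \<omega> i j. \<omega> \<in> space M \<Longrightarrow> A k \<omega> $ i $ j \<in> {0, 1}"
    and A_diag: "\<And>k \<omega> i. \<omega> \<in> space M \<Longrightarrow> A k \<omega> $ i $ i = 0"
    and L: "\<And>k \<omega>. L k \<omega> = laplacian (A k \<omega>)"
    \<comment> \<open>step sizes\<close>
    and \<alpha>_pos: "\<And>k. \<alpha> k > 0"
    and \<alpha>_sum: "filterlim (\<lambda>K. \<Sum>k=1..K. \<alpha> k) at_top sequentially"
    and \<alpha>_sq: "summable (\<lambda>k. (\<alpha> (Suc k))\<^sup>2)"
    \<comment> \<open>noises and initial values are random variables\<close>
    and noise_meas: "\<And>i k. \<nu> i k \<in> borel_measurable M" "\<And>i k. \<delta> i k \<in> borel_measurable M"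
      "\<And>i j k. \<zeta> i j k \<in> borel_measurable M" "\<And>i j k. \<epsilon> i j k \<in> borel_measurable M"
    and init_meas: "\<And>i. x i 0 \<in> borel_measurable M" "\<And>i. lam i 0 \<in> borel_measurable M"
      "\<And>i. z i 0 \<in> borel_measurable M"
    \<comment> \<open>the algorithm\<close>
    and x_step: "\<And>i k \<omega>. \<omega> \<in> space M \<Longrightarrow>
      x i (Suc k) \<omega> = closest_point (\<Omega> i)
        (x i k \<omega> + \<alpha> k *\<^sub>R (- (gradient (f i) (x i k \<omega>) + \<nu> i k \<omega>) + lam i k \<omega>))"
    and lam_step: "\<And>i k \<omega>. \<omega> \<in> space M \<Longrightarrow>
      lam i (Suc k) \<omega> = lam i k \<omega> + \<alpha> k *\<^sub>R
        ((d i + \<delta> i k \<omega>) - x i k \<omega>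
         - (\<Sum>j\<in>UNIV. A k \<omega> $ i $ j *\<^sub>R (lam i k \<omega> - (lam j k \<omega> + \<zeta> i j k \<omega>)))
         - (\<Sum>j\<in>UNIV. A k \<omega> $ i $ j *\<^sub>R (z i k \<omega> - (z j k \<omega> + \<epsilon> i j k \<omega>))))"
    and z_step: "\<And>i k \<omega>. \<omega> \<in> space M \<Longrightarrow>
      z i (Suc k) \<omega> = z i k \<omega> + \<alpha> k *\<^sub>R
        (\<Sum>j\<in>UNIV. A k \<omega> $ i $ j *\<^sub>R (lam i k \<omega> - (lam j k \<omega> + \<zeta> i j k \<omega>)))"
    \<comment> \<open>the \<open>\<sigma>\<close>-algebras, shifted by one: \<open>\<F> k\<close> collects the times before \<open>k\<close>\<close>
    and \<F>: "\<And>k. \<F> k = past M (\<lambda>i. x i 0) (\<lambda>i. lam i 0) (\<lambda>i. z i 0) L \<nu> \<delta> \<zeta> \<epsilon> k"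
    and \<F>': "\<And>k. \<F>' k = past_graph M (\<lambda>i. x i 0) (\<lambda>i. lam i 0) (\<lambda>i. z i 0) L \<nu> \<delta> \<zeta> \<epsilon> k"
    \<comment> \<open>Assumption 1\<close>
    and A1_solvable: "\<exists>X. ra_optimal f d \<Omega> X"
    and A1_diff: "\<And>i y. f i differentiable (at y)"
    and A1_convex: "\<And>i. strictly_convex_on UNIV (f i)"
    and A1_lc: "l\<^sub>c > 0"
    and A1_lipschitz: "\<And>i y y'. norm (gradient (f i) y - gradient (f i) y') \<le> l\<^sub>c * norm (y - y')"
    \<comment> \<open>Assumption 2\<close>
    and A2_set: "\<And>i. closed (\<Omega> i)" "\<And>i. convex (\<Omega> i)" "\<And>i. interior (\<Omega> i) \<noteq> {}"
    and A2_indep: "\<And>i y. y \<in> \<Omega> i \<Longrightarrow>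
      independent ((\<lambda>j. gradient (q i j) y) ` active_set (p i) (q i) y)"
    \<comment> \<open>Assumption 3\<close>
    and A3_iid: "iid M L"
    and A3_mean: "\<And>k. Lbar = integral\<^sup>L M (L k)"
    and A3_sym: "transpose Lbar = Lbar"
    and A3_two: "CARD('n) \<ge> 2"
    and A3_s2: "second_smallest_eigenvalue Lbar > 0"
    \<comment> \<open>Assumption 4\<close>
    and A4_iid: "\<And>i. iid M (\<delta> i)"
    and A4_mean: "\<And>i k. integral\<^sup>L M (\<delta> i k) = 0"
    and A4_moment: "\<And>i k. integrable M (\<lambda>\<omega>. (norm (\<delta> i k \<omega>))\<^sup>2)"
    \<comment> \<open>Assumption 5\<close>
    and A5_i: "\<And>i j k. AE \<omega> in M. vec_cond_exp M (\<F>' k) (\<zeta> i j k) \<omega> = 0"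
              "\<And>i j k. AE \<omega> in M. vec_cond_exp M (\<F>' k) (\<epsilon> i j k) \<omega> = 0"
    and A5_\<mu>: "\<mu> > 0"
    and A5_ii: "\<And>i j k. AE \<omega> in M.
                  nn_cond_exp M (\<F>' k) (\<lambda>\<omega>. ennreal ((norm (\<zeta> i j k \<omega>))\<^sup>2)) \<omega> \<le> ennreal (\<mu>\<^sup>2)"
               "\<And>i j k. AE \<omega> in M.
                  nn_cond_exp M (\<F>' k) (\<lambda>\<omega>. ennreal ((norm (\<epsilon> i j k \<omega>))\<^sup>2)) \<omega> \<le> ennreal (\<mu>\<^sup>2)"
    and A5_c: "c > 0"
    and A5_iii: "\<And>i k. AE \<omega> in M. vec_cond_exp M (\<F> k) (\<nu> i k) \<omega> = 0"
                "\<And>i k. AE \<omega> in M.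
                  nn_cond_exp M (\<F> k) (\<lambda>\<omega>. ennreal ((norm (\<nu> i k \<omega>))\<^sup>2)) \<omega>
                    \<le> ennreal (c * (1 + (norm (x i k \<omega>))\<^sup>2))"
    and A5_iv_seq: "\<And>i. prob_space.indep_set M
                  (sigma_sets (space M) (\<Union>k. events_of M (L k)))
                  (sigma_sets (space M) (\<Union>k. events_of M (\<delta> i k)))"
    and A5_iv_past: "\<And>k. prob_space.indep_set M
                  (sigma_sets (space M) (events_of M (L k) \<union> (\<Union>i. events_of M (\<delta> i k))))
                  (sets (\<F> k))"
    and optimal: "ra_optimal f d \<Omega> xstar"
  shows "\<forall>i. AE \<omega> in M. (\<lambda>k. x i k \<omega>) \<longlonglongrightarrow> xstar i"
proof -
  interpret stochastic_allocation M f d \<Omega> A L Lbar \<alpha> x lam z \<nu> \<delta> \<zeta> \<epsilon> \<F> \<F>' l\<^sub>c \<mu> c xstar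
    by (rule stochastic_allocation.intro[OF prob stochastic_allocation_axioms.intro]) (fact assms)+
  show ?thesis using iterates_converge by (rule AE_all_countable[THEN iffD1])
qed

end
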